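(* Fix $\gamma>1/2$. Let $J=J_N$ be the $N\times N$ matrix with $J_{ij}=\mathbf{1}_{j=i+1}$, let $D_N$ be the $N\times N$ diagonal matrix with diagonal entries $d_1,\dots,d_N$, and set $M_N=D_N+J$. Let $G_N$ be an $N\times N$ matrix with i.i.d. standard complex Gaussian entries (independent of $D_N$ when $D_N$ is random), let $\mathcal{M}_N:=M_N+N^{-\gamma}G_N$, and let $L_N$ be the empirical measure of the eigenvalues of $\mathcal{M}_N$. (a) Let $d_i$ be i.i.d. random variables of law $\nu$ supported on a subset of a simply connected compact subset of $\mathbb{C}$ with Lebesgue area $0$. Then, as $N\to\infty$, $L_N$ converges weakly in probability to a measure $\mu$ characterized by $\mathcal{L}_\mu(z)=(\mathbb{E}_\nu\log|z-d_1|)\vee0$. (b) Let $f:[0,1]\to\mathbb{C}$ be H\"older-continuous and set $d_i=f(i/N)$. Then, as $N\to\infty$, $L_N$ converges weakly in probability to a probability measure $\mu$ satisfying $$\mu=\int_0^1\mathrm{unif}_{f(t),1}\,dt,$$ where $\mathrm{unif}_{a,b}$ denotes the uniform law on the circle in the complex plane of radius $b$ and center $a$.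
   Context: For a probability measure $\mu$ on $\mathbb{C}$ integrating the logarithm at infinity, $\mathcal{L}_\mu(z):=\int\log|z-y|\,\mu(dy)$ is its logarithmic potential. $x\vee y:=\max\{x,y\}$. The empirical measure of eigenvalues is $L_N=N^{-1}\sum_{i=1}^N\delta_{\lambda_i}$ with $\lambda_i$ the eigenvalues of $\mathcal{M}_N$. Random probability measures $L_N$ converge weakly in probability to $\mu$ if $\int f\,dL_N\to\int f\,d\mu$ in probability for every bounded continuous $f$. *)

theory Defs
  imports "HOL-Probability.Probability" "Jordan_Normal_Form.Char_Poly"
begin

(* Indices are 0-based: entry (i, j) below is the usual entry (i + 1, j + 1). *)
definition shift_mat :: "nat \<Rightarrow> complex mat" where
  "shift_mat N = Matrix.mat N N (\<lambda>(i, j). if j = i + 1 then 1 else 0)"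

definition noisy_mat :: "real \<Rightarrow> nat \<Rightarrow> (nat \<Rightarrow> complex) \<Rightarrow> (nat \<times> nat \<Rightarrow> complex) \<Rightarrow> complex mat" where
  "noisy_mat \<gamma> N d g =
     (mat_diag N d + shift_mat N) + complex_of_real (real N powr (- \<gamma>)) \<cdot>\<^sub>m Matrix.mat N N g"

(* Eigenvalues are counted with algebraic multiplicity: the roots of the characteristic
   polynomial, as a multiset of size N for an N x N matrix (N > 0). *)
definition empirical_eigenvalue_measure :: "complex mat \<Rightarrow> complex measure" where
  "empirical_eigenvalue_measure A =
     distr (measure_pmf (pmf_of_multiset (proots (char_poly A)))) borel (\<lambda>z. z)"

(* Circularly symmetric, normalised by E|g|^2 = 1. *)
definition std_complex_gaussian :: "complex measure" where
  "std_complex_gaussian = density lborel (\<lambda>z. ennreal (exp (- (cmod z)\<^sup>2) / pi))"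

definition iid :: "'w measure \<Rightarrow> 'i set \<Rightarrow> ('i \<Rightarrow> 'w \<Rightarrow> complex) \<Rightarrow> complex measure \<Rightarrow> bool" where
  "iid P I X \<nu> \<longleftrightarrow>
     prob_space.indep_vars P (\<lambda>_. borel) X I \<and> (\<forall>i\<in>I. distr P borel (X i) = \<nu>)"

(* Independence of the two random vectors via their generated sigma-algebras; the library's
   indep_var requires both vectors to have the same type. *)
definition indep_families ::
    "'w measure \<Rightarrow> 'i set \<Rightarrow> ('i \<Rightarrow> 'w \<Rightarrow> complex) \<Rightarrow> 'j set \<Rightarrow> ('j \<Rightarrow> 'w \<Rightarrow> complex) \<Rightarrow> bool" where
  "indep_families P I X J Y \<longleftrightarrow>
     prob_space.indep_set P
       (sets (vimage_algebra (space P) (\<lambda>\<omega>. \<lambda>i\<in>I. X i \<omega>) (PiM I (\<lambda>_. borel))))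
       (sets (vimage_algebra (space P) (\<lambda>\<omega>. \<lambda>j\<in>J. Y j \<omega>) (PiM J (\<lambda>_. borel))))"

(* The N-th random measure L N may live on its own probability space P N. The measurability
   conjunct is needed because Isabelle's measure assigns 0 to non-measurable sets. *)
definition weakly_converges_in_prob ::
    "(nat \<Rightarrow> 'w measure) \<Rightarrow> (nat \<Rightarrow> 'w \<Rightarrow> complex measure) \<Rightarrow> complex measure \<Rightarrow> bool" where
  "weakly_converges_in_prob P L \<mu> \<longleftrightarrow>
     (\<forall>f :: complex \<Rightarrow> real. continuous_on UNIV f \<and> bounded (range f) \<longrightarrow>
        (\<forall>N. (\<lambda>\<omega>. \<integral>y. f y \<partial>L N \<omega>) \<in> borel_measurable (P N)) \<and>
        (\<forall>\<epsilon>>0. (\<lambda>N. measure (P N)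
            {\<omega> \<in> space (P N). \<bar>(\<integral>y. f y \<partial>L N \<omega>) - (\<integral>y. f y \<partial>\<mu>)\<bar> > \<epsilon>}) \<longlonglongrightarrow> 0))"

(* The library has ln 0 = 0, and the Bochner integral of a non-integrable function is 0; the
   logarithmic potential must instead take the value - \<infinity> where appropriate. *)
definition log_ext :: "real \<Rightarrow> ereal" where
  "log_ext x = (if x > 0 then ereal (ln x) else - \<infinity>)"

definition integrates_log_at_infinity :: "complex measure \<Rightarrow> bool" where
  "integrates_log_at_infinity \<mu> \<longleftrightarrow> integrable \<mu> (\<lambda>y. ln (max 1 (cmod y)))"

(* Positive part minus negative part; e2ennreal truncates negative values to 0. For a probability
   measure integrating the logarithm at infinity the first term is finite. *)
definition log_potential :: "complex measure \<Rightarrow> complex \<Rightarrow> ereal" where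
  "log_potential \<mu> z =
     enn2ereal (\<integral>\<^sup>+ y. e2ennreal (log_ext (cmod (z - y))) \<partial>\<mu>) -
     enn2ereal (\<integral>\<^sup>+ y. e2ennreal (- log_ext (cmod (z - y))) \<partial>\<mu>)"

definition has_log_potential :: "complex measure \<Rightarrow> (complex \<Rightarrow> ereal) \<Rightarrow> bool" where
  "has_log_potential \<mu> u \<longleftrightarrow>
     prob_space \<mu> \<and> sets \<mu> = sets borel \<and> integrates_log_at_infinity \<mu> \<and>
     (\<forall>z. log_potential \<mu> z = u z)"

definition holder_continuous_on :: "real set \<Rightarrow> (real \<Rightarrow> complex) \<Rightarrow> bool" where
  "holder_continuous_on S f \<longleftrightarrow>
     (\<exists>C \<alpha>. 0 < \<alpha> \<and> \<alpha> \<le> 1 \<and> (\<forall>s\<in>S. \<forall>t\<in>S. cmod (f s - f t) \<le> C * \<bar>s - t\<bar> powr \<alpha>))"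

definition unif_circle :: "complex \<Rightarrow> real \<Rightarrow> complex measure" where
  "unif_circle a b =
     distr (uniform_measure lborel {0..2 * pi}) borel (\<lambda>\<theta>. a + complex_of_real b * cis \<theta>)"

end

theory Submission
  imports Defs "HOL-Complex_Analysis.Complex_Analysis" "HOL-Real_Asymp.Real_Asymp"
begin

text \<open>
  Let \<open>X N z = (1 / N) ln \<bar>det (z - M)\<bar>\<close> be the logarithmic potential of the empirical eigenvalue
  measure of the perturbed matrix \<open>M\<close>. The theorem holds because, at every point \<open>z\<close>, \<open>X N z\<close>
  converges in \<open>L\<^sup>1\<close> to an explicit function \<open>U z\<close>: the mean of \<open>ln \<bar>z - d\<bar>\<close>, clipped at zero, for
  independent diagonal entries, and the mean of \<open>max (ln \<bar>z - f t\<bar>) 0\<close> over \<open>t\<close> along a path.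

  Expand the determinant as a polynomial in the noise entries. A monomial is given by the set of rows
  in which the noise is chosen together with the permutation, and the permutation is recovered from
  its values on these rows, so distinct choices give distinct monomials (\<open>inj_pair_graph\<close>).

  The upper bound on \<open>X N z\<close> comes from the second moment of the determinant, which is a sum over
  these choices of squared coefficients. Reading the choices row by row gives words in three letters
  (diagonal, superdiagonal, noise) in which a diagonal letter never follows a superdiagonal one. The
  noise is chosen in \<open>k\<close> rows in at most \<open>N ^ k\<close> ways, so each noise letter costs a
  factor of order \<open>N ^ (1 - 2 \<gamma>)\<close>, which vanishes in the limit. Hence long runs of diagonal
  and of superdiagonal letters dominate, and the sum is at most a constant times a product of factors
  \<open>max 1 \<bar>d i - z\<bar>\<^sup>2 + \<epsilon>\<close> (\<open>sum_word_weight_le\<close>). For random \<open>d\<close> the same bound is applied to a small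
  power of the determinant: as the power tends to zero, the moments of \<open>\<bar>d - z\<bar>\<close> see \<open>E ln \<bar>d - z\<bar>\<close>, and the
  clipping occurs outside the expectation.

  The lower bound on the mean of \<open>X N z\<close> is subharmonicity. The mean of \<open>ln \<bar>det\<bar>\<close> over the noise
  is at least the logarithm of any single coefficient, up to an error proportional to the degree of its
  monomial (\<open>ln1p_multi_affine\<close>). Coefficients of bounded degree suffice. For a
  path, cut the rows into boundedly many blocks on which \<open>f\<close> hardly varies, and use in each block either the
  diagonal or the superdiagonal closed up by one noise entry (\<open>block_pair\<close>). For independent entries, use the
  full diagonal or the full superdiagonal.
  The two bounds together control the \<open>L\<^sup>1\<close> distance (\<open>L1_bound_of_moment_bounds\<close>).

  To pass from potentials to measures, Jensen's formula writes the mean of \<open>ln \<bar>z - y\<bar>\<close> over the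
  circle of centre \<open>a\<close> and radius \<open>r\<close> as \<open>ln (max \<bar>y - a\<bar> r)\<close>. The difference of the means for \<open>2 r\<close>
  and \<open>r\<close> is a continuous bump of compact support, a tent. Integrals of tents against the empirical measures
  therefore converge, and mixtures of small tents approximate every test function. This gives weak
  convergence to any measure with the right tent integrals (\<open>weak_convergence\<close>), and uniqueness.

  Along a path, the mixture of circles has these tent integrals by Jensen's formula again. For independent
  entries the limit is not explicit. It is obtained as a limit point of realizations of the empirical
  measure (\<open>limit_measure_exists\<close>), and its potential is identified with \<open>U\<close> at every point by letting the radius of
  the circles tend to zero (\<open>has_log_potential_of_circle_means\<close>).
\<close>

section \<open>Jensen's formula on a circle\<close>

text \<open>Fatou's lemma applied to \<open>g - ln F\<^sub>n\<close>, which is nonnegative, turns a lower bound on the means of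
  \<open>ln F\<^sub>n\<close> into integrability of \<open>ln f\<close>; in particular \<open>f\<close> cannot vanish on a set of positive
  measure. The comparison with \<open>K F\<^sub>n\<close> then dominates the sequence from below.\<close>
lemma (in prob_space) log_integral_limit:
  fixes F :: "nat \<Rightarrow> 'a \<Rightarrow> real" and f g :: "'a \<Rightarrow> real"
  assumes [measurable]: "\<And>n. F n \<in> borel_measurable M" "f \<in> borel_measurable M"
    and pos: "\<And>n x. x \<in> space M \<Longrightarrow> 0 < F n x" and nn: "\<And>x. x \<in> space M \<Longrightarrow> 0 \<le> f x"
    and lim: "\<And>x. x \<in> space M \<Longrightarrow> (\<lambda>n. F n x) \<longlonglongrightarrow> f x"
    and le: "\<And>n x. x \<in> space M \<Longrightarrow> f x \<le> K * F n x" and K: "K > 0"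
    and up: "\<And>n x. x \<in> space M \<Longrightarrow> ln (F n x) \<le> g x" and g: "integrable M g"
    and int: "\<And>n. integrable M (\<lambda>x. ln (F n x))"
    and low: "\<And>n. v \<le> (\<integral>x. ln (F n x) \<partial>M)"
  shows "AE x in M. f x \<noteq> 0" "integrable M (\<lambda>x. ln (f x))"
    "(\<lambda>n. \<integral>x. ln (F n x) \<partial>M) \<longlonglongrightarrow> (\<integral>x. ln (f x) \<partial>M)" "v \<le> (\<integral>x. ln (f x) \<partial>M)"
proof -
  have [measurable]: "g \<in> borel_measurable M" using g by auto
  let ?h = "\<lambda>n x. ennreal (g x - ln (F n x))"
  have "(\<integral>\<^sup>+ x. liminf (\<lambda>n. ?h n x) \<partial>M) \<le> liminf (\<lambda>n. \<integral>\<^sup>+ x. ?h n x \<partial>M)"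
    by (rule nn_integral_liminf) measurable
  also have "\<dots> \<le> liminf (\<lambda>n. ennreal ((\<integral>x. g x \<partial>M) - v))"
  proof (rule Liminf_mono, rule always_eventually, intro allI)
    fix n
    have "(\<integral>\<^sup>+ x. ?h n x \<partial>M) = ennreal (\<integral>x. g x - ln (F n x) \<partial>M)"
      by (rule nn_integral_eq_integral) (use g int up in auto)
    also have "\<dots> \<le> ennreal ((\<integral>x. g x \<partial>M) - v)"
      using low[of n] by (subst Bochner_Integration.integral_diff[OF g int]) (auto intro!: ennreal_leI)
    finally show "(\<integral>\<^sup>+ x. ?h n x \<partial>M) \<le> ennreal ((\<integral>x. g x \<partial>M) - v)" .
  qed
  also have "\<dots> = ennreal ((\<integral>x. g x \<partial>M) - v)" by (simp add: Liminf_const)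
  finally have fat: "(\<integral>\<^sup>+ x. liminf (\<lambda>n. ?h n x) \<partial>M) \<le> ennreal ((\<integral>x. g x \<partial>M) - v)" .
  have "(\<integral>\<^sup>+ x. liminf (\<lambda>n. ?h n x) \<partial>M) \<noteq> \<infinity>"
    using fat by (metis ennreal_less_top infinity_ennreal_def leD)
  then have fin: "AE x in M. liminf (\<lambda>n. ?h n x) \<noteq> \<infinity>"
    by (intro nn_integral_noteq_infinite) measurable
  have zero: "liminf (\<lambda>n. ?h n x) = \<infinity>" if x: "x \<in> space M" and "f x = 0" for x
  proof -
    have "filterlim (\<lambda>n. F n x) (at_right 0) sequentially"
      using lim[OF x] pos[OF x] \<open>f x = 0\<close>
      by (auto simp: filterlim_at less_imp_neq[THEN not_sym] intro!: always_eventually)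
    then have "LIM n sequentially. ln (F n x) :> at_bot"
      by (rule filterlim_compose[OF ln_at_0])
    then have "LIM n sequentially. - ln (F n x) :> at_top"
      by (simp add: filterlim_uminus_at_bot)
    then have "LIM n sequentially. g x + - ln (F n x) :> at_top"
      by (intro filterlim_tendsto_add_at_top[of _ "g x"]) auto
    then have "(\<lambda>n. ?h n x) \<longlonglongrightarrow> Orderings.top"
      by (subst ennreal_tendsto_top_eq_at_top) simp
    then show ?thesis by (simp add: lim_imp_Liminf)
  qed
  show nz: "AE x in M. f x \<noteq> 0"
    using fin AE_space by eventually_elim (use zero in auto)
  have limln: "(\<lambda>n. ln (F n x)) \<longlonglongrightarrow> ln (f x)" if "x \<in> space M" "f x \<noteq> 0" for x
    using lim[OF that(1)] that(2) by (intro tendsto_ln) auto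
  have gln: "ln (f x) \<le> g x" if "x \<in> space M" "f x \<noteq> 0" for x
    using limln[OF that] up[OF that(1)] by (intro LIMSEQ_le_const2[where X="\<lambda>n. ln (F n x)"]) auto
  have "(\<integral>\<^sup>+ x. ennreal (g x - ln (f x)) \<partial>M) = (\<integral>\<^sup>+ x. liminf (\<lambda>n. ?h n x) \<partial>M)"
  proof (rule nn_integral_cong_AE, use nz in \<open>rule AE_mp\<close>, rule AE_I2, rule impI)
    fix x assume x: "x \<in> space M" "f x \<noteq> 0"
    have "(\<lambda>n. ?h n x) \<longlonglongrightarrow> ennreal (g x - ln (f x))"
      using limln[OF x] by (intro tendsto_ennrealI tendsto_diff) auto
    then show "ennreal (g x - ln (f x)) = liminf (\<lambda>n. ?h n x)"
      by (simp add: lim_imp_Liminf)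
  qed
  then have "(\<integral>\<^sup>+ x. ennreal (g x - ln (f x)) \<partial>M) < \<infinity>"
    using fat by (metis ennreal_less_top infinity_ennreal_def order_le_less_trans)
  then have "integrable M (\<lambda>x. g x - ln (f x))"
  proof (intro integrableI_nonneg)
    show "AE x in M. 0 \<le> g x - ln (f x)"
      using nz AE_space by eventually_elim (use gln in auto)
  qed measurable
  from Bochner_Integration.integrable_diff[OF g this]
  show fi: "integrable M (\<lambda>x. ln (f x))" by simp
  show conv: "(\<lambda>n. \<integral>x. ln (F n x) \<partial>M) \<longlonglongrightarrow> (\<integral>x. ln (f x) \<partial>M)"
  proof (rule integral_dominated_convergence[where w="\<lambda>x. \<bar>g x\<bar> + \<bar>ln (f x)\<bar> + \<bar>ln K\<bar>"])
    show "integrable M (\<lambda>x. \<bar>g x\<bar> + \<bar>ln (f x)\<bar> + \<bar>ln K\<bar>)" using fi g by simp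
    show "AE x in M. (\<lambda>n. ln (F n x)) \<longlonglongrightarrow> ln (f x)"
      using nz by (rule AE_mp) (use limln in auto)
    fix n
    show "AE x in M. norm (ln (F n x)) \<le> \<bar>g x\<bar> + \<bar>ln (f x)\<bar> + \<bar>ln K\<bar>"
    proof (use nz in \<open>rule AE_mp\<close>, rule AE_I2, rule impI)
      fix x assume x: "x \<in> space M" "f x \<noteq> 0"
      have "ln (f x) \<le> ln (K * F n x)"
        using le[OF x(1)] nn[OF x(1)] x(2) by (intro ln_mono) (auto simp: less_le)
      also have "\<dots> = ln K + ln (F n x)" using K pos[OF x(1), of n] by (simp add: ln_mult)
      finally show "norm (ln (F n x)) \<le> \<bar>g x\<bar> + \<bar>ln (f x)\<bar> + \<bar>ln K\<bar>"
        using up[OF x(1), of n] by auto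
    qed
  qed auto
  show "v \<le> (\<integral>x. ln (f x) \<partial>M)"
    by (rule LIMSEQ_le_const[OF conv]) (use low in auto)
qed

text \<open>The uniform law on angles; integrals against it are means over a circle.\<close>
abbreviation circ :: "real measure" where "circ \<equiv> uniform_measure lborel {0..2*pi}"

lemma prob_space_circ: "prob_space circ"
  by (rule prob_space_uniform_measure) auto

lemma circ_integral_eq:
  fixes f :: "real \<Rightarrow> real"
  assumes "continuous_on UNIV f"
  shows "integrable circ f" "(\<integral>\<theta>. f \<theta> \<partial>circ) = integral {0..2*pi} f / (2*pi)"
proof -
  have [measurable]: "f \<in> borel_measurable borel"
    using assms by (rule borel_measurable_continuous_onI)
  have c: "continuous_on {0..2*pi} f" using assms continuous_on_subset by blast
  have si: "set_integrable lborel {0..2*pi} f"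
    using c by (rule borel_integrable_atLeastAtMost')
  have U: "circ = density lborel (\<lambda>x. ennreal (indicator {0..2*pi} x / (2*pi)))"
    unfolding uniform_measure_def
  proof (rule density_cong; (intro AE_I2)?)
    fix x :: real
    show "indicator {0..2*pi} x / emeasure lborel {0..2*pi} = ennreal (indicator {0..2*pi} x / (2*pi))"
      by (cases "x \<in> {0..2*pi}") (simp_all add: divide_ennreal[symmetric])
  qed measurable
  show "integrable circ f"
    unfolding U using si
    by (subst integrable_density) (auto simp: set_integrable_def)
  have "(\<integral>\<theta>. f \<theta> \<partial>circ) = (\<integral>x. (indicator {0..2*pi} x / (2*pi)) * f x \<partial>lborel)"
    unfolding U by (subst integral_density) auto
  also have "\<dots> = (LINT x:{0..2*pi}|lborel. f x) / (2*pi)"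
    unfolding set_lebesgue_integral_def by (simp flip: integral_divide_zero)
  also have "(LINT x:{0..2*pi}|lborel. f x) = integral {0..2*pi} f"
    by (rule set_borel_integral_eq_integral[OF si])
  finally show "(\<integral>\<theta>. f \<theta> \<partial>circ) = integral {0..2*pi} f / (2*pi)" .
qed

text \<open>The mean value property of \<open>Re (Ln (1 - q u))\<close>, which is harmonic near the closed unit disc.\<close>
lemma circle_mean_ln_inside:
  assumes q: "cmod q < 1"
  shows "integrable circ (\<lambda>\<theta>. ln (cmod (1 - q * cis \<theta>)))" "(\<integral>\<theta>. ln (cmod (1 - q * cis \<theta>)) \<partial>circ) = 0"
proof -
  have lt: "cmod (q * u) < 1" if "cmod u \<le> 1" for u
  proof -
    have "cmod (q * u) \<le> cmod q * 1" using that by (simp only: norm_mult) (intro mult_left_mono; simp)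
    then show ?thesis using q by simp
  qed
  have re: "0 < Re (1 - q * u)" if "cmod u \<le> 1" for u
    using lt[OF that] complex_Re_le_cmod[of "q*u"] by simp
  have nz: "1 - q * u \<noteq> 0" if "cmod u \<le> 1" for u using re[OF that] by force
  have cont: "continuous_on UNIV (\<lambda>\<theta>. ln (cmod (1 - q * cis \<theta>)))"
    by (intro continuous_intros) (use nz in auto)
  show "integrable circ (\<lambda>\<theta>. ln (cmod (1 - q * cis \<theta>)))"
    by (rule circ_integral_eq[OF cont])
  let ?f = "\<lambda>u. Ln (1 - q * u)"
  have "?f holomorphic_on cball 0 1"
    by (intro holomorphic_intros) (use re in \<open>auto simp: complex_nonpos_Reals_iff dest!: re\<close>)
  from Cauchy_integral_circlepath_simple[OF this, of 0]
  have "((\<lambda>u. ?f u / u) has_contour_integral 0) (circlepath 0 1)" by simp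
  then have "((\<lambda>t. ?f (cis t) / cis t * \<i> * cis t) has_integral 0) {0..2*pi}"
    unfolding circlepath_def by (subst (asm) has_contour_integral_part_circlepath_iff) (auto simp: mult_ac)
  then have "((\<lambda>t. (- \<i>) * (?f (cis t) / cis t * \<i> * cis t)) has_integral (- \<i>) * 0) {0..2*pi}"
    by (rule has_integral_mult_right)
  then have "((\<lambda>t. ?f (cis t)) has_integral 0) {0..2*pi}"
    by (simp add: mult_ac)
  from has_integral_linear[OF this bounded_linear_Re]
  have "((\<lambda>t. Re (?f (cis t))) has_integral 0) {0..2*pi}" by (simp add: o_def)
  then have "((\<lambda>t. ln (cmod (1 - q * cis t))) has_integral 0) {0..2*pi}"
    using nz by (subst (asm) has_integral_cong[where g="\<lambda>t. ln (cmod (1 - q * cis t))"]) (auto simp: Re_Ln)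
  then have "integral {0..2*pi} (\<lambda>t. ln (cmod (1 - q * cis t))) = 0"
    by (rule integral_unique)
  then show "(\<integral>\<theta>. ln (cmod (1 - q * cis \<theta>)) \<partial>circ) = 0"
    using circ_integral_eq(2)[OF cont] by simp
qed

text \<open>When \<open>\<bar>q\<bar> = 1\<close> the integrand has a singularity on the circle. It is approached from the radii
  \<open>\<rho>\<^sub>n q\<close>, where the mean is zero, and the limit theorem above applies with \<open>K = 2\<close>.\<close>
lemma circle_mean_ln_unit:
  assumes q: "cmod q \<le> 1"
  shows "integrable circ (\<lambda>\<theta>. ln (cmod (1 - q * cis \<theta>)))" "(\<integral>\<theta>. ln (cmod (1 - q * cis \<theta>)) \<partial>circ) = 0"
    "AE \<theta> in circ. 1 - q * cis \<theta> \<noteq> 0"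
proof -
  interpret prob_space circ by (rule prob_space_circ)
  define \<rho> where "\<rho> n = 1 - 1 / (real n + 2)" for n :: nat
  have \<rho>: "0 < \<rho> n" "\<rho> n < 1" for n by (auto simp: \<rho>_def field_simps)
  have \<rho>q: "cmod (of_real (\<rho> n) * q) < 1" for n
  proof -
    have "cmod (of_real (\<rho> n) * q) = \<rho> n * cmod q" using \<rho>[of n] by (simp add: norm_mult)
    also have "\<dots> \<le> \<rho> n * 1" using \<rho>[of n] q by (intro mult_left_mono) auto
    finally show ?thesis using \<rho>[of n] by linarith
  qed
  have \<rho>lim: "\<rho> \<longlonglongrightarrow> 1" unfolding \<rho>_def by real_asymp
  let ?F = "\<lambda>n \<theta>. cmod (1 - of_real (\<rho> n) * q * cis \<theta>)" and ?f = "\<lambda>\<theta>. cmod (1 - q * cis \<theta>)"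
  have u: "cmod (q * cis \<theta>) \<le> 1" for \<theta> using q by (simp add: norm_mult)
  have low: "1 - \<rho> n \<le> ?F n \<theta>" for n \<theta>
  proof -
    have "1 - ?F n \<theta> \<le> cmod (of_real (\<rho> n) * q * cis \<theta>)"
      by (metis diff_le_eq add.commute norm_one norm_triangle_sub)
    also have "\<dots> \<le> \<rho> n" using \<rho>[of n] q by (simp add: norm_mult mult_left_le)
    finally show ?thesis by simp
  qed
  have pos: "0 < ?F n \<theta>" for n \<theta> using low[of n \<theta>] \<rho>(2)[of n] by linarith
  have up: "?F n \<theta> \<le> 2" for n \<theta>
  proof -
    have "?F n \<theta> \<le> 1 + cmod (of_real (\<rho> n) * q * cis \<theta>)" by (metis norm_one norm_triangle_ineq4)
    also have "\<dots> \<le> 2" using \<rho>q[of n] by (simp add: norm_mult)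
    finally show ?thesis .
  qed
  have cmp: "?f \<theta> \<le> 2 * ?F n \<theta>" for n \<theta>
  proof -
    have "1 - q * cis \<theta> = (1 - of_real (\<rho> n) * q * cis \<theta>) - of_real (1 - \<rho> n) * (q * cis \<theta>)"
      by (simp add: algebra_simps)
    then have "?f \<theta> \<le> ?F n \<theta> + cmod (of_real (1 - \<rho> n) * (q * cis \<theta>))"
      by (metis norm_triangle_ineq4)
    also have "cmod (of_real (1 - \<rho> n) * (q * cis \<theta>)) = (1 - \<rho> n) * cmod (q * cis \<theta>)"
      using \<rho>[of n] by (simp add: norm_mult del: of_real_diff)
    also have "\<dots> \<le> 1 - \<rho> n" using u[of \<theta>] \<rho>[of n] by (simp add: mult_left_le)
    finally show ?thesis using low[of n \<theta>] by linarith
  qed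
  have lim: "(\<lambda>n. ?F n \<theta>) \<longlonglongrightarrow> ?f \<theta>" for \<theta>
    using \<rho>lim by (auto intro!: tendsto_eq_intros)
  have [measurable]: "cis \<in> borel_measurable borel"
    by (intro borel_measurable_continuous_onI continuous_intros)
  have I: "integrable circ (\<lambda>\<theta>. ln (?F n \<theta>))" "(\<integral>\<theta>. ln (?F n \<theta>) \<partial>circ) = 0" for n
    using circle_mean_ln_inside[OF \<rho>q[of n]] by simp_all
  note L = log_integral_limit[of ?F ?f 2 "\<lambda>_. ln 2" 0, OF _ _ pos _ lim cmp]
  have U: "ln (?F n \<theta>) \<le> ln 2" for n \<theta> using pos[of n \<theta>] up[of n \<theta>] by simp
  have LL: "AE x in circ. ?f x \<noteq> 0" "integrable circ (\<lambda>x. ln (?f x))"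
    "(\<lambda>n. \<integral>x. ln (?F n x) \<partial>circ) \<longlonglongrightarrow> (\<integral>x. ln (?f x) \<partial>circ)"
    by (rule L; use U I in simp)+
  show "integrable circ (\<lambda>\<theta>. ln (?f \<theta>))" by (rule LL)
  show "(\<integral>\<theta>. ln (?f \<theta>) \<partial>circ) = 0" using LL(3) unfolding I(2) by (rule LIMSEQ_unique[OF _ tendsto_const])
  show "AE \<theta> in circ. 1 - q * cis \<theta> \<noteq> 0" using LL(1) by simp
qed

text \<open>Factoring out the larger of \<open>w - a\<close> and \<open>r\<close> (after reflecting in the circle in the second case) leaves
  \<open>\<bar>1 - q \<zeta>\<bar>\<close> with \<open>\<bar>q\<bar> \<le> 1\<close>, whose logarithm has mean zero.\<close>
theorem jensen_circle:
  assumes r: "r > 0"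
  shows "integrable circ (\<lambda>\<theta>. ln (cmod (a + of_real r * cis \<theta> - w)))"
    "(\<integral>\<theta>. ln (cmod (a + of_real r * cis \<theta> - w)) \<partial>circ) = ln (max (cmod (w - a)) r)"
    "AE \<theta> in circ. a + of_real r * cis \<theta> - w \<noteq> 0"
proof -
  interpret prob_space circ by (rule prob_space_circ)
  obtain q b :: complex where b: "b \<noteq> 0" "cmod b = max (cmod (w - a)) r" and q: "cmod q \<le> 1"
    and eq: "\<And>\<theta>. cmod (a + of_real r * cis \<theta> - w) = cmod b * cmod (1 - q * cis \<theta>)"
  proof (cases "cmod (w - a) \<ge> r")
    case True
    then have "w \<noteq> a" using r by auto
    show ?thesis
    proof (rule that[of "w - a" "of_real r / (w - a)"])
      fix \<theta>
      have "a + of_real r * cis \<theta> - w = - (w - a) * (1 - of_real r / (w - a) * cis \<theta>)"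
        using \<open>w \<noteq> a\<close> by (simp add: field_simps)
      then show "cmod (a + of_real r * cis \<theta> - w) = cmod (w - a) * cmod (1 - of_real r / (w - a) * cis \<theta>)"
        by (metis norm_minus_cancel norm_mult)
    qed (use True \<open>w \<noteq> a\<close> r in \<open>simp_all add: norm_divide\<close>)
  next
    case False
    show ?thesis
    proof (rule that[of "of_real r" "cnj ((w - a) / of_real r)"])
      fix \<theta>
      have "a + of_real r * cis \<theta> - w = of_real r * cis \<theta> * cnj (1 - cnj ((w - a) / of_real r) * cis \<theta>)"
      proof -
        have "cis \<theta> * cnj (cis \<theta>) = 1" by (simp add: cis_cnj cis_mult)
        then have "of_real r * cis \<theta> * cnj (1 - cnj ((w - a) / of_real r) * cis \<theta>)
            = of_real r * cis \<theta> - of_real r * ((w - a) / of_real r)"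
          by (simp only: complex_cnj_diff complex_cnj_mult complex_cnj_one complex_cnj_cnj)
             (metis (no_types) mult.assoc mult.commute mult.right_neutral right_diff_distrib)
        then show ?thesis using r by simp
      qed
      then show "cmod (a + of_real r * cis \<theta> - w) = cmod (of_real r) * cmod (1 - cnj ((w - a) / of_real r) * cis \<theta>)"
        by (simp only: norm_mult complex_mod_cnj norm_cis mult_1_right)
    qed (use False r in \<open>simp_all add: norm_divide del: complex_cnj_divide complex_cnj_diff\<close>)
  qed
  note U = circle_mean_ln_unit[OF q]
  have ln: "AE \<theta> in circ. ln (cmod (a + of_real r * cis \<theta> - w)) = ln (cmod b) + ln (cmod (1 - q * cis \<theta>))"
    using U(3) by eventually_elim (use b(1) in \<open>simp only: eq; subst ln_mult; simp\<close>)
  have [measurable]: "cis \<in> borel_measurable borel"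
    by (intro borel_measurable_continuous_onI continuous_intros)
  have int: "integrable circ (\<lambda>\<theta>. ln (cmod b) + ln (cmod (1 - q * cis \<theta>)))" using U by simp
  show "integrable circ (\<lambda>\<theta>. ln (cmod (a + of_real r * cis \<theta> - w)))"
  proof (rule integrable_cong_AE_imp[OF int])
    show "AE \<theta> in circ. ln (cmod b) + ln (cmod (1 - q * cis \<theta>)) = ln (cmod (a + of_real r * cis \<theta> - w))"
      using ln by eventually_elim simp
  qed measurable
  have "(\<integral>\<theta>. ln (cmod (a + of_real r * cis \<theta> - w)) \<partial>circ) = (\<integral>\<theta>. ln (cmod b) + ln (cmod (1 - q * cis \<theta>)) \<partial>circ)"
    by (rule integral_cong_AE) (measurable, rule ln)
  also have "\<dots> = ln (cmod b)" using U using prob_space by simp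
  finally show "(\<integral>\<theta>. ln (cmod (a + of_real r * cis \<theta> - w)) \<partial>circ) = ln (max (cmod (w - a)) r)"
    using b by simp
  show "AE \<theta> in circ. a + of_real r * cis \<theta> - w \<noteq> 0"
    using U(3)
  proof eventually_elim
    fix \<theta> assume "1 - q * cis \<theta> \<noteq> 0"
    then have "cmod (a + of_real r * cis \<theta> - w) \<noteq> 0" using b(1) by (simp only: eq) simp
    then show "a + of_real r * cis \<theta> - w \<noteq> 0" by (simp only: norm_eq_zero not_False_eq_True)
  qed
qed

section \<open>Rotation-invariant laws\<close>

lemma measurable_Complex [measurable]: "(\<lambda>p. Complex (fst p) (snd p)) \<in> borel_measurable (borel \<Otimes>\<^sub>M borel)"
  unfolding Complex_eq by measurable

lemma lborel_complex: "(lborel :: complex measure) = distr (lborel \<Otimes>\<^sub>M lborel) borel (\<lambda>p. Complex (fst p) (snd p))"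
proof (rule lborel_eqI)
  fix l u :: complex assume le: "\<And>b. b \<in> Basis \<Longrightarrow> l \<bullet> b \<le> u \<bullet> b"
  have le': "Re l \<le> Re u" "Im l \<le> Im u"
    using le[of 1] le[of \<i>] by (auto simp: Basis_complex_def inner_complex_def)
  have "(\<lambda>p. Complex (fst p) (snd p)) -` box l u \<inter> space (lborel \<Otimes>\<^sub>M lborel) = {Re l <..< Re u} \<times> {Im l <..< Im u}"
    by (auto simp: box_def Basis_complex_def inner_complex_def space_pair_measure)
  then have "emeasure (distr (lborel \<Otimes>\<^sub>M lborel) borel (\<lambda>p. Complex (fst p) (snd p))) (box l u)
    = emeasure (lborel \<Otimes>\<^sub>M lborel) ({Re l <..< Re u} \<times> {Im l <..< Im u})"
    by (subst emeasure_distr) auto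
  also have "\<dots> = emeasure lborel {Re l <..< Re u} * emeasure lborel {Im l <..< Im u}"
    by (rule lborel.emeasure_pair_measure_Times) auto
  also have "\<dots> = ennreal ((Re u - Re l) * (Im u - Im l))"
    using le' by (simp add: ennreal_mult)
  finally show "emeasure (distr (lborel \<Otimes>\<^sub>M lborel) borel (\<lambda>p. Complex (fst p) (snd p))) (box l u)
    = ennreal (\<Prod>b\<in>Basis. (u - l) \<bullet> b)"
    by (simp add: Basis_complex_def inner_complex_def)
qed simp

lemma nn_integral_lborel_complex:
  fixes f :: "complex \<Rightarrow> ennreal"
  assumes [measurable]: "f \<in> borel_measurable borel"
  shows "(\<integral>\<^sup>+z. f z \<partial>lborel) = (\<integral>\<^sup>+x. (\<integral>\<^sup>+y. f (Complex x y) \<partial>lborel) \<partial>lborel)"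
    and "(\<integral>\<^sup>+z. f z \<partial>lborel) = (\<integral>\<^sup>+y. (\<integral>\<^sup>+x. f (Complex x y) \<partial>lborel) \<partial>lborel)"
proof -
  have "(\<integral>\<^sup>+z. f z \<partial>lborel) = (\<integral>\<^sup>+p. f (Complex (fst p) (snd p)) \<partial>(lborel \<Otimes>\<^sub>M lborel))"
    by (subst lborel_complex, subst nn_integral_distr) auto
  also have "\<dots> = (\<integral>\<^sup>+x. (\<integral>\<^sup>+y. f (Complex x y) \<partial>lborel) \<partial>lborel)"
    by (subst lborel.nn_integral_fst[symmetric]) auto
  finally show 1: "(\<integral>\<^sup>+z. f z \<partial>lborel) = (\<integral>\<^sup>+x. (\<integral>\<^sup>+y. f (Complex x y) \<partial>lborel) \<partial>lborel)" .
  show "(\<integral>\<^sup>+z. f z \<partial>lborel) = (\<integral>\<^sup>+y. (\<integral>\<^sup>+x. f (Complex x y) \<partial>lborel) \<partial>lborel)"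
    unfolding 1 by (rule lborel_pair.Fubini'[symmetric]) (simp add: split_beta')
qed

lemma measurable_Complex_section [measurable]:
  "(\<lambda>x. Complex x y) \<in> borel_measurable borel" "(\<lambda>y. Complex x y) \<in> borel_measurable borel"
  unfolding Complex_eq by measurable

lemma nn_integral_lborel_shear:
  fixes f :: "complex \<Rightarrow> ennreal"
  assumes [measurable]: "f \<in> borel_measurable borel"
  shows "(\<integral>\<^sup>+z. f (z + of_real (t * Im z)) \<partial>lborel) = (\<integral>\<^sup>+z. f z \<partial>lborel)"
    and "(\<integral>\<^sup>+z. f (z + \<i> * of_real (t * Re z)) \<partial>lborel) = (\<integral>\<^sup>+z. f z \<partial>lborel)"
proof -
  have "(\<integral>\<^sup>+z. f (z + of_real (t * Im z)) \<partial>lborel) = (\<integral>\<^sup>+y. (\<integral>\<^sup>+x. f (Complex (t * y + 1 * x) y) \<partial>lborel) \<partial>lborel)"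
    by (subst nn_integral_lborel_complex(2)) (auto intro!: nn_integral_cong arg_cong[where f=f] simp: complex_eq_iff)
  also have "\<dots> = (\<integral>\<^sup>+y. (\<integral>\<^sup>+x. f (Complex x y) \<partial>lborel) \<partial>lborel)"
    using nn_integral_real_affine[of "\<lambda>x. f (Complex x y)" 1 "t * y" for y] by simp
  finally show "(\<integral>\<^sup>+z. f (z + of_real (t * Im z)) \<partial>lborel) = (\<integral>\<^sup>+z. f z \<partial>lborel)"
    by (simp add: nn_integral_lborel_complex(2))
  have "(\<integral>\<^sup>+z. f (z + \<i> * of_real (t * Re z)) \<partial>lborel) = (\<integral>\<^sup>+x. (\<integral>\<^sup>+y. f (Complex x (t * x + 1 * y)) \<partial>lborel) \<partial>lborel)"
    by (subst nn_integral_lborel_complex(1)) (auto intro!: nn_integral_cong arg_cong[where f=f] simp: complex_eq_iff)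
  also have "\<dots> = (\<integral>\<^sup>+x. (\<integral>\<^sup>+y. f (Complex x y) \<partial>lborel) \<partial>lborel)"
    using nn_integral_real_affine[of "\<lambda>y. f (Complex x y)" 1 "t * x" for x] by simp
  finally show "(\<integral>\<^sup>+z. f (z + \<i> * of_real (t * Re z)) \<partial>lborel) = (\<integral>\<^sup>+z. f z \<partial>lborel)"
    by (simp add: nn_integral_lborel_complex(1))
qed

text \<open>A rotation other than the half turn is a product of three shears, and each shear preserves area by
  Fubini and translation invariance. The half turn is the square of a quarter turn.\<close>
lemma nn_integral_lborel_rotation:
  fixes f :: "complex \<Rightarrow> ennreal"
  assumes [measurable]: "f \<in> borel_measurable borel" and u: "cmod u = 1"
  shows "(\<integral>\<^sup>+z. f (u * z) \<partial>lborel) = (\<integral>\<^sup>+z. f z \<partial>lborel)"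
proof -
  have main: "(\<integral>\<^sup>+z. f (u * z) \<partial>lborel) = (\<integral>\<^sup>+z. f z \<partial>lborel)"
    if [measurable]: "f \<in> borel_measurable borel" and u: "cmod u = 1" "u \<noteq> -1" for u and f :: "complex \<Rightarrow> ennreal"
  proof -
    \<comment> \<open>Minus the tangent of half the angle of rotation.\<close>
    define t where "t = - Im u / (1 + Re u)"
    let ?H = "\<lambda>z. z + of_real (t * Im z)" and ?V = "\<lambda>z. z + \<i> * of_real (Im u * Re z)"
    have sq: "(Re u)\<^sup>2 + (Im u)\<^sup>2 = 1" using u(1) by (simp add: cmod_power2[symmetric])
    have "1 + Re u \<noteq> 0"
    proof
      assume 0: "1 + Re u = 0"
      then have "Re u = -1" by simp
      with sq have "Im u = 0" by simp
      with \<open>Re u = -1\<close> u(2) show False by (simp add: complex_eq_iff)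
    qed
    then have t1: "t * (1 + Re u) = - Im u" by (simp add: t_def)
    have "(t * Im u) * (1 + Re u) = (Re u - 1) * (1 + Re u)"
    proof -
      have "(t * Im u) * (1 + Re u) = Im u * (t * (1 + Re u))" by (simp only: mult_ac)
      also have "\<dots> = - (Im u)\<^sup>2" unfolding t1 by (simp add: power2_eq_square)
      also have "\<dots> = (Re u - 1) * (1 + Re u)" using sq by (simp add: algebra_simps power2_eq_square)
      finally show ?thesis .
    qed
    then have ts: "t * Im u = Re u - 1" using \<open>1 + Re u \<noteq> 0\<close> by simp
    have eq: "?H (?V (?H z)) = u * z" for z
    proof -
      have "Re (?H (?V (?H z))) = (1 + t * Im u) * Re z + t * (1 + (1 + t * Im u)) * Im z"
        by (simp add: algebra_simps)
      also have "\<dots> = Re u * Re z + (t * (1 + Re u)) * Im z" unfolding ts by (simp add: algebra_simps)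
      finally have "Re (?H (?V (?H z))) = Re u * Re z + (t * (1 + Re u)) * Im z" .
      moreover have "Im (?H (?V (?H z))) = Im u * Re z + (1 + t * Im u) * Im z" by (simp add: algebra_simps)
      ultimately show ?thesis unfolding t1 ts by (intro complex_eqI) simp_all
    qed
    have "(\<integral>\<^sup>+z. f z \<partial>lborel) = (\<integral>\<^sup>+z. f (?H z) \<partial>lborel)" by (rule nn_integral_lborel_shear[symmetric]) simp
    also have "\<dots> = (\<integral>\<^sup>+z. f (?H (?V z)) \<partial>lborel)" by (rule nn_integral_lborel_shear(2)[symmetric]) simp
    also have "\<dots> = (\<integral>\<^sup>+z. f (?H (?V (?H z))) \<partial>lborel)" by (rule nn_integral_lborel_shear(1)[symmetric]) simp
    finally show ?thesis unfolding eq by simp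
  qed
  show ?thesis
  proof (cases "u = -1")
    case True
    have "(\<integral>\<^sup>+z. f (\<i> * (\<i> * z)) \<partial>lborel) = (\<integral>\<^sup>+z. f (\<i> * z) \<partial>lborel)"
      by (rule main[where f="\<lambda>z. f (\<i> * z)"]) (auto simp: complex_eq_iff)
    also have "\<dots> = (\<integral>\<^sup>+z. f z \<partial>lborel)" by (rule main) (auto simp: complex_eq_iff)
    finally show ?thesis using True by (simp flip: mult.assoc)
  qed (use main u in auto)
qed

lemma ennreal_integral_le_nn_integral:
  assumes "integrable M g" shows "ennreal (\<integral>x. g x \<partial>M) \<le> (\<integral>\<^sup>+x. ennreal (g x) \<partial>M)"
proof -
  have "ennreal (\<integral>x. g x \<partial>M) \<le> ennreal (\<integral>x. max 0 (g x) \<partial>M)"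
    using assms by (intro ennreal_leI integral_mono) auto
  also have "\<dots> = (\<integral>\<^sup>+x. ennreal (max 0 (g x)) \<partial>M)"
    using assms by (intro nn_integral_eq_integral[symmetric]) auto
  finally show ?thesis by (simp add: ennreal_max_0)
qed

text \<open>Subharmonicity of \<open>ln (1 + \<bar>z\<bar>\<^sup>2)\<close>, and its counterpart at the other end of the polynomial
  \<open>\<alpha> + w \<zeta>\<close>. By Cauchy-Schwarz, \<open>ln (1 + \<bar>\<alpha> + w \<zeta>\<bar>\<^sup>2)\<close> is at least
  \<open>2 ln \<bar>1 + A + conj \<alpha> w \<zeta>\<bar> - ln (1 + A)\<close> with \<open>A = \<bar>\<alpha>\<bar>\<^sup>2\<close> or \<open>A = \<bar>w\<bar>\<^sup>2\<close>, and Jensen's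
  formula gives a lower bound on the mean of the right-hand side.\<close>
lemma circ_mean_ln1p:
  shows "ennreal (ln (1 + (cmod \<alpha>)\<^sup>2)) \<le> (\<integral>\<^sup>+\<theta>. ennreal (ln (1 + (cmod (\<alpha> + w * cis \<theta>))\<^sup>2)) \<partial>circ)" (is "?A")
    and "ennreal (ln (1 + (cmod w)\<^sup>2)) \<le> (\<integral>\<^sup>+\<theta>. ennreal (ln (1 + (cmod (\<alpha> + w * cis \<theta>))\<^sup>2)) \<partial>circ)" (is "?B")
proof -
  interpret prob_space circ by (rule prob_space_circ)
  have main: "ennreal (ln (1 + A)) \<le> (\<integral>\<^sup>+\<theta>. ennreal (ln (1 + (cmod (\<alpha> + w * cis \<theta>))\<^sup>2)) \<partial>circ)"
    if A: "A \<ge> 0" and cs: "\<And>\<theta>. (cmod (of_real (1 + A) + cnj \<alpha> * w * cis \<theta>))\<^sup>2 \<le> (1 + A) * (1 + (cmod (\<alpha> + w * cis \<theta>))\<^sup>2)" for A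
  proof -
    let ?B = "cnj \<alpha> * w" and ?f = "\<lambda>\<theta>. ln (cmod (of_real (1 + A) + cnj \<alpha> * w * cis \<theta>))"
    have I: "integrable circ ?f \<and> ln (1 + A) \<le> (\<integral>\<theta>. ?f \<theta> \<partial>circ)"
    proof (cases "?B = 0")
      case True
      have "?f = (\<lambda>_. ln (1 + A))" unfolding True using A by (simp del: of_real_add)
      then show ?thesis using prob_space by simp
    next
      case False
      have sg: "?B = of_real (cmod ?B) * sgn ?B" "sgn ?B \<noteq> 0" "cmod (sgn ?B) = 1"
        by (use False in \<open>simp add: sgn_eq\<close>) (simp_all only: sgn_zero_iff norm_sgn False if_False not_False_eq_True)
      have eq: "cmod (of_real (1 + A) + ?B * cis \<theta>) = cmod (of_real (1 + A) / sgn ?B + of_real (cmod ?B) * cis \<theta> - 0)" for \<theta>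
      proof -
        have "of_real (1 + A) + ?B * cis \<theta> = sgn ?B * (of_real (1 + A) / sgn ?B + of_real (cmod ?B) * cis \<theta> - 0)"
          by (subst sg(1)) (use sg(2) in \<open>simp add: distrib_left mult_ac del: of_real_add\<close>)
        then have "cmod (of_real (1 + A) + ?B * cis \<theta>) = cmod (sgn ?B) * cmod (of_real (1 + A) / sgn ?B + of_real (cmod ?B) * cis \<theta> - 0)"
          by (simp only: norm_mult)
        then show ?thesis using sg(3) by simp
      qed
      have "0 < cmod ?B" using False by simp
      note J = jensen_circle[OF this, of "of_real (1 + A) / sgn ?B" 0]
      have "ln (1 + A) \<le> ln (max (cmod (0 - of_real (1 + A) / sgn ?B)) (cmod ?B))"
      proof (rule ln_mono)
        have "cmod (0 - of_real (1 + A) / sgn ?B) = 1 + A"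
          using A sg(3) by (simp add: norm_divide del: of_real_add)
        then show "1 + A \<le> max (cmod (0 - of_real (1 + A) / sgn ?B)) (cmod ?B)" by simp
      qed (use A in auto)
      then show ?thesis unfolding eq using J(1,2) by simp
    qed
    have "ln (1 + A) \<le> (\<integral>\<theta>. 2 * ?f \<theta> - ln (1 + A) \<partial>circ)" using I prob_space by simp
    then have "ennreal (ln (1 + A)) \<le> ennreal (\<integral>\<theta>. 2 * ?f \<theta> - ln (1 + A) \<partial>circ)" by (rule ennreal_leI)
    also have "\<dots> \<le> (\<integral>\<^sup>+\<theta>. ennreal (2 * ?f \<theta> - ln (1 + A)) \<partial>circ)"
      using I by (intro ennreal_integral_le_nn_integral) simp
    also have "\<dots> \<le> (\<integral>\<^sup>+\<theta>. ennreal (ln (1 + (cmod (\<alpha> + w * cis \<theta>))\<^sup>2)) \<partial>circ)"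
    proof (intro nn_integral_mono ennreal_leI)
      fix \<theta>
      let ?y = "cmod (of_real (1 + A) + cnj \<alpha> * w * cis \<theta>)" and ?z = "1 + (cmod (\<alpha> + w * cis \<theta>))\<^sup>2"
      have z: "1 \<le> ?z" by simp
      show "2 * ?f \<theta> - ln (1 + A) \<le> ln ?z"
      proof (cases "?y = 0")
        case True
        then have "ln ?y = 0" by (simp only: ln_0)
        moreover have "0 \<le> ln (1 + A)" using A by simp
        moreover have "0 \<le> ln ?z" using z by (rule ln_ge_zero)
        ultimately show ?thesis by linarith
      next
        case False
        then have "2 * ?f \<theta> = ln (?y\<^sup>2)" by (simp add: ln_realpow)
        also have "\<dots> \<le> ln ((1 + A) * ?z)" using cs[of \<theta>] False by (intro ln_mono) auto
        also have "\<dots> = ln (1 + A) + ln ?z" using A z by (intro ln_mult_pos) (auto intro: add_pos_nonneg)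
        finally show ?thesis by simp
      qed
    qed
    finally show ?thesis .
  qed
  \<comment> \<open>Cauchy-Schwarz for the vectors \<open>(1, x)\<close> and \<open>(1, y)\<close>; below, \<open>y\<close> is \<open>\<alpha> + w \<zeta>\<close>, and \<open>x\<close> is \<open>\<alpha>\<close> or \<open>w \<zeta>\<close>.\<close>
  have cs: "(cmod (1 + cnj x * y))\<^sup>2 \<le> (1 + (cmod x)\<^sup>2) * (1 + (cmod y)\<^sup>2)" for x y :: complex
  proof -
    have "(1 + (cmod x)\<^sup>2) * (1 + (cmod y)\<^sup>2) - (cmod (1 + cnj x * y))\<^sup>2 = (cmod (x - y))\<^sup>2"
      unfolding cmod_power2 by (simp add: algebra_simps power2_eq_square)
    then show ?thesis by (metis diff_ge_0_iff_ge zero_le_power2)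
  qed
  show ?A
  proof (rule main)
    fix \<theta>
    have "of_real (1 + (cmod \<alpha>)\<^sup>2) + cnj \<alpha> * w * cis \<theta> = 1 + cnj \<alpha> * (\<alpha> + w * cis \<theta>)"
      by (simp add: complex_norm_square algebra_simps flip: of_real_power)
    then show "(cmod (of_real (1 + (cmod \<alpha>)\<^sup>2) + cnj \<alpha> * w * cis \<theta>))\<^sup>2 \<le> (1 + (cmod \<alpha>)\<^sup>2) * (1 + (cmod (\<alpha> + w * cis \<theta>))\<^sup>2)"
      by (simp only: cs)
  qed simp
  show ?B
  proof (rule main)
    fix \<theta>
    have "cis \<theta> * cnj (cis \<theta>) = 1" by (simp add: cis_cnj cis_mult)
    then have "of_real (1 + (cmod w)\<^sup>2) + cnj \<alpha> * w * cis \<theta> = cnj (1 + cnj (w * cis \<theta>) * (\<alpha> + w * cis \<theta>))"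
      by (simp add: complex_norm_square algebra_simps flip: of_real_power)
    then have "cmod (of_real (1 + (cmod w)\<^sup>2) + cnj \<alpha> * w * cis \<theta>) = cmod (1 + cnj (w * cis \<theta>) * (\<alpha> + w * cis \<theta>))"
      by (metis complex_mod_cnj)
    then show "(cmod (of_real (1 + (cmod w)\<^sup>2) + cnj \<alpha> * w * cis \<theta>))\<^sup>2 \<le> (1 + (cmod w)\<^sup>2) * (1 + (cmod (\<alpha> + w * cis \<theta>))\<^sup>2)"
      using cs[of "w * cis \<theta>"] by (simp add: norm_mult)
  qed simp
qed

text \<open>The properties of the Gaussian law that the argument uses: the logarithmic moment keeps a noise factor from
  destroying the lower bounds on logarithms of determinants.\<close>
locale isotropic_law = prob_space M for M :: "complex measure" +
  fixes c C :: real
  assumes sets_M [measurable_cong, simp]: "sets M = sets borel"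
    and rotation: "\<And>u (f :: complex \<Rightarrow> ennreal). cmod u = 1 \<Longrightarrow> f \<in> borel_measurable borel \<Longrightarrow>
        (\<integral>\<^sup>+z. f (u * z) \<partial>M) = (\<integral>\<^sup>+z. f z \<partial>M)"
    and c_nonneg: "c \<ge> 0" and second_moment: "(\<integral>\<^sup>+z. ennreal ((cmod z)\<^sup>2) \<partial>M) \<le> ennreal c"
    and C_nonneg: "C \<ge> 0" and log_moment: "(\<integral>\<^sup>+z. ennreal (- ln (min 1 ((cmod z)\<^sup>2))) \<partial>M) \<le> ennreal C"
    and nonzero: "AE z in M. z \<noteq> 0"
begin

text \<open>Averaging over \<open>z\<close> and \<open>- z\<close> removes the cross term, by the parallelogram law.\<close>
lemma second_moment_affine:
  "(\<integral>\<^sup>+z. ennreal ((cmod (\<alpha> + \<beta> * z))\<^sup>2) \<partial>M) \<le> ennreal ((cmod \<alpha>)\<^sup>2 + c * (cmod \<beta>)\<^sup>2)"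
proof -
  let ?I = "\<integral>\<^sup>+z. ennreal ((cmod (\<alpha> + \<beta> * z))\<^sup>2) \<partial>M" and ?X = "ennreal ((cmod \<alpha>)\<^sup>2 + c * (cmod \<beta>)\<^sup>2)"
  have "?I = (\<integral>\<^sup>+z. ennreal ((cmod (\<alpha> + \<beta> * (-1 * z)))\<^sup>2) \<partial>M)"
    by (rule rotation[symmetric]) auto
  then have "?I + ?I = ?I + (\<integral>\<^sup>+z. ennreal ((cmod (\<alpha> - \<beta> * z))\<^sup>2) \<partial>M)" by simp
  also have "\<dots> = (\<integral>\<^sup>+z. ennreal ((cmod (\<alpha> + \<beta> * z))\<^sup>2) + ennreal ((cmod (\<alpha> - \<beta> * z))\<^sup>2) \<partial>M)"
    by (rule nn_integral_add[symmetric]) auto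
  also have "\<dots> = (\<integral>\<^sup>+z. ennreal (2 * (cmod \<alpha>)\<^sup>2) + ennreal (2 * (cmod \<beta>)\<^sup>2) * ennreal ((cmod z)\<^sup>2) \<partial>M)"
  proof (rule nn_integral_cong)
    fix z
    have "(cmod (\<alpha> + \<beta> * z))\<^sup>2 + (cmod (\<alpha> - \<beta> * z))\<^sup>2 = 2 * (cmod \<alpha>)\<^sup>2 + 2 * (cmod \<beta>)\<^sup>2 * (cmod z)\<^sup>2"
      unfolding norm_mult[symmetric] power_mult_distrib[symmetric] mult.assoc cmod_power2
      by (simp add: power2_eq_square algebra_simps)
    then show "ennreal ((cmod (\<alpha> + \<beta> * z))\<^sup>2) + ennreal ((cmod (\<alpha> - \<beta> * z))\<^sup>2) = ennreal (2 * (cmod \<alpha>)\<^sup>2) + ennreal (2 * (cmod \<beta>)\<^sup>2) * ennreal ((cmod z)\<^sup>2)"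
      by (simp flip: ennreal_plus ennreal_mult)
  qed
  also have "\<dots> = ennreal (2 * (cmod \<alpha>)\<^sup>2) + ennreal (2 * (cmod \<beta>)\<^sup>2) * (\<integral>\<^sup>+z. ennreal ((cmod z)\<^sup>2) \<partial>M)"
    by (subst nn_integral_add, simp, simp, subst nn_integral_cmult) (auto simp: emeasure_space_1)
  also have "\<dots> \<le> ennreal (2 * (cmod \<alpha>)\<^sup>2) + ennreal (2 * (cmod \<beta>)\<^sup>2) * ennreal c"
    by (intro add_left_mono mult_left_mono second_moment) auto
  also have "\<dots> = ?X + ?X"
    using c_nonneg by (simp flip: ennreal_plus ennreal_mult add: algebra_simps)
  finally show ?thesis
    using c_nonneg by (cases ?I) (auto simp: top_unique simp flip: ennreal_plus)
qed

text \<open>Write \<open>z\<close> as a uniform phase times \<open>z\<close> and use the circle means. In the second bound the factor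
  \<open>\<bar>z\<bar>\<close> in front of \<open>\<beta>\<close> is paid for by the logarithmic moment \<open>C\<close>.\<close>
lemma ln1p_affine:
  shows "ennreal (ln (1 + (cmod \<alpha>)\<^sup>2)) \<le> (\<integral>\<^sup>+z. ennreal (ln (1 + (cmod (\<alpha> + \<beta> * z))\<^sup>2)) \<partial>M)" (is ?A)
    and "ennreal (ln (1 + (cmod \<beta>)\<^sup>2)) \<le> (\<integral>\<^sup>+z. ennreal (ln (1 + (cmod (\<alpha> + \<beta> * z))\<^sup>2)) \<partial>M) + ennreal C" (is ?B)
proof -
  interpret K: prob_space circ by (rule prob_space_circ)
  interpret P: pair_sigma_finite circ M ..
  let ?F = "\<lambda>w. ennreal (ln (1 + (cmod w)\<^sup>2))"
  have [measurable]: "cis \<in> borel_measurable borel"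
    by (intro borel_measurable_continuous_onI continuous_intros)
  have "(\<integral>\<^sup>+z. ?F (\<alpha> + \<beta> * z) \<partial>M) = (\<integral>\<^sup>+\<theta>. (\<integral>\<^sup>+z. ?F (\<alpha> + \<beta> * z) \<partial>M) \<partial>circ)"
    using K.emeasure_space_1 by simp
  also have "\<dots> = (\<integral>\<^sup>+\<theta>. (\<integral>\<^sup>+z. ?F (\<alpha> + \<beta> * (cis \<theta> * z)) \<partial>M) \<partial>circ)"
    by (intro nn_integral_cong rotation[symmetric]) auto
  also have "\<dots> = (\<integral>\<^sup>+z. (\<integral>\<^sup>+\<theta>. ?F (\<alpha> + \<beta> * (cis \<theta> * z)) \<partial>circ) \<partial>M)"
    by (rule P.Fubini'[symmetric]) (auto simp: split_beta')
  also have "\<dots> = (\<integral>\<^sup>+z. (\<integral>\<^sup>+\<theta>. ?F (\<alpha> + (\<beta> * z) * cis \<theta>) \<partial>circ) \<partial>M)"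
    by (simp add: mult_ac)
  finally have eq: "(\<integral>\<^sup>+z. ?F (\<alpha> + \<beta> * z) \<partial>M) = (\<integral>\<^sup>+z. (\<integral>\<^sup>+\<theta>. ?F (\<alpha> + (\<beta> * z) * cis \<theta>) \<partial>circ) \<partial>M)" .
  have "?F \<alpha> = (\<integral>\<^sup>+z. ?F \<alpha> \<partial>M)" by (simp add: emeasure_space_1)
  also have "\<dots> \<le> (\<integral>\<^sup>+z. (\<integral>\<^sup>+\<theta>. ?F (\<alpha> + (\<beta> * z) * cis \<theta>) \<partial>circ) \<partial>M)"
    by (intro nn_integral_mono circ_mean_ln1p)
  finally show ?A unfolding eq .
  have "?F \<beta> = (\<integral>\<^sup>+z. ?F \<beta> \<partial>M)" by (simp add: emeasure_space_1)
  also have "\<dots> \<le> (\<integral>\<^sup>+z. ?F (\<beta> * z) + ennreal (- ln (min 1 ((cmod z)\<^sup>2))) \<partial>M)"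
  proof (rule nn_integral_mono_AE, use nonzero in eventually_elim)
    fix z :: complex assume "z \<noteq> 0"
    define m where "m = min 1 ((cmod z)\<^sup>2)"
    have m: "0 < m" "m \<le> 1" "m \<le> (cmod z)\<^sup>2" using \<open>z \<noteq> 0\<close> by (auto simp: m_def)
    have "m * (1 + (cmod \<beta>)\<^sup>2) \<le> 1 + (cmod (\<beta> * z))\<^sup>2"
      using m mult_right_mono[OF m(3), of "(cmod \<beta>)\<^sup>2"] by (simp add: algebra_simps norm_mult power_mult_distrib)
    then have "ln (m * (1 + (cmod \<beta>)\<^sup>2)) \<le> ln (1 + (cmod (\<beta> * z))\<^sup>2)"
      using m by (intro ln_mono) (auto intro!: mult_pos_pos add_pos_nonneg)
    then have "ln (1 + (cmod \<beta>)\<^sup>2) \<le> ln (1 + (cmod (\<beta> * z))\<^sup>2) + - ln m"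
      using m by (subst (asm) ln_mult_pos) (auto intro: add_pos_nonneg)
    then show "?F \<beta> \<le> ?F (\<beta> * z) + ennreal (- ln (min 1 ((cmod z)\<^sup>2)))"
      unfolding m_def[symmetric] using m by (subst ennreal_plus[symmetric]) (auto intro!: ennreal_leI)
  qed
  also have "\<dots> = (\<integral>\<^sup>+z. ?F (\<beta> * z) \<partial>M) + (\<integral>\<^sup>+z. ennreal (- ln (min 1 ((cmod z)\<^sup>2))) \<partial>M)"
    by (rule nn_integral_add) auto
  also have "\<dots> \<le> (\<integral>\<^sup>+z. (\<integral>\<^sup>+\<theta>. ?F (\<alpha> + (\<beta> * z) * cis \<theta>) \<partial>circ) \<partial>M) + ennreal C"
    by (intro add_mono nn_integral_mono circ_mean_ln1p log_moment)
  finally show ?B unfolding eq .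
qed

end

lemma nn_integral_std_complex_gaussian:
  assumes [measurable]: "f \<in> borel_measurable borel"
  shows "(\<integral>\<^sup>+z. f z \<partial>std_complex_gaussian) = (\<integral>\<^sup>+z. ennreal (exp (- (cmod z)\<^sup>2) / pi) * f z \<partial>lborel)"
  unfolding std_complex_gaussian_def by (subst nn_integral_density) auto

text \<open>Only finiteness of the moments matters, so crude bounds serve: the second moment is compared with a
  wider Gaussian, and the logarithm near the origin with a sum over dyadic discs.\<close>
lemma isotropic_std_complex_gaussian:
  assumes "prob_space std_complex_gaussian"
  shows "\<exists>c C. isotropic_law std_complex_gaussian c C"
proof -
  interpret prob_space std_complex_gaussian by fact
  have sets [measurable_cong, simp]: "sets std_complex_gaussian = sets borel"
    by (simp add: std_complex_gaussian_def)
  have "(\<integral>\<^sup>+z. ennreal ((cmod z)\<^sup>2) \<partial>std_complex_gaussian)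
      = (\<integral>\<^sup>+z. ennreal (exp (- (cmod z)\<^sup>2) / pi) * ennreal ((cmod z)\<^sup>2) \<partial>lborel)"
    by (rule nn_integral_std_complex_gaussian) measurable
  also have "\<dots> \<le> (\<integral>\<^sup>+z. ennreal (2 * exp (- (cmod z)\<^sup>2 / 2)) \<partial>lborel)"
  proof (rule nn_integral_mono)
    fix z :: complex
    let ?x = "(cmod z)\<^sup>2"
    have "?x / 2 \<le> exp (?x / 2)" using exp_ge_add_one_self[of "?x / 2"] by linarith
    then have "exp (- ?x) * ?x \<le> exp (- ?x) * (2 * exp (?x / 2))" by (intro mult_left_mono) auto
    also have "\<dots> = 2 * exp (- ?x / 2)" by (simp flip: exp_add)
    finally have "exp (- ?x) * ?x \<le> 2 * exp (- ?x / 2)" .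
    moreover have "exp (- ?x) / pi * ?x \<le> exp (- ?x) * ?x"
    proof -
      have "exp (- ?x) / pi \<le> exp (- ?x) / 1" using pi_gt3 by (intro divide_left_mono) auto
      then show ?thesis by (intro mult_right_mono) auto
    qed
    ultimately show "ennreal (exp (- ?x) / pi) * ennreal ?x \<le> ennreal (2 * exp (- ?x / 2))"
      by (subst ennreal_mult[symmetric]) (auto intro!: ennreal_leI)
  qed
  also have "\<dots> = (\<integral>\<^sup>+x. (\<integral>\<^sup>+y. ennreal (4 * pi) * (ennreal (std_normal_density x) * ennreal (std_normal_density y)) \<partial>lborel) \<partial>lborel)"
    by (subst nn_integral_lborel_complex(1))
       (auto intro!: nn_integral_cong arg_cong[where f=ennreal] simp: std_normal_density_def cmod_power2 exp_add[symmetric] add_divide_distrib simp flip: ennreal_mult)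
  also have "\<dots> < \<infinity>"
  proof -
    interpret N: prob_space "density lborel std_normal_density" by (rule prob_space_normal_density) simp
    have "(\<integral>\<^sup>+x. ennreal (std_normal_density x) \<partial>lborel) = 1"
      using N.emeasure_space_1 by (subst (asm) emeasure_density) auto
    then show ?thesis by (simp add: nn_integral_cmult nn_integral_multc mult.assoc[symmetric] ennreal_mult_less_top)
  qed
  finally have "(\<integral>\<^sup>+z. ennreal ((cmod z)\<^sup>2) \<partial>std_complex_gaussian) < \<infinity>" .
  then obtain c where c: "c \<ge> 0" "(\<integral>\<^sup>+z. ennreal ((cmod z)\<^sup>2) \<partial>std_complex_gaussian) = ennreal c"
    by (cases "\<integral>\<^sup>+z. ennreal ((cmod z)\<^sup>2) \<partial>std_complex_gaussian") auto
  have "(\<integral>\<^sup>+z. ennreal (- ln (min 1 ((cmod z)\<^sup>2))) \<partial>std_complex_gaussian)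
      = (\<integral>\<^sup>+z. ennreal (exp (- (cmod z)\<^sup>2) / pi) * ennreal (- ln (min 1 ((cmod z)\<^sup>2))) \<partial>lborel)"
    by (rule nn_integral_std_complex_gaussian) measurable
  also have "\<dots> \<le> (\<integral>\<^sup>+z. (\<Sum>k. ennreal (2 ^ (k + 2)) * indicator (cball (0::complex) ((1/2) ^ k)) z) \<partial>lborel)"
  proof (rule nn_integral_mono)
    fix z :: complex
    have "ennreal (- ln (min 1 ((cmod z)\<^sup>2))) \<le> (\<Sum>k. ennreal (2 ^ (k + 2)) * indicator (cball (0::complex) ((1/2) ^ k)) z)"
    proof (cases "z = 0 \<or> cmod z \<ge> 1")
      case True
      then have "- ln (min 1 ((cmod z)\<^sup>2)) = 0" by (auto simp: min_def)
      then show ?thesis by simp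
    next
      case False
      then have z: "0 < cmod z" "cmod z < 1" by auto
      define k where "k = (LEAST k. (1/2) ^ Suc k < cmod z)"
      have ex: "\<exists>k. (1/2) ^ Suc k < cmod z"
      proof -
        obtain n where "(1/2) ^ n < cmod z" using real_arch_pow_inv[OF z(1), of "1/2"] by auto
        then have "(1/2) ^ Suc n < cmod z" by (rule order_le_less_trans[rotated]) (intro power_decreasing; simp)
        then show ?thesis by blast
      qed
      have k1: "(1/2) ^ Suc k < cmod z" unfolding k_def using ex by (rule LeastI_ex)
      have k2: "cmod z \<le> (1/2) ^ k"
      proof (cases k)
        case 0 then show ?thesis using z by simp
      next
        case (Suc j)
        then have "\<not> (1/2) ^ Suc j < cmod z" unfolding k_def by (intro not_less_Least) simp
        then show ?thesis using Suc by simp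
      qed
      have inv: "1 / cmod z \<le> 2 ^ Suc k"
        using k1 z by (simp add: field_simps power_divide)
      have "- ln (min 1 ((cmod z)\<^sup>2)) = 2 * ln (1 / cmod z)"
        using z abs_square_less_1[of "cmod z"] by (simp add: min_def ln_realpow ln_div)
      also have "\<dots> \<le> 2 * (1 / cmod z)" using z ln_bound[of "1 / cmod z"] by simp
      also have "\<dots> \<le> 2 ^ (k + 2)" using inv by simp
      finally have "ennreal (- ln (min 1 ((cmod z)\<^sup>2))) \<le> ennreal (2 ^ (k + 2)) * indicator (cball (0::complex) ((1/2) ^ k)) z"
        using k2 by (auto simp: indicator_def intro!: ennreal_leI)
      also have "\<dots> \<le> (\<Sum>k. ennreal (2 ^ (k + 2)) * indicator (cball (0::complex) ((1/2) ^ k)) z)"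
      proof -
        have "h k \<le> (\<Sum>k. h k)" for h :: "nat \<Rightarrow> ennreal"
          using sum_le_suminf[of h "{k}"] by simp
        then show ?thesis .
      qed
      finally show ?thesis .
    qed
    moreover have "ennreal (exp (- (cmod z)\<^sup>2) / pi) \<le> 1"
    proof -
      have "exp (- (cmod z)\<^sup>2) \<le> 1" by simp
      then have "exp (- (cmod z)\<^sup>2) \<le> pi" using pi_gt3 by linarith
      then show ?thesis by simp
    qed
    ultimately have "ennreal (exp (- (cmod z)\<^sup>2) / pi) * ennreal (- ln (min 1 ((cmod z)\<^sup>2)))
      \<le> 1 * (\<Sum>k. ennreal (2 ^ (k + 2)) * indicator (cball (0::complex) ((1/2) ^ k)) z)"
      by (intro mult_mono zero_le)
    then show "ennreal (exp (- (cmod z)\<^sup>2) / pi) * ennreal (- ln (min 1 ((cmod z)\<^sup>2)))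
      \<le> (\<Sum>k. ennreal (2 ^ (k + 2)) * indicator (cball (0::complex) ((1/2) ^ k)) z)"
      by (simp only: mult_1)
  qed
  also have "\<dots> = (\<Sum>k. ennreal (2 ^ (k + 2)) * emeasure lborel (cball (0::complex) ((1/2) ^ k)))"
  proof (subst nn_integral_suminf)
    show "(\<lambda>z. ennreal (2 ^ (k + 2)) * indicator (cball (0::complex) ((1/2) ^ k)) z) \<in> borel_measurable lborel" for k
      by (intro borel_measurable_times_ennreal borel_measurable_indicator borel_measurable_const) simp
  qed (simp add: nn_integral_cmult_indicator)
  also have "\<dots> \<le> (\<Sum>k. ennreal (16 * (1/2) ^ k))"
  proof (intro suminf_le summableI)
    fix k :: nat
    let ?r = "(1/2) ^ k :: real"
    have "cball (0::complex) ?r \<subseteq> cbox (- Complex ?r ?r) (Complex ?r ?r)"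
    proof
      fix z :: complex assume "z \<in> cball 0 ?r"
      then have "\<bar>Re z\<bar> \<le> ?r" "\<bar>Im z\<bar> \<le> ?r"
        using abs_Re_le_cmod[of z] abs_Im_le_cmod[of z] by auto
      then show "z \<in> cbox (- Complex ?r ?r) (Complex ?r ?r)"
        by (auto simp: cbox_def Basis_complex_def inner_complex_def)
    qed
    then have "emeasure lborel (cball (0::complex) ?r) \<le> emeasure lborel (cbox (- Complex ?r ?r) (Complex ?r ?r))"
      by (intro emeasure_mono) auto
    also have "\<dots> = ennreal (4 * ?r\<^sup>2)"
      by (subst emeasure_lborel_cbox) (auto simp: Basis_complex_def inner_complex_def power2_eq_square)
    finally have "ennreal (2 ^ (k + 2)) * emeasure lborel (cball (0::complex) ?r) \<le> ennreal (2 ^ (k + 2)) * ennreal (4 * ?r\<^sup>2)"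
      by (intro mult_left_mono) auto
    also have "\<dots> = ennreal (16 * ?r)"
      by (simp flip: ennreal_mult add: power2_eq_square power_divide)
    finally show "ennreal (2 ^ (k + 2)) * emeasure lborel (cball (0::complex) ?r) \<le> ennreal (16 * ?r)" .
  qed
  also have "\<dots> < \<infinity>"
    by (subst suminf_ennreal2) (auto intro!: summable_mult summable_geometric)
  finally have "(\<integral>\<^sup>+z. ennreal (- ln (min 1 ((cmod z)\<^sup>2))) \<partial>std_complex_gaussian) < \<infinity>" .
  then obtain C where C: "C \<ge> 0" "(\<integral>\<^sup>+z. ennreal (- ln (min 1 ((cmod z)\<^sup>2))) \<partial>std_complex_gaussian) = ennreal C"
    by (cases "\<integral>\<^sup>+z. ennreal (- ln (min 1 ((cmod z)\<^sup>2))) \<partial>std_complex_gaussian") auto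
  have "isotropic_law std_complex_gaussian c C"
  proof
    fix u and f :: "complex \<Rightarrow> ennreal" assume u: "cmod u = 1" and [measurable]: "f \<in> borel_measurable borel"
    have "(\<integral>\<^sup>+z. f (u * z) \<partial>std_complex_gaussian) = (\<integral>\<^sup>+z. ennreal (exp (- (cmod (u * z))\<^sup>2) / pi) * f (u * z) \<partial>lborel)"
      using u by (subst nn_integral_std_complex_gaussian) (auto simp: norm_mult)
    also have "\<dots> = (\<integral>\<^sup>+z. ennreal (exp (- (cmod z)\<^sup>2) / pi) * f z \<partial>lborel)"
      using u by (intro nn_integral_lborel_rotation) auto
    finally show "(\<integral>\<^sup>+z. f (u * z) \<partial>std_complex_gaussian) = (\<integral>\<^sup>+z. f z \<partial>std_complex_gaussian)"
      by (simp add: nn_integral_std_complex_gaussian)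
  next
    show "AE z in std_complex_gaussian. z \<noteq> 0"
    proof -
      have "AE z in lborel. 0 < ennreal (exp (- (cmod z)\<^sup>2) / pi) \<longrightarrow> z \<noteq> 0"
        using AE_lborel_singleton[of "0::complex"] by eventually_elim simp
      then show ?thesis unfolding std_complex_gaussian_def by (subst AE_density) simp_all
    qed
  qed (use c C in auto)
  then show ?thesis by blast
qed

section \<open>Polynomials in independent rotation-invariant variables\<close>

lemma sum_Pow_insert:
  fixes f :: "'a set \<Rightarrow> 'b :: comm_monoid_add"
  assumes "finite I" "e \<notin> I"
  shows "(\<Sum>E\<in>Pow (insert e I). f E) = (\<Sum>E\<in>Pow I. f E) + (\<Sum>E\<in>Pow I. f (insert e E))"
proof -
  have inj: "inj_on (insert e) (Pow I)" using assms(2) by (auto simp: inj_on_def)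
  show ?thesis
    unfolding Pow_insert using assms
    by (subst sum.union_disjoint) (auto simp: sum.reindex[OF inj])
qed

text \<open>A polynomial of degree at most one in each variable, with coefficients indexed by monomials.\<close>
definition multi_affine :: "'i set \<Rightarrow> ('i set \<Rightarrow> complex) \<Rightarrow> ('i \<Rightarrow> complex) \<Rightarrow> complex" where
  "multi_affine I a x = (\<Sum>E\<in>Pow I. a E * (\<Prod>e\<in>E. x e))"

text \<open>As a function of one more variable the polynomial is affine, which reduces the next two lemmas to
  one variable at a time.\<close>
lemma multi_affine_insert:
  assumes "finite I" "e \<notin> I"
  shows "multi_affine (insert e I) a (x(e := y)) = multi_affine I a x + multi_affine I (\<lambda>E. a (insert e E)) x * y"
proof -
  have A: "(\<Prod>i\<in>E. (x(e := y)) i) = (\<Prod>i\<in>E. x i)" if "E \<in> Pow I" for E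
    using that assms by (intro prod.cong) auto
  have B: "(\<Prod>i\<in>insert e E. (x(e := y)) i) = (\<Prod>i\<in>E. x i) * y" if E: "E \<in> Pow I" for E
  proof -
    have "finite E" "e \<notin> E" using E assms by (auto intro: finite_subset)
    then have "(\<Prod>i\<in>insert e E. (x(e := y)) i) = y * (\<Prod>i\<in>E. (x(e := y)) i)" by simp
    also have "(\<Prod>i\<in>E. (x(e := y)) i) = (\<Prod>i\<in>E. x i)" using \<open>e \<notin> E\<close> by (intro prod.cong) auto
    finally show ?thesis by simp
  qed
  have "multi_affine (insert e I) a (x(e := y))
      = (\<Sum>E\<in>Pow I. a E * (\<Prod>i\<in>E. x i)) + (\<Sum>E\<in>Pow I. a (insert e E) * ((\<Prod>i\<in>E. x i) * y))"
    unfolding multi_affine_def sum_Pow_insert[OF assms]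
    by (intro arg_cong2[where f="(+)"] sum.cong refl) (simp_all only: A B)
  then show ?thesis by (simp add: multi_affine_def sum_distrib_right mult.assoc)
qed

context isotropic_law
begin

lemma product_sigma_finite_const: "product_sigma_finite (\<lambda>_. M)"
  by (standard)

lemma measurable_multi_affine [measurable]:
  assumes "finite I"
  shows "multi_affine I a \<in> borel_measurable (PiM I (\<lambda>_. M))"
proof -
  have "(\<lambda>x. \<Prod>e\<in>E. x e) \<in> borel_measurable (PiM I (\<lambda>_. M))" if "E \<in> Pow I" for E
  proof (rule borel_measurable_prod)
    fix e assume "e \<in> E"
    then have "(\<lambda>x. x e) \<in> PiM I (\<lambda>_. M) \<rightarrow>\<^sub>M M" using that by (intro measurable_component_singleton) auto
    then show "(\<lambda>x. x e) \<in> borel_measurable (PiM I (\<lambda>_. M))"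
      by (subst (asm) measurable_cong_sets[OF refl sets_M])
  qed
  then show ?thesis unfolding multi_affine_def[abs_def]
    by (intro borel_measurable_sum borel_measurable_times borel_measurable_const) auto
qed

text \<open>Distinct monomials are uncorrelated.\<close>
lemma second_moment_multi_affine:
  assumes "finite I"
  shows "(\<integral>\<^sup>+x. ennreal ((cmod (multi_affine I a x))\<^sup>2) \<partial>PiM I (\<lambda>_. M))
      \<le> ennreal (\<Sum>E\<in>Pow I. c ^ card E * (cmod (a E))\<^sup>2)"
  using assms
proof (induction I arbitrary: a)
  case empty
  interpret product_sigma_finite "\<lambda>_. M" by (rule product_sigma_finite_const)
  show ?case by (simp add: multi_affine_def PiM_empty nn_integral_count_space_finite)
next
  case (insert e I)
  interpret product_sigma_finite "\<lambda>_. M" by (rule product_sigma_finite_const)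
  have fin: "finite (insert e I)" using insert.hyps by simp
  note [measurable] = measurable_multi_affine[OF insert.hyps(1)] measurable_multi_affine[OF fin]
  let ?P = "multi_affine I a" and ?Q = "multi_affine I (\<lambda>E. a (insert e E))"
  have "(\<integral>\<^sup>+x. ennreal ((cmod (multi_affine (insert e I) a x))\<^sup>2) \<partial>PiM (insert e I) (\<lambda>_. M))
     = (\<integral>\<^sup>+x. (\<integral>\<^sup>+y. ennreal ((cmod (?P x + ?Q x * y))\<^sup>2) \<partial>M) \<partial>PiM I (\<lambda>_. M))"
    by (subst product_nn_integral_insert) (use insert.hyps in \<open>simp_all add: multi_affine_insert\<close>)
  also have "\<dots> \<le> (\<integral>\<^sup>+x. ennreal ((cmod (?P x))\<^sup>2 + c * (cmod (?Q x))\<^sup>2) \<partial>PiM I (\<lambda>_. M))"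
    by (intro nn_integral_mono second_moment_affine)
  also have "\<dots> = (\<integral>\<^sup>+x. ennreal ((cmod (?P x))\<^sup>2) + ennreal c * ennreal ((cmod (?Q x))\<^sup>2) \<partial>PiM I (\<lambda>_. M))"
    using c_nonneg by (simp add: ennreal_mult)
  also have "\<dots> = (\<integral>\<^sup>+x. ennreal ((cmod (?P x))\<^sup>2) \<partial>PiM I (\<lambda>_. M)) + ennreal c * (\<integral>\<^sup>+x. ennreal ((cmod (?Q x))\<^sup>2) \<partial>PiM I (\<lambda>_. M))"
    by (subst nn_integral_add) (auto simp: nn_integral_cmult)
  also have "\<dots> \<le> ennreal (\<Sum>E\<in>Pow I. c ^ card E * (cmod (a E))\<^sup>2) + ennreal c * ennreal (\<Sum>E\<in>Pow I. c ^ card E * (cmod (a (insert e E)))\<^sup>2)"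
    by (intro add_mono mult_left_mono insert.IH) auto
  also have "\<dots> = ennreal ((\<Sum>E\<in>Pow I. c ^ card E * (cmod (a E))\<^sup>2) + c * (\<Sum>E\<in>Pow I. c ^ card E * (cmod (a (insert e E)))\<^sup>2))"
    using c_nonneg by (simp add: ennreal_mult sum_nonneg)
  also have "c * (\<Sum>E\<in>Pow I. c ^ card E * (cmod (a (insert e E)))\<^sup>2) = (\<Sum>E\<in>Pow I. c ^ card (insert e E) * (cmod (a (insert e E)))\<^sup>2)"
    unfolding sum_distrib_left
  proof (rule sum.cong)
    fix E assume "E \<in> Pow I"
    then have "finite E" "e \<notin> E" using insert.hyps by (auto intro: finite_subset)
    then show "c * (c ^ card E * (cmod (a (insert e E)))\<^sup>2) = c ^ card (insert e E) * (cmod (a (insert e E)))\<^sup>2" by simp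
  qed simp
  finally show ?case unfolding sum_Pow_insert[OF insert.hyps] .
qed

text \<open>Integrate out the variables one at a time, keeping at each step the part of the affine function that
  contains the chosen monomial. Each variable in the monomial costs \<open>C\<close>, and the others cost nothing. The
  logarithm \<open>ln (1 + \<bar>z\<bar>\<^sup>2)\<close> is nonnegative, so no integrability has to be known in advance.\<close>
lemma ln1p_multi_affine:
  assumes "finite I" "E \<subseteq> I"
  shows "ennreal (ln (1 + (cmod (a E))\<^sup>2))
      \<le> (\<integral>\<^sup>+x. ennreal (ln (1 + (cmod (multi_affine I a x))\<^sup>2)) \<partial>PiM I (\<lambda>_. M)) + ennreal (C * card E)"
  using assms
proof (induction I arbitrary: a E)
  case empty
  interpret product_sigma_finite "\<lambda>_. M" by (rule product_sigma_finite_const)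
  from empty show ?case by (simp add: multi_affine_def PiM_empty nn_integral_count_space_finite)
next
  case (insert e I)
  interpret product_sigma_finite "\<lambda>_. M" by (rule product_sigma_finite_const)
  have fin: "finite (insert e I)" using insert.hyps by simp
  note [measurable] = measurable_multi_affine[OF insert.hyps(1)] measurable_multi_affine[OF fin]
  let ?P = "multi_affine I a" and ?Q = "multi_affine I (\<lambda>E. a (insert e E))"
  let ?F = "\<lambda>w. ennreal (ln (1 + (cmod w)\<^sup>2))"
  interpret pr: prob_space "PiM I (\<lambda>_. M)" by (rule prob_space_PiM) (rule prob_space_axioms)
  have eq: "(\<integral>\<^sup>+x. ?F (multi_affine (insert e I) a x) \<partial>PiM (insert e I) (\<lambda>_. M))
     = (\<integral>\<^sup>+x. (\<integral>\<^sup>+y. ?F (?P x + ?Q x * y) \<partial>M) \<partial>PiM I (\<lambda>_. M))"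
    by (subst product_nn_integral_insert) (use insert.hyps in \<open>simp_all add: multi_affine_insert\<close>)
  show ?case
  proof (cases "e \<in> E")
    case False
    then have "E \<subseteq> I" using insert.prems by auto
    from insert.IH[OF this, of a]
    have "?F (a E) \<le> (\<integral>\<^sup>+x. ?F (?P x) \<partial>PiM I (\<lambda>_. M)) + ennreal (C * card E)" .
    also have "\<dots> \<le> (\<integral>\<^sup>+x. (\<integral>\<^sup>+y. ?F (?P x + ?Q x * y) \<partial>M) \<partial>PiM I (\<lambda>_. M)) + ennreal (C * card E)"
      by (intro add_right_mono nn_integral_mono ln1p_affine)
    finally show ?thesis unfolding eq .
  next
    case True
    define E' where "E' = E - {e}"
    have E': "E = insert e E'" "E' \<subseteq> I" "card E = Suc (card E')"
      using True insert.prems insert.hyps(1) card.remove[of E e]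
      by (auto simp: E'_def intro: finite_subset[of E "insert e I"])
    have "?F (a E) \<le> (\<integral>\<^sup>+x. ?F (?Q x) \<partial>PiM I (\<lambda>_. M)) + ennreal (C * card E')"
      using insert.IH[OF E'(2), of "\<lambda>E. a (insert e E)"] E'(1) by simp
    also have "\<dots> \<le> (\<integral>\<^sup>+x. (\<integral>\<^sup>+y. ?F (?P x + ?Q x * y) \<partial>M) + ennreal C \<partial>PiM I (\<lambda>_. M)) + ennreal (C * card E')"
      by (intro add_right_mono nn_integral_mono ln1p_affine)
    also have "\<dots> = (\<integral>\<^sup>+x. (\<integral>\<^sup>+y. ?F (?P x + ?Q x * y) \<partial>M) \<partial>PiM I (\<lambda>_. M)) + (ennreal C + ennreal (C * card E'))"
      by (subst nn_integral_add) (auto simp: pr.emeasure_space_1 add.assoc)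
    also have "ennreal C + ennreal (C * card E') = ennreal (C * card E)"
      using C_nonneg E'(3) by (simp flip: ennreal_plus add: algebra_simps)
    finally show ?thesis unfolding eq .
  qed
qed

end

section \<open>The determinant as a polynomial in the noise\<close>

definition bidiag :: "(nat \<Rightarrow> complex) \<Rightarrow> nat \<Rightarrow> nat \<Rightarrow> complex" where
  "bidiag a i j = (if j = i then a i else if j = Suc i then 1 else 0)"

text \<open>The Leibniz formula for the determinant of \<open>bidiag a + \<delta> g\<close>, so that \<open>g\<close> can be varied as a function.\<close>
definition noisy_det :: "nat \<Rightarrow> (nat \<Rightarrow> complex) \<Rightarrow> real \<Rightarrow> (nat \<times> nat \<Rightarrow> complex) \<Rightarrow> complex" where
  "noisy_det N a \<delta> g = (\<Sum>\<sigma> | \<sigma> permutes {..<N}. of_int (sign \<sigma>) * (\<Prod>i<N. bidiag a i (\<sigma> i) + of_real \<delta> * g (i, \<sigma> i)))"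

text \<open>A pair \<open>(S, \<sigma>)\<close> selects one term of the expanded determinant: the noise in the rows of \<open>S\<close>, and a
  nonzero entry of the bidiagonal matrix in each other row.\<close>
definition near_id_pairs :: "nat \<Rightarrow> (nat set \<times> (nat \<Rightarrow> nat)) set" where
  "near_id_pairs N = {(S, \<sigma>). S \<subseteq> {..<N} \<and> \<sigma> permutes {..<N} \<and> (\<forall>i\<in>{..<N} - S. \<sigma> i = i \<or> \<sigma> i = Suc i)}"

definition pair_graph :: "nat set \<times> (nat \<Rightarrow> nat) \<Rightarrow> (nat \<times> nat) set" where
  "pair_graph p = (\<lambda>i. (i, snd p i)) ` fst p"

definition pair_coeff :: "nat \<Rightarrow> (nat \<Rightarrow> complex) \<Rightarrow> real \<Rightarrow> nat set \<times> (nat \<Rightarrow> nat) \<Rightarrow> complex" where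
  "pair_coeff N a \<delta> p = of_int (sign (snd p)) * of_real \<delta> ^ card (fst p) * (\<Prod>i\<in>{..<N} - fst p. bidiag a i (snd p i))"

definition det_coeff :: "nat \<Rightarrow> (nat \<Rightarrow> complex) \<Rightarrow> real \<Rightarrow> (nat \<times> nat) set \<Rightarrow> complex" where
  "det_coeff N a \<delta> E = (\<Sum>p\<in>{p\<in>near_id_pairs N. pair_graph p = E}. pair_coeff N a \<delta> p)"

lemma finite_near_id_pairs: "finite (near_id_pairs N)"
proof (rule finite_subset)
  show "near_id_pairs N \<subseteq> Pow {..<N} \<times> {\<sigma>. \<sigma> permutes {..<N}}" by (auto simp: near_id_pairs_def)
qed (simp add: finite_permutations)

lemma noisy_det_eq_multi_affine: "noisy_det N a \<delta> g = multi_affine ({..<N} \<times> {..<N}) (det_coeff N a \<delta>) g"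
proof -
  let ?Q = "Pow {..<N} \<times> {\<sigma>. \<sigma> permutes {..<N}}"
  let ?t = "\<lambda>p. pair_coeff N a \<delta> p * (\<Prod>e\<in>pair_graph p. g e)"
  have fin: "finite ?Q" by (simp add: finite_permutations)
  have "noisy_det N a \<delta> g = (\<Sum>\<sigma> | \<sigma> permutes {..<N}. \<Sum>S\<in>Pow {..<N}. ?t (S, \<sigma>))"
    unfolding noisy_det_def
  proof (rule sum.cong)
    fix \<sigma> assume "\<sigma> \<in> {\<sigma>. \<sigma> permutes {..<N}}"
    have "(\<Prod>i<N. bidiag a i (\<sigma> i) + of_real \<delta> * g (i, \<sigma> i)) = (\<Prod>i<N. of_real \<delta> * g (i, \<sigma> i) + bidiag a i (\<sigma> i))"
      by (simp add: add.commute)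
    also have "\<dots> = (\<Sum>S\<in>Pow {..<N}. (\<Prod>i\<in>S. of_real \<delta> * g (i, \<sigma> i)) * (\<Prod>i\<in>{..<N} - S. bidiag a i (\<sigma> i)))"
      by (rule prod_add) simp
    finally show "of_int (sign \<sigma>) * (\<Prod>i<N. bidiag a i (\<sigma> i) + of_real \<delta> * g (i, \<sigma> i)) = (\<Sum>S\<in>Pow {..<N}. ?t (S, \<sigma>))"
    proof (simp only: sum_distrib_left, intro sum.cong refl)
      fix S assume "S \<in> Pow {..<N}"
      have "(\<Prod>e\<in>pair_graph (S, \<sigma>). g e) = (\<Prod>i\<in>S. g (i, \<sigma> i))"
        unfolding pair_graph_def by (simp, subst prod.reindex) (auto simp: inj_on_def)
      then show "of_int (sign \<sigma>) * ((\<Prod>i\<in>S. of_real \<delta> * g (i, \<sigma> i)) * (\<Prod>i\<in>{..<N} - S. bidiag a i (\<sigma> i))) = ?t (S, \<sigma>)"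
        by (simp add: pair_coeff_def prod.distrib)
    qed
  qed simp
  also have "\<dots> = (\<Sum>S\<in>Pow {..<N}. \<Sum>\<sigma> | \<sigma> permutes {..<N}. ?t (S, \<sigma>))" by (rule sum.swap)
  also have "\<dots> = (\<Sum>p\<in>?Q. ?t p)" by (subst sum.cartesian_product) simp
  also have "\<dots> = (\<Sum>p\<in>near_id_pairs N. ?t p)"
  proof (rule sum.mono_neutral_right[OF fin])
    show "near_id_pairs N \<subseteq> ?Q" by (auto simp: near_id_pairs_def)
    show "\<forall>p\<in>?Q - near_id_pairs N. ?t p = 0"
    proof
      fix p assume "p \<in> ?Q - near_id_pairs N"
      then obtain i where "i \<in> {..<N} - fst p" "bidiag a i (snd p i) = 0"
        by (cases p) (auto simp: near_id_pairs_def bidiag_def)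
      then have "(\<Prod>i\<in>{..<N} - fst p. bidiag a i (snd p i)) = 0" by (intro prod_zero) auto
      then show "?t p = 0" by (simp add: pair_coeff_def)
    qed
  qed
  also have "\<dots> = (\<Sum>E\<in>Pow ({..<N} \<times> {..<N}). \<Sum>p\<in>{p\<in>near_id_pairs N. pair_graph p = E}. ?t p)"
  proof (rule sum.group[symmetric, OF finite_near_id_pairs])
    show "pair_graph ` near_id_pairs N \<subseteq> Pow ({..<N} \<times> {..<N})"
      by (auto simp: near_id_pairs_def pair_graph_def dest: permutes_in_image)
        (metis lessThan_iff permutes_in_image subset_iff)+
  qed simp
  also have "\<dots> = multi_affine ({..<N} \<times> {..<N}) (det_coeff N a \<delta>) g"
    unfolding multi_affine_def det_coeff_def sum_distrib_right by (intro sum.cong) auto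
  finally show ?thesis .
qed

text \<open>The determinant expands without collisions: the positions of the noise entries determine the
  permutation. Outside \<open>S\<close> it stays or moves up by one, and injectivity leaves only one way to do so.\<close>
lemma inj_pair_graph: "inj_on pair_graph (near_id_pairs N)"
proof (rule inj_onI)
  fix p p' assume p: "p \<in> near_id_pairs N" "p' \<in> near_id_pairs N" and eq: "pair_graph p = pair_graph p'"
  obtain S \<sigma> S' \<tau> where ps: "p = (S, \<sigma>)" "p' = (S', \<tau>)" by (cases p, cases p')
  have S': "S' = S" using arg_cong[OF eq, of "image fst"] by (simp add: ps pair_graph_def image_image)
  have on: "\<sigma> i = \<tau> i" if "i \<in> S" for i
  proof -
    have "(i, \<sigma> i) \<in> pair_graph p'" using that eq[symmetric] by (auto simp: ps pair_graph_def)
    then show ?thesis by (auto simp: ps pair_graph_def)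
  qed
  have perm: "\<sigma> permutes {..<N}" "\<tau> permutes {..<N}"
    and near: "\<And>i. i < N \<Longrightarrow> i \<notin> S \<Longrightarrow> \<sigma> i = i \<or> \<sigma> i = Suc i" "\<And>i. i < N \<Longrightarrow> i \<notin> S \<Longrightarrow> \<tau> i = i \<or> \<tau> i = Suc i"
    using p by (auto simp: ps S' near_id_pairs_def)
  \<comment> \<open>At a first index of disagreement one permutation fixes \<open>i\<close>, so the other one reaches \<open>i\<close> from \<open>i - 1\<close>.\<close>
  have step: False
    if i: "i < N" "i \<notin> S" "\<phi> i = i" "\<psi> i = Suc i" and least: "\<And>j. j < i \<Longrightarrow> \<phi> j = \<psi> j"
      and P: "\<phi> permutes {..<N}" "\<psi> permutes {..<N}" and on: "\<And>j. j \<in> S \<Longrightarrow> \<phi> j = \<psi> j"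
      and near: "\<And>i. i < N \<Longrightarrow> i \<notin> S \<Longrightarrow> \<psi> i = i \<or> \<psi> i = Suc i" for i \<phi> \<psi>
  proof -
    obtain j where j: "\<psi> j = i" using P(2) by (metis permutes_surj surjD)
    have "j \<noteq> i" using j i by auto
    have "j < N" using j i(1) P(2) by (metis lessThan_iff permutes_not_in)
    have "j \<notin> S"
    proof
      assume "j \<in> S"
      then have "\<phi> j = \<phi> i" using on j i by simp
      then show False using P(1) \<open>j \<noteq> i\<close> by (metis permutes_inj injD)
    qed
    then have "\<psi> j = j \<or> \<psi> j = Suc j" using near \<open>j < N\<close> by auto
    then have "j < i" using j \<open>j \<noteq> i\<close> by auto
    then have "\<phi> j = \<phi> i" using least j i by simp
    then show False using P(1) \<open>j \<noteq> i\<close> by (metis permutes_inj injD)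
  qed
  have "\<sigma> i = \<tau> i" for i
  proof (induction i rule: less_induct)
    case (less i)
    show ?case
    proof (cases "i < N \<and> i \<notin> S")
      case True
      show ?thesis
      proof (rule ccontr)
        assume "\<sigma> i \<noteq> \<tau> i"
        then consider "\<sigma> i = i" "\<tau> i = Suc i" | "\<tau> i = i" "\<sigma> i = Suc i" using near[of i] True by auto
        then show False
        proof cases
          case 1 then show False using step[of i \<sigma> \<tau>] True less perm on near by auto
        next
          case 2 then show False using step[of i \<tau> \<sigma>] True less perm on near by (metis)
        qed
      qed
    next
      case False
      then show ?thesis using on perm by (metis lessThan_iff permutes_not_in)
    qed
  qed
  then show "p = p'" by (simp add: ps S' fun_eq_iff)
qed

lemma det_coeff_pair_graph:
  assumes "p \<in> near_id_pairs N"
  shows "det_coeff N a \<delta> (pair_graph p) = pair_coeff N a \<delta> p"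
proof -
  have "{p'\<in>near_id_pairs N. pair_graph p' = pair_graph p} = {p}"
    using assms inj_pair_graph[of N] by (auto dest: inj_onD)
  then show ?thesis by (simp add: det_coeff_def)
qed

lemma card_pair_graph: "card (pair_graph p) = card (fst p)"
  unfolding pair_graph_def by (rule card_image) (auto simp: inj_on_def)

lemma pair_graph_subset: "p \<in> near_id_pairs N \<Longrightarrow> pair_graph p \<subseteq> {..<N} \<times> {..<N}"
  by (auto simp: near_id_pairs_def pair_graph_def) (metis lessThan_iff permutes_in_image subset_iff)+

lemma sum_det_coeff:
  assumes "c \<ge> 0"
  shows "(\<Sum>E\<in>Pow ({..<N} \<times> {..<N}). c ^ card E * (cmod (det_coeff N a \<delta> E))\<^sup>2)
    = (\<Sum>p\<in>near_id_pairs N. c ^ card (fst p) * (cmod (pair_coeff N a \<delta> p))\<^sup>2)"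
proof -
  let ?h = "\<lambda>E. c ^ card E * (cmod (det_coeff N a \<delta> E))\<^sup>2"
  have "(\<Sum>E\<in>Pow ({..<N} \<times> {..<N}). ?h E) = (\<Sum>E\<in>pair_graph ` near_id_pairs N. ?h E)"
  proof (rule sum.mono_neutral_right)
    show "\<forall>E\<in>Pow ({..<N} \<times> {..<N}) - pair_graph ` near_id_pairs N. ?h E = 0"
    proof
      fix E assume "E \<in> Pow ({..<N} \<times> {..<N}) - pair_graph ` near_id_pairs N"
      then have "{p\<in>near_id_pairs N. pair_graph p = E} = {}" by blast
      then have "det_coeff N a \<delta> E = 0" unfolding det_coeff_def by (simp only: sum.empty)
      then show "?h E = 0" by simp
    qed
  qed (use pair_graph_subset in auto)
  also have "\<dots> = (\<Sum>p\<in>near_id_pairs N. ?h (pair_graph p))"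
    by (subst sum.reindex[OF inj_pair_graph]) simp
  also have "\<dots> = (\<Sum>p\<in>near_id_pairs N. c ^ card (fst p) * (cmod (pair_coeff N a \<delta> p))\<^sup>2)"
    by (intro sum.cong refl) (simp add: det_coeff_pair_graph card_pair_graph)
  finally show ?thesis .
qed

section \<open>Words\<close>

text \<open>The matrix entry chosen in a row: on the diagonal, on the superdiagonal, or in the noise.\<close>
datatype letter = Diag | Super | Noise

fun letter_weight :: "real \<Rightarrow> real \<Rightarrow> letter \<Rightarrow> real" where
  "letter_weight \<eta> x Diag = x"
| "letter_weight \<eta> x Super = 1"
| "letter_weight \<eta> x Noise = \<eta>"

text \<open>Words grow at the head. If row \<open>i\<close> uses the superdiagonal, column \<open>i + 1\<close> is taken, and row \<open>i + 1\<close>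
  cannot use the diagonal.\<close>
definition next_letters :: "letter list \<Rightarrow> letter set" where
  "next_letters w = (if w \<noteq> [] \<and> hd w = Super then {Super, Noise} else {Diag, Super, Noise})"

fun words :: "nat \<Rightarrow> letter list set" where
  "words 0 = {[]}"
| "words (Suc n) = (\<Union>w\<in>words n. (\<lambda>l. l # w) ` next_letters w)"

fun word_weight :: "real \<Rightarrow> (nat \<Rightarrow> real) \<Rightarrow> letter list \<Rightarrow> real" where
  "word_weight \<eta> x [] = 1"
| "word_weight \<eta> x (l # w) = letter_weight \<eta> (x (length w)) l * word_weight \<eta> x w"

lemma finite_words [simp]: "finite (words n)"
  by (induction n) (auto simp: next_letters_def)

lemma length_words: "w \<in> words n \<Longrightarrow> length w = n"
  by (induction n arbitrary: w) auto

lemma sum_words_Suc: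
  fixes f :: "letter list \<Rightarrow> real"
  shows "(\<Sum>w\<in>words (Suc n). f w) = (\<Sum>w\<in>words n. \<Sum>l\<in>next_letters w. f (l # w))"
proof -
  have "(\<Sum>w\<in>words (Suc n). f w) = (\<Sum>w\<in>words n. sum f ((\<lambda>l. l # w) ` next_letters w))"
    unfolding words.simps by (rule sum.UNION_disjoint) (auto simp: next_letters_def)
  also have "\<dots> = (\<Sum>w\<in>words n. \<Sum>l\<in>next_letters w. f (l # w))"
    by (intro sum.cong refl, subst sum.reindex) (auto simp: inj_on_def)
  finally show ?thesis .
qed

lemma word_weight_nonneg: "\<eta> \<ge> 0 \<Longrightarrow> (\<And>i. x i \<ge> 0) \<Longrightarrow> word_weight \<eta> x w \<ge> 0"
proof (induction w)
  case (Cons l w) then show ?case by (cases l) auto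
qed simp

text \<open>A superdiagonal letter can only be left through a noise letter, of small weight \<open>\<eta>\<close>. The
  transfer matrix is therefore triangular up to \<open>\<eta>\<close>, with eigenvalues \<open>x\<close> and \<open>1\<close>: if a word with a superdiagonal
  letter at its head counts only \<open>\<kappa>\<close> times its weight, one more letter multiplies the sum by at most \<open>max 1 x + \<epsilon>\<close>.\<close>
lemma sum_word_weight_le:
  assumes \<kappa>: "0 < \<kappa>" "\<kappa> \<le> 1" and \<eta>: "0 \<le> \<eta>" "\<eta> + \<kappa> \<le> \<epsilon>" "\<eta> \<le> \<epsilon> * \<kappa>" and x: "\<And>i. x i \<ge> 0"
  shows "(\<Sum>w\<in>words N. word_weight \<eta> x w) \<le> (\<Prod>i<N. max 1 (x i) + \<epsilon>) / \<kappa>"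
proof -
  define \<phi> where "\<phi> w = (if w \<noteq> [] \<and> hd w = Super then \<kappa> else 1)" for w
  have "(\<Sum>w\<in>words n. word_weight \<eta> x w * \<phi> w) \<le> (\<Prod>i<n. max 1 (x i) + \<epsilon>)" for n
  proof (induction n)
    case 0 then show ?case by (simp add: \<phi>_def)
  next
    case (Suc n)
    have "(\<Sum>w\<in>words (Suc n). word_weight \<eta> x w * \<phi> w)
       = (\<Sum>w\<in>words n. word_weight \<eta> x w * (\<Sum>l\<in>next_letters w. letter_weight \<eta> (x n) l * \<phi> (l # w)))"
      unfolding sum_words_Suc by (intro sum.cong refl) (simp add: length_words sum_distrib_left mult_ac)
    also have "\<dots> \<le> (\<Sum>w\<in>words n. word_weight \<eta> x w * ((max 1 (x n) + \<epsilon>) * \<phi> w))"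
    proof (intro sum_mono mult_left_mono word_weight_nonneg \<eta> x)
      fix w
      have "\<kappa> \<le> max 1 (x n) * \<kappa>" using \<kappa> by (simp add: mult_le_cancel_right1)
      then show "(\<Sum>l\<in>next_letters w. letter_weight \<eta> (x n) l * \<phi> (l # w)) \<le> (max 1 (x n) + \<epsilon>) * \<phi> w"
        using \<eta> by (auto simp: next_letters_def \<phi>_def distrib_right)
    qed
    also have "\<dots> = (max 1 (x n) + \<epsilon>) * (\<Sum>w\<in>words n. word_weight \<eta> x w * \<phi> w)"
      by (simp add: sum_distrib_left mult_ac)
    also have "\<dots> \<le> (max 1 (x n) + \<epsilon>) * (\<Prod>i<n. max 1 (x i) + \<epsilon>)"
      using \<eta> \<kappa> by (intro mult_left_mono Suc.IH) auto
    finally show ?case by (simp add: mult.commute)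
  qed
  note this[of N]
  moreover have "\<kappa> * (\<Sum>w\<in>words N. word_weight \<eta> x w) \<le> (\<Sum>w\<in>words N. word_weight \<eta> x w * \<phi> w)"
    unfolding sum_distrib_left
  proof (rule sum_mono)
    fix w
    have "word_weight \<eta> x w * \<kappa> \<le> word_weight \<eta> x w * \<phi> w"
      using \<kappa> by (intro mult_left_mono word_weight_nonneg \<eta> x) (auto simp: \<phi>_def)
    then show "\<kappa> * word_weight \<eta> x w \<le> word_weight \<eta> x w * \<phi> w" by (simp add: mult.commute)
  qed
  ultimately show ?thesis using \<kappa> by (simp add: field_simps)
qed

text \<open>Off \<open>S\<close>, a near-identity permutation that does not fix a row uses the superdiagonal there.\<close>
definition pair_letter :: "nat set \<times> (nat \<Rightarrow> nat) \<Rightarrow> nat \<Rightarrow> letter" where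
  "pair_letter p i = (if i \<in> fst p then Noise else if snd p i = i then Diag else Super)"

text \<open>The row \<open>n - 1\<close> is at the head, in agreement with \<open>words\<close> and \<open>word_weight\<close>.\<close>
definition pair_word :: "nat \<Rightarrow> nat set \<times> (nat \<Rightarrow> nat) \<Rightarrow> letter list" where
  "pair_word n p = rev (map (pair_letter p) [0..<n])"

lemma pair_word_Suc: "pair_word (Suc n) p = pair_letter p n # pair_word n p"
  by (simp add: pair_word_def)

lemma length_pair_word [simp]: "length (pair_word n p) = n"
  by (simp add: pair_word_def)

lemma word_weight_pair_word: "word_weight \<eta> x (pair_word n p) = (\<Prod>i<n. letter_weight \<eta> (x i) (pair_letter p i))"
  by (induction n) (simp_all add: pair_word_Suc mult.commute, simp add: pair_word_def)

lemma count_list_pair_word: "count_list (pair_word n p) l = card {i. i < n \<and> pair_letter p i = l}"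
proof (induction n)
  case 0 then show ?case by (simp add: pair_word_def)
next
  case (Suc n)
  have "{i. i < Suc n \<and> pair_letter p i = l} = (if pair_letter p n = l then insert n else id) {i. i < n \<and> pair_letter p i = l}"
    by (auto simp: less_Suc_eq)
  then show ?case using Suc by (simp add: pair_word_Suc)
qed

lemma pair_word_in_words:
  assumes p: "p \<in> near_id_pairs N"
  shows "n \<le> N \<Longrightarrow> pair_word n p \<in> words n"
proof (induction n)
  case 0 then show ?case by (simp add: pair_word_def)
next
  case (Suc n)
  have "pair_letter p n \<in> next_letters (pair_word n p)"
  proof (cases "pair_word n p \<noteq> [] \<and> hd (pair_word n p) = Super")
    case True
    then obtain m where m: "n = Suc m" by (cases n) (auto simp: pair_word_def)
    with True have "pair_letter p m = Super" by (simp add: pair_word_Suc)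
    then have "m \<notin> fst p" "snd p m \<noteq> m" by (auto simp: pair_letter_def split: if_splits)
    then have "snd p m = n" using p Suc.prems m by (auto simp: near_id_pairs_def)
    moreover have "inj (snd p)" using p by (auto simp: near_id_pairs_def permutes_inj)
    ultimately have "snd p n \<noteq> n" using m by (metis injD n_not_Suc_n)
    then have "pair_letter p n \<noteq> Diag" by (simp add: pair_letter_def)
    then show ?thesis by (cases "pair_letter p n") (auto simp: next_letters_def)
  next
    case False
    then show ?thesis by (cases "pair_letter p n") (auto simp: next_letters_def)
  qed
  then show ?case using Suc by (auto simp: pair_word_Suc)
qed

lemma pair_coeff_weight:
  assumes p: "p \<in> near_id_pairs N"
  shows "c ^ card (fst p) * (cmod (pair_coeff N a \<delta> p))\<^sup>2 = word_weight (c * \<delta>\<^sup>2) (\<lambda>i. (cmod (a i))\<^sup>2) (pair_word N p)"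
proof -
  have S: "fst p \<subseteq> {..<N}" using p by (auto simp: near_id_pairs_def)
  let ?w = "\<lambda>i. letter_weight (c * \<delta>\<^sup>2) ((cmod (a i))\<^sup>2) (pair_letter p i)"
  have "cmod (of_int (sign (snd p))) = 1" by (simp add: sign_def)
  then have "c ^ card (fst p) * (cmod (pair_coeff N a \<delta> p))\<^sup>2
     = (c * \<delta>\<^sup>2) ^ card (fst p) * (\<Prod>i\<in>{..<N} - fst p. (cmod (bidiag a i (snd p i)))\<^sup>2)"
    by (simp add: pair_coeff_def norm_mult norm_power power_mult_distrib power_mult[symmetric] mult.commute[of 2]
        prod_norm[symmetric] prod_power_distrib[symmetric])
      (simp add: power_mult flip: power_abs)
  also have "(\<Prod>i\<in>{..<N} - fst p. (cmod (bidiag a i (snd p i)))\<^sup>2) = (\<Prod>i\<in>{..<N} - fst p. ?w i)"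
    using p by (intro prod.cong refl) (auto simp: pair_letter_def bidiag_def near_id_pairs_def)
  also have "(c * \<delta>\<^sup>2) ^ card (fst p) = (\<Prod>i\<in>fst p. ?w i)" by (simp add: pair_letter_def)
  also have "(\<Prod>i\<in>fst p. ?w i) * (\<Prod>i\<in>{..<N} - fst p. ?w i) = (\<Prod>i<N. ?w i)"
    using prod.subset_diff[OF S, of ?w] by (simp add: mult.commute)
  finally show ?thesis by (simp add: word_weight_pair_word)
qed

text \<open>The word gives \<open>S\<close> and the permutation off \<open>S\<close>; what remains free are the columns of the noise entries.\<close>
lemma card_pair_word_fibre:
  "card {p\<in>near_id_pairs N. pair_word N p = w} \<le> N ^ count_list w Noise"
proof (cases "{p\<in>near_id_pairs N. pair_word N p = w} = {}")
  case False
  then obtain p0 where p0: "p0 \<in> near_id_pairs N" "pair_word N p0 = w" by blast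
  let ?F = "{p\<in>near_id_pairs N. pair_word N p = w}" and ?S = "fst p0"
  have S: "?S \<subseteq> {..<N}" using p0 by (auto simp: near_id_pairs_def)
  have fin: "finite ?S" using S finite_subset by blast
  have lett: "pair_letter p i = pair_letter p0 i" if "p \<in> ?F" "i < N" for p i
    using that p0 by (auto simp: pair_word_def)
  have fst: "fst p = ?S" if "p \<in> ?F" for p
  proof -
    have "i \<in> fst p \<longleftrightarrow> i \<in> ?S" if "i < N" for i
      using lett[OF \<open>p \<in> ?F\<close> that] by (auto simp: pair_letter_def split: if_splits)
    moreover have "fst p \<subseteq> {..<N}" using that by (auto simp: near_id_pairs_def)
    ultimately show ?thesis using S by blast
  qed
  have inj: "inj_on (\<lambda>p. restrict (snd p) ?S) ?F"
  proof (rule inj_onI)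
    fix p p' assume p: "p \<in> ?F" "p' \<in> ?F" and eq: "restrict (snd p) ?S = restrict (snd p') ?S"
    have "snd p i = snd p' i" for i
    proof -
      consider "i \<in> ?S" | "i < N" "i \<notin> ?S" | "\<not> i < N" by blast
      then show ?thesis
      proof cases
        case 1 then show ?thesis using eq by (metis restrict_apply')
      next
        case 2
        then have "snd p i = i \<or> snd p i = Suc i" "snd p' i = i \<or> snd p' i = Suc i"
          using p 2 fst[OF p(1)] fst[OF p(2)] by (auto simp: near_id_pairs_def)
        moreover have "pair_letter p i = pair_letter p' i" using lett[OF p(1) 2(1)] lett[OF p(2) 2(1)] by simp
        ultimately show ?thesis using 2 fst[OF p(1)] fst[OF p(2)] by (auto simp: pair_letter_def split: if_splits)
      next
        case 3
        then have "snd p i = i" "snd p' i = i"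
          using p by (auto simp: near_id_pairs_def permutes_not_in)
        then show ?thesis by simp
      qed
    qed
    then show "p = p'" using fst[OF p(1)] fst[OF p(2)] by (simp add: prod_eq_iff fun_eq_iff)
  qed
  have "(\<lambda>p. restrict (snd p) ?S) ` ?F \<subseteq> ?S \<rightarrow>\<^sub>E {..<N}"
  proof (clarsimp simp: PiE_iff)
    fix T \<sigma> i assume "(T, \<sigma>) \<in> near_id_pairs N" "i \<in> ?S"
    then show "\<sigma> i < N" using S permutes_in_image[of \<sigma> "{..<N}" i] by (auto simp: near_id_pairs_def)
  qed
  then have "card ?F \<le> card (?S \<rightarrow>\<^sub>E {..<N})"
    using inj fin by (intro card_inj_on_le) (auto intro: finite_PiE)
  also have "\<dots> = N ^ card ?S" using fin by (simp add: card_PiE)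
  also have "card ?S = count_list w Noise"
  proof -
    have "{i. i < N \<and> pair_letter p0 i = Noise} = ?S" using S by (auto simp: pair_letter_def split: if_splits)
    then show ?thesis unfolding p0(2)[symmetric] count_list_pair_word by simp
  qed
  finally show ?thesis .
next
  case True
  show ?thesis unfolding True by simp
qed

lemma word_weight_scale: "word_weight (k * \<eta>) x w = k ^ count_list w Noise * word_weight \<eta> x w"
proof (induction w)
  case (Cons l w) then show ?case by (cases l) auto
qed simp

text \<open>The \<open>N\<close> possible columns of a noise entry are absorbed into the weight of a noise letter.\<close>
lemma sum_pair_coeff_le_words:
  assumes "c \<ge> 0"
  shows "(\<Sum>p\<in>near_id_pairs N. c ^ card (fst p) * (cmod (pair_coeff N a \<delta> p))\<^sup>2)
    \<le> (\<Sum>w\<in>words N. word_weight (real N * (c * \<delta>\<^sup>2)) (\<lambda>i. (cmod (a i))\<^sup>2) w)"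
proof -
  let ?W = "word_weight (c * \<delta>\<^sup>2) (\<lambda>i. (cmod (a i))\<^sup>2)"
  have nn: "?W w \<ge> 0" for w using assms by (intro word_weight_nonneg) auto
  have "(\<Sum>p\<in>near_id_pairs N. c ^ card (fst p) * (cmod (pair_coeff N a \<delta> p))\<^sup>2) = (\<Sum>p\<in>near_id_pairs N. ?W (pair_word N p))"
    by (intro sum.cong refl pair_coeff_weight)
  also have "\<dots> = (\<Sum>w\<in>words N. \<Sum>p\<in>{p\<in>near_id_pairs N. pair_word N p = w}. ?W (pair_word N p))"
    by (rule sum.group[symmetric]) (auto simp: finite_near_id_pairs intro: pair_word_in_words)
  also have "\<dots> = (\<Sum>w\<in>words N. real (card {p\<in>near_id_pairs N. pair_word N p = w}) * ?W w)"
    by (intro sum.cong refl) simp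
  also have "\<dots> \<le> (\<Sum>w\<in>words N. real (N ^ count_list w Noise) * ?W w)"
    by (intro sum_mono mult_right_mono nn of_nat_mono card_pair_word_fibre)
  finally show ?thesis by (simp add: word_weight_scale)
qed

text \<open>Cut the rows into blocks of length \<open>m\<close>. On the blocks in \<open>V\<close> the permutation is a cycle that follows the
  superdiagonal and returns by one noise entry in the last row of the block. On the other blocks it is the
  identity.\<close>
lemma block_pair:
  assumes m: "m > 0"
  shows "\<exists>p\<in>near_id_pairs N. card (fst p) \<le> N div m + 1 \<and> (\<forall>a \<delta>.
    cmod (pair_coeff N a \<delta> p) = \<bar>\<delta>\<bar> ^ card (fst p) * (\<Prod>i\<in>{i. i < N \<and> i div m \<notin> V}. cmod (a i)))"
proof -
  define last where "last i \<longleftrightarrow> \<not> (Suc i < N \<and> Suc i div m = i div m)" for i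
  define \<sigma> where "\<sigma> i = (if i < N \<and> i div m \<in> V then if last i then i div m * m else Suc i else i)" for i
  define S where "S = {i. i < N \<and> i div m \<in> V \<and> last i}"
  have blk: "\<sigma> i div m = i div m" for i using m by (auto simp: \<sigma>_def last_def)
  have last_unique: "i = j" if "last i" "last j" "i < N" "j < N" "i div m = j div m" for i j
  proof -
    have False if "i < j" "last i" "j < N" "i div m = j div m" for i j
    proof -
      have "Suc i < N" using that by simp
      moreover have "i div m \<le> Suc i div m" "Suc i div m \<le> j div m" using that div_le_mono[of i "Suc i" m] div_le_mono[of "Suc i" j m] by simp_all
      ultimately show False using that by (simp add: last_def)
    qed
    from this[of i j] this[of j i] that show ?thesis by (metis linorder_neqE_nat)
  qed
  have ge: "i div m * m \<le> i" for i by simp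
  have maps: "\<sigma> i < N" if "i < N" for i
    using that order_le_less_trans[OF ge[of i] that] by (auto simp: \<sigma>_def last_def)
  have inj: "inj_on \<sigma> {..<N}"
  proof (rule inj_onI)
    fix i j assume ij: "i \<in> {..<N}" "j \<in> {..<N}" and eq: "\<sigma> i = \<sigma> j"
    have b: "i div m = j div m" using blk[of i] blk[of j] eq by simp
    have no: "Suc i \<noteq> j div m * m" if "i div m = j div m" for i j
      using ge[of i] that by (metis Suc_n_not_le_n)
    show "i = j"
    proof (cases "i div m \<in> V")
      case True
      then have "\<sigma> i = (if last i then j div m * m else Suc i)" "\<sigma> j = (if last j then i div m * m else Suc j)"
        using ij b by (auto simp: \<sigma>_def)
      then show ?thesis using eq last_unique[of i j] ij b no[of i j] no[of j i] by (auto split: if_splits)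
    next
      case False then show ?thesis using eq ij b by (auto simp: \<sigma>_def)
    qed
  qed
  have perm: "\<sigma> permutes {..<N}"
  proof (rule bij_imp_permutes)
    have "\<sigma> ` {..<N} = {..<N}" using maps inj by (intro endo_inj_surj) auto
    then show "bij_betw \<sigma> {..<N} {..<N}" using inj by (simp add: bij_betw_def)
  qed (auto simp: \<sigma>_def)
  have p: "(S, \<sigma>) \<in> near_id_pairs N"
    using perm by (auto simp: near_id_pairs_def S_def \<sigma>_def)
  have "card S \<le> card {..N div m}"
  proof (rule card_inj_on_le)
    show "inj_on (\<lambda>i. i div m) S" by (rule inj_onI) (auto simp: S_def intro: last_unique)
    show "(\<lambda>i. i div m) ` S \<subseteq> {..N div m}" by (auto simp: S_def intro!: div_le_mono)
  qed simp
  then have card: "card S \<le> N div m + 1" by simp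
  have "(\<Prod>i\<in>{..<N} - S. cmod (bidiag a i (\<sigma> i))) = (\<Prod>i\<in>{i. i < N \<and> i div m \<notin> V}. cmod (a i))" for a
  proof (rule prod.mono_neutral_cong_right)
    show "\<forall>i\<in>{..<N} - S - {i. i < N \<and> i div m \<notin> V}. cmod (bidiag a i (\<sigma> i)) = 1"
      by (auto simp: S_def \<sigma>_def bidiag_def)
  qed (auto simp: S_def \<sigma>_def bidiag_def)
  then have "cmod (pair_coeff N a \<delta> (S, \<sigma>)) = \<bar>\<delta>\<bar> ^ card S * (\<Prod>i\<in>{i. i < N \<and> i div m \<notin> V}. cmod (a i))" for a \<delta>
    by (simp add: pair_coeff_def norm_mult norm_power prod_norm[symmetric] sign_def)
  with p card show ?thesis by (intro bexI[of _ "(S, \<sigma>)"]) auto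
qed

section \<open>Moments of the determinant\<close>

context isotropic_law
begin

abbreviation noise_matrix :: "nat \<Rightarrow> (nat \<times> nat \<Rightarrow> complex) measure" where
  "noise_matrix N \<equiv> PiM ({..<N} \<times> {..<N}) (\<lambda>_. M)"

lemma second_moment_noisy_det:
  "(\<integral>\<^sup>+g. ennreal ((cmod (noisy_det N a \<delta> g))\<^sup>2) \<partial>noise_matrix N)
    \<le> ennreal (\<Sum>w\<in>words N. word_weight (real N * (c * \<delta>\<^sup>2)) (\<lambda>i. (cmod (a i))\<^sup>2) w)"
proof -
  have "(\<integral>\<^sup>+g. ennreal ((cmod (noisy_det N a \<delta> g))\<^sup>2) \<partial>noise_matrix N)
     \<le> ennreal (\<Sum>E\<in>Pow ({..<N} \<times> {..<N}). c ^ card E * (cmod (det_coeff N a \<delta> E))\<^sup>2)"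
    unfolding noisy_det_eq_multi_affine by (rule second_moment_multi_affine) simp
  also have "\<dots> \<le> ennreal (\<Sum>w\<in>words N. word_weight (real N * (c * \<delta>\<^sup>2)) (\<lambda>i. (cmod (a i))\<^sup>2) w)"
    unfolding sum_det_coeff[OF c_nonneg] by (intro ennreal_leI sum_pair_coeff_le_words c_nonneg)
  finally show ?thesis .
qed

text \<open>The scale \<open>\<tau>\<close> will tend to zero, where \<open>ln (1 + \<bar>z / \<tau>\<bar>\<^sup>2) + 2 ln \<tau>\<close> tends to \<open>2 ln \<bar>z\<bar>\<close>.\<close>
lemma ln1p_noisy_det:
  assumes p: "p \<in> near_id_pairs N"
  shows "ennreal (ln (1 + (cmod (pair_coeff N a \<delta> p) / \<tau>)\<^sup>2))
    \<le> (\<integral>\<^sup>+g. ennreal (ln (1 + (cmod (noisy_det N a \<delta> g) / \<tau>)\<^sup>2)) \<partial>noise_matrix N) + ennreal (C * card (fst p))"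
proof -
  have eq: "noisy_det N a \<delta> g / of_real \<tau> = multi_affine ({..<N} \<times> {..<N}) (\<lambda>E. det_coeff N a \<delta> E / of_real \<tau>) g" for g
    unfolding noisy_det_eq_multi_affine multi_affine_def by (simp add: sum_divide_distrib)
  have sq: "(cmod (z / of_real \<tau>))\<^sup>2 = (cmod z / \<tau>)\<^sup>2" for z
    by (simp add: norm_divide power_divide)
  from ln1p_multi_affine[OF _ pair_graph_subset[OF p], of "\<lambda>E. det_coeff N a \<delta> E / of_real \<tau>"]
  show ?thesis
    unfolding eq[symmetric] sq det_coeff_pair_graph[OF p] card_pair_graph by simp
qed

end

section \<open>From moments to distances in mean\<close>

text \<open>The regularized logarithms \<open>ln (sqrt (\<tau>\<^sup>2 + p\<^sup>2))\<close> decrease to \<open>ln p\<close>, are dominated from above through the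
  small moment, and have means bounded below.\<close>
lemma (in prob_space) ln_integrable_of_regularized:
  fixes p :: "'a \<Rightarrow> real"
  assumes [measurable]: "p \<in> borel_measurable M" and nn: "\<And>x. 0 \<le> p x" and s: "s > 0"
    and up: "(\<integral>\<^sup>+x. ennreal (((p x)\<^sup>2) powr s) \<partial>M) \<le> ennreal K"
    and low: "\<And>\<tau>. 0 < \<tau> \<Longrightarrow> \<tau> \<le> 1 \<Longrightarrow> ennreal (2 * v - 2 * ln \<tau>) \<le> (\<integral>\<^sup>+x. ennreal (ln (1 + (p x / \<tau>)\<^sup>2)) \<partial>M)"
  shows "integrable M (\<lambda>x. ((p x)\<^sup>2) powr s)" "AE x in M. p x \<noteq> 0" "integrable M (\<lambda>x. ln (p x))" "v \<le> (\<integral>x. ln (p x) \<partial>M)"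
proof -
  show ps: "integrable M (\<lambda>x. ((p x)\<^sup>2) powr s)"
    using up by (intro integrableI_nonneg) (auto intro: order_le_less_trans)
  define g where "g x = ln (1 + (p x)\<^sup>2) / 2" for x
  have [measurable]: "g \<in> borel_measurable M" unfolding g_def by measurable
  have g0: "0 \<le> g x" for x by (simp add: g_def)
  have gint: "integrable M g"
  proof (rule Bochner_Integration.integrable_bound[where f="\<lambda>x. 1 + ((p x)\<^sup>2) powr s / s"])
    show "integrable M (\<lambda>x. 1 + ((p x)\<^sup>2) powr s / s)" using ps by simp
    show "AE x in M. norm (g x) \<le> norm (1 + ((p x)\<^sup>2) powr s / s)"
    proof (rule AE_I2)
      fix x
      have "ln (1 + (p x)\<^sup>2) \<le> 2 + ((p x)\<^sup>2) powr s / s"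
      proof (cases "(p x)\<^sup>2 \<le> 1")
        case True
        have "ln (1 + (p x)\<^sup>2) \<le> (p x)\<^sup>2" by (rule ln_add_one_self_le_self) simp
        then show ?thesis using True s by (smt (verit) divide_nonneg_pos powr_ge_zero)
      next
        case False
        then have "ln (1 + (p x)\<^sup>2) \<le> ln (2 * (p x)\<^sup>2)" by (intro ln_mono) auto
        also have "\<dots> = ln 2 + ln ((p x)\<^sup>2)" using False by (subst ln_mult_pos) auto
        also have "ln ((p x)\<^sup>2) \<le> ((p x)\<^sup>2) powr s / s" using False s by (intro ln_powr_bound) auto
        finally show ?thesis using ln2_le_25_over_36 by linarith
      qed
      moreover have "0 \<le> ((p x)\<^sup>2) powr s / s" using s by simp
      ultimately have "g x \<le> 1 + ((p x)\<^sup>2) powr s / s" unfolding g_def by linarith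
      then show "norm (g x) \<le> norm (1 + ((p x)\<^sup>2) powr s / s)" using g0[of x] s by (simp add: divide_nonneg_pos)
    qed
  qed measurable
  define \<tau> where "\<tau> n = inverse (real (Suc n))" for n
  have \<tau>: "0 < \<tau> n" "\<tau> n \<le> 1" for n by (auto simp: \<tau>_def field_simps)
  have \<tau>lim: "\<tau> \<longlonglongrightarrow> 0" unfolding \<tau>_def by (rule LIMSEQ_inverse_real_of_nat)
  define F where "F n x = sqrt ((\<tau> n)\<^sup>2 + (p x)\<^sup>2)" for n x
  have Fpos: "0 < F n x" for n x using \<tau>[of n] by (auto simp: F_def intro: add_pos_nonneg)
  have lnF: "ln (F n x) = ln (\<tau> n) + ln (1 + (p x / \<tau> n)\<^sup>2) / 2" for n x
  proof -
    have "(\<tau> n)\<^sup>2 + (p x)\<^sup>2 = (\<tau> n)\<^sup>2 * (1 + (p x / \<tau> n)\<^sup>2)"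
      using \<tau>[of n] by (simp add: field_simps power_divide)
    then have "ln ((\<tau> n)\<^sup>2 + (p x)\<^sup>2) = 2 * ln (\<tau> n) + ln (1 + (p x / \<tau> n)\<^sup>2)"
      using \<tau>[of n] by (simp add: ln_mult_pos ln_realpow add_pos_nonneg)
    then show ?thesis using \<tau>[of n] by (simp add: F_def ln_sqrt add_pos_nonneg)
  qed
  have lnFg: "ln (F n x) \<le> g x" for n x
  proof -
    have "(\<tau> n)\<^sup>2 \<le> 1" using \<tau>[of n] by (simp add: power_le_one)
    then show ?thesis using \<tau>[of n] by (simp add: F_def g_def ln_sqrt add_pos_nonneg)
  qed
  have hint: "integrable M (\<lambda>x. ln (1 + (p x / \<tau> n)\<^sup>2))" for n
  proof (rule Bochner_Integration.integrable_bound[where f="\<lambda>x. 2 * g x - 2 * ln (\<tau> n)"])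
    show "integrable M (\<lambda>x. 2 * g x - 2 * ln (\<tau> n))" using gint by simp
    show "AE x in M. norm (ln (1 + (p x / \<tau> n)\<^sup>2)) \<le> norm (2 * g x - 2 * ln (\<tau> n))"
    proof (rule AE_I2)
      fix x
      have "0 \<le> ln (1 + (p x / \<tau> n)\<^sup>2)" by simp
      moreover have "ln (1 + (p x / \<tau> n)\<^sup>2) \<le> 2 * g x - 2 * ln (\<tau> n)" using lnFg[of n x] lnF[of n x] by simp
      ultimately show "norm (ln (1 + (p x / \<tau> n)\<^sup>2)) \<le> norm (2 * g x - 2 * ln (\<tau> n))" by simp
    qed
  qed measurable
  have Fint: "integrable M (\<lambda>x. ln (F n x))" for n unfolding lnF using hint by simp
  have Flow: "v \<le> (\<integral>x. ln (F n x) \<partial>M)" for n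
  proof -
    have "ennreal (2 * v - 2 * ln (\<tau> n)) \<le> (\<integral>\<^sup>+x. ennreal (ln (1 + (p x / \<tau> n)\<^sup>2)) \<partial>M)"
      by (rule low) (use \<tau> in auto)
    also have "\<dots> = ennreal (\<integral>x. ln (1 + (p x / \<tau> n)\<^sup>2) \<partial>M)"
      by (rule nn_integral_eq_integral[OF hint]) simp
    finally have "2 * v - 2 * ln (\<tau> n) \<le> (\<integral>x. ln (1 + (p x / \<tau> n)\<^sup>2) \<partial>M)"
      by (subst (asm) ennreal_le_iff) (auto intro!: integral_nonneg_AE)
    then show ?thesis unfolding lnF using hint[of n] by (simp add: prob_space)
  qed
  have Fmeas: "F n \<in> borel_measurable M" for n unfolding F_def by measurable
  have Flim: "(\<lambda>n. F n x) \<longlonglongrightarrow> p x" for x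
  proof -
    have "(\<lambda>n. F n x) \<longlonglongrightarrow> sqrt (0\<^sup>2 + (p x)\<^sup>2)" unfolding F_def by (intro tendsto_intros \<tau>lim)
    then show ?thesis using nn[of x] by simp
  qed
  have ple: "p x \<le> 1 * F n x" for n x unfolding F_def by (simp add: real_le_rsqrt)
  have L: "AE x in M. p x \<noteq> 0" "integrable M (\<lambda>x. ln (p x))" "v \<le> (\<integral>x. ln (p x) \<partial>M)"
    by (rule log_integral_limit[of F p 1 g v]; use Fmeas Fpos nn Flim ple lnFg gint Fint Flow in simp)+
  then show "AE x in M. p x \<noteq> 0" "integrable M (\<lambda>x. ln (p x))" "v \<le> (\<integral>x. ln (p x) \<partial>M)" by simp_all
qed

text \<open>With \<open>X = ln p / N\<close>, write \<open>\<bar>X - \<beta>\<bar>\<close> as twice the positive part of \<open>X - \<beta>\<close> minus \<open>X - \<beta>\<close>. The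
  positive part is at most \<open>exp (2 s N (X - \<beta>)) / (2 s N)\<close>, which the moment bound controls, and the mean
  of \<open>X\<close> is bounded below by \<open>v / N\<close>.\<close>
lemma (in prob_space) L1_bound_of_moment_bounds:
  fixes p :: "'a \<Rightarrow> real" and N :: nat
  assumes meas [measurable]: "p \<in> borel_measurable M" and nn: "\<And>x. 0 \<le> p x" and s: "s > 0" and N: "N > 0" and K: "K \<ge> 0"
    and up: "(\<integral>\<^sup>+x. ennreal (((p x)\<^sup>2) powr s) \<partial>M) \<le> ennreal K"
    and low: "\<And>\<tau>. 0 < \<tau> \<Longrightarrow> \<tau> \<le> 1 \<Longrightarrow> ennreal (2 * v - 2 * ln \<tau>) \<le> (\<integral>\<^sup>+x. ennreal (ln (1 + (p x / \<tau>)\<^sup>2)) \<partial>M)"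
  shows "integrable M (\<lambda>x. ln (p x) / N)"
    "(\<integral>x. \<bar>ln (p x) / N - U\<bar> \<partial>M) \<le> \<bar>\<beta> - U\<bar> + K * exp (- 2 * s * N * \<beta>) / (s * N) + (\<beta> - v / N)"
proof -
  have I: "integrable M (\<lambda>x. ((p x)\<^sup>2) powr s)" "AE x in M. p x \<noteq> 0" "integrable M (\<lambda>x. ln (p x))" "v \<le> (\<integral>x. ln (p x) \<partial>M)"
    by (rule ln_integrable_of_regularized[OF meas nn s up low]; assumption)+
  let ?X = "\<lambda>x. ln (p x) / N" and ?e = "\<lambda>x. ((p x)\<^sup>2) powr s * exp (- 2 * s * N * \<beta>) / (2 * s * N)"
  show XI: "integrable M ?X" using I(3) by simp
  have eI: "integrable M ?e" using I(1) by simp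
  have "(\<integral>x. \<bar>?X x - U\<bar> \<partial>M) \<le> (\<integral>x. \<bar>\<beta> - U\<bar> + (2 * ?e x - ?X x + \<beta>) \<partial>M)"
  proof (rule integral_mono_AE)
    show "AE x in M. \<bar>?X x - U\<bar> \<le> \<bar>\<beta> - U\<bar> + (2 * ?e x - ?X x + \<beta>)"
      using I(2)
    proof eventually_elim
      fix x assume "p x \<noteq> 0"
      then have p: "p x > 0" using nn[of x] by simp
      let ?y = "2 * s * N * (?X x - \<beta>)"
      have c: "0 < 2 * s * N" using s N by simp
      have "?y \<le> exp ?y" using exp_ge_add_one_self[of ?y] by linarith
      also have "exp ?y = ((p x)\<^sup>2) powr s * exp (- 2 * s * N * \<beta>)"
        using p s N by (simp add: powr_def ln_realpow exp_add[symmetric] right_diff_distrib)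
      finally have 1: "?X x - \<beta> \<le> ?e x" using c by (simp add: pos_le_divide_eq mult.commute)
      have 2: "0 \<le> ?e x" using c by simp
      from 1 2 show "\<bar>?X x - U\<bar> \<le> \<bar>\<beta> - U\<bar> + (2 * ?e x - ?X x + \<beta>)" by linarith
    qed
  next
    show "integrable M (\<lambda>x. \<bar>?X x - U\<bar>)" using XI by (intro integrable_abs Bochner_Integration.integrable_diff integrable_const)
    show "integrable M (\<lambda>x. \<bar>\<beta> - U\<bar> + (2 * ?e x - ?X x + \<beta>))"
      using XI eI by (intro Bochner_Integration.integrable_add Bochner_Integration.integrable_diff integrable_mult_right integrable_const)
  qed
  also have "\<dots> = \<bar>\<beta> - U\<bar> + (2 * (\<integral>x. ?e x \<partial>M) - (\<integral>x. ?X x \<partial>M) + \<beta>)"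
  proof -
    have "(\<integral>x. \<bar>\<beta> - U\<bar> + (2 * ?e x - ?X x + \<beta>) \<partial>M) = (\<integral>x. \<bar>\<beta> - U\<bar> \<partial>M) + (\<integral>x. 2 * ?e x - ?X x + \<beta> \<partial>M)"
      using XI eI by (intro Bochner_Integration.integral_add Bochner_Integration.integrable_add Bochner_Integration.integrable_diff integrable_mult_right integrable_const)
    also have "(\<integral>x. 2 * ?e x - ?X x + \<beta> \<partial>M) = (\<integral>x. 2 * ?e x - ?X x \<partial>M) + (\<integral>x. \<beta> \<partial>M)"
      using XI eI by (intro Bochner_Integration.integral_add Bochner_Integration.integrable_add Bochner_Integration.integrable_diff integrable_mult_right integrable_const)
    also have "(\<integral>x. 2 * ?e x - ?X x \<partial>M) = (\<integral>x. 2 * ?e x \<partial>M) - (\<integral>x. ?X x \<partial>M)"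
      using XI eI by (intro Bochner_Integration.integral_diff integrable_mult_right)
    finally show ?thesis by (simp add: prob_space)
  qed
  also have "2 * (\<integral>x. ?e x \<partial>M) \<le> K * exp (- 2 * s * N * \<beta>) / (s * N)"
  proof -
    have "ennreal (\<integral>x. ((p x)\<^sup>2) powr s \<partial>M) \<le> ennreal K"
      using up by (subst nn_integral_eq_integral[symmetric]) (use I(1) in auto)
    then have "(\<integral>x. ((p x)\<^sup>2) powr s \<partial>M) \<le> K" using K by (simp add: ennreal_le_iff)
    then have "(\<integral>x. ((p x)\<^sup>2) powr s \<partial>M) * (exp (- 2 * s * N * \<beta>) / (s * N)) \<le> K * (exp (- 2 * s * N * \<beta>) / (s * N))"
      using s by (intro mult_right_mono) auto
    then show ?thesis by (simp add: field_simps)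
  qed
  also have "(\<integral>x. ?X x \<partial>M) = (\<integral>x. ln (p x) \<partial>M) / N" by simp
  finally show "(\<integral>x. \<bar>?X x - U\<bar> \<partial>M) \<le> \<bar>\<beta> - U\<bar> + K * exp (- 2 * s * N * \<beta>) / (s * N) + (\<beta> - v / N)"
    using divide_right_mono[OF I(4), of "real N"] by simp
qed

lemma powr_sum_le_sum_powr:
  fixes f :: "'b \<Rightarrow> real"
  assumes s: "0 < s" "s \<le> 1" and fin: "finite A" and nn: "\<And>i. f i \<ge> 0"
  shows "(\<Sum>i\<in>A. f i) powr s \<le> (\<Sum>i\<in>A. f i powr s)"
proof -
  have add: "(x + y) powr s \<le> x powr s + y powr s" if "x \<ge> 0" "y \<ge> 0" for x y :: real
  proof (cases "x + y = 0")
    case True then show ?thesis using that by simp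
  next
    case False
    then have t: "x + y > 0" using that by simp
    have le: "u \<le> u powr s" if "0 \<le> u" "u \<le> 1" for u :: real
      using that s powr_mono'[of s 1 u] by (cases "u = 0") auto
    have "1 = x / (x + y) + y / (x + y)" using t by (simp add: add_divide_distrib[symmetric])
    also have "\<dots> \<le> (x / (x + y)) powr s + (y / (x + y)) powr s"
      using that t by (intro add_mono le) auto
    also have "\<dots> = (x powr s + y powr s) / (x + y) powr s"
      using that t by (simp add: powr_divide add_divide_distrib)
    finally show ?thesis using t by (simp add: field_simps)
  qed
  from fin show ?thesis
  proof (induction A)
    case (insert a A)
    have "(f a + sum f A) powr s \<le> f a powr s + sum f A powr s" by (rule add) (auto intro: sum_nonneg nn)
    then show ?case using insert by simp
  qed simp
qed

text \<open>Jensen's inequality for the concave function \<open>x powr s\<close>, through its tangent at \<open>T\<close>.\<close>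
lemma (in prob_space) nn_integral_powr_le:
  fixes f :: "'a \<Rightarrow> real"
  assumes [measurable]: "f \<in> borel_measurable M" and nn: "\<And>x. f x \<ge> 0" and s: "0 < s" "s \<le> 1" and T: "T > 0"
    and le: "(\<integral>\<^sup>+x. ennreal (f x) \<partial>M) \<le> ennreal T"
  shows "(\<integral>\<^sup>+x. ennreal (f x powr s) \<partial>M) \<le> ennreal (T powr s)"
proof -
  have tangent: "f x powr s \<le> T powr s * (1 - s) + T powr s * (s / T) * f x" for x
  proof (cases "f x = 0")
    case True then show ?thesis using s by simp
  next
    case False
    then have fp: "f x / T > 0" using T nn[of x] by simp
    have "(f x / T) powr s * 1 powr (1 - s) \<le> s * (f x / T) + (1 - s) * 1"
      by (rule Youngs_inequality_0) (use s fp in auto)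
    then have "(f x / T) powr s \<le> (1 - s) + s / T * f x" by simp
    then have "T powr s * (f x / T) powr s \<le> T powr s * ((1 - s) + s / T * f x)" by (intro mult_left_mono) auto
    moreover have "T powr s * (f x / T) powr s = f x powr s" using T nn[of x] by (simp add: powr_divide)
    ultimately show ?thesis by (simp add: algebra_simps)
  qed
  have "(\<integral>\<^sup>+x. ennreal (f x powr s) \<partial>M) \<le> (\<integral>\<^sup>+x. ennreal (T powr s * (1 - s)) + ennreal (T powr s * (s / T)) * ennreal (f x) \<partial>M)"
    using s T nn tangent by (intro nn_integral_mono) (simp flip: ennreal_mult ennreal_plus)
  also have "\<dots> = ennreal (T powr s * (1 - s)) + ennreal (T powr s * (s / T)) * (\<integral>\<^sup>+x. ennreal (f x) \<partial>M)"
    by (subst nn_integral_add) (auto simp: nn_integral_cmult emeasure_space_1)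
  also have "\<dots> \<le> ennreal (T powr s * (1 - s)) + ennreal (T powr s * (s / T)) * ennreal T"
    by (intro add_left_mono mult_left_mono le) auto
  also have "\<dots> = ennreal (T powr s * (1 - s) + T powr s * (s / T) * T)"
    using s T by (simp flip: ennreal_mult ennreal_plus)
  also have "T powr s * (1 - s) + T powr s * (s / T) * T = T powr s" using T by (simp add: algebra_simps)
  finally show ?thesis .
qed

lemma word_weight_powr:
  assumes "\<eta> \<ge> 0" "\<And>i. x i \<ge> 0"
  shows "word_weight \<eta> x w powr s = word_weight (\<eta> powr s) (\<lambda>i. x i powr s) w"
proof (induction w)
  case (Cons l w)
  have "letter_weight \<eta> (x (length w)) l \<ge> 0" using assms by (cases l) auto
  then have "word_weight \<eta> x (l # w) powr s = letter_weight \<eta> (x (length w)) l powr s * word_weight \<eta> x w powr s"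
    using assms by (simp add: powr_mult word_weight_nonneg)
  then show ?case using Cons by (cases l) auto
qed simp

text \<open>The word that follows the superdiagonal throughout has weight one.\<close>
lemma sum_word_weight_ge_1:
  assumes "\<eta> \<ge> 0" "\<And>i. x i \<ge> 0"
  shows "1 \<le> (\<Sum>w\<in>words N. word_weight \<eta> x w)"
proof -
  have w: "replicate N Super \<in> words N \<and> word_weight \<eta> x (replicate N Super) = 1"
  proof (induction N)
    case (Suc N)
    have "Super \<in> next_letters (replicate N Super)" by (simp add: next_letters_def)
    then show ?case using Suc by auto
  qed simp
  have "word_weight \<eta> x (replicate N Super) \<le> (\<Sum>w\<in>words N. word_weight \<eta> x w)"
    using w assms by (intro member_le_sum) (auto intro: word_weight_nonneg)
  then show ?thesis using w by simp
qed

lemma word_weight_eq_prod: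
  "word_weight \<eta> x w = (\<Prod>i<length w. letter_weight \<eta> (x i) (rev w ! i))"
proof (induction w)
  case (Cons l w)
  have "(\<Prod>i<length w. letter_weight \<eta> (x i) (rev (l # w) ! i)) = (\<Prod>i<length w. letter_weight \<eta> (x i) (rev w ! i))"
    by (intro prod.cong refl) (simp add: nth_append)
  moreover have "rev (l # w) ! length w = l" by (simp add: nth_append)
  ultimately show ?case using Cons by (simp add: mult.commute del: rev.simps)
qed simp

lemma prod_lessThan_mono_ennreal:
  fixes f g :: "nat \<Rightarrow> ennreal"
  assumes "\<And>i. i < N \<Longrightarrow> f i \<le> g i" shows "(\<Prod>i<N. f i) \<le> (\<Prod>i<N. g i)"
  using assms by (induction N) (auto intro!: mult_mono)

text \<open>Each row contributes one letter to a word, so the weight is a product of independent factors and its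
  expectation replaces every diagonal weight by its mean.\<close>
lemma (in prob_space) expectation_word_weights:
  fixes X :: "nat \<Rightarrow> 'a \<Rightarrow> complex" and f :: "complex \<Rightarrow> real"
  assumes ind: "indep_vars (\<lambda>_. borel) X {..<N}"
    and f [measurable]: "f \<in> borel_measurable borel" and nn: "\<And>z. f z \<ge> 0" and \<eta>: "\<eta> \<ge> 0" and \<rho>: "\<rho> \<ge> 0"
    and le: "\<And>i. i < N \<Longrightarrow> (\<integral>\<^sup>+\<omega>. ennreal (f (X i \<omega>)) \<partial>M) \<le> ennreal \<rho>"
  shows "(\<integral>\<^sup>+\<omega>. ennreal (\<Sum>w\<in>words N. word_weight \<eta> (\<lambda>i. f (X i \<omega>)) w) \<partial>M) \<le> ennreal (\<Sum>w\<in>words N. word_weight \<eta> (\<lambda>_. \<rho>) w)"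
proof -
  have X [measurable]: "i < N \<Longrightarrow> X i \<in> borel_measurable M" for i
    using ind by (auto simp: indep_vars_def)
  have lw: "0 \<le> letter_weight \<eta> x l" if "x \<ge> 0" for x l using that \<eta> by (cases l) auto
  have lm [measurable]: "(\<lambda>z. letter_weight \<eta> (f z) l) \<in> borel_measurable borel" for l by (cases l) auto
  have one: "(\<integral>\<^sup>+\<omega>. ennreal (word_weight \<eta> (\<lambda>i. f (X i \<omega>)) w) \<partial>M) \<le> ennreal (word_weight \<eta> (\<lambda>_. \<rho>) w)"
    if w: "w \<in> words N" for w
  proof -
    have len: "length w = N" using w by (rule length_words)
    have "(\<integral>\<^sup>+\<omega>. ennreal (word_weight \<eta> (\<lambda>i. f (X i \<omega>)) w) \<partial>M)
       = (\<integral>\<^sup>+\<omega>. (\<Prod>i<N. ennreal (letter_weight \<eta> (f (X i \<omega>)) (rev w ! i))) \<partial>M)"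
      unfolding word_weight_eq_prod len by (intro nn_integral_cong prod_ennreal[symmetric] lw nn)
    also have "\<dots> = (\<Prod>i<N. \<integral>\<^sup>+\<omega>. ennreal (letter_weight \<eta> (f (X i \<omega>)) (rev w ! i)) \<partial>M)"
      by (rule indep_vars_nn_integral) (auto intro!: indep_vars_compose2[OF ind])
    also have "\<dots> \<le> (\<Prod>i<N. ennreal (letter_weight \<eta> \<rho> (rev w ! i)))"
    proof (rule prod_lessThan_mono_ennreal)
      fix i assume "i < N"
      then show "(\<integral>\<^sup>+\<omega>. ennreal (letter_weight \<eta> (f (X i \<omega>)) (rev w ! i)) \<partial>M) \<le> ennreal (letter_weight \<eta> \<rho> (rev w ! i))"
        using le[of i] by (cases "rev w ! i") (auto simp: emeasure_space_1)
    qed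
    also have "\<dots> = ennreal (word_weight \<eta> (\<lambda>_. \<rho>) w)"
      unfolding word_weight_eq_prod len by (intro prod_ennreal lw \<rho>)
    finally show ?thesis .
  qed
  have wm: "(\<lambda>\<omega>. ennreal (word_weight \<eta> (\<lambda>i. f (X i \<omega>)) w)) \<in> borel_measurable M" if "w \<in> words N" for w
  proof -
    have "(\<lambda>\<omega>. \<Prod>i<N. letter_weight \<eta> (f (X i \<omega>)) (rev w ! i)) \<in> borel_measurable M"
      by (intro borel_measurable_prod measurable_compose[OF X lm]) auto
    then show ?thesis unfolding word_weight_eq_prod length_words[OF that] by simp
  qed
  have "(\<integral>\<^sup>+\<omega>. ennreal (\<Sum>w\<in>words N. word_weight \<eta> (\<lambda>i. f (X i \<omega>)) w) \<partial>M) = (\<integral>\<^sup>+\<omega>. (\<Sum>w\<in>words N. ennreal (word_weight \<eta> (\<lambda>i. f (X i \<omega>)) w)) \<partial>M)"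
    by (intro nn_integral_cong sum_ennreal[symmetric] word_weight_nonneg \<eta> nn)
  also have "\<dots> = (\<Sum>w\<in>words N. \<integral>\<^sup>+\<omega>. ennreal (word_weight \<eta> (\<lambda>i. f (X i \<omega>)) w) \<partial>M)"
    by (rule nn_integral_sum) (rule wm)
  also have "\<dots> \<le> (\<Sum>w\<in>words N. ennreal (word_weight \<eta> (\<lambda>_. \<rho>) w))" by (rule sum_mono) (rule one)
  also have "\<dots> = ennreal (\<Sum>w\<in>words N. word_weight \<eta> (\<lambda>_. \<rho>) w)" by (intro sum_ennreal word_weight_nonneg \<eta> \<rho>)
  finally show ?thesis .
qed

lemma measurable_noisy_det:
  assumes "\<And>i. i < N \<Longrightarrow> (\<lambda>x. a x i) \<in> borel_measurable Q"
    and "\<And>i j. i < N \<Longrightarrow> j < N \<Longrightarrow> (\<lambda>x. g x (i, j)) \<in> borel_measurable Q"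
  shows "(\<lambda>x. noisy_det N (a x) \<delta> (g x)) \<in> borel_measurable Q"
  unfolding noisy_det_def
proof (intro borel_measurable_sum borel_measurable_times borel_measurable_const borel_measurable_prod borel_measurable_add)
  fix \<sigma> i assume \<sigma>: "\<sigma> \<in> {\<sigma>. \<sigma> permutes {..<N}}" and i: "i \<in> {..<N}"
  then have "\<sigma> i < N" using permutes_in_image[of \<sigma> "{..<N}" i] by auto
  then show "(\<lambda>x. g x (i, \<sigma> i)) \<in> borel_measurable Q" using i by (intro assms) auto
  show "(\<lambda>x. bidiag (a x) i (\<sigma> i)) \<in> borel_measurable Q"
    using assms(1)[of i] i by (cases "\<sigma> i = i"; cases "\<sigma> i = Suc i") (simp_all add: bidiag_def)
qed

lemma noisy_det_cong:
  assumes "\<And>i. i < N \<Longrightarrow> a i = a' i" "\<And>i j. i < N \<Longrightarrow> j < N \<Longrightarrow> g (i, j) = g' (i, j)"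
  shows "noisy_det N a \<delta> g = noisy_det N a' \<delta> g'"
  unfolding noisy_det_def
proof (intro sum.cong prod.cong refl arg_cong2[where f="(*)"] arg_cong2[where f="(+)"])
  fix \<sigma> i assume \<sigma>: "\<sigma> \<in> {\<sigma>. \<sigma> permutes {..<N}}" and i: "i \<in> {..<N}"
  then have "\<sigma> i < N" using permutes_in_image[of \<sigma> "{..<N}" i] by auto
  then show "g (i, \<sigma> i) = g' (i, \<sigma> i)" using i assms by auto
  show "bidiag a i (\<sigma> i) = bidiag a' i (\<sigma> i)" using i assms by (simp add: bidiag_def)
qed

lemma iid_distr_PiM:
  assumes "prob_space P" "I \<noteq> {}" "iid P I X \<nu>" "sets \<nu> = sets borel"
  shows "distr P (PiM I (\<lambda>_. borel)) (\<lambda>\<omega>. \<lambda>i\<in>I. X i \<omega>) = PiM I (\<lambda>_. \<nu>)"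
proof -
  interpret prob_space P by fact
  have ind: "indep_vars (\<lambda>_. borel) X I" and d: "\<And>i. i \<in> I \<Longrightarrow> distr P borel (X i) = \<nu>"
    using assms by (auto simp: iid_def)
  have "distr P (PiM I (\<lambda>_. borel)) (\<lambda>\<omega>. \<lambda>i\<in>I. X i \<omega>) = PiM I (\<lambda>i. distr P borel (X i))"
  proof -
    have "\<And>i. i \<in> I \<Longrightarrow> X i \<in> borel_measurable P" using ind by (auto simp: indep_vars_def)
    from indep_vars_iff_distr_eq_PiM'[OF assms(2) this] show ?thesis using ind by simp
  qed
  also have "\<dots> = PiM I (\<lambda>_. \<nu>)" by (intro PiM_cong refl d)
  finally show ?thesis .
qed

text \<open>Independent families have a product joint law, so one family can be fixed while the other is
  integrated out.\<close>
lemma nn_integral_freeze: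
  assumes P: "prob_space P" and ind: "indep_families P I X J Y"
    and X: "\<And>i. i \<in> I \<Longrightarrow> X i \<in> borel_measurable P" and Y: "\<And>j. j \<in> J \<Longrightarrow> Y j \<in> borel_measurable P"
    and F [measurable]: "F \<in> borel_measurable (PiM I (\<lambda>_. borel) \<Otimes>\<^sub>M PiM J (\<lambda>_. borel))"
  shows "(\<integral>\<^sup>+\<omega>. F (\<lambda>i\<in>I. X i \<omega>, \<lambda>j\<in>J. Y j \<omega>) \<partial>P)
    = (\<integral>\<^sup>+\<omega>. (\<integral>\<^sup>+y. F (\<lambda>i\<in>I. X i \<omega>, y) \<partial>distr P (PiM J (\<lambda>_. borel)) (\<lambda>\<omega>. \<lambda>j\<in>J. Y j \<omega>)) \<partial>P)"
proof -
  interpret prob_space P by fact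
  let ?A = "PiM I (\<lambda>_. borel :: complex measure)" and ?B = "PiM J (\<lambda>_. borel :: complex measure)"
  let ?X = "\<lambda>\<omega>. \<lambda>i\<in>I. X i \<omega>" and ?Y = "\<lambda>\<omega>. \<lambda>j\<in>J. Y j \<omega>"
  have X' [measurable]: "?X \<in> P \<rightarrow>\<^sub>M ?A" by (intro measurable_restrict X)
  have Y' [measurable]: "?Y \<in> P \<rightarrow>\<^sub>M ?B" by (intro measurable_restrict Y)
  interpret DX: prob_space "distr P ?A ?X" by (rule prob_space_distr) fact
  interpret DY: prob_space "distr P ?B ?Y" by (rule prob_space_distr) fact
  have joint: "distr P ?A ?X \<Otimes>\<^sub>M distr P ?B ?Y = distr P (?A \<Otimes>\<^sub>M ?B) (\<lambda>\<omega>. (?X \<omega>, ?Y \<omega>))"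
  proof (rule pair_measure_eqI)
    show "sigma_finite_measure (distr P ?A ?X)" "sigma_finite_measure (distr P ?B ?Y)" by unfold_locales
    show "sets (distr P ?A ?X \<Otimes>\<^sub>M distr P ?B ?Y) = sets (distr P (?A \<Otimes>\<^sub>M ?B) (\<lambda>\<omega>. (?X \<omega>, ?Y \<omega>)))"
      by (simp cong: sets_pair_measure_cong)
    fix A B assume "A \<in> sets (distr P ?A ?X)" "B \<in> sets (distr P ?B ?Y)"
    then have AB [measurable]: "A \<in> sets ?A" "B \<in> sets ?B" by auto
    have "prob (?X -` A \<inter> space P \<inter> (?Y -` B \<inter> space P)) = prob (?X -` A \<inter> space P) * prob (?Y -` B \<inter> space P)"
    proof (rule indep_setD[OF ind[unfolded indep_families_def]])
      have "?X \<in> space P \<rightarrow> space ?A" "?Y \<in> space P \<rightarrow> space ?B"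
        using measurable_space[OF X'] measurable_space[OF Y'] by auto
      then show "?X -` A \<inter> space P \<in> sets (vimage_algebra (space P) ?X ?A)"
        "?Y -` B \<inter> space P \<in> sets (vimage_algebra (space P) ?Y ?B)"
        using AB by (auto simp: sets_vimage_algebra2)
    qed
    moreover have "?X -` A \<inter> space P \<inter> (?Y -` B \<inter> space P) = (\<lambda>\<omega>. (?X \<omega>, ?Y \<omega>)) -` (A \<times> B) \<inter> space P" by auto
    ultimately have "prob ((\<lambda>\<omega>. (?X \<omega>, ?Y \<omega>)) -` (A \<times> B) \<inter> space P) = prob (?X -` A \<inter> space P) * prob (?Y -` B \<inter> space P)" by simp
    then show "emeasure (distr P ?A ?X) A * emeasure (distr P ?B ?Y) B = emeasure (distr P (?A \<Otimes>\<^sub>M ?B) (\<lambda>\<omega>. (?X \<omega>, ?Y \<omega>))) (A \<times> B)"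
      by (simp add: emeasure_distr emeasure_eq_measure ennreal_mult)
  qed
  have "(\<integral>\<^sup>+\<omega>. F (?X \<omega>, ?Y \<omega>) \<partial>P) = (\<integral>\<^sup>+z. F z \<partial>(distr P ?A ?X \<Otimes>\<^sub>M distr P ?B ?Y))"
    unfolding joint by (subst nn_integral_distr) auto
  also have "\<dots> = (\<integral>\<^sup>+x. (\<integral>\<^sup>+y. F (x, y) \<partial>distr P ?B ?Y) \<partial>distr P ?A ?X)"
    by (rule DY.nn_integral_fst[symmetric]) simp
  also have "\<dots> = (\<integral>\<^sup>+\<omega>. (\<integral>\<^sup>+y. F (?X \<omega>, y) \<partial>distr P ?B ?Y) \<partial>P)"
    by (subst nn_integral_distr) auto
  finally show ?thesis .
qed

section \<open>The normalized logarithm of the determinant\<close>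

lemma ennreal_diff_le:
  assumes "ennreal a \<le> x + ennreal b" "b \<ge> 0" shows "ennreal (a - b) \<le> x"
proof (cases x)
  case (real r)
  then have "ennreal a \<le> ennreal (r + b)" using assms by (simp add: ennreal_plus)
  then have "a \<le> r + b \<or> a \<le> 0" using real assms by (auto simp: ennreal_le_iff2 simp flip: ennreal_plus)
  then have "a - b \<le> r" using real assms by auto
  then show ?thesis using real by (auto intro: ennreal_leI)
qed simp

definition normalized_log_det :: "real \<Rightarrow> nat \<Rightarrow> (nat \<Rightarrow> complex) \<Rightarrow> (nat \<times> nat \<Rightarrow> complex) \<Rightarrow> complex \<Rightarrow> real" where
  "normalized_log_det \<gamma> N d g z = ln (cmod (noisy_det N (\<lambda>i. d i - z) (real N powr - \<gamma>) g)) / N"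

context isotropic_law
begin

text \<open>The noise may be integrated out first, with the diagonal held fixed. Both diagonal models have this
  property, and it is the only relation between diagonal and noise that the estimates use.\<close>
definition freezes :: "nat \<Rightarrow> 'w measure \<Rightarrow> (nat \<Rightarrow> 'w \<Rightarrow> complex) \<Rightarrow> (nat \<times> nat \<Rightarrow> 'w \<Rightarrow> complex) \<Rightarrow> bool" where
  "freezes N P D G \<longleftrightarrow> prob_space P \<and> (\<forall>i<N. D i \<in> borel_measurable P) \<and> (\<forall>i<N. \<forall>j<N. G (i, j) \<in> borel_measurable P) \<and>
    (\<forall>\<delta> z. \<forall>h :: complex \<Rightarrow> ennreal. h \<in> borel_measurable borel \<longrightarrow>
      (\<integral>\<^sup>+\<omega>. h (noisy_det N (\<lambda>i. D i \<omega> - z) \<delta> (\<lambda>e. G e \<omega>)) \<partial>P)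
      = (\<integral>\<^sup>+\<omega>. (\<integral>\<^sup>+g. h (noisy_det N (\<lambda>i. D i \<omega> - z) \<delta> g) \<partial>noise_matrix N) \<partial>P))"

lemma prob_space_noise_matrix: "prob_space (noise_matrix N)"
  by (rule prob_space_PiM) (rule prob_space_axioms)

lemma measurable_noise_entry: "i < N \<Longrightarrow> j < N \<Longrightarrow> (\<lambda>g. g (i, j)) \<in> borel_measurable (noise_matrix N)"
  by (subst measurable_cong_sets[OF refl sets_M[symmetric]]) (rule measurable_component_singleton, simp)

lemma measurable_noisy_det_noise [measurable]: "noisy_det N a \<delta> \<in> borel_measurable (noise_matrix N)"
  by (rule measurable_noisy_det[where a="\<lambda>_. a" and g="\<lambda>g. g"]) (auto intro: measurable_noise_entry)

text \<open>Moments of order \<open>2 s\<close>, at most two, inherit the sum over words, since \<open>x powr s\<close> is concave and subadditive.\<close>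
lemma second_moment_powr_noisy_det:
  assumes s: "0 < s" "s \<le> 1"
  shows "(\<integral>\<^sup>+g. ennreal (((cmod (noisy_det N a \<delta> g))\<^sup>2) powr s) \<partial>noise_matrix N)
    \<le> ennreal (\<Sum>w\<in>words N. word_weight ((real N * (c * \<delta>\<^sup>2)) powr s) (\<lambda>i. ((cmod (a i))\<^sup>2) powr s) w)"
proof -
  interpret nm: prob_space "noise_matrix N" by (rule prob_space_noise_matrix)
  let ?\<eta> = "real N * (c * \<delta>\<^sup>2)" and ?x = "\<lambda>i. (cmod (a i))\<^sup>2"
  have \<eta>: "?\<eta> \<ge> 0" using c_nonneg by simp
  let ?T = "\<Sum>w\<in>words N. word_weight ?\<eta> ?x w"
  have T: "?T > 0" using sum_word_weight_ge_1[OF \<eta>, of ?x N] by simp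
  have "(\<integral>\<^sup>+g. ennreal (((cmod (noisy_det N a \<delta> g))\<^sup>2) powr s) \<partial>noise_matrix N) \<le> ennreal (?T powr s)"
    by (rule nm.nn_integral_powr_le) (use s T second_moment_noisy_det in auto)
  also have "\<dots> \<le> ennreal (\<Sum>w\<in>words N. word_weight ?\<eta> ?x w powr s)"
    using s \<eta> by (intro ennreal_leI powr_sum_le_sum_powr) (auto intro: word_weight_nonneg)
  also have "\<dots> = ennreal (\<Sum>w\<in>words N. word_weight (?\<eta> powr s) (\<lambda>i. ?x i powr s) w)"
    using \<eta> by (simp add: word_weight_powr)
  finally show ?thesis .
qed

text \<open>The upper bound is a moment averaged over the diagonal, and the lower bound is the mean of the
  logarithm of one coefficient \<open>p\<close> of degree at most \<open>k\<close>. The value \<open>\<beta>\<close> is free: it should lie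
  slightly above the target \<open>U\<close>.\<close>
lemma freezes_L1_bound:
  assumes fr: "freezes N P D G" and N: "N > 0" and s: "0 < s" "s \<le> 1" and K: "K \<ge> 0"
    and up: "(\<integral>\<^sup>+\<omega>. ennreal (\<Sum>w\<in>words N. word_weight ((real N * (c * (real N powr - \<gamma>)\<^sup>2)) powr s) (\<lambda>i. ((cmod (D i \<omega> - z))\<^sup>2) powr s) w) \<partial>P) \<le> ennreal K"
    and p: "p \<in> near_id_pairs N" "card (fst p) \<le> k"
    and nz: "AE \<omega> in P. pair_coeff N (\<lambda>i. D i \<omega> - z) (real N powr - \<gamma>) p \<noteq> 0
      \<and> q \<omega> \<le> ln (cmod (pair_coeff N (\<lambda>i. D i \<omega> - z) (real N powr - \<gamma>) p))"
    and qint: "integrable P q"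
  shows "integrable P (\<lambda>\<omega>. normalized_log_det \<gamma> N (\<lambda>i. D i \<omega>) (\<lambda>e. G e \<omega>) z)"
    "(\<integral>\<omega>. \<bar>normalized_log_det \<gamma> N (\<lambda>i. D i \<omega>) (\<lambda>e. G e \<omega>) z - U\<bar> \<partial>P)
      \<le> \<bar>\<beta> - U\<bar> + K * exp (- 2 * s * N * \<beta>) / (s * N) + (\<beta> - ((\<integral>\<omega>. q \<omega> \<partial>P) - C * k / 2) / N)"
proof -
  interpret P: prob_space P using fr by (simp add: freezes_def)
  let ?\<delta> = "real N powr - \<gamma>"
  let ?det = "\<lambda>\<omega>. noisy_det N (\<lambda>i. D i \<omega> - z) ?\<delta> (\<lambda>e. G e \<omega>)"
  have frz: "(\<integral>\<^sup>+\<omega>. h (?det \<omega>) \<partial>P) = (\<integral>\<^sup>+\<omega>. (\<integral>\<^sup>+g. h (noisy_det N (\<lambda>i. D i \<omega> - z) ?\<delta> g) \<partial>noise_matrix N) \<partial>P)"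
    if "h \<in> borel_measurable borel" for h :: "complex \<Rightarrow> ennreal"
    using fr that unfolding freezes_def by blast
  have meas: "(\<lambda>\<omega>. cmod (?det \<omega>)) \<in> borel_measurable P"
  proof -
    have "?det \<in> borel_measurable P"
    proof (rule measurable_noisy_det[where a="\<lambda>\<omega> i. D i \<omega> - z" and g="\<lambda>\<omega> e. G e \<omega>"])
      show "(\<lambda>\<omega>. D i \<omega> - z) \<in> borel_measurable P" if "i < N" for i
        by (intro borel_measurable_diff borel_measurable_const) (use fr that in \<open>auto simp: freezes_def\<close>)
      show "(\<lambda>\<omega>. G (i, j) \<omega>) \<in> borel_measurable P" if "i < N" "j < N" for i j
        using fr that by (auto simp: freezes_def)
    qed
    then show ?thesis by measurable
  qed
  have [measurable]: "q \<in> borel_measurable P" using qint by auto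
  have U: "(\<integral>\<^sup>+\<omega>. ennreal (((cmod (?det \<omega>))\<^sup>2) powr s) \<partial>P) \<le> ennreal K"
  proof -
    have "(\<integral>\<^sup>+\<omega>. ennreal (((cmod (?det \<omega>))\<^sup>2) powr s) \<partial>P)
      = (\<integral>\<^sup>+\<omega>. (\<integral>\<^sup>+g. ennreal (((cmod (noisy_det N (\<lambda>i. D i \<omega> - z) ?\<delta> g))\<^sup>2) powr s) \<partial>noise_matrix N) \<partial>P)"
      by (rule frz) measurable
    also have "\<dots> \<le> (\<integral>\<^sup>+\<omega>. ennreal (\<Sum>w\<in>words N. word_weight ((real N * (c * ?\<delta>\<^sup>2)) powr s) (\<lambda>i. ((cmod (D i \<omega> - z))\<^sup>2) powr s) w) \<partial>P)"
      by (intro nn_integral_mono second_moment_powr_noisy_det s)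
    finally show ?thesis using up by simp
  qed
  have low: "ennreal (2 * ((\<integral>\<omega>. q \<omega> \<partial>P) - C * k / 2) - 2 * ln \<tau>) \<le> (\<integral>\<^sup>+\<omega>. ennreal (ln (1 + (cmod (?det \<omega>) / \<tau>)\<^sup>2)) \<partial>P)"
    if \<tau>: "0 < \<tau>" for \<tau>
  proof -
    let ?pc = "\<lambda>\<omega>. cmod (pair_coeff N (\<lambda>i. D i \<omega> - z) ?\<delta> p)"
    let ?I = "\<lambda>\<omega>. \<integral>\<^sup>+g. ennreal (ln (1 + (cmod (noisy_det N (\<lambda>i. D i \<omega> - z) ?\<delta> g) / \<tau>)\<^sup>2)) \<partial>noise_matrix N"
    have eq: "(\<integral>\<^sup>+\<omega>. ennreal (ln (1 + (cmod (?det \<omega>) / \<tau>)\<^sup>2)) \<partial>P) = (\<integral>\<^sup>+\<omega>. ?I \<omega> \<partial>P)"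
      by (rule frz) measurable
    have "ennreal (2 * (\<integral>\<omega>. q \<omega> \<partial>P) - (2 * ln \<tau> + C * k)) = ennreal (\<integral>\<omega>. 2 * q \<omega> - (2 * ln \<tau> + C * k) \<partial>P)"
    proof -
      have "(\<integral>\<omega>. 2 * q \<omega> - (2 * ln \<tau> + C * k) \<partial>P) = (\<integral>\<omega>. 2 * q \<omega> \<partial>P) - (\<integral>\<omega>. 2 * ln \<tau> + C * k \<partial>P)"
        using qint by (intro Bochner_Integration.integral_diff) auto
      then show ?thesis by (simp add: P.prob_space)
    qed
    also have "\<dots> \<le> (\<integral>\<^sup>+\<omega>. ennreal (2 * q \<omega> - (2 * ln \<tau> + C * k)) \<partial>P)"
      using qint by (intro ennreal_integral_le_nn_integral) auto
    also have "\<dots> \<le> (\<integral>\<^sup>+\<omega>. ?I \<omega> \<partial>P)"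
    proof (rule nn_integral_mono_AE, use nz in eventually_elim)
      fix \<omega> assume A: "pair_coeff N (\<lambda>i. D i \<omega> - z) ?\<delta> p \<noteq> 0 \<and> q \<omega> \<le> ln (?pc \<omega>)"
      then have pc: "?pc \<omega> > 0" by simp
      have "ln ((?pc \<omega> / \<tau>)\<^sup>2) \<le> ln (1 + (?pc \<omega> / \<tau>)\<^sup>2)"
        using pc \<tau> by (intro ln_mono) auto
      moreover have "ln ((?pc \<omega> / \<tau>)\<^sup>2) = 2 * (ln (?pc \<omega>) - ln \<tau>)"
        using pc \<tau> by (simp add: ln_realpow ln_div)
      ultimately have "2 * q \<omega> - 2 * ln \<tau> \<le> ln (1 + (?pc \<omega> / \<tau>)\<^sup>2)"
        using A by simp
      then have "ennreal (2 * q \<omega> - 2 * ln \<tau>) \<le> ennreal (ln (1 + (?pc \<omega> / \<tau>)\<^sup>2))" by (rule ennreal_leI)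
      also have "\<dots> \<le> ?I \<omega> + ennreal (C * card (fst p))" by (rule ln1p_noisy_det[OF p(1)])
      also have "\<dots> \<le> ?I \<omega> + ennreal (C * k)"
        using p(2) C_nonneg by (intro add_left_mono ennreal_leI mult_left_mono) auto
      finally show "ennreal (2 * q \<omega> - (2 * ln \<tau> + C * k)) \<le> ?I \<omega>"
        unfolding diff_diff_eq[symmetric] by (rule ennreal_diff_le) (use C_nonneg in auto)
    qed
    finally show ?thesis unfolding eq by (simp add: algebra_simps)
  qed
  have nnd: "\<And>\<omega>. 0 \<le> cmod (?det \<omega>)" by simp
  have lo: "\<And>\<tau>. 0 < \<tau> \<Longrightarrow> \<tau> \<le> 1 \<Longrightarrow> ennreal (2 * ((\<integral>\<omega>. q \<omega> \<partial>P) - C * k / 2) - 2 * ln \<tau>) \<le> (\<integral>\<^sup>+\<omega>. ennreal (ln (1 + (cmod (?det \<omega>) / \<tau>)\<^sup>2)) \<partial>P)"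
    by (rule low)
  show "integrable P (\<lambda>\<omega>. normalized_log_det \<gamma> N (\<lambda>i. D i \<omega>) (\<lambda>e. G e \<omega>) z)"
    unfolding normalized_log_det_def by (rule P.L1_bound_of_moment_bounds(1)[OF meas nnd s(1) N K U lo]; assumption)
  show "(\<integral>\<omega>. \<bar>normalized_log_det \<gamma> N (\<lambda>i. D i \<omega>) (\<lambda>e. G e \<omega>) z - U\<bar> \<partial>P)
      \<le> \<bar>\<beta> - U\<bar> + K * exp (- 2 * s * N * \<beta>) / (s * N) + (\<beta> - ((\<integral>\<omega>. q \<omega> \<partial>P) - C * k / 2) / N)" for U
    unfolding normalized_log_det_def by (rule P.L1_bound_of_moment_bounds(2)[OF meas nnd s(1) N K U lo]; assumption)
qed

text \<open>The full superdiagonal, closed up by one noise entry, has a coefficient that does not involve the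
  diagonal. Its logarithm is of order \<open>ln N\<close>, negligible after division by \<open>N\<close>.\<close>
lemma corner_pair:
  assumes N: "N > 0"
  shows "\<exists>p\<in>near_id_pairs N. card (fst p) \<le> 2 \<and> (\<forall>a. - 2 * \<bar>\<gamma>\<bar> * ln N \<le> ln (cmod (pair_coeff N a (real N powr - \<gamma>) p))
      \<and> pair_coeff N a (real N powr - \<gamma>) p \<noteq> 0)"
proof -
  let ?\<delta> = "real N powr - \<gamma>"
  obtain p where p: "p \<in> near_id_pairs N" "card (fst p) \<le> N div N + 1"
    "\<And>a \<delta>. cmod (pair_coeff N a \<delta> p) = \<bar>\<delta>\<bar> ^ card (fst p) * (\<Prod>i\<in>{i. i < N \<and> i div N \<notin> {0}}. cmod (a i))"
    using block_pair[OF N, of N "{0}"] by blast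
  have E: "{i. i < N \<and> i div N \<notin> {0}} = {}" by auto
  have eq: "cmod (pair_coeff N a ?\<delta> p) = ?\<delta> ^ card (fst p)" for a
    using p(3)[of a ?\<delta>] unfolding E by simp
  have two: "card (fst p) \<le> 2" using p(2) N by simp
  have nz: "pair_coeff N a ?\<delta> p \<noteq> 0" for a
  proof -
    have "0 < cmod (pair_coeff N a ?\<delta> p)" unfolding eq using N by simp
    then show ?thesis by (simp only: zero_less_norm_iff not_False_eq_True)
  qed
  have "ln (cmod (pair_coeff N a ?\<delta> p)) = - (card (fst p) * \<gamma> * ln N)" for a
    unfolding eq using N by (simp add: ln_realpow ln_powr)
  moreover have "card (fst p) * \<gamma> * ln N \<le> 2 * \<bar>\<gamma>\<bar> * ln N"
  proof (rule mult_right_mono)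
    have "card (fst p) * \<gamma> \<le> card (fst p) * \<bar>\<gamma>\<bar>" by (intro mult_left_mono) auto
    also have "\<dots> \<le> 2 * \<bar>\<gamma>\<bar>" using two by (intro mult_right_mono) auto
    finally show "card (fst p) * \<gamma> \<le> 2 * \<bar>\<gamma>\<bar>" .
  qed (use N in simp)
  ultimately show ?thesis using p(1) two nz by (intro bexI[of _ p]) auto
qed

text \<open>The weight of a noise letter: variance of a noise entry times the number of its columns.\<close>
definition noise_level :: "real \<Rightarrow> nat \<Rightarrow> real" where
  "noise_level \<gamma> N = real N * (c * (real N powr - \<gamma>)\<^sup>2)"

lemma noise_level_eq: "N > 0 \<Longrightarrow> noise_level \<gamma> N = c * real N powr (1 - 2 * \<gamma>)"
proof -
  assume "N > 0"
  have "(real N powr - \<gamma>)\<^sup>2 = real N powr (- 2 * \<gamma>)" by (subst power2_eq_square, subst powr_add[symmetric]) simp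
  then have "noise_level \<gamma> N = c * (real N * real N powr (- 2 * \<gamma>))" by (simp add: noise_level_def)
  also have "real N * real N powr (- 2 * \<gamma>) = real N powr (1 + - 2 * \<gamma>)" by (rule powr_mult_base) simp
  finally show ?thesis by simp
qed

lemma noise_level_nonneg: "0 \<le> noise_level \<gamma> N"
  using c_nonneg by (simp add: noise_level_def)

lemma noise_level_le:
  assumes "\<gamma> > 1/2" "N > 0" shows "noise_level \<gamma> N \<le> c"
proof -
  have "real N powr (1 - 2 * \<gamma>) \<le> real N powr 0" using assms by (intro powr_mono) auto
  then show ?thesis using assms c_nonneg by (simp add: noise_level_eq mult_left_le)
qed

lemma noise_level_tendsto:
  assumes "\<gamma> > 1/2" shows "noise_level \<gamma> \<longlonglongrightarrow> 0"
proof -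
  have "(\<lambda>N. real N powr (1 - 2 * \<gamma>)) \<longlonglongrightarrow> 0"
    using assms by (intro tendsto_neg_powr filterlim_real_sequentially) auto
  then have "(\<lambda>N. c * real N powr (1 - 2 * \<gamma>)) \<longlonglongrightarrow> c * 0" by (intro tendsto_intros)
  moreover have "\<forall>\<^sub>F N in sequentially. c * real N powr (1 - 2 * \<gamma>) = noise_level \<gamma> N"
    using eventually_gt_at_top[of 0] by eventually_elim (simp add: noise_level_eq)
  ultimately have "noise_level \<gamma> \<longlonglongrightarrow> c * 0" by (rule Lim_transform_eventually)
  then show ?thesis by simp
qed

text \<open>Crude bounds suffice for domination: in the upper bound \<open>\<kappa> = 1\<close>, and in the lower bound the coefficient of
  the superdiagonal. The constants do not depend on \<open>N\<close>, nor on the diagonal except through \<open>R\<close>.\<close>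
lemma uniform_L1_bound:
  assumes \<gamma>: "\<gamma> > 1/2" and fr: "freezes N P D G" and N: "N > 0" and R: "R \<ge> 1"
    and up: "(\<integral>\<^sup>+\<omega>. ennreal (\<Sum>w\<in>words N. word_weight (noise_level \<gamma> N) (\<lambda>i. (cmod (D i \<omega> - z))\<^sup>2) w) \<partial>P)
      \<le> ennreal (\<Sum>w\<in>words N. word_weight (noise_level \<gamma> N) (\<lambda>_. R) w)"
  shows "integrable P (\<lambda>\<omega>. normalized_log_det \<gamma> N (\<lambda>i. D i \<omega>) (\<lambda>e. G e \<omega>) z)"
    "(\<integral>\<omega>. \<bar>normalized_log_det \<gamma> N (\<lambda>i. D i \<omega>) (\<lambda>e. G e \<omega>) z - U\<bar> \<partial>P)
      \<le> \<bar>U\<bar> + ln (R + c + 1) + 1 + 2 * \<gamma> + C"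
proof -
  interpret P: prob_space P using fr by (simp add: freezes_def)
  let ?\<eta> = "noise_level \<gamma> N"
  define K where "K = (R + c + 1) ^ N"
  have \<eta>: "0 \<le> ?\<eta>" "?\<eta> \<le> c" using noise_level_nonneg noise_level_le[OF \<gamma> N] by auto
  have base: "R + c + 1 > 1" using R c_nonneg by simp
  then have K: "K \<ge> 0" by (simp add: K_def)
  have "(\<Sum>w\<in>words N. word_weight ?\<eta> (\<lambda>_. R) w) \<le> (\<Prod>i<N. max 1 R + (c + 1)) / 1"
    using \<eta> R c_nonneg by (intro sum_word_weight_le) auto
  also have "\<dots> = K" using R by (simp add: K_def max_def add.assoc)
  finally have "(\<integral>\<^sup>+\<omega>. ennreal (\<Sum>w\<in>words N. word_weight ?\<eta> (\<lambda>i. (cmod (D i \<omega> - z))\<^sup>2) w) \<partial>P) \<le> ennreal K"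
    using up by (meson ennreal_leI order_trans)
  then have up': "(\<integral>\<^sup>+\<omega>. ennreal (\<Sum>w\<in>words N. word_weight ((real N * (c * (real N powr - \<gamma>)\<^sup>2)) powr 1) (\<lambda>i. ((cmod (D i \<omega> - z))\<^sup>2) powr 1) w) \<partial>P) \<le> ennreal K"
    using \<eta> by (simp add: noise_level_def)
  obtain p where p: "p \<in> near_id_pairs N" "card (fst p) \<le> 2"
    "\<And>a. - 2 * \<bar>\<gamma>\<bar> * ln N \<le> ln (cmod (pair_coeff N a (real N powr - \<gamma>) p))" "\<And>a. pair_coeff N a (real N powr - \<gamma>) p \<noteq> 0"
    using corner_pair[OF N, of \<gamma>] by metis
  note B = freezes_L1_bound[OF fr N _ _ K up' p(1,2), of "\<lambda>_. - 2 * \<bar>\<gamma>\<bar> * ln N"]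
  show "integrable P (\<lambda>\<omega>. normalized_log_det \<gamma> N (\<lambda>i. D i \<omega>) (\<lambda>e. G e \<omega>) z)"
    by (rule B(1)) (use p(3,4) in auto)
  let ?\<beta> = "ln (R + c + 1) / 2"
  have "(\<integral>\<omega>. \<bar>normalized_log_det \<gamma> N (\<lambda>i. D i \<omega>) (\<lambda>e. G e \<omega>) z - U\<bar> \<partial>P)
    \<le> \<bar>?\<beta> - U\<bar> + K * exp (- 2 * 1 * real N * ?\<beta>) / (1 * real N) + (?\<beta> - ((\<integral>\<omega>. - 2 * \<bar>\<gamma>\<bar> * ln N \<partial>P) - C * real 2 / 2) / N)"
    by (rule B(2)) (use p(3,4) in auto)
  also have "K * exp (- 2 * 1 * real N * ?\<beta>) = 1"
  proof -
    have "exp (- 2 * 1 * real N * ?\<beta>) = inverse (exp (N * ln (R + c + 1)))" by (simp add: exp_minus[symmetric])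
    also have "exp (N * ln (R + c + 1)) = K" using base by (simp add: K_def exp_of_nat_mult)
    finally show ?thesis using base by (simp add: K_def)
  qed
  also have "(?\<beta> - ((\<integral>\<omega>. - 2 * \<bar>\<gamma>\<bar> * ln N \<partial>P) - C * real 2 / 2) / N) = ?\<beta> + 2 * \<gamma> * (ln N / N) + C / N"
    using \<gamma> by (simp add: P.prob_space diff_divide_distrib)
  also have "\<bar>?\<beta> - U\<bar> + 1 / (1 * real N) + (?\<beta> + 2 * \<gamma> * (ln N / N) + C / N) \<le> \<bar>?\<beta> - U\<bar> + 1 + (?\<beta> + 2 * \<gamma> * 1 + C)"
  proof -
    have "ln N \<le> N" using N ln_bound[of "real N"] by simp
    then have "ln N / N \<le> 1" using N by simp
    then have "2 * \<gamma> * (ln N / N) \<le> 2 * \<gamma> * 1" using \<gamma> by (intro mult_left_mono) auto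
    moreover have "C / N \<le> C" using N C_nonneg by (simp add: divide_le_eq mult_le_cancel_left1)
    moreover have "1 / (1 * real N) \<le> 1" using N by simp
    ultimately show ?thesis by linarith
  qed
  also have "\<dots> \<le> \<bar>U\<bar> + ln (R + c + 1) + 1 + 2 * \<gamma> + C"
  proof -
    have "0 \<le> ?\<beta>" using base by simp
    then show ?thesis by (auto simp: abs_if)
  qed
  finally show "(\<integral>\<omega>. \<bar>normalized_log_det \<gamma> N (\<lambda>i. D i \<omega>) (\<lambda>e. G e \<omega>) z - U\<bar> \<partial>P)
      \<le> \<bar>U\<bar> + ln (R + c + 1) + 1 + 2 * \<gamma> + C" .
qed

end

section \<open>Small moments and clipped potentials\<close>

lemma powr_sub_one_le:
  fixes y s :: real assumes "y \<ge> 0" "0 < s" "s \<le> 1"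
  shows "(y powr s - 1) / s \<le> y - 1"
proof -
  have "y powr s \<le> s * y + (1 - s)"
  proof (cases "y = 0")
    case False
    have "y powr s * 1 powr (1 - s) \<le> s * y + (1 - s) * 1"
      by (rule Youngs_inequality_0) (use assms False in auto)
    then show ?thesis by simp
  qed (use assms in auto)
  then have "y powr s - 1 \<le> (y - 1) * s" by (simp add: algebra_simps)
  then show ?thesis using assms by (simp add: divide_le_eq)
qed

lemma powr_sub_one_tendsto:
  fixes y :: real assumes y: "y > 0"
  shows "(\<lambda>n. (y powr inverse (real (Suc n)) - 1) / inverse (real (Suc n))) \<longlonglongrightarrow> ln y"
proof -
  have "((\<lambda>s. y powr s) has_real_derivative (y powr 0 * ln y)) (at 0)"
    using y by (auto intro!: derivative_eq_intros simp: powr_def)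
  then have "((\<lambda>s. (y powr (0 + s) - y powr 0) / s) \<longlongrightarrow> ln y) (at 0)"
    using y by (simp add: DERIV_def)
  then have "((\<lambda>s. (y powr s - 1) / s) \<longlongrightarrow> ln y) (at 0)" using y by simp
  moreover have "filterlim (\<lambda>n. inverse (real (Suc n))) (at 0) sequentially"
    using LIMSEQ_inverse_real_of_nat by (auto simp: filterlim_at)
  ultimately show ?thesis by (rule filterlim_compose)
qed

text \<open>The difference quotients \<open>(f powr (2 s) - 1) / (2 s)\<close> tend to \<open>ln f\<close> as \<open>s\<close> tends to zero. If all of
  them had mean at least \<open>V\<close>, so would \<open>ln f\<close>, by the limit theorem for logarithms applied to their
  exponentials.\<close>
lemma (in prob_space) small_moment_lt:
  fixes f :: "'a \<Rightarrow> real"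
  assumes [measurable]: "f \<in> borel_measurable M" and nn: "\<And>x. f x \<ge> 0" and bd: "AE x in M. f x \<le> B"
    and no: "\<not> ((AE x in M. f x \<noteq> 0) \<and> integrable M (\<lambda>x. ln (f x)) \<and> V \<le> (\<integral>x. ln (f x) \<partial>M))"
  shows "\<exists>s. 0 < s \<and> s \<le> 1 \<and> integrable M (\<lambda>x. ((f x)\<^sup>2) powr s) \<and> (\<integral>x. ((f x)\<^sup>2) powr s \<partial>M) < 1 + 2 * s * V"
proof -
  have int: "integrable M (\<lambda>x. ((f x)\<^sup>2) powr s)" if "0 < s" for s
  proof (rule integrable_const_bound[where B="(B\<^sup>2) powr s"])
    show "AE x in M. norm (((f x)\<^sup>2) powr s) \<le> (B\<^sup>2) powr s"
      using bd by eventually_elim (use nn that in \<open>auto intro!: powr_mono2 power_mono\<close>)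
  qed measurable
  show ?thesis
  proof (rule ccontr)
    assume contr: "\<not> ?thesis"
    define s where "s n = inverse (real (Suc n))" for n
    have s: "0 < s n" "s n \<le> 1" for n by (auto simp: s_def field_simps)
    define h where "h n x = (((f x)\<^sup>2) powr s n - 1) / (2 * s n)" for n x
    have hint: "integrable M (h n)" for n unfolding h_def using int[OF s(1)] by simp
    have hlow: "V \<le> (\<integral>x. h n x \<partial>M)" for n
    proof -
      have "1 + 2 * s n * V \<le> (\<integral>x. ((f x)\<^sup>2) powr s n \<partial>M)" using contr s[of n] int[OF s(1), of n] by force
      moreover have "(\<integral>x. h n x \<partial>M) = ((\<integral>x. ((f x)\<^sup>2) powr s n \<partial>M) - 1) / (2 * s n)"
        unfolding h_def using int[OF s(1), of n] by (simp add: prob_space)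
      ultimately show ?thesis using s[of n] by (simp add: pos_le_divide_eq mult.commute)
    qed
    have hup: "h n x \<le> ((f x)\<^sup>2 - 1) / 2" for n x
      using powr_sub_one_le[of "(f x)\<^sup>2" "s n"] s[of n] by (simp add: h_def field_simps)
    have gint: "integrable M (\<lambda>x. ((f x)\<^sup>2 - 1) / 2)"
      using int[of 1] nn by simp
    have cmp: "f x \<le> 1 * exp (h n x)" for n x
    proof (cases "f x = 0")
      case False
      then have p: "f x > 0" using nn[of x] by simp
      have "2 * s n * ln (f x) = ln (((f x)\<^sup>2) powr s n)" using p by (simp add: ln_powr ln_realpow)
      also have "\<dots> \<le> ((f x)\<^sup>2) powr s n - 1" using p by (intro ln_le_minus_one) auto
      finally have "ln (f x) \<le> h n x" using s[of n] by (simp add: h_def pos_le_divide_eq mult.commute)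
      then have "exp (ln (f x)) \<le> exp (h n x)" by simp
      then show ?thesis using p by simp
    qed simp
    have lim: "(\<lambda>n. exp (h n x)) \<longlonglongrightarrow> f x" for x
    proof (cases "f x = 0")
      case True
      have "(\<lambda>n. exp (- (real (Suc n) / 2))) \<longlonglongrightarrow> 0" by real_asymp
      moreover have "exp (h n x) = exp (- (real (Suc n) / 2))" for n
        using True by (simp add: h_def s_def field_simps)
      ultimately show ?thesis using True by simp
    next
      case False
      then have p: "f x > 0" using nn[of x] by simp
      have "(\<lambda>n. (((f x)\<^sup>2) powr s n - 1) / s n / 2) \<longlonglongrightarrow> ln ((f x)\<^sup>2) / 2"
        unfolding s_def using p by (intro tendsto_divide powr_sub_one_tendsto tendsto_const) auto
      then have "(\<lambda>n. h n x) \<longlonglongrightarrow> ln (f x)" using p by (simp add: h_def ln_realpow mult.commute)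
      then have "(\<lambda>n. exp (h n x)) \<longlonglongrightarrow> exp (ln (f x))" by (rule tendsto_exp)
      then show ?thesis using p by simp
    qed
    have hm: "h n \<in> borel_measurable M" for n unfolding h_def by measurable
    have "AE x in M. f x \<noteq> 0" "integrable M (\<lambda>x. ln (f x))" "V \<le> (\<integral>x. ln (f x) \<partial>M)"
      by (rule log_integral_limit[of "\<lambda>n x. exp (h n x)" f 1 "\<lambda>x. ((f x)\<^sup>2 - 1) / 2" V];
          use hm nn lim cmp hup gint hint hlow in simp)+
    with no show False by blast
  qed
qed

text \<open>Real-valued version of the positive part of the logarithmic potential: it is zero also where the
  potential is \<open>- \<infinity>\<close>.\<close>
definition clipped_potential :: "complex measure \<Rightarrow> complex \<Rightarrow> real" where
  "clipped_potential \<nu> z = (if (AE x in \<nu>. cmod (x - z) \<noteq> 0) \<and> integrable \<nu> (\<lambda>x. ln (cmod (x - z)))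
     then max 0 (\<integral>x. ln (cmod (x - z)) \<partial>\<nu>) else 0)"

context isotropic_law
begin

lemma freezes_deterministic:
  assumes P: "prob_space P" and iid: "iid P ({..<N} \<times> {..<N}) G M" and N: "N > 0"
  shows "freezes N P (\<lambda>i _. d i) G"
  unfolding freezes_def
proof (intro conjI allI impI)
  interpret P: prob_space P by fact
  have G: "G e \<in> borel_measurable P" if "e \<in> {..<N} \<times> {..<N}" for e
    using iid that by (auto simp: iid_def P.indep_vars_def)
  show "prob_space P" by fact
  show "G (i, j) \<in> borel_measurable P" if "i < N" "j < N" for i j using G that by auto
  fix \<delta> z and h :: "complex \<Rightarrow> ennreal" assume [measurable]: "h \<in> borel_measurable borel"
  have D: "distr P (PiM ({..<N} \<times> {..<N}) (\<lambda>_. borel)) (\<lambda>\<omega>. \<lambda>e\<in>{..<N} \<times> {..<N}. G e \<omega>) = noise_matrix N"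
    by (rule iid_distr_PiM) (use P iid N in auto)
  have m: "noisy_det N a \<delta> \<in> borel_measurable (PiM ({..<N} \<times> {..<N}) (\<lambda>_. borel))" for a
    using measurable_noisy_det_noise[of N a \<delta>] by (simp cong: measurable_cong_sets sets_PiM_cong)
  have "(\<integral>\<^sup>+g. h (noisy_det N (\<lambda>i. d i - z) \<delta> g) \<partial>noise_matrix N)
     = (\<integral>\<^sup>+\<omega>. h (noisy_det N (\<lambda>i. d i - z) \<delta> (\<lambda>e\<in>{..<N} \<times> {..<N}. G e \<omega>)) \<partial>P)"
    unfolding D[symmetric]
    by (rule nn_integral_distr) (auto intro!: measurable_restrict G measurable_compose[OF m])
  also have "\<dots> = (\<integral>\<^sup>+\<omega>. h (noisy_det N (\<lambda>i. d i - z) \<delta> (\<lambda>e. G e \<omega>)) \<partial>P)"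
    by (intro nn_integral_cong arg_cong[where f=h] noisy_det_cong) auto
  finally show "(\<integral>\<^sup>+\<omega>. h (noisy_det N (\<lambda>i. d i - z) \<delta> (\<lambda>e. G e \<omega>)) \<partial>P)
      = (\<integral>\<^sup>+\<omega>. (\<integral>\<^sup>+g. h (noisy_det N (\<lambda>i. d i - z) \<delta> g) \<partial>noise_matrix N) \<partial>P)"
    by (simp add: P.emeasure_space_1)
qed simp

lemma freezes_independent:
  assumes P: "prob_space P" and iid: "iid P ({..<N} \<times> {..<N}) G M" and N: "N > 0"
    and D: "\<And>i. i < N \<Longrightarrow> D i \<in> borel_measurable P" and ind: "indep_families P {..<N} D ({..<N} \<times> {..<N}) G"
  shows "freezes N P D G"
  unfolding freezes_def
proof (intro conjI allI impI)
  interpret P: prob_space P by fact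
  have G: "G e \<in> borel_measurable P" if "e \<in> {..<N} \<times> {..<N}" for e
    using iid that by (auto simp: iid_def P.indep_vars_def)
  show "prob_space P" by fact
  show "G (i, j) \<in> borel_measurable P" if "i < N" "j < N" for i j using G that by auto
  show "D i \<in> borel_measurable P" if "i < N" for i by (rule D) fact
  fix \<delta> z and h :: "complex \<Rightarrow> ennreal" assume [measurable]: "h \<in> borel_measurable borel"
  let ?I = "{..<N} \<times> {..<N}" and ?B = "PiM ({..<N} \<times> {..<N}) (\<lambda>_. borel :: complex measure)" and ?A = "PiM {..<N} (\<lambda>_. borel :: complex measure)"
  let ?F = "\<lambda>p. h (noisy_det N (\<lambda>i. fst p i - z) \<delta> (snd p))"
  have dist: "distr P ?B (\<lambda>\<omega>. \<lambda>e\<in>?I. G e \<omega>) = noise_matrix N"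
    by (rule iid_distr_PiM) (use P iid N in auto)
  have "(\<lambda>p. noisy_det N (\<lambda>i. fst p i - z) \<delta> (snd p)) \<in> borel_measurable (?A \<Otimes>\<^sub>M ?B)"
  proof (rule measurable_noisy_det[where a="\<lambda>p i. fst p i - z" and g="\<lambda>p. snd p"])
    show "(\<lambda>p. fst p i - z) \<in> borel_measurable (?A \<Otimes>\<^sub>M ?B)" if "i < N" for i
      by (intro borel_measurable_diff borel_measurable_const measurable_compose[OF measurable_fst measurable_component_singleton]) (use that in auto)
    show "(\<lambda>p. snd p (i, j)) \<in> borel_measurable (?A \<Otimes>\<^sub>M ?B)" if "i < N" "j < N" for i j
      by (intro measurable_compose[OF measurable_snd measurable_component_singleton]) (use that in auto)
  qed
  then have F: "?F \<in> borel_measurable (?A \<Otimes>\<^sub>M ?B)" by measurable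
  have "(\<integral>\<^sup>+\<omega>. h (noisy_det N (\<lambda>i. D i \<omega> - z) \<delta> (\<lambda>e. G e \<omega>)) \<partial>P) = (\<integral>\<^sup>+\<omega>. ?F (\<lambda>i\<in>{..<N}. D i \<omega>, \<lambda>e\<in>?I. G e \<omega>) \<partial>P)"
    by (intro nn_integral_cong arg_cong[where f=h]) (auto intro!: noisy_det_cong)
  also have "\<dots> = (\<integral>\<^sup>+\<omega>. (\<integral>\<^sup>+y. ?F (\<lambda>i\<in>{..<N}. D i \<omega>, y) \<partial>distr P ?B (\<lambda>\<omega>. \<lambda>e\<in>?I. G e \<omega>)) \<partial>P)"
    by (rule nn_integral_freeze[OF P ind _ _ F]) (use D G in auto)
  also have "\<dots> = (\<integral>\<^sup>+\<omega>. (\<integral>\<^sup>+g. h (noisy_det N (\<lambda>i. D i \<omega> - z) \<delta> g) \<partial>noise_matrix N) \<partial>P)"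
    unfolding dist by (intro nn_integral_cong arg_cong[where f=h]) (auto intro!: noisy_det_cong)
  finally show "(\<integral>\<^sup>+\<omega>. h (noisy_det N (\<lambda>i. D i \<omega> - z) \<delta> (\<lambda>e. G e \<omega>)) \<partial>P)
      = (\<integral>\<^sup>+\<omega>. (\<integral>\<^sup>+g. h (noisy_det N (\<lambda>i. D i \<omega> - z) \<delta> g) \<partial>noise_matrix N) \<partial>P)" .
qed

end

section \<open>Independent diagonal entries\<close>

lemma word_weight_mono:
  assumes "\<eta> \<ge> 0" "\<And>i. 0 \<le> x i" "\<And>i. i < length w \<Longrightarrow> x i \<le> y i"
  shows "word_weight \<eta> x w \<le> word_weight \<eta> y w"
  using assms(3)
proof (induction w)
  case (Cons l w)
  then have "word_weight \<eta> x w \<le> word_weight \<eta> y w" "x (length w) \<le> y (length w)" by auto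
  moreover have "0 \<le> y (length w)" using assms(2)[of "length w"] \<open>x (length w) \<le> y (length w)\<close> by linarith
  ultimately show ?case using assms
    by (cases l) (auto intro!: mult_mono word_weight_nonneg)
qed simp

lemma clipped_potential_bounds:
  assumes "prob_space \<nu>" "sets \<nu> = sets borel" "AE x in \<nu>. cmod x \<le> B" "B \<ge> 0"
  shows "0 \<le> clipped_potential \<nu> z" "clipped_potential \<nu> z \<le> B + cmod z"
proof -
  interpret prob_space \<nu> by fact
  show "0 \<le> clipped_potential \<nu> z" by (simp add: clipped_potential_def)
  have "(\<integral>x. ln (cmod (x - z)) \<partial>\<nu>) \<le> B + cmod z" if I: "integrable \<nu> (\<lambda>x. ln (cmod (x - z)))"
  proof -
    have "(\<integral>x. ln (cmod (x - z)) \<partial>\<nu>) \<le> (\<integral>x. B + cmod z \<partial>\<nu>)"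
    proof (rule integral_mono_AE[OF I])
      show "AE x in \<nu>. ln (cmod (x - z)) \<le> B + cmod z"
        using assms(3)
      proof eventually_elim
        fix x assume "cmod x \<le> B"
        then have "cmod (x - z) \<le> B + cmod z" using norm_triangle_ineq4[of x z] by linarith
        moreover have "ln (cmod (x - z)) \<le> cmod (x - z)"
          using ln_bound[of "cmod (x - z)"] by (cases "x = z") auto
        ultimately show "ln (cmod (x - z)) \<le> B + cmod z" by linarith
      qed
    qed simp
    then show ?thesis by (simp add: prob_space)
  qed
  then show "clipped_potential \<nu> z \<le> B + cmod z" using assms(4) by (simp add: clipped_potential_def)
qed

lemma error_term_tendsto: "(\<lambda>N. a / real N + (b * ln (real N) + c) / real N) \<longlonglongrightarrow> (0 :: real)"
proof -
  have "(\<lambda>N. a * (1 / real N) + (b * (ln (real N) / real N) + c * (1 / real N))) \<longlonglongrightarrow> a * 0 + (b * 0 + c * 0)"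
    by (intro tendsto_intros lim_1_over_n filterlim_compose[OF ln_x_over_x_tendsto_0 filterlim_real_sequentially])
  then show ?thesis by (simp add: add_divide_distrib)
qed

lemma iid_words_bound:
  assumes P: "prob_space P" and iid: "iid P {..<N} D \<nu>" and sets: "sets \<nu> = sets borel"
    and f: "f \<in> borel_measurable borel" "\<And>x. f x \<ge> 0" and \<rho>: "\<rho> \<ge> 0" "(\<integral>\<^sup>+x. ennreal (f x) \<partial>\<nu>) \<le> ennreal \<rho>" and \<eta>: "\<eta> \<ge> 0"
  shows "(\<integral>\<^sup>+\<omega>. ennreal (\<Sum>w\<in>words N. word_weight \<eta> (\<lambda>i. f (D i \<omega>)) w) \<partial>P) \<le> ennreal (\<Sum>w\<in>words N. word_weight \<eta> (\<lambda>_. \<rho>) w)"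
proof -
  interpret P: prob_space P by fact
  have ind: "P.indep_vars (\<lambda>_. borel) D {..<N}" and dist: "\<And>i. i < N \<Longrightarrow> distr P borel (D i) = \<nu>"
    using iid by (auto simp: iid_def)
  have D: "i < N \<Longrightarrow> D i \<in> borel_measurable P" for i using ind by (auto simp: P.indep_vars_def)
  show ?thesis
  proof (rule P.expectation_word_weights[OF ind f \<eta> \<rho>(1)])
    fix i assume i: "i < N"
    have "(\<integral>\<^sup>+\<omega>. ennreal (f (D i \<omega>)) \<partial>P) = (\<integral>\<^sup>+x. ennreal (f x) \<partial>distr P borel (D i))"
      using f(1) by (subst nn_integral_distr[OF D[OF i]]) auto
    then show "(\<integral>\<^sup>+\<omega>. ennreal (f (D i \<omega>)) \<partial>P) \<le> ennreal \<rho>" using \<rho>(2) dist[OF i] by simp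
  qed
qed

context isotropic_law
begin

text \<open>For a suitable \<open>s\<close> the moment \<open>\<rho>\<close> of order \<open>2 s\<close> of \<open>\<bar>d - z\<bar>\<close> is at most \<open>1 + 2 s (U + e / 2)\<close>, so the sum over words is at
  most a constant times \<open>exp (2 s N (U + e))\<close>. For the lower bound, use the full diagonal if \<open>U > 0\<close>, where
  the mean of its logarithm is \<open>N U\<close>, and the superdiagonal if \<open>U = 0\<close>.\<close>
lemma iid_log_det_tendsto:
  fixes P :: "nat \<Rightarrow> 'w measure"
  assumes \<gamma>: "\<gamma> > 1/2" and \<nu>: "prob_space \<nu>" "sets \<nu> = sets borel" "AE x in \<nu>. cmod x \<le> B" "B \<ge> 0"
    and fr: "\<And>N. N > 0 \<Longrightarrow> freezes N (P N) (D N) (G N)" and iid: "\<And>N. iid (P N) {..<N} (D N) \<nu>"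
  shows "(\<lambda>N. \<integral>\<omega>. \<bar>normalized_log_det \<gamma> N (\<lambda>i. D N i \<omega>) (\<lambda>e. G N e \<omega>) z - clipped_potential \<nu> z\<bar> \<partial>P N) \<longlonglongrightarrow> 0"
proof -
  interpret \<nu>: prob_space \<nu> by fact
  note [measurable_cong] = \<nu>(2)
  let ?E = "\<lambda>N. \<integral>\<omega>. \<bar>normalized_log_det \<gamma> N (\<lambda>i. D N i \<omega>) (\<lambda>e. G N e \<omega>) z - clipped_potential \<nu> z\<bar> \<partial>P N"
  define U where "U = clipped_potential \<nu> z"
  have U0: "U \<ge> 0" unfolding U_def by (rule clipped_potential_bounds[OF \<nu>])
  have main: "\<forall>\<^sub>F N in sequentially. ?E N < 3 * e" if e: "e > 0" for e
  proof -
    have no: "\<not> ((AE x in \<nu>. cmod (x - z) \<noteq> 0) \<and> integrable \<nu> (\<lambda>x. ln (cmod (x - z))) \<and> U + e / 2 \<le> (\<integral>x. ln (cmod (x - z)) \<partial>\<nu>))"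
    proof
      assume A: "(AE x in \<nu>. cmod (x - z) \<noteq> 0) \<and> integrable \<nu> (\<lambda>x. ln (cmod (x - z))) \<and> U + e / 2 \<le> (\<integral>x. ln (cmod (x - z)) \<partial>\<nu>)"
      then have "U = max 0 (\<integral>x. ln (cmod (x - z)) \<partial>\<nu>)" unfolding U_def clipped_potential_def by (subst if_P) auto
      with A e show False by linarith
    qed
    have bd: "AE x in \<nu>. cmod (x - z) \<le> B + cmod z"
      using \<nu>(3) by eventually_elim (metis add_right_mono norm_triangle_ineq4 order_trans)
    have fm: "(\<lambda>x. cmod (x - z)) \<in> borel_measurable \<nu>" by measurable
    from \<nu>.small_moment_lt[OF fm norm_ge_zero bd no]
    obtain s where s: "0 < s" "s \<le> 1" and int: "integrable \<nu> (\<lambda>x. ((cmod (x - z))\<^sup>2) powr s)"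
      and lt: "(\<integral>x. ((cmod (x - z))\<^sup>2) powr s \<partial>\<nu>) < 1 + 2 * s * (U + e / 2)" by blast
    define \<rho> where "\<rho> = (\<integral>x. ((cmod (x - z))\<^sup>2) powr s \<partial>\<nu>)"
    have \<rho>0: "\<rho> \<ge> 0" unfolding \<rho>_def by (intro integral_nonneg_AE) auto
    have \<rho>eq: "(\<integral>\<^sup>+x. ennreal (((cmod (x - z))\<^sup>2) powr s) \<partial>\<nu>) \<le> ennreal \<rho>"
      unfolding \<rho>_def using int by (subst nn_integral_eq_integral) auto
    \<comment> \<open>The choices give \<open>max 1 \<rho> + \<epsilon> \<le> exp (2 s \<beta>)\<close>; half of the margin \<open>e\<close> is used for \<open>\<rho>\<close> and half for \<open>\<epsilon>\<close>.\<close>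
    define \<epsilon> where "\<epsilon> = s * e"
    define \<beta> where "\<beta> = U + e"
    define \<kappa> where "\<kappa> = min 1 (\<epsilon> / 2)"
    have \<epsilon>0: "\<epsilon> > 0" and \<kappa>: "0 < \<kappa>" "\<kappa> \<le> 1" "\<kappa> \<le> \<epsilon> / 2" using s e by (auto simp: \<epsilon>_def \<kappa>_def)
    have "max 1 \<rho> \<le> 1 + 2 * s * (U + e / 2)" using lt U0 e s by (simp add: \<rho>_def)
    then have "max 1 \<rho> + \<epsilon> \<le> 1 + 2 * s * \<beta>" by (simp add: \<epsilon>_def \<beta>_def algebra_simps)
    also have "\<dots> \<le> exp (2 * s * \<beta>)" by (rule exp_ge_add_one_self)
    finally have base: "max 1 \<rho> + \<epsilon> \<le> exp (2 * s * \<beta>)" .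
    have "(\<lambda>N. noise_level \<gamma> N powr s) \<longlonglongrightarrow> 0"
      by (rule tendsto_zero_powrI[OF noise_level_tendsto[OF \<gamma>] tendsto_const]) (use s noise_level_nonneg in auto)
    then have "\<forall>\<^sub>F N in sequentially. noise_level \<gamma> N powr s < min (\<epsilon> / 2) (\<epsilon> * \<kappa>)"
      by (rule order_tendstoD) (use \<epsilon>0 \<kappa> in auto)
    moreover have "\<forall>\<^sub>F N in sequentially. 1 / (\<kappa> * s) / real N + (2 * \<gamma> * ln (real N) + C) / real N < e"
      by (rule order_tendstoD[OF error_term_tendsto]) (use e in auto)
    ultimately show ?thesis
      using eventually_gt_at_top[of 0]
    proof eventually_elim
      fix N :: nat
      assume \<eta>: "noise_level \<gamma> N powr s < min (\<epsilon> / 2) (\<epsilon> * \<kappa>)" and err: "1 / (\<kappa> * s) / real N + (2 * \<gamma> * ln (real N) + C) / real N < e" and N: "0 < N"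
      interpret P: prob_space "P N" using fr[OF N] by (simp add: freezes_def)
      define K where "K = (max 1 \<rho> + \<epsilon>) ^ N / \<kappa>"
      have K0: "K \<ge> 0" using \<epsilon>0 \<kappa> by (simp add: K_def)
      have lnN: "0 \<le> ln (real N)" using N by simp
      have "(\<Sum>w\<in>words N. word_weight (noise_level \<gamma> N powr s) (\<lambda>_. \<rho>) w) \<le> K"
        using sum_word_weight_le[of \<kappa> "noise_level \<gamma> N powr s" \<epsilon> "\<lambda>_. \<rho>" N] \<eta> \<kappa> \<rho>0 by (simp add: K_def)
      then have "ennreal (\<Sum>w\<in>words N. word_weight (noise_level \<gamma> N powr s) (\<lambda>_. \<rho>) w) \<le> ennreal K" by (rule ennreal_leI)
      moreover have "(\<integral>\<^sup>+\<omega>. ennreal (\<Sum>w\<in>words N. word_weight (noise_level \<gamma> N powr s) (\<lambda>i. ((cmod (D N i \<omega> - z))\<^sup>2) powr s) w) \<partial>P N)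
        \<le> ennreal (\<Sum>w\<in>words N. word_weight (noise_level \<gamma> N powr s) (\<lambda>_. \<rho>) w)"
        by (rule iid_words_bound[OF P.prob_space_axioms iid \<nu>(2) _ _ \<rho>0 \<rho>eq]) auto
      ultimately have up: "(\<integral>\<^sup>+\<omega>. ennreal (\<Sum>w\<in>words N. word_weight ((real N * (c * (real N powr - \<gamma>)\<^sup>2)) powr s) (\<lambda>i. ((cmod (D N i \<omega> - z))\<^sup>2) powr s) w) \<partial>P N) \<le> ennreal K"
        unfolding noise_level_def by (rule order_trans[rotated])
      have Kexp: "K * exp (- 2 * s * N * \<beta>) \<le> 1 / \<kappa>"
      proof -
        have "(max 1 \<rho> + \<epsilon>) ^ N \<le> exp (2 * s * \<beta>) ^ N" using base \<epsilon>0 by (intro power_mono) auto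
        also have "\<dots> = exp (N * (2 * s * \<beta>))" by (rule exp_of_nat_mult[symmetric])
        finally have "(max 1 \<rho> + \<epsilon>) ^ N * exp (- 2 * s * N * \<beta>) \<le> exp (N * (2 * s * \<beta>)) * exp (- 2 * s * N * \<beta>)"
          by (intro mult_right_mono) auto
        also have "\<dots> = 1" by (simp add: exp_add[symmetric])
        finally show ?thesis using \<kappa> by (simp add: K_def divide_right_mono)
      qed
      then have Kerr: "K * exp (- 2 * s * N * \<beta>) / (s * N) \<le> 1 / (\<kappa> * s) / real N"
        using divide_right_mono[OF Kexp, of "s * N"] s N by (simp add: field_simps)
      note bound = freezes_L1_bound(2)[OF fr[OF N] N s K0 up, where U=U and \<beta>=\<beta>]
      have "?E N \<le> 2 * e + (1 / (\<kappa> * s) / real N + (2 * \<gamma> * ln (real N) + C) / real N)"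
      proof (cases "U > 0")
        case True
        have L: "AE x in \<nu>. cmod (x - z) \<noteq> 0" "integrable \<nu> (\<lambda>x. ln (cmod (x - z)))" "U = (\<integral>x. ln (cmod (x - z)) \<partial>\<nu>)"
          using True unfolding U_def clipped_potential_def by (auto split: if_splits)
        have ind: "P.indep_vars (\<lambda>_. borel) (D N) {..<N}" and dist: "\<And>i. i < N \<Longrightarrow> distr (P N) borel (D N i) = \<nu>"
          using iid[of N] by (auto simp: iid_def)
        have Dm: "i < N \<Longrightarrow> D N i \<in> borel_measurable (P N)" for i using ind by (auto simp: P.indep_vars_def)
        have lm: "(\<lambda>x. ln (cmod (x - z))) \<in> borel_measurable borel" by measurable
        have Dint: "integrable (P N) (\<lambda>\<omega>. ln (cmod (D N i \<omega> - z)))" and Dval: "(\<integral>\<omega>. ln (cmod (D N i \<omega> - z)) \<partial>P N) = U" if "i < N" for i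
        proof -
          show "integrable (P N) (\<lambda>\<omega>. ln (cmod (D N i \<omega> - z)))"
            using L(2) unfolding dist[OF that, symmetric] by (subst (asm) integrable_distr_eq[OF Dm[OF that] lm])
          show "(\<integral>\<omega>. ln (cmod (D N i \<omega> - z)) \<partial>P N) = U"
            unfolding L(3) dist[OF that, symmetric] by (rule integral_distr[OF Dm[OF that] lm, symmetric])
        qed
        have Dnz: "AE \<omega> in P N. \<forall>i\<in>{..<N}. D N i \<omega> - z \<noteq> 0"
        proof (rule AE_finite_allI)
          fix i assume "i \<in> {..<N}"
          then have i: "i < N" by simp
          have "AE x in distr (P N) borel (D N i). x - z \<noteq> 0" using L(1) unfolding dist[OF i] by simp
          then show "AE \<omega> in P N. D N i \<omega> - z \<noteq> 0"
            by (subst (asm) AE_distr_iff[OF Dm[OF i]]) auto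
        qed simp
        let ?p = "({} :: nat set, id :: nat \<Rightarrow> nat)" and ?q = "\<lambda>\<omega>. \<Sum>i<N. ln (cmod (D N i \<omega> - z))"
        have p: "?p \<in> near_id_pairs N" "card (fst ?p) \<le> 0" by (auto simp: near_id_pairs_def permutes_id)
        have pc: "pair_coeff N a \<delta> ?p = (\<Prod>i<N. a i)" for a \<delta> by (simp add: pair_coeff_def bidiag_def)
        have qint: "integrable (P N) ?q" by (intro Bochner_Integration.integrable_sum Dint) simp
        have qval: "(\<integral>\<omega>. ?q \<omega> \<partial>P N) = N * U"
          by (subst Bochner_Integration.integral_sum) (auto intro: Dint simp: Dval)
        have AEq: "AE \<omega> in P N. pair_coeff N (\<lambda>i. D N i \<omega> - z) (real N powr - \<gamma>) ?p \<noteq> 0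
            \<and> ?q \<omega> \<le> ln (cmod (pair_coeff N (\<lambda>i. D N i \<omega> - z) (real N powr - \<gamma>) ?p))"
          using Dnz
        proof eventually_elim
          fix \<omega> assume A: "\<forall>i\<in>{..<N}. D N i \<omega> - z \<noteq> 0"
          have "ln (cmod (\<Prod>i<N. D N i \<omega> - z)) = ?q \<omega>"
            unfolding prod_norm[symmetric] using A by (intro ln_prod) auto
          then show "pair_coeff N (\<lambda>i. D N i \<omega> - z) (real N powr - \<gamma>) ?p \<noteq> 0
            \<and> ?q \<omega> \<le> ln (cmod (pair_coeff N (\<lambda>i. D N i \<omega> - z) (real N powr - \<gamma>) ?p))"
            unfolding pc using A by simp
        qed
        have "?E N \<le> \<bar>\<beta> - U\<bar> + K * exp (- 2 * s * N * \<beta>) / (s * N) + (\<beta> - ((\<integral>\<omega>. ?q \<omega> \<partial>P N) - C * real 0 / 2) / N)"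
          unfolding U_def[symmetric] by (rule bound[OF p AEq qint])
        also have "(\<beta> - ((\<integral>\<omega>. ?q \<omega> \<partial>P N) - C * real 0 / 2) / N) = e" using N by (simp add: qval \<beta>_def)
        finally have "?E N \<le> 2 * e + 1 / (\<kappa> * s) / real N" using Kerr e by (simp add: \<beta>_def)
        moreover have "0 \<le> (2 * \<gamma> * ln (real N) + C) / real N" using \<gamma> lnN C_nonneg by simp
        ultimately show ?thesis by linarith
      next
        case False
        then have "U = 0" using U0 by simp
        obtain p where p: "p \<in> near_id_pairs N" "card (fst p) \<le> 2"
          "\<And>a. - 2 * \<bar>\<gamma>\<bar> * ln N \<le> ln (cmod (pair_coeff N a (real N powr - \<gamma>) p)) \<and> pair_coeff N a (real N powr - \<gamma>) p \<noteq> 0"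
          using corner_pair[OF N, of \<gamma>] by blast
        have "?E N \<le> \<bar>\<beta> - U\<bar> + K * exp (- 2 * s * N * \<beta>) / (s * N) + (\<beta> - ((\<integral>\<omega>. - 2 * \<bar>\<gamma>\<bar> * ln N \<partial>P N) - C * real 2 / 2) / N)"
          unfolding U_def[symmetric] by (rule bound[OF p(1,2)]) (use p(3) in auto)
        also have "(\<beta> - ((\<integral>\<omega>. - 2 * \<bar>\<gamma>\<bar> * ln N \<partial>P N) - C * real 2 / 2) / N) = e + (2 * \<gamma> * ln N + C) / N"
          using \<gamma> \<open>U = 0\<close> by (simp add: P.prob_space \<beta>_def diff_divide_distrib add_divide_distrib)
        finally show ?thesis using Kerr e by (simp add: \<beta>_def)
      qed
      then show "?E N < 3 * e" using err by linarith
    qed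
  qed
  show ?thesis
  proof (rule LIMSEQ_I)
    fix r :: real assume "r > 0"
    then have "\<forall>\<^sub>F N in sequentially. ?E N < 3 * (r / 3)" by (intro main) simp
    then obtain N0 where "\<And>N. N \<ge> N0 \<Longrightarrow> ?E N < r" by (auto simp: eventually_sequentially)
    moreover have "0 \<le> ?E N" for N by (intro integral_nonneg_AE) auto
    ultimately show "\<exists>N0. \<forall>N\<ge>N0. norm (?E N - 0) < r" by (intro exI[of _ N0]) auto
  qed
qed

lemma iid_log_det_bounded:
  assumes \<gamma>: "\<gamma> > 1/2" and \<nu>: "prob_space \<nu>" "sets \<nu> = sets borel" "AE x in \<nu>. cmod x \<le> B" "B \<ge> 0"
    and fr: "freezes N P D G" and iid: "iid P {..<N} D \<nu>" and N: "N > 0" and z: "cmod z \<le> r"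
  shows "integrable P (\<lambda>\<omega>. normalized_log_det \<gamma> N (\<lambda>i. D i \<omega>) (\<lambda>e. G e \<omega>) z)"
    "(\<integral>\<omega>. \<bar>normalized_log_det \<gamma> N (\<lambda>i. D i \<omega>) (\<lambda>e. G e \<omega>) z - clipped_potential \<nu> z\<bar> \<partial>P)
      \<le> (B + r) + ln ((B + r)\<^sup>2 + 1 + c + 1) + 1 + 2 * \<gamma> + C"
proof -
  interpret \<nu>: prob_space \<nu> by fact
  have P: "prob_space P" using fr by (simp add: freezes_def)
  let ?R = "(B + r)\<^sup>2 + 1"
  have "(\<integral>\<^sup>+x. ennreal ((cmod (x - z))\<^sup>2) \<partial>\<nu>) \<le> (\<integral>\<^sup>+x. ennreal ?R \<partial>\<nu>)"
  proof (rule nn_integral_mono_AE, use \<nu>(3) in eventually_elim)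
    fix x assume "cmod x \<le> B"
    then have "cmod (x - z) \<le> B + r" using norm_triangle_ineq4[of x z] z by linarith
    then have "(cmod (x - z))\<^sup>2 \<le> (B + r)\<^sup>2" by (intro power_mono) auto
    then show "ennreal ((cmod (x - z))\<^sup>2) \<le> ennreal ?R" by (intro ennreal_leI) simp
  qed
  then have le: "(\<integral>\<^sup>+x. ennreal ((cmod (x - z))\<^sup>2) \<partial>\<nu>) \<le> ennreal ?R" by (simp add: \<nu>.emeasure_space_1)
  have up: "(\<integral>\<^sup>+\<omega>. ennreal (\<Sum>w\<in>words N. word_weight (noise_level \<gamma> N) (\<lambda>i. (cmod (D i \<omega> - z))\<^sup>2) w) \<partial>P)
      \<le> ennreal (\<Sum>w\<in>words N. word_weight (noise_level \<gamma> N) (\<lambda>_. ?R) w)"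
    by (rule iid_words_bound[OF P iid \<nu>(2) _ _ _ le noise_level_nonneg]) auto
  show "integrable P (\<lambda>\<omega>. normalized_log_det \<gamma> N (\<lambda>i. D i \<omega>) (\<lambda>e. G e \<omega>) z)"
    by (rule uniform_L1_bound(1)[OF \<gamma> fr N _ up]) simp
  have "\<bar>clipped_potential \<nu> z\<bar> \<le> B + r" using clipped_potential_bounds[OF \<nu>, of z] z by simp
  with uniform_L1_bound(2)[OF \<gamma> fr N _ up, of "clipped_potential \<nu> z"]
  show "(\<integral>\<omega>. \<bar>normalized_log_det \<gamma> N (\<lambda>i. D i \<omega>) (\<lambda>e. G e \<omega>) z - clipped_potential \<nu> z\<bar> \<partial>P)
      \<le> (B + r) + ln (?R + c + 1) + 1 + 2 * \<gamma> + C" by simp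
qed

end

section \<open>Diagonal entries along a path\<close>

lemma continuous_on_imp_riemann_sums:
  fixes g :: "real \<Rightarrow> real"
  assumes cont: "continuous_on {0..1} g"
  shows "(\<lambda>N. (\<Sum>i<N. g (real (i + 1) / real N)) / real N) \<longlonglongrightarrow> integral {0..1} g"
proof (rule LIMSEQ_I)
  fix e :: real assume e: "e > 0"
  have "uniformly_continuous_on {0..1} g" using cont by (rule compact_uniformly_continuous) simp
  then obtain d where d: "d > 0" "\<And>s t. s \<in> {0..1} \<Longrightarrow> t \<in> {0..1} \<Longrightarrow> dist s t < d \<Longrightarrow> dist (g s) (g t) < e / 2"
    using e unfolding uniformly_continuous_on_def by (metis half_gt_zero)
  obtain N0 :: nat where N0: "real N0 > 1 / d" using reals_Archimedean2 by blast
  have "norm ((\<Sum>i<N. g (real (i + 1) / real N)) / real N - integral {0..1} g) < e" if N: "N \<ge> Suc N0" for N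
  proof -
    have Npos: "real N > 0" using N by simp
    have Nd: "1 / real N < d"
    proof -
      have "1 / d < real N" using N0 N by simp
      then show ?thesis using d(1) Npos by (simp add: field_simps)
    qed
    have le1: "real k / real N \<le> 1" if "k \<le> N" for k using that Npos by simp
    have int: "g integrable_on {a..b}" if "0 \<le> a" "b \<le> 1" for a b
      by (rule integrable_continuous_real) (rule continuous_on_subset[OF cont], use that in auto)
    have "\<bar>(\<Sum>i<k. g (real (i + 1) / real N)) / real N - integral {0..real k / real N} g\<bar> \<le> real k * (e / 2 / real N)" if "k \<le> N" for k
      using that
    proof (induction k)
      case 0 then show ?case by simp
    next
      case (Suc k)
      let ?a = "real k / real N" and ?b = "real (Suc k) / real N"
      have ab: "0 \<le> ?a" "?a \<le> ?b" "?b \<le> 1" using le1[OF Suc.prems] Npos by (auto simp: divide_right_mono)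
      have len: "?b - ?a = 1 / real N" by (simp add: diff_divide_distrib[symmetric])
      have split: "integral {0..?b} g = integral {0..?a} g + integral {?a..?b} g"
        using ab by (intro Henstock_Kurzweil_Integration.integral_combine[symmetric] int) auto
      have "norm (integral {?a..?b} (\<lambda>t. g ?b - g t)) \<le> e / 2 * (?b - ?a)"
      proof (rule integral_bound)
        show "continuous_on {?a..?b} (\<lambda>t. g ?b - g t)"
          by (intro continuous_intros continuous_on_subset[OF cont]) (use ab in auto)
        fix t assume t: "t \<in> {?a..?b}"
        have "dist ?b t < d" using t len Nd by (auto simp: dist_real_def)
        moreover have "0 \<le> t" "t \<le> 1" using t ab by (simp_all only: atLeastAtMost_iff) linarith+
        moreover have "?b \<in> {0..1}" using order_trans[OF ab(1,2)] ab(3) by simp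
        ultimately have "dist (g ?b) (g t) < e / 2" using d(2)[of ?b t] by (simp only: atLeastAtMost_iff)
        then show "norm (g ?b - g t) \<le> e / 2" by (simp add: dist_real_def)
      qed (use ab in auto)
      moreover have "integral {?a..?b} (\<lambda>t. g ?b - g t) = g ?b / real N - integral {?a..?b} g"
        using ab int[of ?a ?b] len by (subst Henstock_Kurzweil_Integration.integral_diff) auto
      ultimately have "\<bar>g ?b / real N - integral {?a..?b} g\<bar> \<le> e / 2 / real N" using len by simp
      with Suc.IH Suc.prems split show ?case
        by (simp add: add_divide_distrib distrib_right)
    qed
    from this[of N] have "\<bar>(\<Sum>i<N. g (real (i + 1) / real N)) / real N - integral {0..1} g\<bar> \<le> e / 2"
      using Npos by simp
    then show ?thesis using e by simp
  qed
  then show "\<exists>N0. \<forall>N\<ge>N0. norm ((\<Sum>i<N. g (real (i + 1) / real N)) / real N - integral {0..1} g) < e" by blast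
qed

definition path_potential :: "(real \<Rightarrow> complex) \<Rightarrow> complex \<Rightarrow> real" where
  "path_potential f z = integral {0..1} (\<lambda>t. ln (max 1 (cmod (f t - z))))"

lemma ln_max_1_bounds: "0 \<le> ln (max 1 (x::real))" "x \<ge> 0 \<Longrightarrow> ln (max 1 x) \<le> x"
proof -
  show "0 \<le> ln (max 1 x)" by simp
  assume "x \<ge> 0"
  then show "ln (max 1 x) \<le> x" using ln_le_minus_one[of "max 1 x"] by (auto simp: max_def split: if_splits)
qed

lemma path_potential_bounds:
  assumes "continuous_on {0..1} f" "\<And>t. t \<in> {0..1} \<Longrightarrow> cmod (f t) \<le> B"
  shows "0 \<le> path_potential f z" "path_potential f z \<le> B + cmod z"
proof -
  have c: "continuous_on {0..1} (\<lambda>t. ln (max 1 (cmod (f t - z))))"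
    by (intro continuous_intros assms) (auto simp: max_def)
  show "0 \<le> path_potential f z" unfolding path_potential_def
    by (intro Henstock_Kurzweil_Integration.integral_nonneg integrable_continuous_real c) (simp add: ln_max_1_bounds)
  have "path_potential f z \<le> integral {0..1} (\<lambda>t::real. B + cmod z)"
    unfolding path_potential_def
  proof (intro integral_le integrable_continuous_real c)
    fix t :: real assume "t \<in> {0..1}"
    then have "cmod (f t - z) \<le> B + cmod z" using norm_triangle_ineq4[of "f t" z] assms(2)[of t] by linarith
    then show "ln (max 1 (cmod (f t - z))) \<le> B + cmod z" using ln_max_1_bounds(2)[of "cmod (f t - z)"] by simp
  qed auto
  then show "path_potential f z \<le> B + cmod z" by simp
qed

context isotropic_law
begin

text \<open>Write \<open>a i\<close> for the diagonal entry of row \<open>i\<close> minus \<open>z\<close>. The second moment is at most a constant times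
  the product of the \<open>max 1 \<bar>a i\<bar>\<^sup>2 + e\<close>, whose normalized
  logarithm is a Riemann sum. For the lower bound take blocks of length about \<open>d N\<close>, where \<open>d\<close> is a modulus of
  continuity for \<open>e\<close>, and follow the superdiagonal on the blocks \<open>V\<close> that contain a row with
  \<open>\<bar>a i\<bar> < 1\<close>. On the other blocks the diagonal has its full contribution, and on the blocks in
  \<open>V\<close> the loss is at most \<open>e\<close> per row.\<close>
lemma path_log_det_tendsto:
  fixes P :: "nat \<Rightarrow> 'w measure" and f :: "real \<Rightarrow> complex"
  assumes \<gamma>: "\<gamma> > 1/2" and cont: "continuous_on {0..1} f"
    and fr: "\<And>N. N > 0 \<Longrightarrow> freezes N (P N) (\<lambda>i _. f (real (i + 1) / real N)) (G N)"
  shows "(\<lambda>N. \<integral>\<omega>. \<bar>normalized_log_det \<gamma> N (\<lambda>i. f (real (i + 1) / real N)) (\<lambda>e. G N e \<omega>) z - path_potential f z\<bar> \<partial>P N) \<longlonglongrightarrow> 0"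
proof -
  let ?E = "\<lambda>N. \<integral>\<omega>. \<bar>normalized_log_det \<gamma> N (\<lambda>i. f (real (i + 1) / real N)) (\<lambda>e. G N e \<omega>) z - path_potential f z\<bar> \<partial>P N"
  define U where "U = path_potential f z"
  define a where "a N i = f (real (i + 1) / real N) - z" for N i
  define Uavg where "Uavg N = (\<Sum>i<N. ln (max 1 (cmod (a N i)))) / real N" for N
  have Uavg_lim: "Uavg \<longlonglongrightarrow> U"
    unfolding Uavg_def[abs_def] U_def path_potential_def a_def
    by (rule continuous_on_imp_riemann_sums) (intro continuous_intros cont, auto simp: max_def)
  have main: "\<forall>\<^sub>F N in sequentially. ?E N < 4 * e" if e: "e > 0" for e
  proof -
    have "uniformly_continuous_on {0..1} f" using cont by (rule compact_uniformly_continuous) simp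
    then obtain d where d: "d > 0" "\<And>s t. s \<in> {0..1} \<Longrightarrow> t \<in> {0..1} \<Longrightarrow> dist s t < d \<Longrightarrow> dist (f s) (f t) < e"
      using e unfolding uniformly_continuous_on_def by metis
    \<comment> \<open>A bound for the number of blocks of length about \<open>d N\<close>, uniform in \<open>N\<close>.\<close>
    define k where "k = nat \<lceil>2 / d\<rceil> + 1"
    define \<kappa> where "\<kappa> = min 1 (e / 2)"
    have \<kappa>: "0 < \<kappa>" "\<kappa> \<le> 1" "\<kappa> \<le> e / 2" using e by (auto simp: \<kappa>_def)
    have "\<forall>\<^sub>F N in sequentially. noise_level \<gamma> N < min (e / 2) (e * \<kappa>)"
      by (rule order_tendstoD[OF noise_level_tendsto[OF \<gamma>]]) (use e \<kappa> in auto)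
    moreover have "\<forall>\<^sub>F N in sequentially. 1 / \<kappa> / real N + (k * \<gamma> * ln (real N) + C * k / 2) / real N < e"
      by (rule order_tendstoD[OF error_term_tendsto]) (use e in auto)
    moreover have "\<forall>\<^sub>F N in sequentially. dist (Uavg N) U < e" by (rule tendstoD[OF Uavg_lim e])
    moreover have "\<forall>\<^sub>F N in sequentially. 2 \<le> d * real N"
      using d(1) by real_asymp
    ultimately show ?thesis
      using eventually_gt_at_top[of 0]
    proof eventually_elim
      fix N :: nat
      assume \<eta>: "noise_level \<gamma> N < min (e / 2) (e * \<kappa>)"
        and err: "1 / \<kappa> / real N + (k * \<gamma> * ln (real N) + C * k / 2) / real N < e"
        and Uavg: "dist (Uavg N) U < e" and dN: "2 \<le> d * real N" and N: "0 < N"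
      interpret P: prob_space "P N" using fr[OF N] by (simp add: freezes_def)
      let ?a = "a N"
      define \<beta> where "\<beta> = Uavg N + e / 2"
      define K where "K = (\<Prod>i<N. max 1 ((cmod (?a i))\<^sup>2) + e) / \<kappa>"
      have K0: "K \<ge> 0" using e \<kappa> by (auto simp: K_def intro!: divide_nonneg_pos prod_nonneg add_nonneg_nonneg)
      have "(\<Sum>w\<in>words N. word_weight (noise_level \<gamma> N) (\<lambda>i. (cmod (?a i))\<^sup>2) w) \<le> K"
        unfolding K_def by (rule sum_word_weight_le) (use \<eta> \<kappa> noise_level_nonneg in auto)
      then have up: "(\<integral>\<^sup>+\<omega>. ennreal (\<Sum>w\<in>words N. word_weight ((real N * (c * (real N powr - \<gamma>)\<^sup>2)) powr 1) (\<lambda>i. ((cmod (f (real (i + 1) / real N) - z))\<^sup>2) powr 1) w) \<partial>P N) \<le> ennreal K"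
        using noise_level_nonneg[of \<gamma> N] by (simp add: P.emeasure_space_1 noise_level_def a_def ennreal_leI)
      have NU: "real N * Uavg N = (\<Sum>i<N. ln (max 1 (cmod (?a i))))" using N by (simp add: Uavg_def)
      have Kexp: "K * exp (- 2 * 1 * real N * \<beta>) / (1 * real N) \<le> 1 / \<kappa> / real N"
      proof -
        have "(\<Prod>i<N. max 1 ((cmod (?a i))\<^sup>2) + e) \<le> (\<Prod>i<N. exp (2 * ln (max 1 (cmod (?a i))) + e))"
        proof (rule prod_mono, safe)
          fix i
          let ?m = "max 1 (cmod (?a i))"
          have m1: "1 \<le> ?m\<^sup>2" by (rule one_le_power) simp
          have "max 1 ((cmod (?a i))\<^sup>2) \<le> ?m\<^sup>2" using m1 by (auto simp: max_def)
          then have "max 1 ((cmod (?a i))\<^sup>2) + e \<le> ?m\<^sup>2 * (1 + e)"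
          proof -
            have "1 * e \<le> ?m\<^sup>2 * e" using m1 e by (intro mult_right_mono) auto
            then show ?thesis using \<open>max 1 ((cmod (?a i))\<^sup>2) \<le> ?m\<^sup>2\<close> by (simp only: distrib_left mult_1_right mult_1_left)
          qed
          also have "\<dots> \<le> ?m\<^sup>2 * exp e" using exp_ge_add_one_self[of e] by (intro mult_left_mono) auto
          also have "?m\<^sup>2 = exp (2 * ln ?m)" by (simp add: exp_double power2_eq_square)
          finally show "max 1 ((cmod (?a i))\<^sup>2) + e \<le> exp (2 * ln ?m + e)" by (simp add: exp_add)
          show "0 \<le> max 1 ((cmod (?a i))\<^sup>2) + e" using e by auto
        qed
        also have "\<dots> = exp (2 * (real N * Uavg N) + N * e)"
          unfolding NU by (simp add: exp_sum[symmetric] sum.distrib sum_distrib_left)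
        finally have "(\<Prod>i<N. max 1 ((cmod (?a i))\<^sup>2) + e) * exp (- 2 * 1 * real N * \<beta>) \<le> exp (2 * (real N * Uavg N) + N * e) * exp (- 2 * 1 * real N * \<beta>)"
          by (intro mult_right_mono) auto
        also have "\<dots> = 1" by (simp add: exp_add[symmetric] \<beta>_def algebra_simps)
        finally have "K * exp (- 2 * 1 * real N * \<beta>) \<le> 1 / \<kappa>" using \<kappa> by (simp add: K_def divide_right_mono)
        then have "K * exp (- 2 * 1 * real N * \<beta>) / real N \<le> 1 / \<kappa> / real N" by (rule divide_right_mono) simp
        then show ?thesis by simp
      qed
      define m where "m = nat \<lfloor>d * real N\<rfloor>"
      have m: "m > 0" "real m \<le> d * real N" "d * real N / 2 \<le> real m"
      proof -
        have r: "real m = of_int \<lfloor>d * real N\<rfloor>" using dN by (simp add: m_def)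
        show "real m \<le> d * real N" unfolding r by simp
        show "d * real N / 2 \<le> real m" unfolding r using dN by linarith
        then show "m > 0" using dN by (cases m) auto
      qed
      have mk: "N div m + 1 \<le> k"
      proof -
        have "real (N div m * m) \<le> real N" by (simp only: of_nat_le_iff) simp
        then have "real (N div m) \<le> real N / real m" using m(1) by (simp add: pos_le_divide_eq)
        also have "\<dots> \<le> real N / (d * real N / 2)" using m dN N d by (intro divide_left_mono mult_pos_pos) auto
        also have "\<dots> = 2 / d" using N by simp
        finally have "real (N div m) \<le> 2 / d" .
        then have "N div m \<le> nat \<lceil>2 / d\<rceil>" by linarith
        then show ?thesis by (simp add: k_def)
      qed
      \<comment> \<open>The blocks on which the superdiagonal is followed.\<close>
      define V where "V = {i div m | i. i < N \<and> cmod (?a i) < 1}"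
      obtain p where p: "p \<in> near_id_pairs N" "card (fst p) \<le> N div m + 1"
        "\<And>a \<delta>. cmod (pair_coeff N a \<delta> p) = \<bar>\<delta>\<bar> ^ card (fst p) * (\<Prod>i\<in>{i. i < N \<and> i div m \<notin> V}. cmod (a i))"
        using block_pair[OF m(1), of N V] by blast
      have big: "1 \<le> cmod (?a i)" if "i < N" "i div m \<notin> V" for i using that unfolding V_def by force
      have small: "ln (max 1 (cmod (?a i))) \<le> e" if "i < N" "i div m \<in> V" for i
      proof -
        obtain j where j: "j < N" "cmod (?a j) < 1" "i div m = j div m" using \<open>i div m \<in> V\<close> unfolding V_def by force
        have "i div m * m \<le> i" "j div m * m \<le> j" "i < i div m * m + m" "j < j div m * m + m"
          using dividend_less_div_times[OF m(1), of i] dividend_less_div_times[OF m(1), of j] by (simp_all add: add.commute)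
        then have "i < j + m" "j < i + m" unfolding j(3) by linarith+
        then have "\<bar>real i - real j\<bar> < real m" by linarith
        then have "\<bar>real i - real j\<bar> < d * real N" using m(2) by linarith
        then have "dist (real (i + 1) / real N) (real (j + 1) / real N) < d"
          using N by (simp add: dist_real_def diff_divide_distrib[symmetric] divide_less_eq mult.commute)
        then have "dist (f (real (i + 1) / real N)) (f (real (j + 1) / real N)) < e"
          using that j(1) N by (intro d(2)) auto
        then have "cmod (?a i - ?a j) < e" by (simp add: a_def dist_norm)
        then have "cmod (?a i) \<le> 1 + e" using j(2) norm_triangle_sub[of "?a i" "?a j"] by linarith
        then have "max 1 (cmod (?a i)) \<le> 1 + e" using e by simp
        then show ?thesis using ln_le_minus_one[of "max 1 (cmod (?a i))"] by linarith
      qed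
      have aN: "?a = (\<lambda>i. f (real (i + 1) / real N) - z)" by (simp add: a_def fun_eq_iff)
      define q where "q = - (k * \<gamma> * ln N) + N * Uavg N - N * e"
      have pcnz: "pair_coeff N ?a (real N powr - \<gamma>) p \<noteq> 0 \<and> q \<le> ln (cmod (pair_coeff N ?a (real N powr - \<gamma>) p))"
      proof -
        let ?\<delta> = "real N powr - \<gamma>" and ?D = "{i. i < N \<and> i div m \<notin> V}" and ?W = "{i. i < N \<and> i div m \<in> V}"
        have pos: "0 < (\<Prod>i\<in>?D. cmod (?a i))" using big by (intro prod_pos) force
        have \<delta>0: "0 < ?\<delta>" using N by simp
        have "ln (cmod (pair_coeff N ?a ?\<delta> p)) = card (fst p) * ln ?\<delta> + ln (\<Prod>i\<in>?D. cmod (?a i))"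
          unfolding p(3) using pos \<delta>0 by (simp add: ln_mult_pos ln_realpow)
        also have "ln (\<Prod>i\<in>?D. cmod (?a i)) = (\<Sum>i\<in>?D. ln (cmod (?a i)))"
          using big by (intro ln_prod) force+
        also have "\<dots> = (\<Sum>i\<in>?D. ln (max 1 (cmod (?a i))))"
          using big by (intro sum.cong refl) (auto simp: max_def)
        also have "\<dots> = real N * Uavg N - (\<Sum>i\<in>?W. ln (max 1 (cmod (?a i))))"
        proof -
          have "{..<N} = ?D \<union> ?W" by auto
          then have "(\<Sum>i<N. ln (max 1 (cmod (?a i)))) = (\<Sum>i\<in>?D. ln (max 1 (cmod (?a i)))) + (\<Sum>i\<in>?W. ln (max 1 (cmod (?a i))))"
            by (simp only:) (rule sum.union_disjoint, auto)
          then show ?thesis using NU by simp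
        qed
        finally have eq: "ln (cmod (pair_coeff N ?a ?\<delta> p)) = card (fst p) * ln ?\<delta> + (real N * Uavg N - (\<Sum>i\<in>?W. ln (max 1 (cmod (?a i)))))" .
        have "(\<Sum>i\<in>?W. ln (max 1 (cmod (?a i)))) \<le> (\<Sum>i\<in>?W. e)" by (rule sum_mono) (use small in auto)
        also have "\<dots> \<le> N * e"
        proof -
          have "card ?W \<le> card {..<N}" by (intro card_mono) auto
          then show ?thesis using e by simp
        qed
        finally have W: "(\<Sum>i\<in>?W. ln (max 1 (cmod (?a i)))) \<le> N * e" .
        have "card (fst p) * \<gamma> * ln N \<le> k * \<gamma> * ln N"
          using p(2) mk \<gamma> N by (intro mult_right_mono) auto
        then have "- (k * \<gamma> * ln N) \<le> card (fst p) * ln ?\<delta>" using N by (simp add: ln_powr)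
        with W eq have "q \<le> ln (cmod (pair_coeff N ?a ?\<delta> p))" by (simp add: q_def)
        moreover have "0 < cmod (pair_coeff N ?a ?\<delta> p)" unfolding p(3) using pos \<delta>0 by simp
        ultimately show ?thesis by simp
      qed
      have "?E N \<le> \<bar>\<beta> - U\<bar> + K * exp (- 2 * 1 * real N * \<beta>) / (1 * real N) + (\<beta> - ((\<integral>\<omega>. q \<partial>P N) - C * real k / 2) / N)"
        unfolding U_def[symmetric]
        by (rule freezes_L1_bound(2)[OF fr[OF N] N _ _ K0 up p(1)]) (use p(2) mk pcnz[unfolded aN] in simp_all)
      also have "(\<beta> - ((\<integral>\<omega>. q \<partial>P N) - C * real k / 2) / N) = 3 / 2 * e + (k * \<gamma> * ln N + C * k / 2) / N"
        using N by (simp add: P.prob_space q_def \<beta>_def diff_divide_distrib add_divide_distrib)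
      finally have "?E N \<le> \<bar>\<beta> - U\<bar> + 3 / 2 * e + (1 / \<kappa> / real N + (k * \<gamma> * ln N + C * k / 2) / N)" using Kexp by linarith
      moreover have "\<bar>\<beta> - U\<bar> < e + e / 2" using Uavg unfolding \<beta>_def dist_real_def by linarith
      ultimately show "?E N < 4 * e" using err by linarith
    qed
  qed
  show ?thesis
  proof (rule LIMSEQ_I)
    fix r :: real assume "r > 0"
    then have "\<forall>\<^sub>F N in sequentially. ?E N < 4 * (r / 4)" by (intro main) simp
    then obtain N0 where "\<And>N. N \<ge> N0 \<Longrightarrow> ?E N < r" by (auto simp: eventually_sequentially)
    moreover have "0 \<le> ?E N" for N by (intro integral_nonneg_AE) auto
    ultimately show "\<exists>N0. \<forall>N\<ge>N0. norm (?E N - 0) < r" by (intro exI[of _ N0]) auto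
  qed
qed

lemma path_log_det_bounded:
  assumes \<gamma>: "\<gamma> > 1/2" and cont: "continuous_on {0..1} f" and B: "\<And>t. t \<in> {0..1} \<Longrightarrow> cmod (f t) \<le> B"
    and fr: "freezes N P (\<lambda>i _. f (real (i + 1) / real N)) G" and N: "N > 0" and z: "cmod z \<le> r"
  shows "integrable P (\<lambda>\<omega>. normalized_log_det \<gamma> N (\<lambda>i. f (real (i + 1) / real N)) (\<lambda>e. G e \<omega>) z)"
    "(\<integral>\<omega>. \<bar>normalized_log_det \<gamma> N (\<lambda>i. f (real (i + 1) / real N)) (\<lambda>e. G e \<omega>) z - path_potential f z\<bar> \<partial>P)
      \<le> (B + r) + ln ((B + r)\<^sup>2 + 1 + c + 1) + 1 + 2 * \<gamma> + C"
proof -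
  interpret P: prob_space P using fr by (simp add: freezes_def)
  let ?R = "(B + r)\<^sup>2 + 1"
  have "(\<Sum>w\<in>words N. word_weight (noise_level \<gamma> N) (\<lambda>i. (cmod (f (real (i + 1) / real N) - z))\<^sup>2) w)
      \<le> (\<Sum>w\<in>words N. word_weight (noise_level \<gamma> N) (\<lambda>_. ?R) w)"
  proof (intro sum_mono word_weight_mono noise_level_nonneg)
    fix w i assume "w \<in> words N" "i < length w"
    then have i: "i < N" using length_words by simp
    have "cmod (f (real (i + 1) / real N) - z) \<le> cmod (f (real (i + 1) / real N)) + cmod z" by (rule norm_triangle_ineq4)
    also have "\<dots> \<le> B + r" using B[of "real (i + 1) / real N"] i z by (intro add_mono) auto
    finally have "(cmod (f (real (i + 1) / real N) - z))\<^sup>2 \<le> (B + r)\<^sup>2" by (intro power_mono) auto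
    then show "(cmod (f (real (i + 1) / real N) - z))\<^sup>2 \<le> ?R" by simp
  qed simp
  then have up: "(\<integral>\<^sup>+\<omega>. ennreal (\<Sum>w\<in>words N. word_weight (noise_level \<gamma> N) (\<lambda>i. (cmod (f (real (i + 1) / real N) - z))\<^sup>2) w) \<partial>P)
      \<le> ennreal (\<Sum>w\<in>words N. word_weight (noise_level \<gamma> N) (\<lambda>_. ?R) w)"
    by (simp add: P.emeasure_space_1 ennreal_leI)
  show "integrable P (\<lambda>\<omega>. normalized_log_det \<gamma> N (\<lambda>i. f (real (i + 1) / real N)) (\<lambda>e. G e \<omega>) z)"
    by (rule uniform_L1_bound(1)[OF \<gamma> fr N _ up]) simp
  have "\<bar>path_potential f z\<bar> \<le> B + r" using path_potential_bounds[OF cont B, of z] z by simp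
  with uniform_L1_bound(2)[OF \<gamma> fr N _ up, of "path_potential f z"]
  show "(\<integral>\<omega>. \<bar>normalized_log_det \<gamma> N (\<lambda>i. f (real (i + 1) / real N)) (\<lambda>e. G e \<omega>) z - path_potential f z\<bar> \<partial>P)
      \<le> (B + r) + ln (?R + c + 1) + 1 + 2 * \<gamma> + C" by simp
qed

end

section \<open>Tent functions\<close>

text \<open>The bump \<open>ln 2\<close> on the disc of radius \<open>r\<close>, falling to zero at radius \<open>2 r\<close>. As a difference of two truncated
  logarithms it is a difference of circle means of \<open>ln \<bar>w - z\<bar>\<close>.\<close>
definition tent :: "real \<Rightarrow> complex \<Rightarrow> real" where
  "tent r w = ln (max (cmod w) (2 * r)) - ln (max (cmod w) r)"

definition tent_mass :: "real \<Rightarrow> real" where "tent_mass r = (\<integral>w. tent r w \<partial>lborel)"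

text \<open>The mixture of tents that approximates \<open>f\<close>: the convolution with the normalized tent.\<close>
definition smoothing :: "(complex \<Rightarrow> real) \<Rightarrow> real \<Rightarrow> complex \<Rightarrow> real" where
  "smoothing f r y = (\<integral>a. f a * tent r (y - a) \<partial>lborel) / tent_mass r"

definition tent_integral :: "complex measure \<Rightarrow> real \<Rightarrow> complex \<Rightarrow> real" where
  "tent_integral \<rho> r a = (\<integral>y. tent r (y - a) \<partial>\<rho>)"

lemma tent_bounds:
  assumes "r > 0"
  shows "0 \<le> tent r w" "tent r w \<le> ln 2" "2 * r \<le> cmod w \<Longrightarrow> tent r w = 0" "cmod w \<le> r \<Longrightarrow> tent r w = ln 2"
proof -
  show "0 \<le> tent r w" unfolding tent_def using assms by (auto intro!: ln_mono)
  have "max (cmod w) (2 * r) \<le> 2 * max (cmod w) r" using assms norm_ge_zero[of w] by (auto simp: max_def)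
  then have "ln (max (cmod w) (2 * r)) \<le> ln (2 * max (cmod w) r)" using assms by (intro ln_mono) auto
  also have "\<dots> = ln 2 + ln (max (cmod w) r)" using assms by (intro ln_mult_pos) auto
  finally show "tent r w \<le> ln 2" by (simp add: tent_def)
  show "2 * r \<le> cmod w \<Longrightarrow> tent r w = 0" using assms by (simp add: tent_def)
  show "cmod w \<le> r \<Longrightarrow> tent r w = ln 2"
    using assms by (simp add: tent_def max_def ln_mult_pos)
qed

lemma tent_measurable [measurable]: "tent r \<in> borel_measurable borel"
  unfolding tent_def[abs_def] by measurable

lemma tent_minus: "tent r (y - a) = tent r (a - y)"
  by (simp add: tent_def norm_minus_commute)

lemma integrable_indicator_cball:
  "integrable lborel (\<lambda>w::complex. indicator (cball 0 \<rho>) w * k :: real)"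
proof (intro integrable_mult_left integrable_real_indicator)
  show "emeasure lborel (cball (0::complex) \<rho>) < \<infinity>" by (rule emeasure_bounded_finite) simp
qed simp

lemma integrable_tent:
  assumes "r > 0" shows "integrable lborel (tent r)"
proof (rule Bochner_Integration.integrable_bound)
  show "integrable lborel (\<lambda>w::complex. indicator (cball 0 (2 * r)) w * ln 2 :: real)"
    by (rule integrable_indicator_cball)
  show "AE w in lborel. norm (tent r w) \<le> norm (indicator (cball 0 (2 * r)) w * ln 2 :: real)"
  proof (rule AE_I2)
    fix w :: complex
    show "norm (tent r w) \<le> norm (indicator (cball 0 (2 * r)) w * ln 2 :: real)"
      using tent_bounds[OF assms, of w] by (cases "w \<in> cball 0 (2 * r)") auto
  qed
qed measurable

lemma tent_mass_pos:
  assumes "r > 0" shows "tent_mass r > 0"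
proof -
  have I: "integrable lborel (\<lambda>w::complex. indicator (cball 0 r) w * ln 2 :: real)"
    by (rule integrable_indicator_cball)
  have "0 < measure lborel (cball (0::complex) r) * ln 2"
    using assms content_cball_pos[of r "0::complex"] by simp
  also have "\<dots> = (\<integral>w. indicator (cball (0::complex) r) w * ln 2 \<partial>lborel)"
    by simp
  also have "\<dots> \<le> tent_mass r"
    unfolding tent_mass_def
  proof (rule integral_mono[OF I integrable_tent[OF assms]])
    fix w :: complex
    show "indicator (cball 0 r) w * ln 2 \<le> tent r w"
      using tent_bounds[OF assms, of w] by (cases "w \<in> cball 0 r") auto
  qed
  finally show ?thesis .
qed

lemma integral_tent_shift: "(\<integral>a. tent r (y - a) \<partial>lborel) = tent_mass r"
proof -
  have "tent_mass r = (\<integral>w. tent r w \<partial>distr lborel borel ((+) (- y)))"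
    unfolding tent_mass_def by (subst lborel_distr_plus) simp
  also have "\<dots> = (\<integral>a. tent r (- y + a) \<partial>lborel)"
    by (rule integral_distr) auto
  finally show ?thesis by (simp add: tent_minus[of r y] add.commute)
qed

lemma integrable_tent_shift: "r > 0 \<Longrightarrow> integrable lborel (\<lambda>a. tent r (y - a))"
proof -
  assume r: "r > 0"
  have "integrable (distr lborel borel ((+) (- y))) (tent r)"
    by (subst lborel_distr_plus) (rule integrable_tent[OF r])
  then have "integrable lborel (\<lambda>a. tent r (- y + a))" by (subst (asm) integrable_distr_eq) auto
  then show ?thesis by (simp add: tent_minus[of r y] add.commute)
qed

definition bounded_support :: "real \<Rightarrow> (complex \<Rightarrow> real) \<Rightarrow> bool" where
  "bounded_support R f \<longleftrightarrow> continuous_on UNIV f \<and> (\<forall>y. cmod y > R \<longrightarrow> f y = 0)"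

lemma bounded_support_measurable: "bounded_support R f \<Longrightarrow> f \<in> borel_measurable borel"
  unfolding bounded_support_def by (intro borel_measurable_continuous_onI) simp

lemma bounded_support_bounded:
  assumes "bounded_support R f" shows "\<exists>B\<ge>0. \<forall>y. \<bar>f y\<bar> \<le> B"
proof -
  have "compact (f ` cball 0 R)"
    using assms by (intro compact_continuous_image) (auto simp: bounded_support_def intro: continuous_on_subset)
  then have "bounded (f ` cball 0 R)" by (rule compact_imp_bounded)
  then obtain B where B: "\<forall>x\<in>f ` cball 0 R. norm x \<le> B" by (auto simp: bounded_iff)
  have "\<bar>f y\<bar> \<le> max B 0" for y
  proof (cases "cmod y \<le> R")
    case True
    then have "f y \<in> f ` cball 0 R" by auto
    then have "norm (f y) \<le> B" using B by blast
    then show ?thesis by simp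
  next
    case False then show ?thesis using assms by (simp add: bounded_support_def)
  qed
  then show ?thesis by (intro exI[of _ "max B 0"]) auto
qed

lemma bounded_support_integrable:
  assumes "bounded_support R f" shows "integrable lborel f"
proof -
  have "integrable lborel (\<lambda>x. indicator (cball 0 R) x *\<^sub>R f x)"
    using assms by (intro borel_integrable_compact) (auto simp: bounded_support_def intro: continuous_on_subset)
  moreover have "(\<lambda>x. indicator (cball 0 R) x *\<^sub>R f x) = f"
    using assms by (auto simp: bounded_support_def fun_eq_iff indicator_def)
  ultimately show ?thesis by simp
qed

lemma bounded_support_uniformly_continuous:
  assumes f: "bounded_support R f" and e: "e > 0"
  shows "\<exists>d>0. \<forall>a y. cmod (a - y) < d \<longrightarrow> \<bar>f a - f y\<bar> < e"
proof -
  have "uniformly_continuous_on (cball 0 (R + 1)) f"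
    using f by (intro compact_uniformly_continuous) (auto simp: bounded_support_def intro: continuous_on_subset)
  then obtain d where d: "d > 0" "\<And>a y. a \<in> cball 0 (R + 1) \<Longrightarrow> y \<in> cball 0 (R + 1) \<Longrightarrow> dist a y < d \<Longrightarrow> dist (f a) (f y) < e"
    using e unfolding uniformly_continuous_on_def by metis
  have "\<bar>f a - f y\<bar> < e" if ay: "cmod (a - y) < min d 1" for a y
  proof (cases "cmod a \<le> R + 1 \<and> cmod y \<le> R + 1")
    case True
    then show ?thesis using d(2)[of a y] ay by (auto simp: dist_norm)
  next
    case False
    have "cmod a \<le> cmod y + cmod (a - y)" "cmod y \<le> cmod a + cmod (a - y)"
      using norm_triangle_sub[of a y] norm_triangle_sub[of y a] by (auto simp: norm_minus_commute)
    then have "cmod a > R \<and> cmod y > R" using False ay by auto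
    then show ?thesis using f e by (simp add: bounded_support_def)
  qed
  then show ?thesis using d(1) by (intro exI[of _ "min d 1"]) auto
qed

lemma integrable_mult_tent:
  assumes f: "bounded_support R f" and r: "r > 0"
  shows "integrable lborel (\<lambda>a. f a * tent r (y - a))"
proof (rule Bochner_Integration.integrable_bound)
  note [measurable] = bounded_support_measurable[OF f]
  show "integrable lborel (\<lambda>a. f a * ln 2)" using bounded_support_integrable[OF f] by simp
  show "(\<lambda>a. f a * tent r (y - a)) \<in> borel_measurable lborel" by measurable
  show "AE a in lborel. norm (f a * tent r (y - a)) \<le> norm (f a * ln 2)"
    using tent_bounds(1,2)[OF r] by (intro AE_I2) (simp add: abs_mult mult_left_mono)
qed

lemma smoothing_close:
  assumes f: "bounded_support R f" and r: "r > 0" and e: "\<And>a y. cmod (a - y) < 2 * r \<Longrightarrow> \<bar>f a - f y\<bar> \<le> e"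
  shows "\<bar>smoothing f r y - f y\<bar> \<le> e"
proof -
  let ?c = "tent_mass r"
  have c: "?c > 0" by (rule tent_mass_pos[OF r])
  have eq: "(\<integral>a. f a * tent r (y - a) \<partial>lborel) - f y * ?c = (\<integral>a. (f a - f y) * tent r (y - a) \<partial>lborel)"
    using integrable_mult_tent[OF f r, of y] integrable_tent_shift[OF r, of y]
    by (simp add: left_diff_distrib integral_tent_shift)
  have I: "integrable lborel (\<lambda>a. (f a - f y) * tent r (y - a))"
    using integrable_mult_tent[OF f r, of y] integrable_tent_shift[OF r, of y]
    by (simp add: left_diff_distrib)
  have "\<bar>\<integral>a. (f a - f y) * tent r (y - a) \<partial>lborel\<bar> \<le> (\<integral>a. \<bar>(f a - f y) * tent r (y - a)\<bar> \<partial>lborel)"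
    by (rule integral_abs_bound)
  also have "\<dots> \<le> (\<integral>a. e * tent r (y - a) \<partial>lborel)"
  proof (rule integral_mono)
    fix a :: complex
    show "\<bar>(f a - f y) * tent r (y - a)\<bar> \<le> e * tent r (y - a)"
    proof (cases "cmod (a - y) < 2 * r")
      case True
      then show ?thesis using e[OF True] tent_bounds(1)[OF r, of "y - a"] by (simp add: abs_mult mult_right_mono)
    next
      case False
      then have "tent r (y - a) = 0" using tent_bounds(3)[OF r, of "y - a"] by (simp add: norm_minus_commute)
      then show ?thesis by simp
    qed
  qed (use I integrable_tent_shift[OF r, of y] in auto)
  also have "\<dots> = e * ?c" by (simp add: integral_tent_shift)
  finally have "\<bar>(\<integral>a. f a * tent r (y - a) \<partial>lborel) - f y * ?c\<bar> \<le> e * ?c" unfolding eq .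
  moreover have "smoothing f r y - f y = ((\<integral>a. f a * tent r (y - a) \<partial>lborel) - f y * ?c) / ?c"
    using c by (simp add: smoothing_def diff_divide_distrib)
  ultimately show ?thesis using c by (simp add: abs_divide divide_le_eq)
qed

lemma tent_integral_bounds:
  assumes "prob_space \<rho>" "sets \<rho> = sets borel" "r > 0"
  shows "integrable \<rho> (\<lambda>y. tent r (y - a))" "0 \<le> tent_integral \<rho> r a" "tent_integral \<rho> r a \<le> ln 2"
proof -
  interpret prob_space \<rho> by fact
  note [measurable_cong] = assms(2)
  show I: "integrable \<rho> (\<lambda>y. tent r (y - a))"
    by (rule integrable_const_bound[where B="ln 2"]) (use tent_bounds[OF assms(3)] in auto)
  show "0 \<le> tent_integral \<rho> r a" unfolding tent_integral_def
    by (intro integral_nonneg_AE AE_I2 tent_bounds assms)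
  have "tent_integral \<rho> r a \<le> (\<integral>y. ln 2 \<partial>\<rho>)" unfolding tent_integral_def
    by (intro integral_mono I) (use tent_bounds[OF assms(3)] in auto)
  then show "tent_integral \<rho> r a \<le> ln 2" by (simp add: prob_space)
qed

lemma tent_integral_measurable:
  assumes "prob_space \<rho>" "sets \<rho> = sets borel"
  shows "tent_integral \<rho> r \<in> borel_measurable borel"
proof -
  interpret prob_space \<rho> by fact
  note [measurable_cong] = assms(2)
  show ?thesis unfolding tent_integral_def[abs_def] by measurable
qed

text \<open>Fubini: the integral of a smoothed function depends on the measure only through its tent integrals.\<close>
lemma integral_smoothing:
  assumes \<rho>: "prob_space \<rho>" "sets \<rho> = sets borel" and f: "bounded_support R f" and r: "r > 0"
  shows "integrable \<rho> (smoothing f r)"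
    "(\<integral>y. smoothing f r y \<partial>\<rho>) = (\<integral>a. f a * tent_integral \<rho> r a \<partial>lborel) / tent_mass r"
proof -
  interpret prob_space \<rho> by fact
  interpret pair_sigma_finite lborel \<rho> ..
  note [measurable_cong] = \<rho>(2)
  note [measurable] = bounded_support_measurable[OF f] tent_integral_measurable[OF \<rho>]
  have fi: "integrable lborel f" by (rule bounded_support_integrable[OF f])
  have I: "integrable (lborel \<Otimes>\<^sub>M \<rho>) (\<lambda>(a, y). f a * tent r (y - a))"
  proof (rule Fubini_integrable)
    show "(\<lambda>(a, y). f a * tent r (y - a)) \<in> borel_measurable (lborel \<Otimes>\<^sub>M \<rho>)" by measurable
    have "(\<lambda>a. \<integral>y. norm (case (a, y) of (a, y) \<Rightarrow> f a * tent r (y - a)) \<partial>\<rho>) = (\<lambda>a. \<bar>f a\<bar> * tent_integral \<rho> r a)"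
      unfolding tent_integral_def using tent_bounds(1)[OF r] by (simp add: abs_mult)
    moreover have "integrable lborel (\<lambda>a. \<bar>f a\<bar> * tent_integral \<rho> r a)"
    proof (rule Bochner_Integration.integrable_bound)
      show "integrable lborel (\<lambda>a. f a * ln 2)" using fi by simp
      show "AE a in lborel. norm (\<bar>f a\<bar> * tent_integral \<rho> r a) \<le> norm (f a * ln 2)"
        using tent_integral_bounds[OF \<rho> r] by (intro AE_I2) (simp add: abs_mult mult_left_mono)
    qed measurable
    ultimately show "integrable lborel (\<lambda>a. \<integral>y. norm (case (a, y) of (a, y) \<Rightarrow> f a * tent r (y - a)) \<partial>\<rho>)" by simp
    show "AE a in lborel. integrable \<rho> (\<lambda>y. case (a, y) of (a, y) \<Rightarrow> f a * tent r (y - a))"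
      using tent_integral_bounds(1)[OF \<rho> r] by simp
  qed
  have "integrable \<rho> (\<lambda>y. \<integral>a. f a * tent r (y - a) \<partial>lborel)"
    using integrable_snd[OF I] by simp
  then show "integrable \<rho> (smoothing f r)" unfolding smoothing_def[abs_def] by simp
  have "(\<integral>y. (\<integral>a. f a * tent r (y - a) \<partial>lborel) \<partial>\<rho>) = (\<integral>a. (\<integral>y. f a * tent r (y - a) \<partial>\<rho>) \<partial>lborel)"
    by (rule Fubini_integral[OF I])
  then show "(\<integral>y. smoothing f r y \<partial>\<rho>) = (\<integral>a. f a * tent_integral \<rho> r a \<partial>lborel) / tent_mass r"
    by (simp add: smoothing_def tent_integral_def)
qed

lemma integral_diff_smoothing_le:
  assumes \<rho>: "prob_space \<rho>" "sets \<rho> = sets borel" and f: "bounded_support R f" and r: "r > 0"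
    and e: "\<And>a y. cmod (a - y) < 2 * r \<Longrightarrow> \<bar>f a - f y\<bar> \<le> e"
  shows "\<bar>(\<integral>y. f y \<partial>\<rho>) - (\<integral>y. smoothing f r y \<partial>\<rho>)\<bar> \<le> e"
proof -
  interpret prob_space \<rho> by fact
  note [measurable_cong] = \<rho>(2)
  note [measurable] = bounded_support_measurable[OF f]
  obtain B where "B \<ge> 0" "\<forall>y. \<bar>f y\<bar> \<le> B" using bounded_support_bounded[OF f] by blast
  then have fi: "integrable \<rho> f" by (intro integrable_const_bound[where B=B]) auto
  note si = integral_smoothing(1)[OF \<rho> f r]
  have "\<bar>(\<integral>y. f y \<partial>\<rho>) - (\<integral>y. smoothing f r y \<partial>\<rho>)\<bar> = \<bar>\<integral>y. f y - smoothing f r y \<partial>\<rho>\<bar>"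
    using fi si by simp
  also have "\<dots> \<le> (\<integral>y. \<bar>f y - smoothing f r y\<bar> \<partial>\<rho>)" by (rule integral_abs_bound)
  also have "\<dots> \<le> (\<integral>y. e \<partial>\<rho>)"
  proof (rule integral_mono)
    show "\<bar>f y - smoothing f r y\<bar> \<le> e" for y
      using smoothing_close[OF f r e, of y] by (simp add: abs_minus_commute)
  qed (use fi si in auto)
  finally show ?thesis by (simp add: prob_space)
qed

lemma integral_bounded_support_diff_le:
  assumes \<rho>: "prob_space \<rho>" "sets \<rho> = sets borel" and \<mu>: "prob_space \<mu>" "sets \<mu> = sets borel"
    and f: "bounded_support R f" and r: "r > 0"
    and e: "\<And>a y. cmod (a - y) < 2 * r \<Longrightarrow> \<bar>f a - f y\<bar> \<le> e"
  shows "\<bar>(\<integral>y. f y \<partial>\<rho>) - (\<integral>y. f y \<partial>\<mu>)\<bar>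
    \<le> 2 * e + (\<integral>a. \<bar>f a\<bar> * \<bar>tent_integral \<rho> r a - tent_integral \<mu> r a\<bar> \<partial>lborel) / tent_mass r"
proof -
  note [measurable] = bounded_support_measurable[OF f] tent_integral_measurable[OF \<rho>] tent_integral_measurable[OF \<mu>]
  have fi: "integrable lborel f" by (rule bounded_support_integrable[OF f])
  have int: "integrable lborel (\<lambda>a. f a * tent_integral \<nu> r a)" if \<nu>: "prob_space \<nu>" "sets \<nu> = sets borel" for \<nu>
  proof (rule Bochner_Integration.integrable_bound)
    show "(\<lambda>a. f a * tent_integral \<nu> r a) \<in> borel_measurable lborel"
      by (intro borel_measurable_times) (use bounded_support_measurable[OF f] tent_integral_measurable[OF \<nu>] in simp_all)
    show "integrable lborel (\<lambda>a. f a * ln 2)" using fi by simp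
    show "AE a in lborel. norm (f a * tent_integral \<nu> r a) \<le> norm (f a * ln 2)"
      using tent_integral_bounds[OF \<nu> r] by (intro AE_I2) (simp add: abs_mult mult_left_mono)
  qed
  have c: "tent_mass r > 0" by (rule tent_mass_pos[OF r])
  have "(\<integral>y. smoothing f r y \<partial>\<rho>) - (\<integral>y. smoothing f r y \<partial>\<mu>) = (\<integral>a. f a * (tent_integral \<rho> r a - tent_integral \<mu> r a) \<partial>lborel) / tent_mass r"
    using int[OF \<rho>] int[OF \<mu>] by (simp add: integral_smoothing(2)[OF \<rho> f r] integral_smoothing(2)[OF \<mu> f r] right_diff_distrib diff_divide_distrib)
  moreover have "\<bar>\<integral>a. f a * (tent_integral \<rho> r a - tent_integral \<mu> r a) \<partial>lborel\<bar>
      \<le> (\<integral>a. \<bar>f a\<bar> * \<bar>tent_integral \<rho> r a - tent_integral \<mu> r a\<bar> \<partial>lborel)"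
    using integral_abs_bound[of lborel "\<lambda>a. f a * (tent_integral \<rho> r a - tent_integral \<mu> r a)"] by (simp add: abs_mult)
  ultimately have "\<bar>(\<integral>y. smoothing f r y \<partial>\<rho>) - (\<integral>y. smoothing f r y \<partial>\<mu>)\<bar>
      \<le> (\<integral>a. \<bar>f a\<bar> * \<bar>tent_integral \<rho> r a - tent_integral \<mu> r a\<bar> \<partial>lborel) / tent_mass r"
    using c by (simp add: divide_right_mono)
  with integral_diff_smoothing_le[OF \<rho> f r e] integral_diff_smoothing_le[OF \<mu> f r e] show ?thesis by linarith
qed

text \<open>Equal tent integrals give equal integrals of continuous functions of bounded support, by smoothing at
  small radius. Such functions approximate indicators of compact sets.\<close>
lemma eq_of_tent_integrals:
  assumes \<rho>: "prob_space \<rho>" "sets \<rho> = sets borel" and \<mu>: "prob_space \<mu>" "sets \<mu> = sets borel"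
    and eq: "\<And>r a. r > 0 \<Longrightarrow> tent_integral \<rho> r a = tent_integral \<mu> r a"
  shows "\<rho> = \<mu>"
proof -
  interpret \<rho>: prob_space \<rho> by fact
  interpret \<mu>: prob_space \<mu> by fact
  note [measurable_cong] = \<rho>(2) \<mu>(2)
  have int: "(\<integral>y. f y \<partial>\<rho>) = (\<integral>y. f y \<partial>\<mu>)" if f: "bounded_support R f" for R f
  proof -
    have "\<bar>(\<integral>y. f y \<partial>\<rho>) - (\<integral>y. f y \<partial>\<mu>)\<bar> \<le> e" if e: "e > 0" for e
    proof -
      obtain d where d: "d > 0" "\<And>a y. cmod (a - y) < d \<Longrightarrow> \<bar>f a - f y\<bar> < e / 2"
      proof -
        have "0 < e / 2" using e by simp
        from bounded_support_uniformly_continuous[OF f this] that show ?thesis by blast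
      qed
      have "\<bar>(\<integral>y. f y \<partial>\<rho>) - (\<integral>y. f y \<partial>\<mu>)\<bar> \<le> 2 * (e / 2) +
          (\<integral>a. \<bar>f a\<bar> * \<bar>tent_integral \<rho> (d / 2) a - tent_integral \<mu> (d / 2) a\<bar> \<partial>lborel) / tent_mass (d / 2)"
        by (rule integral_bounded_support_diff_le[OF \<rho> \<mu> f]) (use d in \<open>auto intro: less_imp_le\<close>)
      then show ?thesis using eq[of "d / 2"] d(1) by simp
    qed
    then have "\<bar>(\<integral>y. f y \<partial>\<rho>) - (\<integral>y. f y \<partial>\<mu>)\<bar> \<le> 0" by (rule field_le_epsilon) simp
    then show ?thesis by simp
  qed
  have compact: "emeasure \<rho> S = emeasure \<mu> S" if S: "compact S" for S :: "complex set"
  proof (cases "S = {}")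
    case False
    let ?S = S
    have Sm [measurable]: "S \<in> sets borel" using S by (intro borel_closed compact_imp_closed)
    define F where "F n y = max 0 (1 - real n * infdist y ?S)" for n y
    obtain R where R: "\<forall>y\<in>?S. cmod y \<le> R" using compact_imp_bounded[OF S] by (auto simp: bounded_iff)
    have supp: "bounded_support (R + 2) (F (Suc n))" for n
    proof -
      have "F (Suc n) y = 0" if "cmod y > R + 2" for y
      proof -
        have "1 \<le> infdist y ?S"
        proof (subst infdist_notempty[OF False], rule cINF_greatest[OF False])
          fix s assume "s \<in> ?S"
          then have "cmod s \<le> R" using R by simp
          then show "1 \<le> dist y s" using that norm_triangle_sub[of y s] by (simp add: dist_norm)
        qed
        then have "1 * 1 \<le> real (Suc n) * infdist y ?S" by (intro mult_mono) auto
        then show ?thesis by (simp add: F_def)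
      qed
      moreover have "continuous_on UNIV (F (Suc n))" unfolding F_def[abs_def] by (intro continuous_intros)
      ultimately show ?thesis by (simp add: bounded_support_def)
    qed
    have lim: "(\<lambda>n. F (Suc n) y) \<longlonglongrightarrow> indicator ?S y" for y
    proof (cases "y \<in> ?S")
      case True then show ?thesis by (simp add: F_def)
    next
      case notin: False
      then have pos: "0 < infdist y ?S"
        using infdist_pos_not_in_closed[of ?S y] False compact_imp_closed[OF S] by simp
      obtain m :: nat where m: "1 / infdist y ?S < real m" using reals_Archimedean2 by blast
      have "F (Suc n) y = 0" if "n \<ge> m" for n
      proof -
        have "1 / infdist y ?S < real (Suc n)" using m that by simp
        then have "1 < real (Suc n) * infdist y ?S" using pos by (simp add: divide_less_eq)
        then show ?thesis by (simp add: F_def)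
      qed
      then have "\<forall>\<^sub>F n in sequentially. F (Suc n) y = 0" by (auto simp: eventually_sequentially)
      then show ?thesis using notin by (simp add: tendsto_eventually)
    qed
    have conv: "(\<lambda>n. \<integral>y. F (Suc n) y \<partial>\<nu>) \<longlonglongrightarrow> measure \<nu> ?S" if \<nu>: "prob_space \<nu>" "sets \<nu> = sets borel" for \<nu>
    proof -
      interpret \<nu>: prob_space \<nu> by fact
      note [measurable_cong] = \<nu>(2)
      have "(\<lambda>n. \<integral>y. F (Suc n) y \<partial>\<nu>) \<longlonglongrightarrow> (\<integral>y. indicator ?S y \<partial>\<nu>)"
      proof (rule integral_dominated_convergence[where w="\<lambda>_. 1"])
        show "F (Suc n) \<in> borel_measurable \<nu>" for n
          using bounded_support_measurable[OF supp[of n]] by simp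
        show "AE y in \<nu>. norm (F (Suc n) y) \<le> 1" for n
          by (intro AE_I2) (auto simp: F_def max_def infdist_nonneg)
      qed (use lim in auto)
      then show ?thesis using sets_eq_imp_space_eq[OF \<nu>(2)] by simp
    qed
    have "measure \<rho> ?S = measure \<mu> ?S"
      using LIMSEQ_unique[OF conv[OF \<rho>]] conv[OF \<mu>] int[OF supp] by simp
    then show ?thesis by (simp add: \<rho>.emeasure_eq_measure \<mu>.emeasure_eq_measure)
  qed simp
  have closed: "emeasure \<rho> S = emeasure \<mu> S" if S: "closed S" for S :: "complex set"
  proof -
    let ?A = "\<lambda>n. S \<inter> cball 0 (real n)"
    have inc: "incseq ?A" by (auto simp: incseq_def intro: order_trans)
    have un: "(\<Union>n. ?A n) = S" using real_arch_simple by auto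
    have "(\<lambda>n. emeasure \<rho> (?A n)) \<longlonglongrightarrow> emeasure \<rho> S" "(\<lambda>n. emeasure \<mu> (?A n)) \<longlonglongrightarrow> emeasure \<mu> S"
    proof -
      have rng: "range ?A \<subseteq> sets borel" using S by (auto intro!: borel_closed)
      show "(\<lambda>n. emeasure \<rho> (?A n)) \<longlonglongrightarrow> emeasure \<rho> S"
        using Lim_emeasure_incseq[OF _ inc, of \<rho>] rng unfolding un \<rho>(2) by blast
      show "(\<lambda>n. emeasure \<mu> (?A n)) \<longlonglongrightarrow> emeasure \<mu> S"
        using Lim_emeasure_incseq[OF _ inc, of \<mu>] rng unfolding un \<mu>(2) by blast
    qed
    moreover have "emeasure \<rho> (?A n) = emeasure \<mu> (?A n)" for n
      using S by (intro compact closed_Int_compact) auto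
    ultimately show ?thesis using LIMSEQ_unique by simp
  qed
  show ?thesis
  proof (rule measure_eqI_generator_eq[where E="Collect closed" and \<Omega>=UNIV and A="\<lambda>_. UNIV"])
    show "Int_stable (Collect closed :: complex set set)" by (auto simp: Int_stable_def)
    show "sets \<rho> = sigma_sets UNIV (Collect closed)" "sets \<mu> = sigma_sets UNIV (Collect closed)"
      unfolding \<rho>(2) \<mu>(2) borel_eq_closed by simp_all
  qed (use closed in \<open>auto simp: \<rho>.emeasure_eq_measure\<close>)
qed

section \<open>From potentials to weak convergence\<close>

text \<open>By Jensen's formula, the mean of \<open>ln \<bar>y - z\<bar>\<close> over \<open>z\<close> on the circle of centre \<open>a\<close> and radius \<open>r\<close>.\<close>
definition log_max :: "complex \<Rightarrow> real \<Rightarrow> complex \<Rightarrow> real" where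
  "log_max a r y = ln (max (cmod (y - a)) r)"

definition circle_mean :: "(complex \<Rightarrow> real) \<Rightarrow> complex \<Rightarrow> real \<Rightarrow> real" where
  "circle_mean u a r = (\<integral>\<theta>. u (a + of_real r * cis \<theta>) \<partial>circ)"

lemma tent_eq_log_max: "tent r (y - a) = log_max a (2 * r) y - log_max a r y"
  by (simp add: tent_def log_max_def)

lemma log_max_measurable [measurable]: "log_max a r \<in> borel_measurable borel"
  unfolding log_max_def[abs_def] by measurable

lemma cis_measurable [measurable]: "cis \<in> borel_measurable borel"
  by (intro borel_measurable_continuous_onI continuous_intros)

definition cutoff :: "real \<Rightarrow> complex \<Rightarrow> real" where
  "cutoff R y = max 0 (min 1 (R + 1 - cmod y))"

lemma cutoff_bounds: "0 \<le> cutoff R y" "cutoff R y \<le> 1" "cmod y \<le> R \<Longrightarrow> cutoff R y = 1"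
  by (auto simp: cutoff_def)

lemma bounded_support_cutoff_mult:
  assumes "continuous_on UNIV f" shows "bounded_support (R + 1) (\<lambda>y. f y * cutoff R y)"
  unfolding bounded_support_def cutoff_def
  by (intro conjI continuous_intros assms allI impI) auto

lemma integral_cutoff_tendsto:
  assumes \<rho>: "prob_space \<rho>" "sets \<rho> = sets borel" and f: "continuous_on UNIV f" "\<And>y. \<bar>f y\<bar> \<le> B"
  shows "(\<lambda>n. \<integral>y. f y * cutoff (real n) y \<partial>\<rho>) \<longlonglongrightarrow> (\<integral>y. f y \<partial>\<rho>)"
proof -
  interpret prob_space \<rho> by fact
  note [measurable_cong] = \<rho>(2)
  have [measurable]: "f \<in> borel_measurable borel" using f(1) by (rule borel_measurable_continuous_onI)
  show ?thesis
  proof (rule integral_dominated_convergence[where w="\<lambda>_. B"])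
    show "(\<lambda>y. f y * cutoff (real n) y) \<in> borel_measurable \<rho>" for n unfolding cutoff_def by measurable
    show "AE y in \<rho>. (\<lambda>n. f y * cutoff (real n) y) \<longlonglongrightarrow> f y"
    proof (rule AE_I2)
      fix y
      obtain m where m: "cmod y \<le> real m" using real_arch_simple by blast
      have "f y * cutoff (real n) y = f y" if "n \<ge> m" for n
        using cutoff_bounds(3)[where R="real n" and y=y] m that by simp
      then show "(\<lambda>n. f y * cutoff (real n) y) \<longlonglongrightarrow> f y"
        by (intro tendsto_eventually) (auto simp: eventually_sequentially)
    qed
    show "AE y in \<rho>. norm (f y * cutoff (real n) y) \<le> B" for n
    proof (rule AE_I2)
      fix y
      have "\<bar>f y\<bar> * \<bar>cutoff (real n) y\<bar> \<le> \<bar>f y\<bar> * 1" using cutoff_bounds[where R="real n" and y=y] by (intro mult_left_mono) auto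
      then show "norm (f y * cutoff (real n) y) \<le> B" using f(2)[of y] by (simp add: abs_mult)
    qed
  qed auto
qed

text \<open>The interface between the two halves of the proof: \<open>X N\<close> is the potential of the random measure
  \<open>L N\<close>, expressed through circle means, and it converges in mean to \<open>U\<close> at every point. The index
  \<open>0\<close> is excluded because the empirical measure of an empty matrix is meaningless.\<close>
locale random_potentials =
  fixes P :: "nat \<Rightarrow> 'w measure" and L :: "nat \<Rightarrow> 'w \<Rightarrow> complex measure"
    and X :: "nat \<Rightarrow> complex \<Rightarrow> 'w \<Rightarrow> real" and U :: "complex \<Rightarrow> real"
  assumes P_prob: "\<And>N. prob_space (P N)"
    and L_prob: "\<And>N \<omega>. N > 0 \<Longrightarrow> prob_space (L N \<omega>)" and L_sets: "\<And>N \<omega>. N > 0 \<Longrightarrow> sets (L N \<omega>) = sets borel"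
    and X_meas: "\<And>N. N > 0 \<Longrightarrow> (\<lambda>p. X N (fst p) (snd p)) \<in> borel_measurable (borel \<Otimes>\<^sub>M P N)"
    and X_circ: "\<And>N a r \<omega>. N > 0 \<Longrightarrow> \<omega> \<in> space (P N) \<Longrightarrow> r > 0 \<Longrightarrow> integrable circ (\<lambda>\<theta>. X N (a + of_real r * cis \<theta>) \<omega>)"
    and L_int: "\<And>N a r \<omega>. N > 0 \<Longrightarrow> \<omega> \<in> space (P N) \<Longrightarrow> r > 0 \<Longrightarrow> integrable (L N \<omega>) (log_max a r)"
    and L_eq: "\<And>N a r \<omega>. N > 0 \<Longrightarrow> \<omega> \<in> space (P N) \<Longrightarrow> r > 0 \<Longrightarrow>
        (\<integral>y. log_max a r y \<partial>L N \<omega>) = circle_mean (\<lambda>z. X N z \<omega>) a r"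
    and U_meas [measurable]: "U \<in> borel_measurable borel"
    and U_bdd: "\<And>R. \<exists>B. \<forall>z. cmod z \<le> R \<longrightarrow> \<bar>U z\<bar> \<le> B"
    and X_integrable: "\<And>N z. N > 0 \<Longrightarrow> integrable (P N) (X N z)"
    and X_bdd: "\<And>R. \<exists>B. \<forall>N>0. \<forall>z. cmod z \<le> R \<longrightarrow> (\<integral>\<omega>. \<bar>X N z \<omega> - U z\<bar> \<partial>P N) \<le> B"
    and X_lim: "\<And>z. (\<lambda>N. \<integral>\<omega>. \<bar>X N z \<omega> - U z\<bar> \<partial>P N) \<longlonglongrightarrow> 0"
begin

lemma U_circ_integrable: "integrable circ (\<lambda>\<theta>. U (a + of_real r * cis \<theta>))"
proof -
  interpret prob_space circ by (rule prob_space_circ)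
  obtain B where B: "\<And>z. cmod z \<le> cmod a + \<bar>r\<bar> \<Longrightarrow> \<bar>U z\<bar> \<le> B" using U_bdd by blast
  have "cmod (a + of_real r * cis \<theta>) \<le> cmod a + \<bar>r\<bar>" for \<theta>
    using norm_triangle_ineq[of a "of_real r * cis \<theta>"] by (simp add: norm_mult)
  then show ?thesis by (intro integrable_const_bound[where B=B]) (auto intro: B)
qed

lemma X_circle_measurable:
  assumes "N > 0"
  shows "(\<lambda>p. X N (a + of_real r * cis (fst p)) (snd p)) \<in> borel_measurable (circ \<Otimes>\<^sub>M P N)"
proof -
  have "(\<lambda>p. (a + of_real r * cis (fst p), snd p)) \<in> circ \<Otimes>\<^sub>M P N \<rightarrow>\<^sub>M borel \<Otimes>\<^sub>M P N" by measurable
  from measurable_compose[OF this X_meas[OF assms]] show ?thesis by simp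
qed

lemma circle_mean_X_measurable:
  assumes "N > 0"
  shows "(\<lambda>p. circle_mean (\<lambda>z. X N z (snd p)) (fst p) r) \<in> borel_measurable (borel \<Otimes>\<^sub>M P N)"
proof -
  interpret circ: prob_space circ by (rule prob_space_circ)
  have "(\<lambda>q. (fst (fst q) + of_real r * cis (snd q), snd (fst q))) \<in> (borel \<Otimes>\<^sub>M P N) \<Otimes>\<^sub>M circ \<rightarrow>\<^sub>M borel \<Otimes>\<^sub>M P N" by measurable
  from measurable_compose[OF this X_meas[OF assms]]
  have "(\<lambda>(p, \<theta>). X N (fst p + of_real r * cis \<theta>) (snd p)) \<in> borel_measurable ((borel \<Otimes>\<^sub>M P N) \<Otimes>\<^sub>M circ)"
    by (simp add: split_beta')
  then show ?thesis unfolding circle_mean_def by (rule circ.borel_measurable_lebesgue_integral)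
qed

text \<open>Fubini and dominated convergence on the circle.\<close>
lemma circle_mean_X_tendsto:
  assumes r: "r > 0"
  shows "N > 0 \<Longrightarrow> integrable (P N) (\<lambda>\<omega>. circle_mean (\<lambda>z. X N z \<omega>) a r)"
    and "(\<lambda>N. \<integral>\<omega>. \<bar>circle_mean (\<lambda>z. X N z \<omega>) a r - circle_mean U a r\<bar> \<partial>P N) \<longlonglongrightarrow> 0"
proof -
  interpret circ: prob_space circ by (rule prob_space_circ)
  let ?z = "\<lambda>\<theta>. a + of_real r * cis \<theta>"
  define h where "h N \<theta> = (\<integral>\<omega>. \<bar>X N (?z \<theta>) \<omega> - U (?z \<theta>)\<bar> \<partial>P N)" for N \<theta>
  from X_bdd[of "cmod a + r"] obtain B
    where "\<forall>N>0. \<forall>z. cmod z \<le> cmod a + r \<longrightarrow> (\<integral>\<omega>. \<bar>X N z \<omega> - U z\<bar> \<partial>P N) \<le> B" by (elim exE)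
  then have B: "\<And>N z. N > 0 \<Longrightarrow> cmod z \<le> cmod a + r \<Longrightarrow> (\<integral>\<omega>. \<bar>X N z \<omega> - U z\<bar> \<partial>P N) \<le> B" by simp
  have zb: "cmod (?z \<theta>) \<le> cmod a + r" for \<theta>
    using norm_triangle_ineq[of a "of_real r * cis \<theta>"] r by (simp add: norm_mult)
  have hb: "0 \<le> h N \<theta> \<and> h N \<theta> \<le> B" if "N > 0" for N \<theta>
    unfolding h_def using B[OF that zb] by (auto intro: integral_nonneg_AE)
  have main: "integrable (P N) (\<lambda>\<omega>. circle_mean (\<lambda>z. X N z \<omega>) a r) \<and> h N \<in> borel_measurable circ \<and>
      (\<integral>\<omega>. \<bar>circle_mean (\<lambda>z. X N z \<omega>) a r - circle_mean U a r\<bar> \<partial>P N) \<le> (\<integral>\<theta>. h N \<theta> \<partial>circ)" if N: "N > 0" for N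
  proof -
    interpret PN: prob_space "P N" by (rule P_prob)
    interpret pair_prob_space circ "P N" ..
    note [measurable] = X_circle_measurable[OF N]
    let ?D = "\<lambda>(\<theta>, \<omega>). X N (?z \<theta>) \<omega> - U (?z \<theta>)"
    have Dm: "?D \<in> borel_measurable (circ \<Otimes>\<^sub>M P N)" unfolding split_beta' by measurable
    have hm: "h N \<in> borel_measurable circ"
      unfolding h_def[abs_def]
      by (rule PN.borel_measurable_lebesgue_integral) (use borel_measurable_abs[OF Dm] in \<open>simp add: split_beta'\<close>)
    have hi: "integrable circ (h N)"
      by (rule circ.integrable_const_bound[where B=B]) (use hb[OF N] hm in auto)
    have DI: "integrable (circ \<Otimes>\<^sub>M P N) ?D"
    proof (rule Fubini_integrable[OF Dm])
      show "integrable circ (\<lambda>\<theta>. \<integral>\<omega>. norm (?D (\<theta>, \<omega>)) \<partial>P N)" using hi by (simp add: h_def[abs_def])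
      show "AE \<theta> in circ. integrable (P N) (\<lambda>\<omega>. ?D (\<theta>, \<omega>))" using X_integrable[OF N] by simp
    qed
    have DA: "integrable (circ \<Otimes>\<^sub>M P N) (\<lambda>(\<theta>, \<omega>). \<bar>X N (?z \<theta>) \<omega> - U (?z \<theta>)\<bar>)"
      using integrable_abs[OF DI] by (simp add: split_beta')
    have eq: "circle_mean (\<lambda>z. X N z \<omega>) a r - circle_mean U a r = (\<integral>\<theta>. X N (?z \<theta>) \<omega> - U (?z \<theta>) \<partial>circ)" if "\<omega> \<in> space (P N)" for \<omega>
      unfolding circle_mean_def using X_circ[OF N that r] U_circ_integrable by (intro Bochner_Integration.integral_diff[symmetric])
    have i1: "integrable (P N) (\<lambda>\<omega>. circle_mean (\<lambda>z. X N z \<omega>) a r - circle_mean U a r)"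
      using integrable_snd[OF DI] by (subst Bochner_Integration.integrable_cong[OF refl eq]) auto
    then have "integrable (P N) (\<lambda>\<omega>. (circle_mean (\<lambda>z. X N z \<omega>) a r - circle_mean U a r) + circle_mean U a r)"
      by (intro Bochner_Integration.integrable_add) auto
    then have i2: "integrable (P N) (\<lambda>\<omega>. circle_mean (\<lambda>z. X N z \<omega>) a r)" by simp
    have "(\<integral>\<omega>. \<bar>circle_mean (\<lambda>z. X N z \<omega>) a r - circle_mean U a r\<bar> \<partial>P N) \<le> (\<integral>\<omega>. (\<integral>\<theta>. \<bar>X N (?z \<theta>) \<omega> - U (?z \<theta>)\<bar> \<partial>circ) \<partial>P N)"
    proof (rule integral_mono)
      show "integrable (P N) (\<lambda>\<omega>. \<bar>circle_mean (\<lambda>z. X N z \<omega>) a r - circle_mean U a r\<bar>)" using i1 by simp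
      show "integrable (P N) (\<lambda>\<omega>. \<integral>\<theta>. \<bar>X N (?z \<theta>) \<omega> - U (?z \<theta>)\<bar> \<partial>circ)" by (rule integrable_snd[OF DA])
      fix \<omega> assume \<omega>: "\<omega> \<in> space (P N)"
      show "\<bar>circle_mean (\<lambda>z. X N z \<omega>) a r - circle_mean U a r\<bar> \<le> (\<integral>\<theta>. \<bar>X N (?z \<theta>) \<omega> - U (?z \<theta>)\<bar> \<partial>circ)"
        unfolding eq[OF \<omega>] by (rule integral_abs_bound)
    qed
    also have "\<dots> = (\<integral>\<theta>. h N \<theta> \<partial>circ)" unfolding h_def by (rule Fubini_integral[OF DA])
    finally show ?thesis using i2 hm by simp
  qed
  show "N > 0 \<Longrightarrow> integrable (P N) (\<lambda>\<omega>. circle_mean (\<lambda>z. X N z \<omega>) a r)" using main by blast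
  have hlim: "(\<lambda>N. \<integral>\<theta>. h (Suc N) \<theta> \<partial>circ) \<longlonglongrightarrow> (\<integral>\<theta>. 0 \<partial>circ)"
  proof (rule integral_dominated_convergence[where w="\<lambda>_. B"])
    show "h (Suc N) \<in> borel_measurable circ" for N using main by simp
    show "AE \<theta> in circ. (\<lambda>N. h (Suc N) \<theta>) \<longlonglongrightarrow> 0"
      unfolding h_def using X_lim by (intro AE_I2 LIMSEQ_Suc)
    show "AE \<theta> in circ. norm (h (Suc N) \<theta>) \<le> B" for N using hb[of "Suc N"] by simp
  qed auto
  have "(\<lambda>N. \<integral>\<omega>. \<bar>circle_mean (\<lambda>z. X (Suc N) z \<omega>) a r - circle_mean U a r\<bar> \<partial>P (Suc N)) \<longlonglongrightarrow> 0"
  proof (rule tendsto_sandwich[OF _ _ tendsto_const])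
    show "\<forall>\<^sub>F N in sequentially. 0 \<le> (\<integral>\<omega>. \<bar>circle_mean (\<lambda>z. X (Suc N) z \<omega>) a r - circle_mean U a r\<bar> \<partial>P (Suc N))"
      by (intro always_eventually allI integral_nonneg_AE) auto
    show "\<forall>\<^sub>F N in sequentially. (\<integral>\<omega>. \<bar>circle_mean (\<lambda>z. X (Suc N) z \<omega>) a r - circle_mean U a r\<bar> \<partial>P (Suc N)) \<le> (\<integral>\<theta>. h (Suc N) \<theta> \<partial>circ)"
      using main by (intro always_eventually allI) simp
  qed (use hlim in simp)
  then show "(\<lambda>N. \<integral>\<omega>. \<bar>circle_mean (\<lambda>z. X N z \<omega>) a r - circle_mean U a r\<bar> \<partial>P N) \<longlonglongrightarrow> 0"
    by (rule LIMSEQ_imp_Suc)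
qed

lemma tent_integral_L:
  assumes "N > 0" "\<omega> \<in> space (P N)" "r > 0"
  shows "tent_integral (L N \<omega>) r a = circle_mean (\<lambda>z. X N z \<omega>) a (2 * r) - circle_mean (\<lambda>z. X N z \<omega>) a r"
proof -
  have "2 * r > 0" using assms by simp
  then show ?thesis
    unfolding tent_integral_def tent_eq_log_max using L_int[OF assms(1,2)] L_eq[OF assms(1,2)] assms(3) by simp
qed

lemma tent_integral_L_measurable:
  assumes "N > 0" "r > 0"
  shows "(\<lambda>p. tent_integral (L N (snd p)) r (fst p)) \<in> borel_measurable (borel \<Otimes>\<^sub>M P N)"
proof -
  have "(\<lambda>p. tent_integral (L N (snd p)) r (fst p)) \<in> borel_measurable (borel \<Otimes>\<^sub>M P N) \<longleftrightarrow>
    (\<lambda>p. circle_mean (\<lambda>z. X N z (snd p)) (fst p) (2 * r) - circle_mean (\<lambda>z. X N z (snd p)) (fst p) r) \<in> borel_measurable (borel \<Otimes>\<^sub>M P N)"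
    using assms by (intro measurable_cong tent_integral_L) (auto simp: space_pair_measure)
  then show ?thesis using circle_mean_X_measurable[OF assms(1)] by (simp add: borel_measurable_diff)
qed

text \<open>Measurability in \<open>\<omega>\<close> passes from the potentials to the tents, hence to smoothed functions and their
  limits, so the eigenvalues need not be chosen measurably.\<close>
lemma integral_bounded_support_measurable:
  assumes N: "N > 0" and f: "bounded_support R f"
  shows "(\<lambda>\<omega>. \<integral>y. f y \<partial>L N \<omega>) \<in> borel_measurable (P N)"
proof (rule borel_measurable_LIMSEQ_real)
  let ?r = "\<lambda>n. inverse (real (Suc n))"
  note [measurable] = bounded_support_measurable[OF f]
  interpret PN: prob_space "P N" by (rule P_prob)
  fix \<omega> assume \<omega>: "\<omega> \<in> space (P N)"
  show "(\<lambda>n. \<integral>y. smoothing f (?r n) y \<partial>L N \<omega>) \<longlonglongrightarrow> (\<integral>y. f y \<partial>L N \<omega>)"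
  proof (rule LIMSEQ_I)
    fix e :: real assume e: "e > 0"
    then have "0 < e / 2" by simp
    from bounded_support_uniformly_continuous[OF f this]
    obtain d where d: "d > 0" "\<And>a y. cmod (a - y) < d \<Longrightarrow> \<bar>f a - f y\<bar> < e / 2" by blast
    have "(\<lambda>n. 2 * ?r n) \<longlonglongrightarrow> 2 * 0" by (intro tendsto_intros LIMSEQ_inverse_real_of_nat)
    then have "\<forall>\<^sub>F n in sequentially. 2 * ?r n < d" using d(1) by (intro order_tendstoD) auto
    then obtain n0 where n0: "\<And>n. n \<ge> n0 \<Longrightarrow> 2 * ?r n < d" by (auto simp: eventually_sequentially)
    have "norm ((\<integral>y. smoothing f (?r n) y \<partial>L N \<omega>) - (\<integral>y. f y \<partial>L N \<omega>)) < e" if "n \<ge> n0" for n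
    proof -
      have "\<bar>(\<integral>y. f y \<partial>L N \<omega>) - (\<integral>y. smoothing f (?r n) y \<partial>L N \<omega>)\<bar> \<le> e / 2"
        by (rule integral_diff_smoothing_le[OF L_prob[OF N] L_sets[OF N] f])
          (use n0[OF that] d(2) in \<open>auto intro: less_imp_le dest: order_less_trans\<close>)
      then show ?thesis using e by (simp add: abs_minus_commute)
    qed
    then show "\<exists>n0. \<forall>n\<ge>n0. norm ((\<integral>y. smoothing f (?r n) y \<partial>L N \<omega>) - (\<integral>y. f y \<partial>L N \<omega>)) < e" by blast
  qed
next
  let ?r = "\<lambda>n. inverse (real (Suc n))"
  note [measurable] = bounded_support_measurable[OF f]
  fix n
  note [measurable] = tent_integral_L_measurable[OF N, of "?r n"]
  have "(\<lambda>p. f (fst p) * tent_integral (L N (snd p)) (?r n) (fst p)) \<in> borel_measurable (borel \<Otimes>\<^sub>M P N)"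
    by (intro borel_measurable_times tent_integral_L_measurable[OF N]) measurable
  then have "(\<lambda>p. f (snd p) * tent_integral (L N (fst p)) (?r n) (snd p)) \<in> borel_measurable (P N \<Otimes>\<^sub>M borel)"
  proof -
    assume A: "(\<lambda>p. f (fst p) * tent_integral (L N (snd p)) (?r n) (fst p)) \<in> borel_measurable (borel \<Otimes>\<^sub>M P N)"
    have "(\<lambda>q. (snd q, fst q)) \<in> P N \<Otimes>\<^sub>M borel \<rightarrow>\<^sub>M borel \<Otimes>\<^sub>M P N" by measurable
    from measurable_compose[OF this A] show ?thesis by simp
  qed
  then have "(\<lambda>\<omega>. \<integral>a. f a * tent_integral (L N \<omega>) (?r n) a \<partial>lborel) \<in> borel_measurable (P N)"
    by (intro lborel.borel_measurable_lebesgue_integral) (simp add: split_beta' cong: measurable_cong_sets sets_pair_measure_cong)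
  then show "(\<lambda>\<omega>. \<integral>y. smoothing f (?r n) y \<partial>L N \<omega>) \<in> borel_measurable (P N)"
    using integral_smoothing(2)[OF L_prob[OF N] L_sets[OF N] f, of "?r n"] by simp
qed

lemma tent_integral_L_tendsto:
  assumes r: "r > 0"
  shows "N > 0 \<Longrightarrow> integrable (P N) (\<lambda>\<omega>. \<bar>tent_integral (L N \<omega>) r a - (circle_mean U a (2 * r) - circle_mean U a r)\<bar>)"
    and "(\<lambda>N. \<integral>\<omega>. \<bar>tent_integral (L N \<omega>) r a - (circle_mean U a (2 * r) - circle_mean U a r)\<bar> \<partial>P N) \<longlonglongrightarrow> 0"
proof -
  have r2: "2 * r > 0" using r by simp
  let ?E = "\<lambda>r N \<omega>. \<bar>circle_mean (\<lambda>z. X N z \<omega>) a r - circle_mean U a r\<bar>"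
  let ?T = "\<lambda>N \<omega>. \<bar>tent_integral (L N \<omega>) r a - (circle_mean U a (2 * r) - circle_mean U a r)\<bar>"
  have iE: "integrable (P N) (?E r N)" "integrable (P N) (?E (2 * r) N)" if "N > 0" for N
  proof -
    interpret prob_space "P N" by (rule P_prob)
    show "integrable (P N) (?E r N)" "integrable (P N) (?E (2 * r) N)"
      using circle_mean_X_tendsto(1)[OF r that, of a] circle_mean_X_tendsto(1)[OF r2 that, of a] by auto
  qed
  have iT: "integrable (P N) (?T N)" if N: "N > 0" for N
  proof -
    interpret prob_space "P N" by (rule P_prob)
    have "integrable (P N) (\<lambda>\<omega>. \<bar>circle_mean (\<lambda>z. X N z \<omega>) a (2 * r) - circle_mean (\<lambda>z. X N z \<omega>) a r - (circle_mean U a (2 * r) - circle_mean U a r)\<bar>)"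
      using circle_mean_X_tendsto(1)[OF r N, of a] circle_mean_X_tendsto(1)[OF r2 N, of a] by auto
    then show ?thesis by (subst Bochner_Integration.integrable_cong[OF refl]) (auto simp: tent_integral_L[OF N _ r])
  qed
  then show "N > 0 \<Longrightarrow> integrable (P N) (?T N)" .
  show "(\<lambda>N. \<integral>\<omega>. ?T N \<omega> \<partial>P N) \<longlonglongrightarrow> 0"
  proof (rule tendsto_sandwich[OF _ _ tendsto_const])
    show "\<forall>\<^sub>F N in sequentially. 0 \<le> (\<integral>\<omega>. ?T N \<omega> \<partial>P N)" by (intro always_eventually allI integral_nonneg_AE) auto
    have le: "(\<integral>\<omega>. ?T N \<omega> \<partial>P N) \<le> (\<integral>\<omega>. ?E (2 * r) N \<omega> \<partial>P N) + (\<integral>\<omega>. ?E r N \<omega> \<partial>P N)" if N: "N > 0" for N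
    proof -
      have "(\<integral>\<omega>. ?T N \<omega> \<partial>P N) \<le> (\<integral>\<omega>. ?E (2 * r) N \<omega> + ?E r N \<omega> \<partial>P N)"
      proof (rule integral_mono[OF iT[OF N] Bochner_Integration.integrable_add[OF iE(2)[OF N] iE(1)[OF N]]])
        show "?T N \<omega> \<le> ?E (2 * r) N \<omega> + ?E r N \<omega>" if "\<omega> \<in> space (P N)" for \<omega>
          unfolding tent_integral_L[OF N that r] by linarith
      qed
      then show ?thesis using iE[OF N] by simp
    qed
    show "\<forall>\<^sub>F N in sequentially. (\<integral>\<omega>. ?T N \<omega> \<partial>P N) \<le> (\<integral>\<omega>. ?E (2 * r) N \<omega> \<partial>P N) + (\<integral>\<omega>. ?E r N \<omega> \<partial>P N)"
      by (rule eventually_mono[OF eventually_gt_at_top[of 0]]) (rule le)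
    show "(\<lambda>N. (\<integral>\<omega>. ?E (2 * r) N \<omega> \<partial>P N) + (\<integral>\<omega>. ?E r N \<omega> \<partial>P N)) \<longlonglongrightarrow> 0"
      using tendsto_add[OF circle_mean_X_tendsto(2)[OF r2, of a] circle_mean_X_tendsto(2)[OF r, of a]] by simp
  qed
qed

text \<open>Up to an error \<open>e\<close>, uniform in the measures, both integrals are integrals of tents over their centres;
  the tents converge in mean at each centre, and dominated convergence applies on the support of \<open>f\<close>.\<close>
lemma integral_bounded_support_tendsto:
  assumes \<mu>: "prob_space \<mu>" "sets \<mu> = sets borel"
    and eq: "\<And>r a. r > 0 \<Longrightarrow> tent_integral \<mu> r a = circle_mean U a (2 * r) - circle_mean U a r"
    and f: "bounded_support R f"
  shows "(\<lambda>N. \<integral>\<omega>. \<bar>(\<integral>y. f y \<partial>L N \<omega>) - (\<integral>y. f y \<partial>\<mu>)\<bar> \<partial>P N) \<longlonglongrightarrow> 0"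
proof -
  have fi: "integrable lborel f" by (rule bounded_support_integrable[OF f])
  note [measurable] = bounded_support_measurable[OF f]
  obtain B where B: "B \<ge> 0" "\<And>y. \<bar>f y\<bar> \<le> B" using bounded_support_bounded[OF f] by blast
  have fb: "\<bar>\<integral>y. f y \<partial>\<rho>\<bar> \<le> B" if \<rho>: "prob_space \<rho>" "sets \<rho> = sets borel" for \<rho>
  proof -
    interpret \<rho>: prob_space \<rho> by fact
    note [measurable_cong] = \<rho>(2)
    have "integrable \<rho> f" by (rule \<rho>.integrable_const_bound[where B=B]) (use B in auto)
    then have 1: "(\<integral>y. \<bar>f y\<bar> \<partial>\<rho>) \<le> (\<integral>y. B \<partial>\<rho>)" using B by (intro integral_mono) auto
    have "\<bar>\<integral>y. f y \<partial>\<rho>\<bar> \<le> (\<integral>y. \<bar>f y\<bar> \<partial>\<rho>)" by (rule integral_abs_bound)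
    moreover have "(\<integral>y. B \<partial>\<rho>) = B" by (simp add: \<rho>.prob_space)
    ultimately show ?thesis using 1 by linarith
  qed
  have main: "\<forall>\<^sub>F N in sequentially. (\<integral>\<omega>. \<bar>(\<integral>y. f y \<partial>L (Suc N) \<omega>) - (\<integral>y. f y \<partial>\<mu>)\<bar> \<partial>P (Suc N)) < 2 * e" if e: "e > 0" for e
  proof -
    have "0 < e / 2" using e by simp
    from bounded_support_uniformly_continuous[OF f this]
    obtain d where d: "d > 0" "\<And>a y. cmod (a - y) < d \<Longrightarrow> \<bar>f a - f y\<bar> < e / 2" by blast
    define r where "r = d / 2"
    have r: "r > 0" "2 * r = d" using d by (auto simp: r_def)
    have c: "tent_mass r > 0" by (rule tent_mass_pos[OF r(1)])
    define h where "h N a = (\<integral>\<omega>. \<bar>tent_integral (L N \<omega>) r a - tent_integral \<mu> r a\<bar> \<partial>P N)" for N a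
    note [measurable] = tent_integral_measurable[OF \<mu>]
    have diff_le: "\<bar>tent_integral (L N \<omega>) r a - tent_integral \<mu> r a\<bar> \<le> ln 2" if "N > 0" for N \<omega> a
      using tent_integral_bounds(2,3)[OF L_prob[OF that] L_sets[OF that] r(1), of \<omega> a] tent_integral_bounds(2,3)[OF \<mu> r(1), of a] by linarith
    have step: "h N \<in> borel_measurable borel \<and> (\<forall>a. 0 \<le> h N a \<and> h N a \<le> ln 2) \<and>
        (\<integral>\<omega>. \<bar>(\<integral>y. f y \<partial>L N \<omega>) - (\<integral>y. f y \<partial>\<mu>)\<bar> \<partial>P N) \<le> e + (\<integral>a. \<bar>f a\<bar> * h N a \<partial>lborel) / tent_mass r" if N: "N > 0" for N
    proof -
      interpret PN: prob_space "P N" by (rule P_prob)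
      interpret pair_sigma_finite lborel "P N" ..
      note [measurable] = tent_integral_L_measurable[OF N r(1)] integral_bounded_support_measurable[OF N f]
      have Dm: "(\<lambda>p. \<bar>tent_integral (L N (snd p)) r (fst p) - tent_integral \<mu> r (fst p)\<bar>) \<in> borel_measurable (borel \<Otimes>\<^sub>M P N)"
        by measurable
      have hm: "h N \<in> borel_measurable borel"
        unfolding h_def[abs_def] by (rule PN.borel_measurable_lebesgue_integral) (use Dm in \<open>simp add: split_beta'\<close>)
      have sect: "(\<lambda>\<omega>. \<bar>tent_integral (L N \<omega>) r a - tent_integral \<mu> r a\<bar>) \<in> borel_measurable (P N)" for a
        using measurable_compose[OF measurable_Pair1'[of a borel "P N"] Dm] by simp
      have si: "integrable (P N) (\<lambda>\<omega>. \<bar>tent_integral (L N \<omega>) r a - tent_integral \<mu> r a\<bar>)" for a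
        by (rule PN.integrable_const_bound[where B="ln 2"]) (use sect diff_le[OF N] in auto)
      have hb: "0 \<le> h N a \<and> h N a \<le> ln 2" for a
      proof -
        have "h N a \<le> (\<integral>\<omega>. ln 2 \<partial>P N)" unfolding h_def by (intro integral_mono si) (use diff_le[OF N] in auto)
        moreover have "0 \<le> h N a" unfolding h_def by (intro integral_nonneg_AE) auto
        ultimately show ?thesis by (simp add: PN.prob_space)
      qed
      let ?F = "\<lambda>(a, \<omega>). \<bar>f a\<bar> * \<bar>tent_integral (L N \<omega>) r a - tent_integral \<mu> r a\<bar>"
      have hi: "integrable lborel (\<lambda>a. \<bar>f a\<bar> * h N a)"
      proof (rule Bochner_Integration.integrable_bound)
        show "integrable lborel (\<lambda>a. f a * ln 2)" using fi by simp
        show "AE a in lborel. norm (\<bar>f a\<bar> * h N a) \<le> norm (f a * ln 2)"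
          using hb by (intro AE_I2) (simp add: abs_mult mult_left_mono)
      qed (use hm in measurable)
      have FI: "integrable (lborel \<Otimes>\<^sub>M P N) ?F"
      proof (rule Fubini_integrable)
        have "(\<lambda>p. \<bar>f (fst p)\<bar> * \<bar>tent_integral (L N (snd p)) r (fst p) - tent_integral \<mu> r (fst p)\<bar>) \<in> borel_measurable (borel \<Otimes>\<^sub>M P N)"
          by (intro borel_measurable_times Dm) measurable
        then show "?F \<in> borel_measurable (lborel \<Otimes>\<^sub>M P N)" by (simp add: split_beta' cong: measurable_cong_sets sets_pair_measure_cong)
        show "integrable lborel (\<lambda>a. \<integral>\<omega>. norm (?F (a, \<omega>)) \<partial>P N)" using hi by (simp add: h_def abs_mult)
        show "AE a in lborel. integrable (P N) (\<lambda>\<omega>. ?F (a, \<omega>))" using si by simp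
      qed
      have "(\<integral>\<omega>. \<bar>(\<integral>y. f y \<partial>L N \<omega>) - (\<integral>y. f y \<partial>\<mu>)\<bar> \<partial>P N) \<le> (\<integral>\<omega>. e + (\<integral>a. ?F (a, \<omega>) \<partial>lborel) / tent_mass r \<partial>P N)"
      proof (rule integral_mono)
        show "integrable (P N) (\<lambda>\<omega>. \<bar>(\<integral>y. f y \<partial>L N \<omega>) - (\<integral>y. f y \<partial>\<mu>)\<bar>)"
        proof (rule PN.integrable_const_bound[where B="2 * B"])
          show "AE \<omega> in P N. norm \<bar>(\<integral>y. f y \<partial>L N \<omega>) - (\<integral>y. f y \<partial>\<mu>)\<bar> \<le> 2 * B"
          proof (rule AE_I2)
            fix \<omega>
            show "norm \<bar>(\<integral>y. f y \<partial>L N \<omega>) - (\<integral>y. f y \<partial>\<mu>)\<bar> \<le> 2 * B"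
              using fb[OF L_prob[OF N] L_sets[OF N], of \<omega>] fb[OF \<mu>] by simp
          qed
        qed measurable
        show "integrable (P N) (\<lambda>\<omega>. e + (\<integral>a. ?F (a, \<omega>) \<partial>lborel) / tent_mass r)"
          using integrable_snd[OF FI] by (intro Bochner_Integration.integrable_add integrable_divide) auto
        show "\<bar>(\<integral>y. f y \<partial>L N \<omega>) - (\<integral>y. f y \<partial>\<mu>)\<bar> \<le> e + (\<integral>a. ?F (a, \<omega>) \<partial>lborel) / tent_mass r" for \<omega>
        proof -
          have "\<bar>(\<integral>y. f y \<partial>L N \<omega>) - (\<integral>y. f y \<partial>\<mu>)\<bar>
              \<le> 2 * (e / 2) + (\<integral>a. \<bar>f a\<bar> * \<bar>tent_integral (L N \<omega>) r a - tent_integral \<mu> r a\<bar> \<partial>lborel) / tent_mass r"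
            by (rule integral_bounded_support_diff_le[OF L_prob[OF N] L_sets[OF N] \<mu> f r(1)]) (use d(2) r(2) in \<open>auto intro: less_imp_le\<close>)
          then show ?thesis by simp
        qed
      qed
      also have "\<dots> = e + (\<integral>\<omega>. (\<integral>a. ?F (a, \<omega>) \<partial>lborel) \<partial>P N) / tent_mass r"
        using integrable_snd[OF FI] by (subst Bochner_Integration.integral_add) (auto simp: PN.prob_space)
      also have "(\<integral>\<omega>. (\<integral>a. ?F (a, \<omega>) \<partial>lborel) \<partial>P N) = (\<integral>a. \<bar>f a\<bar> * h N a \<partial>lborel)"
        using Fubini_integral[OF FI] by (simp add: h_def)
      finally show ?thesis using hm hb by blast
    qed
    have hm: "h N \<in> borel_measurable borel" if "N > 0" for N using step[OF that] by (elim conjE)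
    have hb: "0 \<le> h N a" "h N a \<le> ln 2" if "N > 0" for N a using step[OF that] by (elim conjE, simp)+
    have hle: "(\<integral>\<omega>. \<bar>(\<integral>y. f y \<partial>L N \<omega>) - (\<integral>y. f y \<partial>\<mu>)\<bar> \<partial>P N) \<le> e + (\<integral>a. \<bar>f a\<bar> * h N a \<partial>lborel) / tent_mass r"
      if "N > 0" for N using step[OF that] by (elim conjE)
    have hlim: "(\<lambda>N. h (Suc N) a) \<longlonglongrightarrow> 0" for a
      unfolding h_def eq[OF r(1)] by (rule LIMSEQ_Suc[OF tent_integral_L_tendsto(2)[OF r(1)]])
    have "(\<lambda>N. \<integral>a. \<bar>f a\<bar> * h (Suc N) a \<partial>lborel) \<longlonglongrightarrow> (\<integral>a. (0::real) \<partial>(lborel :: complex measure))"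
    proof (rule integral_dominated_convergence[where w="\<lambda>a. \<bar>f a\<bar> * ln 2"])
      show "(\<lambda>a. \<bar>f a\<bar> * h (Suc N) a) \<in> borel_measurable lborel" for N
        using hm[of "Suc N"] by (intro borel_measurable_times) simp_all
      show "AE a in lborel. (\<lambda>N. \<bar>f a\<bar> * h (Suc N) a) \<longlonglongrightarrow> 0"
        using hlim by (intro AE_I2 tendsto_mult_right_zero)
      show "AE a in lborel. norm (\<bar>f a\<bar> * h (Suc N) a) \<le> \<bar>f a\<bar> * ln 2" for N
        using hb[of "Suc N"] by (intro AE_I2) (simp add: abs_mult mult_left_mono)
    qed (use fi in auto)
    then have "(\<lambda>N. e + (\<integral>a. \<bar>f a\<bar> * h (Suc N) a \<partial>lborel) / tent_mass r) \<longlonglongrightarrow> e + 0 / tent_mass r"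
      using c by (intro tendsto_intros) auto
    then have "\<forall>\<^sub>F N in sequentially. e + (\<integral>a. \<bar>f a\<bar> * h (Suc N) a \<partial>lborel) / tent_mass r < 2 * e"
      using e by (intro order_tendstoD) auto
    then show ?thesis
    proof eventually_elim
      fix N assume lt: "e + (\<integral>a. \<bar>f a\<bar> * h (Suc N) a \<partial>lborel) / tent_mass r < 2 * e"
      note hle[of "Suc N", simplified]
      with lt show "(\<integral>\<omega>. \<bar>(\<integral>y. f y \<partial>L (Suc N) \<omega>) - (\<integral>y. f y \<partial>\<mu>)\<bar> \<partial>P (Suc N)) < 2 * e" by linarith
    qed
  qed
  have "(\<lambda>N. \<integral>\<omega>. \<bar>(\<integral>y. f y \<partial>L (Suc N) \<omega>) - (\<integral>y. f y \<partial>\<mu>)\<bar> \<partial>P (Suc N)) \<longlonglongrightarrow> 0"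
  proof (rule LIMSEQ_I)
    fix s :: real assume "s > 0"
    then have "0 < s / 2" by simp
    from main[OF this] obtain N0 where N0: "\<And>N. N \<ge> N0 \<Longrightarrow> (\<integral>\<omega>. \<bar>(\<integral>y. f y \<partial>L (Suc N) \<omega>) - (\<integral>y. f y \<partial>\<mu>)\<bar> \<partial>P (Suc N)) < s"
      by (auto simp: eventually_sequentially)
    moreover have "0 \<le> (\<integral>\<omega>. \<bar>(\<integral>y. f y \<partial>L (Suc N) \<omega>) - (\<integral>y. f y \<partial>\<mu>)\<bar> \<partial>P (Suc N))" for N
      by (intro integral_nonneg_AE) auto
    ultimately show "\<exists>N0. \<forall>N\<ge>N0. norm ((\<integral>\<omega>. \<bar>(\<integral>y. f y \<partial>L (Suc N) \<omega>) - (\<integral>y. f y \<partial>\<mu>)\<bar> \<partial>P (Suc N)) - 0) < s"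
      by (intro exI[of _ N0]) auto
  qed
  then show ?thesis by (rule LIMSEQ_imp_Suc)
qed

text \<open>Bounded continuous functions are reduced to functions of bounded support by a cutoff. The cutoff is a
  test function itself, so the mass that \<open>L N\<close> loses is close to the small mass that \<open>\<mu>\<close> loses. Finally
  convergence in mean implies convergence in probability by Markov's inequality.\<close>
lemma weak_convergence:
  assumes \<mu>: "prob_space \<mu>" "sets \<mu> = sets borel"
    and eq: "\<And>r a. r > 0 \<Longrightarrow> tent_integral \<mu> r a = circle_mean U a (2 * r) - circle_mean U a r"
    and L0: "\<And>\<omega>. L 0 \<omega> = L0"
  shows "weakly_converges_in_prob P L \<mu>"
  unfolding weakly_converges_in_prob_def
proof (intro allI impI, elim conjE, rule conjI)
  fix f :: "complex \<Rightarrow> real" assume f: "continuous_on UNIV f" and bdd: "bounded (range f)"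
  obtain B where "\<forall>x\<in>range f. norm x \<le> B" using bdd by (auto simp: bounded_iff)
  then have B: "\<bar>f y\<bar> \<le> B" for y by auto
  have B0: "0 \<le> B" using B[of 0] by linarith
  have fm [measurable]: "f \<in> borel_measurable borel" using f by (rule borel_measurable_continuous_onI)
  interpret \<mu>: prob_space \<mu> by fact
  have meas: "(\<lambda>\<omega>. \<integral>y. f y \<partial>L N \<omega>) \<in> borel_measurable (P N)" for N
  proof (cases "N > 0")
    case True
    show ?thesis
    proof (rule borel_measurable_LIMSEQ_real)
      show "(\<lambda>n. \<integral>y. f y * cutoff (real n) y \<partial>L N \<omega>) \<longlonglongrightarrow> (\<integral>y. f y \<partial>L N \<omega>)" for \<omega>
        by (rule integral_cutoff_tendsto[OF L_prob[OF True] L_sets[OF True] f B])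
      show "(\<lambda>\<omega>. \<integral>y. f y * cutoff (real n) y \<partial>L N \<omega>) \<in> borel_measurable (P N)" for n
        by (rule integral_bounded_support_measurable[OF True bounded_support_cutoff_mult[OF f]])
    qed
  next
    case False then show ?thesis using L0 by simp
  qed
  then show "\<forall>N. (\<lambda>\<omega>. \<integral>y. f y \<partial>L N \<omega>) \<in> borel_measurable (P N)" ..
  have one: "continuous_on UNIV (\<lambda>y::complex. 1 :: real)" by simp
  have int: "integrable \<rho> g" if "prob_space \<rho>" "sets \<rho> = sets borel" "g \<in> borel_measurable borel" "\<And>y. \<bar>g y\<bar> \<le> b" for \<rho> and g :: "complex \<Rightarrow> real" and b
  proof -
    interpret \<rho>: prob_space \<rho> by fact
    note [measurable_cong] = that(2)
    show ?thesis by (rule \<rho>.integrable_const_bound[where B=b]) (use that in auto)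
  qed
  let ?\<chi> = "\<lambda>n. cutoff (real n)"
  have cm [measurable]: "cutoff R \<in> borel_measurable borel" for R unfolding cutoff_def by measurable
  \<comment> \<open>The mass of \<open>L N\<close> far out is controlled by that of \<open>\<mu>\<close>, because the cutoff itself is a test function.\<close>
  have tail: "\<bar>(\<integral>y. f y \<partial>\<rho>) - (\<integral>y. f y * ?\<chi> n y \<partial>\<rho>)\<bar> \<le> B * (1 - (\<integral>y. 1 * ?\<chi> n y \<partial>\<rho>))"
    if \<rho>: "prob_space \<rho>" "sets \<rho> = sets borel" for \<rho> n
  proof -
    interpret \<rho>: prob_space \<rho> by fact
    have i1: "integrable \<rho> f" by (rule int[OF \<rho> fm B])
    have i2: "integrable \<rho> (\<lambda>y. f y * ?\<chi> n y)"
    proof (rule int[OF \<rho>])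
      show "\<bar>f y * ?\<chi> n y\<bar> \<le> B" for y
        using mult_mono[OF B[of y], of "\<bar>?\<chi> n y\<bar>" 1] cutoff_bounds(1,2)[where R="real n" and y=y] B0 by (simp add: abs_mult)
    qed measurable
    have i3: "integrable \<rho> (?\<chi> n)"
    proof (rule int[OF \<rho> cm])
      show "\<bar>?\<chi> n y\<bar> \<le> 1" for y using cutoff_bounds(1,2)[where R="real n" and y=y] by simp
    qed
    have "\<bar>(\<integral>y. f y \<partial>\<rho>) - (\<integral>y. f y * ?\<chi> n y \<partial>\<rho>)\<bar> = \<bar>\<integral>y. f y - f y * ?\<chi> n y \<partial>\<rho>\<bar>"
      using i1 i2 by simp
    also have "\<dots> \<le> (\<integral>y. \<bar>f y - f y * ?\<chi> n y\<bar> \<partial>\<rho>)" by (rule integral_abs_bound)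
    also have "\<dots> \<le> (\<integral>y. B * (1 - ?\<chi> n y) \<partial>\<rho>)"
    proof (rule integral_mono)
      fix y
      have "\<bar>f y - f y * ?\<chi> n y\<bar> = \<bar>f y\<bar> * (1 - ?\<chi> n y)"
        using cutoff_bounds(2)[where R="real n" and y=y] by (simp add: right_diff_distrib[symmetric, of "f y" 1, simplified] abs_mult)
      then show "\<bar>f y - f y * ?\<chi> n y\<bar> \<le> B * (1 - ?\<chi> n y)"
        using B[of y] cutoff_bounds(2)[where R="real n" and y=y] by (simp add: mult_right_mono)
    qed (use i1 i2 i3 in auto)
    also have "\<dots> = B * (1 - (\<integral>y. 1 * ?\<chi> n y \<partial>\<rho>))" using i3 by (simp add: \<rho>.prob_space)
    finally show ?thesis .
  qed
  let ?A = "\<lambda>n N. \<integral>\<omega>. \<bar>(\<integral>y. f y * ?\<chi> n y \<partial>L N \<omega>) - (\<integral>y. f y * ?\<chi> n y \<partial>\<mu>)\<bar> \<partial>P N"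
  let ?C = "\<lambda>n N. \<integral>\<omega>. \<bar>(\<integral>y. 1 * ?\<chi> n y \<partial>L N \<omega>) - (\<integral>y. 1 * ?\<chi> n y \<partial>\<mu>)\<bar> \<partial>P N"
  let ?t = "\<lambda>n. 1 - (\<integral>y. 1 * ?\<chi> n y \<partial>\<mu>)"
  let ?E = "\<lambda>N. \<integral>\<omega>. \<bar>(\<integral>y. f y \<partial>L N \<omega>) - (\<integral>y. f y \<partial>\<mu>)\<bar> \<partial>P N"
  have Ei: "integrable (P N) (\<lambda>\<omega>. \<bar>(\<integral>y. f y \<partial>L N \<omega>) - (\<integral>y. f y \<partial>\<mu>)\<bar>) \<and> ?E N \<le> ?A n N + B * ?C n N + 2 * B * ?t n" if N: "N > 0" for n N
  proof -
    interpret PN: prob_space "P N" by (rule P_prob)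
    have bnd: "\<bar>\<integral>y. g y \<partial>\<rho>\<bar> \<le> b" if "prob_space \<rho>" "sets \<rho> = sets borel" "g \<in> borel_measurable borel" "\<And>y. \<bar>g y\<bar> \<le> b" for \<rho> and g :: "complex \<Rightarrow> real" and b
    proof -
      interpret \<rho>: prob_space \<rho> by fact
      have "(\<integral>y. \<bar>g y\<bar> \<partial>\<rho>) \<le> (\<integral>y. b \<partial>\<rho>)" using int[OF that] that(4) by (intro integral_mono) auto
      moreover have "\<bar>\<integral>y. g y \<partial>\<rho>\<bar> \<le> (\<integral>y. \<bar>g y\<bar> \<partial>\<rho>)" by (rule integral_abs_bound)
      moreover have "(\<integral>y. b \<partial>\<rho>) = b" by (simp add: \<rho>.prob_space)
      ultimately show ?thesis by linarith
    qed
    have DI: "integrable (P N) (\<lambda>\<omega>. \<bar>(\<integral>y. g y \<partial>L N \<omega>) - (\<integral>y. g y \<partial>\<mu>)\<bar>)"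
      if gm: "g \<in> borel_measurable borel" and gb: "\<And>y. \<bar>g y\<bar> \<le> b" and m: "(\<lambda>\<omega>. \<integral>y. g y \<partial>L N \<omega>) \<in> borel_measurable (P N)" for g :: "complex \<Rightarrow> real" and b :: real
    proof (rule PN.integrable_const_bound[where B="2 * b"])
      show "AE \<omega> in P N. norm \<bar>(\<integral>y. g y \<partial>L N \<omega>) - (\<integral>y. g y \<partial>\<mu>)\<bar> \<le> 2 * b"
      proof (rule AE_I2)
        fix \<omega>
        show "norm \<bar>(\<integral>y. g y \<partial>L N \<omega>) - (\<integral>y. g y \<partial>\<mu>)\<bar> \<le> 2 * b"
          using bnd[OF L_prob[OF N] L_sets[OF N] gm gb, of \<omega>] bnd[OF \<mu> gm gb] by simp
      qed
      show "(\<lambda>\<omega>. \<bar>(\<integral>y. g y \<partial>L N \<omega>) - (\<integral>y. g y \<partial>\<mu>)\<bar>) \<in> borel_measurable (P N)"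
        using m by (intro borel_measurable_abs borel_measurable_diff borel_measurable_const)
    qed
    have I0: "integrable (P N) (\<lambda>\<omega>. \<bar>(\<integral>y. f y \<partial>L N \<omega>) - (\<integral>y. f y \<partial>\<mu>)\<bar>)"
      by (rule DI[OF fm B meas])
    have I1: "integrable (P N) (\<lambda>\<omega>. \<bar>(\<integral>y. f y * ?\<chi> n y \<partial>L N \<omega>) - (\<integral>y. f y * ?\<chi> n y \<partial>\<mu>)\<bar>)"
    proof (rule DI)
      show "\<bar>f y * ?\<chi> n y\<bar> \<le> B" for y
        using mult_mono[OF B[of y], of "\<bar>?\<chi> n y\<bar>" 1] cutoff_bounds(1,2)[where R="real n" and y=y] B0 by (simp add: abs_mult)
      show "(\<lambda>\<omega>. \<integral>y. f y * ?\<chi> n y \<partial>L N \<omega>) \<in> borel_measurable (P N)"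
        by (rule integral_bounded_support_measurable[OF N bounded_support_cutoff_mult[OF f]])
    qed measurable
    have I2: "integrable (P N) (\<lambda>\<omega>. \<bar>(\<integral>y. 1 * ?\<chi> n y \<partial>L N \<omega>) - (\<integral>y. 1 * ?\<chi> n y \<partial>\<mu>)\<bar>)"
    proof (rule DI)
      show "\<bar>1 * ?\<chi> n y\<bar> \<le> 1" for y using cutoff_bounds(1,2)[where R="real n" and y=y] by simp
      show "(\<lambda>\<omega>. \<integral>y. 1 * ?\<chi> n y \<partial>L N \<omega>) \<in> borel_measurable (P N)"
        by (rule integral_bounded_support_measurable[OF N bounded_support_cutoff_mult[OF one]])
    qed measurable
    have "?E N \<le> (\<integral>\<omega>. \<bar>(\<integral>y. f y * ?\<chi> n y \<partial>L N \<omega>) - (\<integral>y. f y * ?\<chi> n y \<partial>\<mu>)\<bar> +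
        (B * \<bar>(\<integral>y. 1 * ?\<chi> n y \<partial>L N \<omega>) - (\<integral>y. 1 * ?\<chi> n y \<partial>\<mu>)\<bar> + 2 * B * ?t n) \<partial>P N)"
    proof (rule integral_mono[OF I0])
      show "integrable (P N) (\<lambda>\<omega>. \<bar>(\<integral>y. f y * ?\<chi> n y \<partial>L N \<omega>) - (\<integral>y. f y * ?\<chi> n y \<partial>\<mu>)\<bar> +
        (B * \<bar>(\<integral>y. 1 * ?\<chi> n y \<partial>L N \<omega>) - (\<integral>y. 1 * ?\<chi> n y \<partial>\<mu>)\<bar> + 2 * B * ?t n))"
        by (intro Bochner_Integration.integrable_add I1 integrable_mult_right I2 PN.integrable_const)
      fix \<omega>
      let ?c = "(\<integral>y. 1 * ?\<chi> n y \<partial>L N \<omega>)" and ?m = "(\<integral>y. 1 * ?\<chi> n y \<partial>\<mu>)"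
      have "B * (1 - ?c) \<le> B * (\<bar>?c - ?m\<bar> + (1 - ?m))" using B0 by (intro mult_left_mono) auto
      then have "B * (1 - ?c) \<le> B * \<bar>?c - ?m\<bar> + B * (1 - ?m)" by (simp only: distrib_left)
      with tail[OF L_prob[OF N] L_sets[OF N], of \<omega> n] tail[OF \<mu>, of n]
      show "\<bar>(\<integral>y. f y \<partial>L N \<omega>) - (\<integral>y. f y \<partial>\<mu>)\<bar> \<le> \<bar>(\<integral>y. f y * ?\<chi> n y \<partial>L N \<omega>) - (\<integral>y. f y * ?\<chi> n y \<partial>\<mu>)\<bar> +
        (B * \<bar>?c - ?m\<bar> + 2 * B * ?t n)" by linarith
    qed
    also have "\<dots> = ?A n N + (\<integral>\<omega>. B * \<bar>(\<integral>y. 1 * ?\<chi> n y \<partial>L N \<omega>) - (\<integral>y. 1 * ?\<chi> n y \<partial>\<mu>)\<bar> + 2 * B * ?t n \<partial>P N)"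
      by (rule Bochner_Integration.integral_add[OF I1]) (intro Bochner_Integration.integrable_add integrable_mult_right I2 PN.integrable_const)
    also have "(\<integral>\<omega>. B * \<bar>(\<integral>y. 1 * ?\<chi> n y \<partial>L N \<omega>) - (\<integral>y. 1 * ?\<chi> n y \<partial>\<mu>)\<bar> + 2 * B * ?t n \<partial>P N)
       = (\<integral>\<omega>. B * \<bar>(\<integral>y. 1 * ?\<chi> n y \<partial>L N \<omega>) - (\<integral>y. 1 * ?\<chi> n y \<partial>\<mu>)\<bar> \<partial>P N) + (\<integral>\<omega>. 2 * B * ?t n \<partial>P N)"
      by (rule Bochner_Integration.integral_add) (intro integrable_mult_right I2 PN.integrable_const)+
    finally show ?thesis using I0 by (simp add: PN.prob_space)
  qed
  have Elim: "\<forall>\<^sub>F N in sequentially. ?E N < e" if e: "e > 0" for e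
  proof -
    have "(\<lambda>n. 2 * B * ?t n) \<longlonglongrightarrow> 2 * B * (1 - (\<integral>y. 1 \<partial>\<mu>))"
      by (intro tendsto_intros integral_cutoff_tendsto[OF \<mu> one, where B=1]) simp
    then have "(\<lambda>n. 2 * B * ?t n) \<longlonglongrightarrow> 0" by (simp add: \<mu>.prob_space)
    then have "\<forall>\<^sub>F n in sequentially. 2 * B * ?t n < e / 2" using e by (intro order_tendstoD) auto
    then obtain n where n: "2 * B * ?t n < e / 2" by (auto simp: eventually_sequentially)
    have "(\<lambda>N. ?A n N + B * ?C n N) \<longlonglongrightarrow> 0 + B * 0"
      by (intro tendsto_intros integral_bounded_support_tendsto[OF \<mu> eq bounded_support_cutoff_mult[OF f]]
          integral_bounded_support_tendsto[OF \<mu> eq bounded_support_cutoff_mult[OF one]])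
    then have "\<forall>\<^sub>F N in sequentially. ?A n N + B * ?C n N < e / 2" using e by (intro order_tendstoD) auto
    then show ?thesis using eventually_gt_at_top[of 0]
    proof eventually_elim
      fix N :: nat assume "?A n N + B * ?C n N < e / 2" "0 < N"
      then show "?E N < e" using conjunct2[OF Ei[of N n]] n by linarith
    qed
  qed
  show "\<forall>\<epsilon>>0. (\<lambda>N. measure (P N) {\<omega> \<in> space (P N). \<bar>(\<integral>y. f y \<partial>L N \<omega>) - (\<integral>y. f y \<partial>\<mu>)\<bar> > \<epsilon>}) \<longlonglongrightarrow> 0"
  proof (intro allI impI)
    fix \<epsilon> :: real assume \<epsilon>: "\<epsilon> > 0"
    show "(\<lambda>N. measure (P N) {\<omega> \<in> space (P N). \<bar>(\<integral>y. f y \<partial>L N \<omega>) - (\<integral>y. f y \<partial>\<mu>)\<bar> > \<epsilon>}) \<longlonglongrightarrow> 0"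
    proof (rule tendstoI)
      fix e :: real assume e: "e > 0"
      then have "0 < e * \<epsilon>" using \<epsilon> by simp
      from Elim[OF this] show "\<forall>\<^sub>F N in sequentially. dist (measure (P N) {\<omega> \<in> space (P N). \<bar>(\<integral>y. f y \<partial>L N \<omega>) - (\<integral>y. f y \<partial>\<mu>)\<bar> > \<epsilon>}) 0 < e"
        using eventually_gt_at_top[of 0]
      proof eventually_elim
        fix N :: nat assume lt: "?E N < e * \<epsilon>" and N: "0 < N"
        interpret PN: prob_space "P N" by (rule P_prob)
        note [measurable] = meas[of N]
        let ?u = "\<lambda>\<omega>. \<bar>(\<integral>y. f y \<partial>L N \<omega>) - (\<integral>y. f y \<partial>\<mu>)\<bar>"
        have "measure (P N) {\<omega> \<in> space (P N). ?u \<omega> > \<epsilon>} \<le> measure (P N) {\<omega> \<in> space (P N). ?u \<omega> \<ge> \<epsilon>}"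
          by (rule PN.finite_measure_mono) auto
        also have "\<dots> \<le> ?E N / \<epsilon>"
          using conjunct1[OF Ei[OF N]] \<epsilon> by (intro integral_Markov_inequality_measure[where A="{}"]) auto
        also have "\<dots> < e" using lt \<epsilon> by (simp add: divide_less_eq)
        finally show "dist (measure (P N) {\<omega> \<in> space (P N). ?u \<omega> > \<epsilon>}) 0 < e" by simp
      qed
    qed
  qed
qed

end

section \<open>Eigenvalues and the determinant\<close>

lemma noisy_mat_carrier: "noisy_mat \<gamma> N d g \<in> carrier_mat N N"
  by (simp add: noisy_mat_def shift_mat_def)

lemma noisy_mat_entry:
  assumes "i < N" "j < N"
  shows "noisy_mat \<gamma> N d g $$ (i, j) - (if i = j then z else 0) = bidiag (\<lambda>i. d i - z) i j + of_real (real N powr - \<gamma>) * g (i, j)"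
  using assms by (auto simp: noisy_mat_def shift_mat_def mat_diag_def bidiag_def)

lemma cmod_poly_char_poly_noisy_mat:
  "cmod (poly (char_poly (noisy_mat \<gamma> N d g)) z) = cmod (noisy_det N (\<lambda>i. d i - z) (real N powr - \<gamma>) g)"
proof -
  let ?A = "noisy_mat \<gamma> N d g" and ?\<delta> = "real N powr - \<gamma>"
  have carr: "- char_matrix ?A z \<in> carrier_mat N N" using noisy_mat_carrier by simp
  have entry: "(- char_matrix ?A z) $$ (i, j) = - (bidiag (\<lambda>i. d i - z) i j + of_real ?\<delta> * g (i, j))" if "i < N" "j < N" for i j
    unfolding noisy_mat_entry[OF that, symmetric] using that noisy_mat_carrier[of \<gamma> N d g]
    by (auto simp: char_matrix_def)
  have "poly (char_poly ?A) z = (\<Sum>p\<in>{p. p permutes {0..<N}}. signof p * (\<Prod>i = 0..<N. (- char_matrix ?A z) $$ (i, p i)))"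
    unfolding char_poly_matrix[OF noisy_mat_carrier] using carr by (simp only: det_def' )
  also have "\<dots> = (\<Sum>p | p permutes {..<N}. of_int (sign p) * (\<Prod>i<N. - (bidiag (\<lambda>i. d i - z) i (p i) + of_real ?\<delta> * g (i, p i))))"
    unfolding lessThan_atLeast0
  proof (intro sum.cong refl arg_cong2[where f="(*)"] prod.cong)
    fix p i assume p: "p \<in> {p. p permutes {0..<N}}" and i: "i \<in> {0..<N}"
    then have "p i < N" using permutes_in_image[of p "{0..<N}" i] by auto
    then show "(- char_matrix ?A z) $$ (i, p i) = - (bidiag (\<lambda>i. d i - z) i (p i) + of_real ?\<delta> * g (i, p i))"
      using i by (intro entry) auto
  qed
  also have "\<dots> = (\<Sum>p | p permutes {..<N}. (- 1) ^ N * (of_int (sign p) * (\<Prod>i<N. bidiag (\<lambda>i. d i - z) i (p i) + of_real ?\<delta> * g (i, p i))))"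
  proof (intro sum.cong refl)
    fix p
    have "(\<Prod>i<N. - x i) = (- 1) ^ N * (\<Prod>i<N. x i)" for x :: "nat \<Rightarrow> complex"
      by (induction N) auto
    then show "of_int (sign p) * (\<Prod>i<N. - (bidiag (\<lambda>i. d i - z) i (p i) + of_real ?\<delta> * g (i, p i)))
      = (- 1) ^ N * (of_int (sign p) * (\<Prod>i<N. bidiag (\<lambda>i. d i - z) i (p i) + of_real ?\<delta> * g (i, p i)))"
      by (simp only: mult.left_commute[of _ "(- 1) ^ N"])
  qed
  also have "\<dots> = (- 1) ^ N * noisy_det N (\<lambda>i. d i - z) ?\<delta> g"
    by (simp add: noisy_det_def sum_distrib_left)
  finally show ?thesis by (simp add: norm_mult norm_power)
qed

text \<open>The eigenvalues \<open>x\<close> are listed with multiplicity, so the multiset average becomes an average over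
  indices.\<close>
lemma empirical_eigenvalue_measure_roots:
  assumes N: "N > 0"
  shows "\<exists>x :: nat \<Rightarrow> complex.
    empirical_eigenvalue_measure (noisy_mat \<gamma> N d g) = distr (measure_pmf (map_pmf x (pmf_of_set {..<N}))) borel (\<lambda>z. z) \<and>
    (\<forall>z. cmod (noisy_det N (\<lambda>i. d i - z) (real N powr - \<gamma>) g) = (\<Prod>i<N. cmod (z - x i)))"
proof -
  let ?A = "noisy_mat \<gamma> N d g"
  let ?p = "char_poly ?A"
  have monic: "degree ?p = N" "lead_coeff ?p = 1"
    using degree_monic_char_poly[OF noisy_mat_carrier[of \<gamma> N d g]] by auto
  obtain x where x: "Polynomial.smult (lead_coeff ?p) (\<Prod>i<degree ?p. [:- x i, 1:]) = ?p" by (rule complex_poly_decompose')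
  then have p: "?p = (\<Prod>i<N. [:- x i, 1:])" using monic by simp
  have "proots (\<Prod>i<n. [:- x i, 1:]) = image_mset x (mset_set {..<n})" for n
  proof (induction n)
    case (Suc n)
    have "(\<Prod>i<n. [:- x i, 1:]) \<noteq> 0" by (simp add: prod_zero_iff)
    moreover have "[:- x n, 1:] \<noteq> 0" by simp
    ultimately have "(\<Prod>i<n. [:- x i, 1:]) * [:- x n, 1:] \<noteq> 0" by (simp only: mult_eq_0_iff not_False_eq_True de_Morgan_disj)
    then have "proots ((\<Prod>i<n. [:- x i, 1:]) * [:- x n, 1:]) = proots (\<Prod>i<n. [:- x i, 1:]) + proots [:- x n, 1:]"
      by (intro proots_mult) auto
    then show ?case using Suc by (simp add: lessThan_Suc)
  qed simp
  then have pr: "proots ?p = image_mset x (mset_set {..<N})" unfolding p .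
  have "pmf_of_multiset (proots ?p) = map_pmf x (pmf_of_set {..<N})"
    unfolding pr using N by (intro map_pmf_of_set[symmetric]) auto
  then have 1: "empirical_eigenvalue_measure ?A = distr (measure_pmf (map_pmf x (pmf_of_set {..<N}))) borel (\<lambda>z. z)"
    unfolding empirical_eigenvalue_measure_def by simp
  have 2: "cmod (noisy_det N (\<lambda>i. d i - z) (real N powr - \<gamma>) g) = (\<Prod>i<N. cmod (z - x i))" for z
    unfolding cmod_poly_char_poly_noisy_mat[symmetric] p by (simp add: poly_prod prod_norm)
  from 1 2 show ?thesis by blast
qed

lemma prob_space_empirical: "prob_space (empirical_eigenvalue_measure A)" "sets (empirical_eigenvalue_measure A) = sets borel"
  unfolding empirical_eigenvalue_measure_def by (auto intro!: measure_pmf.prob_space_distr)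

lemma integral_uniform_points:
  fixes h :: "complex \<Rightarrow> real" and N :: nat and x :: "nat \<Rightarrow> complex"
  assumes N: "N > 0" and h: "h \<in> borel_measurable borel"
  shows "integrable (distr (measure_pmf (map_pmf x (pmf_of_set {..<N}))) borel (\<lambda>z. z)) h"
    "(\<integral>y. h y \<partial>distr (measure_pmf (map_pmf x (pmf_of_set {..<N}))) borel (\<lambda>z. z)) = (\<Sum>i<N. h (x i)) / N"
proof -
  have ne: "{..<N} \<noteq> {}" using N by auto
  show "integrable (distr (measure_pmf (map_pmf x (pmf_of_set {..<N}))) borel (\<lambda>z. z)) h"
  proof (subst integrable_distr_eq)
    have "finite (set_pmf (map_pmf x (pmf_of_set {..<N})))" using ne by (simp add: set_pmf_of_set)
    then show "integrable (measure_pmf (map_pmf x (pmf_of_set {..<N}))) h" by (rule integrable_measure_pmf_finite)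
  qed (use h in auto)
  have "(\<integral>y. h y \<partial>distr (measure_pmf (map_pmf x (pmf_of_set {..<N}))) borel (\<lambda>z. z)) = (\<integral>y. h y \<partial>measure_pmf (map_pmf x (pmf_of_set {..<N})))"
    using h by (subst integral_distr) auto
  also have "\<dots> = (\<integral>i. h (x i) \<partial>measure_pmf (pmf_of_set {..<N}))" by (rule integral_map_pmf)
  also have "\<dots> = (\<Sum>i<N. h (x i)) / N" using ne by (subst integral_pmf_of_set) auto
  finally show "(\<integral>y. h y \<partial>distr (measure_pmf (map_pmf x (pmf_of_set {..<N}))) borel (\<lambda>z. z)) = (\<Sum>i<N. h (x i)) / N" .
qed

text \<open>The normalized logarithm of the determinant is the average of \<open>ln \<bar>z - x\<bar>\<close> over the eigenvalues \<open>x\<close>,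
  except at the eigenvalues themselves, which form a null set on each circle.\<close>
lemma integral_log_max_empirical:
  assumes N: "N > 0" and r: "r > 0"
  shows "integrable circ (\<lambda>\<theta>. normalized_log_det \<gamma> N d g (a + of_real r * cis \<theta>))"
    "integrable (empirical_eigenvalue_measure (noisy_mat \<gamma> N d g)) (log_max a r)"
    "(\<integral>y. log_max a r y \<partial>empirical_eigenvalue_measure (noisy_mat \<gamma> N d g)) = circle_mean (normalized_log_det \<gamma> N d g) a r"
proof -
  interpret circ: prob_space circ by (rule prob_space_circ)
  obtain x :: "nat \<Rightarrow> complex" where x: "empirical_eigenvalue_measure (noisy_mat \<gamma> N d g) = distr (measure_pmf (map_pmf x (pmf_of_set {..<N}))) borel (\<lambda>z. z)"
    and det: "\<And>z. cmod (noisy_det N (\<lambda>i. d i - z) (real N powr - \<gamma>) g) = (\<Prod>i<N. cmod (z - x i))"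
    using empirical_eigenvalue_measure_roots[OF N, of \<gamma> d g] by auto
  show "integrable (empirical_eigenvalue_measure (noisy_mat \<gamma> N d g)) (log_max a r)"
    unfolding x by (rule integral_uniform_points[OF N]) simp
  let ?z = "\<lambda>\<theta>. a + of_real r * cis \<theta>"
  note J = jensen_circle[OF r]
  have AEnz: "AE \<theta> in circ. \<forall>i\<in>{..<N}. ?z \<theta> - x i \<noteq> 0"
  proof (rule AE_finite_allI)
    show "AE \<theta> in circ. ?z \<theta> - x i \<noteq> 0" for i by (rule J(3))
  qed simp
  have AEeq: "AE \<theta> in circ. normalized_log_det \<gamma> N d g (?z \<theta>) = (\<Sum>i<N. ln (cmod (?z \<theta> - x i))) / N"
    using AEnz
  proof eventually_elim
    fix \<theta> assume "\<forall>i\<in>{..<N}. ?z \<theta> - x i \<noteq> 0"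
    then have "ln (\<Prod>i<N. cmod (?z \<theta> - x i)) = (\<Sum>i<N. ln (cmod (?z \<theta> - x i)))" by (intro ln_prod) auto
    then show "normalized_log_det \<gamma> N d g (?z \<theta>) = (\<Sum>i<N. ln (cmod (?z \<theta> - x i))) / N"
      unfolding normalized_log_det_def det by simp
  qed
  have int: "integrable circ (\<lambda>\<theta>. (\<Sum>i<N. ln (cmod (?z \<theta> - x i))) / N)"
    by (intro integrable_divide Bochner_Integration.integrable_sum J(1))
  have meas: "(\<lambda>\<theta>. normalized_log_det \<gamma> N d g (?z \<theta>)) \<in> borel_measurable circ"
    unfolding normalized_log_det_def det by measurable
  show "integrable circ (\<lambda>\<theta>. normalized_log_det \<gamma> N d g (?z \<theta>))"
    by (rule integrable_cong_AE_imp[OF int meas]) (use AEeq in \<open>auto elim: eventually_mono\<close>)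
  have "circle_mean (normalized_log_det \<gamma> N d g) a r = (\<integral>\<theta>. (\<Sum>i<N. ln (cmod (?z \<theta> - x i))) / N \<partial>circ)"
    unfolding circle_mean_def by (rule integral_cong_AE[OF meas _ AEeq]) (use int in auto)
  also have "\<dots> = (\<Sum>i<N. \<integral>\<theta>. ln (cmod (?z \<theta> - x i)) \<partial>circ) / N"
    by (simp add: Bochner_Integration.integral_sum J(1))
  also have "\<dots> = (\<Sum>i<N. log_max a r (x i)) / N" unfolding J(2) log_max_def ..
  also have "\<dots> = (\<integral>y. log_max a r y \<partial>empirical_eigenvalue_measure (noisy_mat \<gamma> N d g))"
    unfolding x by (rule integral_uniform_points(2)[OF N, symmetric]) simp
  finally show "(\<integral>y. log_max a r y \<partial>empirical_eigenvalue_measure (noisy_mat \<gamma> N d g)) = circle_mean (normalized_log_det \<gamma> N d g) a r" ..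
qed

section \<open>Sequential compactness on a disc\<close>

text \<open>A continuous even function of period two that is \<open>0\<close> on \<open>[0, 1/3]\<close> and \<open>1\<close> on \<open>[2/3, 1]\<close>.\<close>
definition schoenberg_wave :: "real \<Rightarrow> real" where
  "schoenberg_wave t = max 0 (min 1 (1/2 - cos (pi * t)))"

text \<open>The coordinates, for \<open>j = 0\<close> and \<open>j = 1\<close>, of Schoenberg's space-filling curve in the unit square.\<close>
definition schoenberg_coord :: "nat \<Rightarrow> real \<Rightarrow> real" where
  "schoenberg_coord j t = (\<Sum>k. schoenberg_wave (3 ^ (2 * k + j) * t) / 2 ^ Suc k)"

lemma schoenberg_wave_bounds: "0 \<le> schoenberg_wave t" "schoenberg_wave t \<le> 1"
  by (auto simp: schoenberg_wave_def)

lemma schoenberg_wave_eq: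
  assumes "0 \<le> u" "u \<le> 1"
  shows "schoenberg_wave (2 * of_int m + (2 * of_bool b + u) / 3) = of_bool b"
proof -
  let ?v = "(2 * of_bool b + u) / 3"
  have cos_eq: "cos (pi * (2 * of_int m + ?v)) = cos (pi * ?v)"
    using cos_int_2pin[of m] sin_int_2pin[of m] by (simp add: distrib_left cos_add mult.assoc mult.left_commute mult.commute[of pi])
  show ?thesis
  proof (cases b)
    case True
    have "cos (pi * ?v) \<le> cos (2 * pi / 3)"
      using True assms by (intro cos_monotone_0_pi_le) (auto simp: field_simps)
    then show ?thesis using True cos_eq by (simp add: schoenberg_wave_def cos_120 cos_120')
  next
    case False
    have "cos (pi / 3) \<le> cos (pi * ?v)"
      using False assms by (intro cos_monotone_0_pi_le) (auto simp: field_simps)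
    then show ?thesis using False cos_eq by (simp add: schoenberg_wave_def cos_60)
  qed
qed

lemma summable_half_powers: "summable (\<lambda>k. (1 :: real) / 2 ^ Suc k)" "(\<Sum>k. (1 :: real) / 2 ^ Suc k) = 1"
  using power_half_series by (auto simp: sums_iff power_divide)

lemma summable_schoenberg: "summable (\<lambda>k. schoenberg_wave (3 ^ (2 * k + j) * t) / 2 ^ Suc k)"
proof (rule summable_comparison_test'[OF summable_half_powers(1)])
  show "norm (schoenberg_wave (3 ^ (2 * n + j) * t) / 2 ^ Suc n) \<le> 1 / 2 ^ Suc n" for n
    using schoenberg_wave_bounds[of "3 ^ (2 * n + j) * t"] by (simp add: divide_right_mono)
qed

lemma schoenberg_coord_bounds: "0 \<le> schoenberg_coord j t" "schoenberg_coord j t \<le> 1"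
proof -
  show "0 \<le> schoenberg_coord j t" unfolding schoenberg_coord_def
    by (intro suminf_nonneg summable_schoenberg) (simp add: schoenberg_wave_bounds)
  have "schoenberg_coord j t \<le> (\<Sum>k. (1 :: real) / 2 ^ Suc k)" unfolding schoenberg_coord_def
    by (intro suminf_le summable_schoenberg summable_half_powers divide_right_mono schoenberg_wave_bounds) simp
  then show "schoenberg_coord j t \<le> 1" using summable_half_powers(2) by simp
qed

lemma continuous_schoenberg_coord: "continuous_on UNIV (schoenberg_coord j)"
proof (rule uniform_limit_theorem)
  show "uniform_limit UNIV (\<lambda>n t. \<Sum>k<n. schoenberg_wave (3 ^ (2 * k + j) * t) / 2 ^ Suc k) (schoenberg_coord j) sequentially"
    unfolding schoenberg_coord_def[abs_def]
  proof (rule Weierstrass_m_test[OF _ summable_half_powers(1)])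
    show "norm (schoenberg_wave (3 ^ (2 * n + j) * t) / 2 ^ Suc n) \<le> 1 / 2 ^ Suc n" for n t
      using schoenberg_wave_bounds[of "3 ^ (2 * n + j) * t"] by (simp add: divide_right_mono)
  qed
  show "\<forall>\<^sub>F n in sequentially. continuous_on UNIV (\<lambda>t. \<Sum>k<n. schoenberg_wave (3 ^ (2 * k + j) * t) / 2 ^ Suc k)"
    unfolding schoenberg_wave_def by (intro always_eventually allI continuous_intros) auto
qed simp

lemma binary_expansion:
  fixes x :: real
  assumes "0 \<le> x" "x \<le> 1"
  shows "\<exists>b :: nat \<Rightarrow> bool. (\<lambda>k. of_bool (b k) / 2 ^ Suc k) sums x"
proof -
  define y where "y = rec_nat x (\<lambda>_ u. 2 * u - of_bool (u \<ge> 1/2))"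
  have y0: "y 0 = x" and yS: "y (Suc n) = 2 * y n - of_bool (y n \<ge> 1/2)" for n by (auto simp: y_def)
  have yb: "0 \<le> y n \<and> y n \<le> 1" for n
    by (induction n) (use assms in \<open>auto simp: y0 yS\<close>)
  have sum: "(\<Sum>k<n. of_bool (y k \<ge> 1/2) / 2 ^ Suc k) = x - y n / 2 ^ n" for n
    by (induction n) (auto simp: y0 yS field_simps)
  have "(\<lambda>n. (1/2) ^ n :: real) \<longlonglongrightarrow> 0" by (rule LIMSEQ_realpow_zero) auto
  then have "(\<lambda>n. y n / 2 ^ n) \<longlonglongrightarrow> 0"
    by (rule tendsto_sandwich[OF _ _ tendsto_const, rotated 2]) (use yb in \<open>auto simp: power_divide divide_right_mono\<close>)
  then have "(\<lambda>n. x - y n / 2 ^ n) \<longlonglongrightarrow> x - 0" by (intro tendsto_intros)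
  then have "(\<lambda>n. \<Sum>k<n. of_bool (y k \<ge> 1/2) / 2 ^ Suc k) \<longlonglongrightarrow> x" unfolding sum by simp
  then have "(\<lambda>k. of_bool (y k \<ge> 1/2) / 2 ^ Suc k) sums x" by (simp only: sums_def)
  then show ?thesis by (rule exI[of _ "\<lambda>k. y k \<ge> 1/2"])
qed

text \<open>If the ternary digits of \<open>t\<close> are twice the interleaved binary digits of \<open>x\<close> and \<open>y\<close>, then the
  wave at \<open>3 ^ m t\<close> reads off the binary digit in position \<open>m\<close>.\<close>
lemma schoenberg_surjective:
  fixes x y :: real
  assumes "0 \<le> x" "x \<le> 1" "0 \<le> y" "y \<le> 1"
  shows "\<exists>t. 0 \<le> t \<and> t \<le> 1 \<and> schoenberg_coord 0 t = x \<and> schoenberg_coord 1 t = y"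
proof -
  obtain a b :: "nat \<Rightarrow> bool" where a: "(\<lambda>k. of_bool (a k) / 2 ^ Suc k) sums x" and b: "(\<lambda>k. of_bool (b k) / 2 ^ Suc k) sums y"
    using binary_expansion assms by metis
  define c where "c j = (if even j then a (j div 2) else b (j div 2))" for j
  define f where "f m j = 2 * of_bool (c (j + m)) / (3 :: real) ^ Suc j" for m j
  define T where "T m = (\<Sum>j. f m j)" for m
  have g: "summable (\<lambda>j. 2 / (3 :: real) ^ Suc j)" "(\<Sum>j. 2 / (3 :: real) ^ Suc j) = 1"
  proof -
    have "(\<lambda>j. (2/3) * (1/3 :: real) ^ j) sums ((2/3) * (1 / (1 - 1/3)))"
      by (intro sums_mult geometric_sums) simp
    then have "(\<lambda>j. 2 / (3 :: real) ^ Suc j) sums 1" by (simp add: power_divide)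
    then show "summable (\<lambda>j. 2 / (3 :: real) ^ Suc j)" "(\<Sum>j. 2 / (3 :: real) ^ Suc j) = 1" by (auto simp: sums_iff)
  qed
  have fb: "0 \<le> f m j" "f m j \<le> 2 / 3 ^ Suc j" for m j by (auto simp: f_def)
  have fs: "summable (f m)" for m
    by (rule summable_comparison_test'[OF g(1)]) (use fb in auto)
  have T01: "0 \<le> T m" "T m \<le> 1" for m
    unfolding T_def using suminf_nonneg[OF fs fb(1)] suminf_le[OF fb(2) fs g(1)] g(2) by auto
  have step: "T m = (2 * of_bool (c m) + T (Suc m)) / 3" for m
  proof -
    have "T m = f m 0 + (\<Sum>j. f m (Suc j))" unfolding T_def using suminf_split_head[OF fs[of m]] by simp
    also have "(\<lambda>j. f m (Suc j)) = (\<lambda>j. f (Suc m) j / 3)" by (simp add: f_def fun_eq_iff)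
    also have "(\<Sum>j. f (Suc m) j / 3) = T (Suc m) / 3" unfolding T_def by (rule suminf_divide[OF fs])
    finally show ?thesis by (simp add: f_def)
  qed
  \<comment> \<open>Multiplying by three shifts the ternary digits, up to an even integer.\<close>
  have shift: "\<exists>n :: int. 3 ^ m * T 0 = 2 * of_int n + T m" for m
  proof (induction m)
    case 0 show ?case by (intro exI[of _ 0]) simp
  next
    case (Suc m)
    then obtain n :: int where "3 ^ m * T 0 = 2 * of_int n + T m" by blast
    then have "3 ^ Suc m * T 0 = 3 * (2 * of_int n + T m)" by (simp add: mult.assoc)
    also have "\<dots> = 2 * of_int (3 * n + of_bool (c m)) + T (Suc m)"
      using step[of m] by (simp add: field_simps)
    finally have "3 ^ Suc m * T 0 = 2 * of_int (3 * n + of_bool (c m)) + T (Suc m)" .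
    then show ?case by blast
  qed
  have wave: "schoenberg_wave (3 ^ m * T 0) = of_bool (c m)" for m
  proof -
    obtain n :: int where "3 ^ m * T 0 = 2 * of_int n + T m" using shift by blast
    then show ?thesis using schoenberg_wave_eq[OF T01[of "Suc m"], of n "c m"] step[of m] by simp
  qed
  have "schoenberg_coord 0 (T 0) = x"
    unfolding schoenberg_coord_def wave using a by (simp add: c_def sums_iff)
  moreover have "schoenberg_coord 1 (T 0) = y"
    unfolding schoenberg_coord_def wave using b by (simp add: c_def sums_iff)
  ultimately show ?thesis using T01[of 0] by blast
qed

text \<open>The compactness theorem for laws on the real line carries over to the disc along a continuous
  surjection from an interval onto a square: lift the laws by a section, extract a limit, and push it forward. For
  discrete laws the section need not be measurable. The curve fills the square of side \<open>2 R\<close>, and \<open>2 R\<close>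
  is a crude bound for its distance from the centre.\<close>
lemma pmf_disc_compactness:
  fixes q :: "nat \<Rightarrow> complex pmf"
  assumes R: "R > 0" and q: "\<And>n. set_pmf (q n) \<subseteq> cball 0 R"
  shows "\<exists>s \<mu>. strict_mono (s :: nat \<Rightarrow> nat) \<and> prob_space \<mu> \<and> sets \<mu> = sets borel \<and> (AE y in \<mu>. cmod y \<le> 2 * R) \<and>
    (\<forall>h :: complex \<Rightarrow> real. continuous_on UNIV h \<longrightarrow> (\<lambda>n. \<integral>y. h y \<partial>measure_pmf (q (s n))) \<longlonglongrightarrow> (\<integral>y. h y \<partial>\<mu>))"
proof -
  define \<phi> where "\<phi> t = Complex (R * (2 * schoenberg_coord 0 t - 1)) (R * (2 * schoenberg_coord 1 t - 1))" for t
  have \<phi>c: "continuous_on UNIV \<phi>"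
    unfolding \<phi>_def[abs_def] Complex_eq by (intro continuous_intros continuous_schoenberg_coord)
  have \<phi>m [measurable]: "\<phi> \<in> borel_measurable borel" using \<phi>c by (rule borel_measurable_continuous_onI)
  have \<phi>b: "cmod (\<phi> t) \<le> 2 * R" for t
  proof -
    have "\<bar>2 * schoenberg_coord j t - 1\<bar> \<le> 1" for j using schoenberg_coord_bounds[of j t] by auto
    then have "\<bar>R * (2 * schoenberg_coord j t - 1)\<bar> \<le> R * 1" for j
      unfolding abs_mult using R by (intro mult_mono) auto
    then have "\<bar>Re (\<phi> t)\<bar> \<le> R" "\<bar>Im (\<phi> t)\<bar> \<le> R" by (simp_all add: \<phi>_def)
    then show ?thesis using cmod_le[of "\<phi> t"] by simp
  qed
  have "\<exists>t. 0 \<le> t \<and> t \<le> 1 \<and> \<phi> t = z" if z: "cmod z \<le> R" for z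
  proof -
    have "\<bar>Re z\<bar> \<le> R" "\<bar>Im z\<bar> \<le> R" using z abs_Re_le_cmod[of z] abs_Im_le_cmod[of z] by auto
    then have "0 \<le> (Re z / R + 1) / 2" "(Re z / R + 1) / 2 \<le> 1" "0 \<le> (Im z / R + 1) / 2" "(Im z / R + 1) / 2 \<le> 1"
      using R by (auto simp: field_simps abs_le_iff)
    from schoenberg_surjective[OF this] obtain t where t: "0 \<le> t" "t \<le> 1" "schoenberg_coord 0 t = (Re z / R + 1) / 2" "schoenberg_coord 1 t = (Im z / R + 1) / 2" by blast
    have "\<phi> t = z" unfolding \<phi>_def t(3,4) using R by (simp add: complex_eq_iff field_simps)
    with t show ?thesis by blast
  qed
  then obtain \<psi> where \<psi>: "\<And>z. cmod z \<le> R \<Longrightarrow> 0 \<le> \<psi> z \<and> \<psi> z \<le> 1 \<and> \<phi> (\<psi> z) = z" by metis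
  define \<nu> where "\<nu> n = distr (measure_pmf (map_pmf \<psi> (q n))) borel (\<lambda>t. t)" for n
  have \<nu>: "real_distribution (\<nu> n)" for n
    unfolding \<nu>_def by (intro real_distribution.intro real_distribution_axioms.intro measure_pmf.prob_space_distr) auto
  have mass: "measure (\<nu> n) {-1<..2} = 1" for n
  proof -
    have "AE z in measure_pmf (map_pmf \<psi> (q n)). z \<in> {-1<..2}"
      using q[of n] \<psi> by (intro AE_pmfI) force
    then have "measure (measure_pmf (map_pmf \<psi> (q n))) {-1<..2} = 1"
      by (intro measure_pmf.prob_eq_1[THEN iffD2]) auto
    then show ?thesis unfolding \<nu>_def by (subst measure_distr) auto
  qed
  have "tight \<nu>"
    unfolding tight_def
  proof (rule conjI)
    show "\<forall>n. real_distribution (\<nu> n)" using \<nu> by blast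
    have "\<exists>a b. a < b \<and> (\<forall>n. 1 - \<epsilon> < measure (\<nu> n) {a<..b})" if "\<epsilon> > 0" for \<epsilon> :: real
      using that mass by (intro exI[of _ "-1"] exI[of _ "2 :: real"]) auto
    then show "\<forall>\<epsilon>>0. \<exists>a b. a < b \<and> (\<forall>n. 1 - \<epsilon> < measure (\<nu> n) {a<..b})" by blast
  qed
  from tight_imp_convergent_subsubsequence[OF this strict_mono_id]
  obtain s M where s: "strict_mono s" and M: "real_distribution M" and conv: "weak_conv_m (\<nu> \<circ> id \<circ> s) M" by blast
  interpret M: real_distribution M by fact
  define \<mu> where "\<mu> = distr M borel \<phi>"
  have \<phi>M: "\<phi> \<in> M \<rightarrow>\<^sub>M borel" using \<phi>m by simp
  have "(\<lambda>n. \<integral>y. h y \<partial>measure_pmf (q (s n))) \<longlonglongrightarrow> (\<integral>y. h y \<partial>\<mu>)" if h: "continuous_on UNIV h" for h :: "complex \<Rightarrow> real"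
  proof -
    have hm: "h \<in> borel_measurable borel" using h by (rule borel_measurable_continuous_onI)
    have "bounded (h ` cball 0 (2 * R))"
      by (intro compact_imp_bounded compact_continuous_image continuous_on_subset[OF h]) auto
    then obtain B where B: "\<And>y. cmod y \<le> 2 * R \<Longrightarrow> norm (h y) \<le> B" by (fastforce simp: bounded_iff)
    have hc: "continuous_on UNIV (\<lambda>t. h (\<phi> t))" by (rule continuous_on_compose2[OF h \<phi>c]) auto
    have "(\<lambda>n. \<integral>t. h (\<phi> t) \<partial>(\<nu> \<circ> id \<circ> s) n) \<longlonglongrightarrow> (\<integral>t. h (\<phi> t) \<partial>M)"
      by (rule weak_conv_imp_integral_bdd_continuous_conv[OF _ M conv, where B=B])
        (use \<nu> B \<phi>b hc in \<open>auto simp: continuous_on_eq_continuous_at\<close>)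
    moreover have "(\<integral>t. h (\<phi> t) \<partial>\<nu> n) = (\<integral>y. h y \<partial>measure_pmf (q n))" for n
    proof -
      have "(\<integral>t. h (\<phi> t) \<partial>\<nu> n) = (\<integral>z. h (\<phi> (\<psi> z)) \<partial>measure_pmf (q n))"
        unfolding \<nu>_def using hm by (subst integral_distr) (auto simp: integral_map_pmf)
      also have "\<dots> = (\<integral>y. h y \<partial>measure_pmf (q n))"
        by (rule integral_cong_AE) (use q[of n] \<psi> in \<open>auto simp: AE_measure_pmf_iff\<close>)
      finally show ?thesis .
    qed
    moreover have "(\<integral>t. h (\<phi> t) \<partial>M) = (\<integral>y. h y \<partial>\<mu>)"
      unfolding \<mu>_def by (rule integral_distr[OF \<phi>M hm, symmetric])
    ultimately show ?thesis by simp
  qed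
  moreover have "prob_space \<mu>" unfolding \<mu>_def by (rule M.prob_space_distr[OF \<phi>M])
  moreover have "AE y in \<mu>. cmod y \<le> 2 * R" unfolding \<mu>_def by (subst AE_distr_iff[OF \<phi>M]) (auto simp: \<phi>b)
  ultimately show ?thesis using s by (intro exI[of _ s] exI[of _ \<mu>]) (auto simp: \<mu>_def)
qed

section \<open>Logarithmic potentials of measures\<close>

lemma ln_lipschitz:
  fixes s t m :: real
  assumes "0 < m" "m \<le> s" "m \<le> t" shows "\<bar>ln s - ln t\<bar> \<le> \<bar>s - t\<bar> / m"
proof -
  have *: "ln s - ln t \<le> \<bar>s - t\<bar> / m" if "m \<le> s" "m \<le> t" for s t :: real
  proof -
    have "ln s - ln t \<le> (s - t) / t" using that assms(1) by (intro ln_diff_le) auto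
    also have "\<dots> \<le> \<bar>s - t\<bar> / t" using that assms(1) by (intro divide_right_mono) auto
    also have "\<dots> \<le> \<bar>s - t\<bar> / m" using that assms(1) by (intro divide_left_mono mult_pos_pos) auto
    finally show ?thesis .
  qed
  show ?thesis using *[of s t] *[of t s] assms by (simp add: abs_le_iff abs_minus_commute)
qed

lemma log_max_lipschitz:
  assumes "0 < m" "m \<le> r" "m \<le> r'"
  shows "\<bar>log_max a r y - log_max a' r' y\<bar> \<le> (cmod (a - a') + \<bar>r - r'\<bar>) / m"
proof -
  have "\<bar>cmod (y - a) - cmod (y - a')\<bar> \<le> cmod (a - a')"
    using norm_triangle_ineq3[of "y - a" "y - a'"] by (simp add: norm_minus_commute)
  then have "\<bar>max (cmod (y - a)) r - max (cmod (y - a')) r'\<bar> \<le> cmod (a - a') + \<bar>r - r'\<bar>" by linarith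
  then have "\<bar>max (cmod (y - a)) r - max (cmod (y - a')) r'\<bar> / m \<le> (cmod (a - a') + \<bar>r - r'\<bar>) / m"
    using assms(1) by (intro divide_right_mono) auto
  moreover have "\<bar>log_max a r y - log_max a' r' y\<bar> \<le> \<bar>max (cmod (y - a)) r - max (cmod (y - a')) r'\<bar> / m"
    unfolding log_max_def using assms by (intro ln_lipschitz) auto
  ultimately show ?thesis by linarith
qed

lemma log_max_mono: "0 < r \<Longrightarrow> r \<le> r' \<Longrightarrow> log_max a r y \<le> log_max a r' y"
  by (simp add: log_max_def ln_mono)

lemma integrable_log_max:
  assumes \<rho>: "prob_space \<rho>" "sets \<rho> = sets borel" "integrates_log_at_infinity \<rho>" and r: "r > 0"
  shows "integrable \<rho> (log_max a r)"
proof -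
  interpret prob_space \<rho> by fact
  note [measurable_cong] = \<rho>(2)
  have i: "integrable \<rho> (\<lambda>y. ln (max 1 (cmod y)) + (ln (1 + cmod a) + \<bar>ln r\<bar>))"
    using \<rho>(3) by (intro Bochner_Integration.integrable_add) (auto simp: integrates_log_at_infinity_def)
  show ?thesis
  proof (rule Bochner_Integration.integrable_bound[OF i])
    show "log_max a r \<in> borel_measurable \<rho>" by measurable
    show "AE y in \<rho>. norm (log_max a r y) \<le> norm (ln (max 1 (cmod y)) + (ln (1 + cmod a) + \<bar>ln r\<bar>))"
    proof (rule AE_I2)
      fix y
      have m: "cmod (y - a) \<le> max 1 (cmod y) * (1 + cmod a)"
      proof -
        have "cmod (y - a) \<le> cmod y + cmod a" by (rule norm_triangle_ineq4)
        also have "\<dots> \<le> max 1 (cmod y) + max 1 (cmod y) * cmod a"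
          using mult_right_mono[of 1 "max 1 (cmod y)" "cmod a"] by auto
        finally show ?thesis by (simp add: distrib_left)
      qed
      have one: "1 \<le> max 1 (cmod y) * (1 + cmod a)" using mult_mono[of 1 "max 1 (cmod y)" 1 "1 + cmod a"] by simp
      have "max (cmod (y - a)) r \<le> (max 1 (cmod y) * (1 + cmod a)) * max 1 r"
        using mult_mono[OF m, of 1 "max 1 r"] mult_mono[OF one, of r "max 1 r"] r one by simp
      then have "log_max a r y \<le> ln ((max 1 (cmod y) * (1 + cmod a)) * max 1 r)"
        unfolding log_max_def using r by (intro ln_mono) auto
      also have "\<dots> = ln (max 1 (cmod y)) + ln (1 + cmod a) + ln (max 1 r)"
      proof -
        have "0 < max 1 (cmod y)" "0 < 1 + cmod a" "0 < max 1 r" using norm_ge_zero[of a] by linarith+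
        then show ?thesis using r by (subst ln_mult_pos; simp add: ln_mult_pos)
      qed
      also have "ln (max 1 r) \<le> \<bar>ln r\<bar>" by (cases "r \<le> 1") (auto simp: max_def)
      finally have up: "log_max a r y \<le> ln (max 1 (cmod y)) + (ln (1 + cmod a) + \<bar>ln r\<bar>)" by simp
      have "ln r \<le> log_max a r y" unfolding log_max_def using r by (intro ln_mono) auto
      moreover have "0 \<le> ln (max 1 (cmod y))" "0 \<le> ln (1 + cmod a)" by auto
      ultimately show "norm (log_max a r y) \<le> norm (ln (max 1 (cmod y)) + (ln (1 + cmod a) + \<bar>ln r\<bar>))"
        using up unfolding real_norm_def by linarith
    qed
  qed
qed

lemma integrates_log_of_bounded:
  assumes \<rho>: "prob_space \<rho>" "sets \<rho> = sets borel" "AE y in \<rho>. cmod y \<le> B"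
  shows "integrates_log_at_infinity \<rho>"
proof -
  interpret prob_space \<rho> by fact
  note [measurable_cong] = \<rho>(2)
  show ?thesis unfolding integrates_log_at_infinity_def
  proof (rule integrable_const_bound[where B="ln (max 1 B)"])
    show "AE y in \<rho>. norm (ln (max 1 (cmod y))) \<le> ln (max 1 B)"
      using \<rho>(3)
    proof eventually_elim
      case (elim y)
      then have "ln (max 1 (cmod y)) \<le> ln (max 1 B)" by (intro ln_mono) auto
      then show ?case by simp
    qed
  qed measurable
qed

text \<open>Jensen's formula integrated over \<open>y\<close>. The integrand is bounded above in terms of \<open>log_max\<close>, and its mean over
  the circle is known, so its absolute value is integrable on the product.\<close>
lemma circle_mean_log_potential:
  assumes \<rho>: "prob_space \<rho>" "sets \<rho> = sets borel" "integrates_log_at_infinity \<rho>" and r: "r > 0"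
  shows "integrable circ (\<lambda>\<theta>. \<integral>y. ln (cmod (y - (a + of_real r * cis \<theta>))) \<partial>\<rho>)"
    "(\<integral>\<theta>. (\<integral>y. ln (cmod (y - (a + of_real r * cis \<theta>))) \<partial>\<rho>) \<partial>circ) = (\<integral>y. log_max a r y \<partial>\<rho>)"
    "AE \<theta> in circ. integrable \<rho> (\<lambda>y. ln (cmod (y - (a + of_real r * cis \<theta>))))"
    "AE \<theta> in circ. AE y in \<rho>. cmod (y - (a + of_real r * cis \<theta>)) \<noteq> 0"
proof -
  interpret \<rho>: prob_space \<rho> by fact
  interpret circ: prob_space circ by (rule prob_space_circ)
  interpret pair_prob_space \<rho> circ ..
  note [measurable_cong] = \<rho>(2)
  let ?w = "\<lambda>\<theta>. a + of_real r * cis \<theta>"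
  let ?F = "\<lambda>y \<theta>. ln (cmod (y - ?w \<theta>))"
  have sym: "cmod (y - ?w \<theta>) = cmod (?w \<theta> - y)" for y \<theta> by (rule norm_minus_commute)
  have j: "integrable circ (?F y)" "(\<integral>\<theta>. ?F y \<theta> \<partial>circ) = log_max a r y" "AE \<theta> in circ. cmod (y - ?w \<theta>) \<noteq> 0" for y
    using jensen_circle[OF r, of a y] unfolding sym by (auto simp: log_max_def)
  note li = integrable_log_max[OF \<rho> r, of a]
  have Fm: "(\<lambda>p. ?F (fst p) (snd p)) \<in> borel_measurable (\<rho> \<Otimes>\<^sub>M circ)" by measurable
  have int: "integrable (\<rho> \<Otimes>\<^sub>M circ) (\<lambda>(y, \<theta>). ?F y \<theta>)"
  proof (rule Fubini_integrable)
    show "(\<lambda>(y, \<theta>). ?F y \<theta>) \<in> borel_measurable (\<rho> \<Otimes>\<^sub>M circ)" using Fm by (simp add: split_beta')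
    show "AE y in \<rho>. integrable circ (\<lambda>\<theta>. case (y, \<theta>) of (y, \<theta>) \<Rightarrow> ?F y \<theta>)" using j(1) by simp
    have b: "integrable \<rho> (\<lambda>y. 3 * \<bar>log_max a r y\<bar> + 2 * ln 2)" using li by simp
    show "integrable \<rho> (\<lambda>y. \<integral>\<theta>. norm (case (y, \<theta>) of (y, \<theta>) \<Rightarrow> ?F y \<theta>) \<partial>circ)"
    proof (rule Bochner_Integration.integrable_bound[OF b])
      show "(\<lambda>y. \<integral>\<theta>. norm (case (y, \<theta>) of (y, \<theta>) \<Rightarrow> ?F y \<theta>) \<partial>circ) \<in> borel_measurable \<rho>"
        by (rule circ.borel_measurable_lebesgue_integral) (use Fm in \<open>simp add: split_beta'\<close>)
      show "AE y in \<rho>. norm (\<integral>\<theta>. norm (case (y, \<theta>) of (y, \<theta>) \<Rightarrow> ?F y \<theta>) \<partial>circ) \<le> norm (3 * \<bar>log_max a r y\<bar> + 2 * ln 2)"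
      proof (rule AE_I2)
        fix y
        let ?b = "\<bar>log_max a r y\<bar> + ln 2"
        have up: "?F y \<theta> \<le> ?b" for \<theta>
        proof (cases "cmod (y - ?w \<theta>) = 0")
          case True then show ?thesis by simp
        next
          case False
          have "cmod (y - ?w \<theta>) \<le> cmod (y - a) + r"
            using norm_triangle_ineq4[of "y - a" "of_real r * cis \<theta>"] r by (simp add: norm_mult algebra_simps)
          also have "\<dots> \<le> 2 * max (cmod (y - a)) r" by simp
          finally have "?F y \<theta> \<le> ln (2 * max (cmod (y - a)) r)" using False by (intro ln_mono) auto
          also have "\<dots> = ln 2 + log_max a r y" using r by (simp add: log_max_def ln_mult_pos)
          finally show ?thesis by linarith
        qed
        have b0: "0 \<le> ?b" by simp
        have "(\<integral>\<theta>. \<bar>?F y \<theta>\<bar> \<partial>circ) \<le> (\<integral>\<theta>. 2 * ?b - ?F y \<theta> \<partial>circ)"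
        proof (rule integral_mono)
          fix \<theta>
          show "\<bar>?F y \<theta>\<bar> \<le> 2 * ?b - ?F y \<theta>" using up[of \<theta>] b0 by (smt (verit))
        qed (use j(1)[of y] in auto)
        also have "\<dots> = 2 * ?b - log_max a r y" using j(1,2)[of y] by (simp add: circ.prob_space)
        also have "\<dots> \<le> 3 * \<bar>log_max a r y\<bar> + 2 * ln 2" by simp
        finally show "norm (\<integral>\<theta>. norm (case (y, \<theta>) of (y, \<theta>) \<Rightarrow> ?F y \<theta>) \<partial>circ) \<le> norm (3 * \<bar>log_max a r y\<bar> + 2 * ln 2)"
          by simp
      qed
    qed
  qed
  show "integrable circ (\<lambda>\<theta>. \<integral>y. ?F y \<theta> \<partial>\<rho>)" by (rule integrable_snd[OF int])
  have "(\<integral>\<theta>. (\<integral>y. ?F y \<theta> \<partial>\<rho>) \<partial>circ) = (\<integral>y. (\<integral>\<theta>. ?F y \<theta> \<partial>circ) \<partial>\<rho>)" by (rule Fubini_integral[OF int])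
  then show "(\<integral>\<theta>. (\<integral>y. ?F y \<theta> \<partial>\<rho>) \<partial>circ) = (\<integral>y. log_max a r y \<partial>\<rho>)" unfolding j(2) .
  show "AE \<theta> in circ. integrable \<rho> (\<lambda>y. ?F y \<theta>)" by (rule AE_integrable_snd[OF int])
  have "AE y in \<rho>. AE \<theta> in circ. cmod (y - ?w \<theta>) \<noteq> 0" using j(3) by simp
  then show "AE \<theta> in circ. AE y in \<rho>. cmod (y - ?w \<theta>) \<noteq> 0"
    by (rule AE_commute[THEN iffD1, rotated]) measurable
qed

text \<open>Monotone convergence: \<open>log_max z r\<close> decreases to \<open>ln \<bar>z - y\<bar>\<close> as \<open>r\<close> tends to zero, also at \<open>y = z\<close>.\<close>
lemma log_potential_tendsto:
  assumes \<rho>: "prob_space \<rho>" "sets \<rho> = sets borel" "integrates_log_at_infinity \<rho>"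
  shows "(\<lambda>n. ereal (\<integral>y. log_max z (inverse (real (Suc n))) y \<partial>\<rho>)) \<longlonglongrightarrow> log_potential \<rho> z"
proof -
  interpret prob_space \<rho> by fact
  note [measurable_cong] = \<rho>(2)
  let ?\<tau> = "\<lambda>n. inverse (real (Suc n))"
  define g where "g n y = log_max z 1 y - log_max z (?\<tau> n) y" for n y
  define b where "b n = (\<integral>y. log_max z (?\<tau> n) y \<partial>\<rho>)" for n
  define a where "a = (\<integral>y. log_max z 1 y \<partial>\<rho>)"
  have \<tau>: "0 < ?\<tau> n" "?\<tau> n \<le> 1" for n by (auto simp: field_simps)
  have li: "integrable \<rho> (log_max z 1)" "integrable \<rho> (log_max z (?\<tau> n))" for n
    using \<tau> by (auto intro!: integrable_log_max[OF \<rho>])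
  have g0: "0 \<le> g n y" for n y using log_max_mono[of "?\<tau> n" 1 z y] \<tau>[of n] by (simp add: g_def)
  have gm [measurable]: "g n \<in> borel_measurable borel" for n unfolding g_def[abs_def] by measurable
  have l1: "0 \<le> log_max z 1 y" for y by (simp add: log_max_def)
  have pos: "(\<integral>\<^sup>+ y. e2ennreal (log_ext (cmod (z - y))) \<partial>\<rho>) = ennreal a"
  proof -
    have "e2ennreal (log_ext (cmod (z - y))) = ennreal (log_max z 1 y)" for y
    proof (cases "cmod (z - y) \<le> 1")
      case True
      then have "log_ext (cmod (z - y)) \<le> 0" by (auto simp: log_ext_def)
      then show ?thesis using True by (simp add: log_max_def norm_minus_commute max_def e2ennreal_neg)
    next
      case False
      then have "0 < cmod (z - y)" by linarith
      then show ?thesis using False by (simp add: log_ext_def log_max_def norm_minus_commute max_def)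
    qed
    then show ?thesis unfolding a_def using li(1) l1 by (simp add: nn_integral_eq_integral)
  qed
  have lim: "(\<lambda>n. ennreal (g n y)) \<longlonglongrightarrow> e2ennreal (- log_ext (cmod (z - y)))" for y
  proof (cases "cmod (z - y) = 0")
    case True
    have "g n y = ln (real (Suc n))" for n using True by (simp add: g_def log_max_def ln_inverse max_def del: of_nat_Suc)
    moreover have "filterlim (\<lambda>n. ln (real (Suc n))) at_top sequentially"
      by (rule filterlim_compose[OF ln_at_top])
        (rule filterlim_compose[OF filterlim_real_sequentially filterlim_Suc])
    ultimately have "filterlim (\<lambda>n. g n y) at_top sequentially" by simp
    then have "(\<lambda>n. ennreal (g n y)) \<longlonglongrightarrow> \<infinity>" by (simp add: ennreal_tendsto_top_eq_at_top)
    then show ?thesis using True by (simp add: log_ext_def)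
  next
    case False
    then have x: "0 < cmod (z - y)" by simp
    have "\<forall>\<^sub>F n in sequentially. ?\<tau> n < cmod (z - y)"
      using order_tendstoD(2)[OF LIMSEQ_inverse_real_of_nat x] .
    then have "\<forall>\<^sub>F n in sequentially. ennreal (g n y) = e2ennreal (- log_ext (cmod (z - y)))"
    proof eventually_elim
      case (elim n)
      then have "log_max z (?\<tau> n) y = ln (cmod (z - y))" by (simp add: log_max_def norm_minus_commute max_def)
      moreover have "log_max z 1 y = max 0 (ln (cmod (z - y)))" using x by (auto simp: log_max_def norm_minus_commute max_def)
      ultimately have "g n y = max 0 (- ln (cmod (z - y)))" by (auto simp: g_def)
      moreover have "- log_ext (cmod (z - y)) = ereal (- ln (cmod (z - y)))" using x by (simp add: log_ext_def)
      ultimately show ?case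
        by (cases "ln (cmod (z - y)) \<le> 0") (auto simp: max_def e2ennreal_neg ennreal_neg)
    qed
    then show ?thesis by (rule tendsto_eventually)
  qed
  have "(\<lambda>n. \<integral>\<^sup>+ y. ennreal (g n y) \<partial>\<rho>) \<longlonglongrightarrow> (\<integral>\<^sup>+ y. e2ennreal (- log_ext (cmod (z - y))) \<partial>\<rho>)"
  proof (rule nn_integral_LIMSEQ)
    show "incseq (\<lambda>n y. ennreal (g n y))"
    proof (intro incseq_SucI le_funI ennreal_leI)
      fix n y
      have "log_max z (?\<tau> (Suc n)) y \<le> log_max z (?\<tau> n) y"
        by (intro log_max_mono \<tau>) (auto simp: field_simps)
      then show "g n y \<le> g (Suc n) y" by (simp add: g_def)
    qed
  qed (use lim in measurable)
  moreover have "(\<integral>\<^sup>+ y. ennreal (g n y) \<partial>\<rho>) = ennreal (a - b n)" for n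
  proof -
    have "integrable \<rho> (g n)" "(\<integral>y. g n y \<partial>\<rho>) = a - b n" unfolding g_def[abs_def] a_def b_def using li by auto
    then show ?thesis using g0 by (simp add: nn_integral_eq_integral)
  qed
  ultimately have "(\<lambda>n. ennreal (a - b n)) \<longlonglongrightarrow> (\<integral>\<^sup>+ y. e2ennreal (- log_ext (cmod (z - y))) \<partial>\<rho>)" (is "_ \<longlonglongrightarrow> ?N") by simp
  then have "(\<lambda>n. enn2ereal (ennreal (a - b n))) \<longlonglongrightarrow> enn2ereal ?N" by (rule tendsto_enn2erealI)
  moreover have "a - b n \<ge> 0" for n
    unfolding a_def b_def using li \<tau> by (auto intro!: integral_mono log_max_mono simp: diff_ge_0_iff_ge)
  then have "enn2ereal (ennreal (a - b n)) = ereal (a - b n)" for n by (rule enn2ereal_ennreal)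
  ultimately have "(\<lambda>n. ereal (a - b n)) \<longlonglongrightarrow> enn2ereal ?N" by (simp only:)
  then have "(\<lambda>n. ereal a + - ereal (a - b n)) \<longlonglongrightarrow> ereal a + - enn2ereal ?N"
    by (intro tendsto_add_ereal_general tendsto_uminus_ereal tendsto_const) auto
  moreover have "a \<ge> 0" unfolding a_def by (intro integral_nonneg_AE AE_I2 l1)
  ultimately show ?thesis unfolding log_potential_def pos b_def by (simp add: enn2ereal_ennreal minus_ereal_def)
qed

text \<open>Where the potential is nonnegative it is a Bochner integral: the truncated integrals decrease to it, so they
  are bounded below, and the limit theorem for logarithms gives integrability.\<close>
lemma log_potential_eq_integral:
  assumes \<rho>: "prob_space \<rho>" "sets \<rho> = sets borel" "integrates_log_at_infinity \<rho>"
  shows "(AE y in \<rho>. cmod (y - z) \<noteq> 0) \<Longrightarrow> integrable \<rho> (\<lambda>y. ln (cmod (y - z))) \<Longrightarrow>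
      log_potential \<rho> z = ereal (\<integral>y. ln (cmod (y - z)) \<partial>\<rho>)"
    and "0 \<le> log_potential \<rho> z \<Longrightarrow> (AE y in \<rho>. cmod (y - z) \<noteq> 0) \<and> integrable \<rho> (\<lambda>y. ln (cmod (y - z)))"
proof -
  interpret prob_space \<rho> by fact
  note [measurable_cong] = \<rho>(2)
  let ?\<tau> = "\<lambda>n. inverse (real (Suc n))"
  define b where "b n = (\<integral>y. log_max z (?\<tau> n) y \<partial>\<rho>)" for n
  have \<tau>: "0 < ?\<tau> n" "?\<tau> n \<le> 1" for n by (auto simp: field_simps)
  have li: "integrable \<rho> (log_max z 1)" "integrable \<rho> (log_max z (?\<tau> n))" for n
    using \<tau> by (auto intro!: integrable_log_max[OF \<rho>])
  have key: "(AE y in \<rho>. cmod (y - z) \<noteq> 0) \<and> integrable \<rho> (\<lambda>y. ln (cmod (y - z))) \<and> b \<longlonglongrightarrow> (\<integral>y. ln (cmod (y - z)) \<partial>\<rho>)"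
    if low: "\<And>n. v \<le> b n" for v
  proof -
    have F: "(\<lambda>n. max (cmod (y - z)) (?\<tau> n)) \<longlonglongrightarrow> cmod (y - z)" for y
    proof -
      have "(\<lambda>n. max (cmod (y - z)) (?\<tau> n)) \<longlonglongrightarrow> max (cmod (y - z)) 0"
        by (intro tendsto_max tendsto_const LIMSEQ_inverse_real_of_nat)
      then show ?thesis by simp
    qed
    note L = log_integral_limit[where F="\<lambda>n y. max (cmod (y - z)) (?\<tau> n)" and f="\<lambda>y. cmod (y - z)" and g="log_max z 1" and K=1 and v=v]
    have h: "0 < max (cmod (y - z)) (?\<tau> n)" "cmod (y - z) \<le> 1 * max (cmod (y - z)) (?\<tau> n)"
      "ln (max (cmod (y - z)) (?\<tau> n)) \<le> log_max z 1 y" for y n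
      using \<tau>[of n] log_max_mono[of "?\<tau> n" 1 z y] by (auto simp: log_max_def less_max_iff_disj)
    have i: "integrable \<rho> (\<lambda>y. ln (max (cmod (y - z)) (?\<tau> n)))" "v \<le> (\<integral>y. ln (max (cmod (y - z)) (?\<tau> n)) \<partial>\<rho>)" for n
      using li(2)[of n] low[of n] by (simp_all add: log_max_def[abs_def] b_def)
    show ?thesis
    proof (intro conjI)
      show "AE y in \<rho>. cmod (y - z) \<noteq> 0" by (rule L(1)) (use F h i li(1) in auto)
      show "integrable \<rho> (\<lambda>y. ln (cmod (y - z)))" by (rule L(2)) (use F h i li(1) in auto)
      show "b \<longlonglongrightarrow> (\<integral>y. ln (cmod (y - z)) \<partial>\<rho>)" unfolding b_def[abs_def] log_max_def
        by (rule L(3)) (use F h i li(1) in auto)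
    qed
  qed
  have blim: "(\<lambda>n. ereal (b n)) \<longlonglongrightarrow> log_potential \<rho> z" unfolding b_def by (rule log_potential_tendsto[OF \<rho>])
  {
    assume ne: "AE y in \<rho>. cmod (y - z) \<noteq> 0" and int: "integrable \<rho> (\<lambda>y. ln (cmod (y - z)))"
    have "(\<integral>y. ln (cmod (y - z)) \<partial>\<rho>) \<le> b n" for n unfolding b_def
    proof (rule integral_mono_AE[OF int li(2)])
      show "AE y in \<rho>. ln (cmod (y - z)) \<le> log_max z (?\<tau> n) y"
        using ne by eventually_elim (simp add: log_max_def ln_mono)
    qed
    from key[OF this] have "b \<longlonglongrightarrow> (\<integral>y. ln (cmod (y - z)) \<partial>\<rho>)" by simp
    then have "(\<lambda>n. ereal (b n)) \<longlonglongrightarrow> ereal (\<integral>y. ln (cmod (y - z)) \<partial>\<rho>)" by (intro tendsto_intros)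
    then show "log_potential \<rho> z = ereal (\<integral>y. ln (cmod (y - z)) \<partial>\<rho>)" by (rule LIMSEQ_unique[OF blim])
  }
  {
    assume nn: "0 \<le> log_potential \<rho> z"
    have "decseq (\<lambda>n. ereal (b n))"
    proof (rule decseq_SucI)
      fix n
      have "b (Suc n) \<le> b n" unfolding b_def
        by (intro integral_mono li log_max_mono \<tau>) (auto simp: field_simps)
      then show "ereal (b (Suc n)) \<le> ereal (b n)" by simp
    qed
    then have "0 \<le> ereal (b n)" for n using decseq_ge[OF _ blim, of n] nn by (meson order_trans)
    then have "0 \<le> b n" for n by simp
    from key[OF this] show "(AE y in \<rho>. cmod (y - z) \<noteq> 0) \<and> integrable \<rho> (\<lambda>y. ln (cmod (y - z)))" by blast
  }
qed

lemma clipped_potential_eq: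
  assumes \<rho>: "prob_space \<rho>" "sets \<rho> = sets borel" "integrates_log_at_infinity \<rho>"
  shows "ereal (clipped_potential \<rho> z) = max (log_potential \<rho> z) 0"
proof (cases "(AE y in \<rho>. cmod (y - z) \<noteq> 0) \<and> integrable \<rho> (\<lambda>y. ln (cmod (y - z)))")
  case True
  then have "log_potential \<rho> z = ereal (\<integral>y. ln (cmod (y - z)) \<partial>\<rho>)" using log_potential_eq_integral(1)[OF \<rho>] by blast
  then show ?thesis using True by (simp add: clipped_potential_def max_def zero_ereal_def)
next
  case False
  then have "\<not> 0 \<le> log_potential \<rho> z" using log_potential_eq_integral(2)[OF \<rho>] by blast
  then have "log_potential \<rho> z \<le> 0" by (simp add: not_le less_imp_le)
  moreover have "clipped_potential \<rho> z = 0" unfolding clipped_potential_def by (rule if_not_P[OF False])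
  ultimately show ?thesis by (simp add: max_absorb2 flip: zero_ereal_def)
qed

lemma regularized_potential_tendsto:
  assumes \<rho>: "prob_space \<rho>" "sets \<rho> = sets borel" "integrates_log_at_infinity \<rho>"
  shows "(\<lambda>n. max 0 (\<integral>y. log_max z (inverse (real (Suc n))) y \<partial>\<rho>)) \<longlonglongrightarrow> clipped_potential \<rho> z"
proof -
  have eq: "ereal (max 0 x) = max (ereal x) 0" for x by (simp add: max_def zero_ereal_def)
  have "(\<lambda>n. max (ereal (\<integral>y. log_max z (inverse (real (Suc n))) y \<partial>\<rho>)) 0) \<longlonglongrightarrow> max (log_potential \<rho> z) 0"
    by (intro tendsto_max log_potential_tendsto[OF \<rho>] tendsto_const)
  then have "(\<lambda>n. ereal (max 0 (\<integral>y. log_max z (inverse (real (Suc n))) y \<partial>\<rho>))) \<longlonglongrightarrow> ereal (clipped_potential \<rho> z)"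
    unfolding clipped_potential_eq[OF \<rho>] eq .
  then show ?thesis unfolding lim_ereal .
qed

lemma integral_log_max_lipschitz:
  assumes \<rho>: "prob_space \<rho>" "sets \<rho> = sets borel" "integrates_log_at_infinity \<rho>" and r: "r > 0"
  shows "\<bar>(\<integral>y. log_max a r y \<partial>\<rho>) - (\<integral>y. log_max a' r y \<partial>\<rho>)\<bar> \<le> cmod (a - a') / r"
proof -
  interpret prob_space \<rho> by fact
  note li = integrable_log_max[OF \<rho> r]
  have "\<bar>(\<integral>y. log_max a r y \<partial>\<rho>) - (\<integral>y. log_max a' r y \<partial>\<rho>)\<bar> = \<bar>\<integral>y. log_max a r y - log_max a' r y \<partial>\<rho>\<bar>"
    using li by simp
  also have "\<dots> \<le> (\<integral>y. \<bar>log_max a r y - log_max a' r y\<bar> \<partial>\<rho>)" by (rule integral_abs_bound)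
  also have "\<dots> \<le> (\<integral>y. cmod (a - a') / r \<partial>\<rho>)"
  proof (rule integral_mono)
    show "\<bar>log_max a r y - log_max a' r y\<bar> \<le> cmod (a - a') / r" for y
      using log_max_lipschitz[of r r r a y a'] r by simp
  qed (use li in auto)
  also have "\<dots> = cmod (a - a') / r" by (simp add: prob_space)
  finally show ?thesis .
qed

lemma clipped_potential_measurable:
  assumes \<rho>: "prob_space \<rho>" "sets \<rho> = sets borel" "integrates_log_at_infinity \<rho>"
  shows "clipped_potential \<rho> \<in> borel_measurable borel"
proof (rule borel_measurable_LIMSEQ_real[OF regularized_potential_tendsto[OF \<rho>]])
  fix n
  let ?\<tau> = "inverse (real (Suc n))"
  have "(1 / ?\<tau>)-lipschitz_on UNIV (\<lambda>z. \<integral>y. log_max z ?\<tau> y \<partial>\<rho>)"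
    by (rule lipschitz_onI) (use integral_log_max_lipschitz[OF \<rho>, of ?\<tau>] in \<open>auto simp: dist_norm mult.commute divide_inverse\<close>)
  then have "continuous_on UNIV (\<lambda>z. \<integral>y. log_max z ?\<tau> y \<partial>\<rho>)" by (rule lipschitz_on_continuous_on)
  then have [measurable]: "(\<lambda>z. \<integral>y. log_max z ?\<tau> y \<partial>\<rho>) \<in> borel_measurable borel" by (rule borel_measurable_continuous_onI)
  show "(\<lambda>z. max 0 (\<integral>y. log_max z ?\<tau> y \<partial>\<rho>)) \<in> borel_measurable borel" by measurable
qed

section \<open>Existence of the limit measure\<close>

lemma tent_lipschitz:
  assumes "0 < m" "m \<le> r" "m \<le> r'"
  shows "\<bar>tent r (y - a) - tent r' (y - a')\<bar> \<le> 2 * (cmod (a - a') + \<bar>r - r'\<bar>) / m"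
proof -
  have "\<bar>log_max a (2 * r) y - log_max a' (2 * r') y\<bar> \<le> (cmod (a - a') + \<bar>2 * r - 2 * r'\<bar>) / (2 * m)"
    using assms by (intro log_max_lipschitz) auto
  also have "\<bar>2 * r - 2 * r'\<bar> = 2 * \<bar>r - r'\<bar>" by (cases "r \<le> r'") auto
  also have "(cmod (a - a') + 2 * \<bar>r - r'\<bar>) / (2 * m) \<le> (2 * cmod (a - a') + 2 * \<bar>r - r'\<bar>) / (2 * m)"
    using assms by (intro divide_right_mono) auto
  also have "\<dots> = (cmod (a - a') + \<bar>r - r'\<bar>) / m" using assms(1) by (simp add: field_simps)
  finally have "\<bar>log_max a (2 * r) y - log_max a' (2 * r') y\<bar> \<le> (cmod (a - a') + \<bar>r - r'\<bar>) / m" .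
  moreover have "\<bar>log_max a r y - log_max a' r' y\<bar> \<le> (cmod (a - a') + \<bar>r - r'\<bar>) / m"
    using assms by (rule log_max_lipschitz)
  moreover have "2 * (cmod (a - a') + \<bar>r - r'\<bar>) / m = (cmod (a - a') + \<bar>r - r'\<bar>) / m + (cmod (a - a') + \<bar>r - r'\<bar>) / m" by simp
  ultimately show ?thesis unfolding tent_eq_log_max by linarith
qed

lemma tent_integral_lipschitz:
  assumes \<rho>: "prob_space \<rho>" "sets \<rho> = sets borel" and m: "0 < m" "m \<le> r" "m \<le> r'"
  shows "\<bar>tent_integral \<rho> r a - tent_integral \<rho> r' a'\<bar> \<le> 2 * (cmod (a - a') + \<bar>r - r'\<bar>) / m"
proof -
  interpret prob_space \<rho> by fact
  have i: "integrable \<rho> (\<lambda>y. tent r (y - a))" "integrable \<rho> (\<lambda>y. tent r' (y - a'))"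
    using tent_integral_bounds(1)[OF \<rho>] m by auto
  have "\<bar>tent_integral \<rho> r a - tent_integral \<rho> r' a'\<bar> = \<bar>\<integral>y. tent r (y - a) - tent r' (y - a') \<partial>\<rho>\<bar>"
    unfolding tent_integral_def using i by simp
  also have "\<dots> \<le> (\<integral>y. \<bar>tent r (y - a) - tent r' (y - a')\<bar> \<partial>\<rho>)" by (rule integral_abs_bound)
  also have "\<dots> \<le> (\<integral>y. 2 * (cmod (a - a') + \<bar>r - r'\<bar>) / m \<partial>\<rho>)"
    using i by (intro integral_mono tent_lipschitz m) auto
  also have "\<dots> = 2 * (cmod (a - a') + \<bar>r - r'\<bar>) / m" by (simp add: prob_space)
  finally show ?thesis .
qed

lemma continuous_tent:
  assumes "r > 0" shows "continuous_on UNIV (\<lambda>y. tent r (y - a))"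
  unfolding tent_def by (intro continuous_intros) (use assms in \<open>auto simp: max_def\<close>)

context random_potentials
begin

text \<open>A nonnegative random variable with small mean takes a small value somewhere.\<close>
lemma approximating_sample:
  fixes a :: "'k \<Rightarrow> complex" and r :: "'k \<Rightarrow> real"
  assumes K: "finite K" and r: "\<And>k. r k > 0" and \<epsilon>: "\<epsilon> > 0"
  shows "\<exists>N \<omega>. N > 0 \<and> (\<forall>k\<in>K. \<bar>tent_integral (L N \<omega>) (r k) (a k) - (circle_mean U (a k) (2 * r k) - circle_mean U (a k) (r k))\<bar> < \<epsilon>)"
proof -
  let ?T = "\<lambda>k N \<omega>. \<bar>tent_integral (L N \<omega>) (r k) (a k) - (circle_mean U (a k) (2 * r k) - circle_mean U (a k) (r k))\<bar>"
  have "(\<lambda>N. \<Sum>k\<in>K. \<integral>\<omega>. ?T k N \<omega> \<partial>P N) \<longlonglongrightarrow> (\<Sum>k\<in>K. 0)"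
    by (intro tendsto_sum tent_integral_L_tendsto(2) r)
  then have "\<forall>\<^sub>F N in sequentially. (\<Sum>k\<in>K. \<integral>\<omega>. ?T k N \<omega> \<partial>P N) < \<epsilon>"
    by (rule order_tendstoD) (use \<epsilon> in simp)
  then have "\<forall>\<^sub>F N in sequentially. (\<Sum>k\<in>K. \<integral>\<omega>. ?T k N \<omega> \<partial>P N) < \<epsilon> \<and> N > 0"
    using eventually_gt_at_top[of 0] by eventually_elim auto
  then obtain N where N: "(\<Sum>k\<in>K. \<integral>\<omega>. ?T k N \<omega> \<partial>P N) < \<epsilon>" "N > 0"
    using eventually_happens'[OF sequentially_bot] by blast
  interpret prob_space "P N" by (rule P_prob)
  note i = tent_integral_L_tendsto(1)[OF r N(2)]
  have "\<exists>\<omega>. (\<Sum>k\<in>K. ?T k N \<omega>) < \<epsilon>"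
  proof (rule ccontr)
    assume "\<not> ?thesis"
    then have "\<epsilon> \<le> (\<Sum>k\<in>K. ?T k N \<omega>)" for \<omega> by (simp add: not_less)
    then have "\<epsilon> \<le> (\<integral>\<omega>. (\<Sum>k\<in>K. ?T k N \<omega>) \<partial>P N)"
      by (intro integral_ge_const Bochner_Integration.integrable_sum i) auto
    also have "\<dots> = (\<Sum>k\<in>K. \<integral>\<omega>. ?T k N \<omega> \<partial>P N)"
      by (rule Bochner_Integration.integral_sum) (rule i)
    finally show False using N(1) by simp
  qed
  then obtain \<omega> where \<omega>: "(\<Sum>k\<in>K. ?T k N \<omega>) < \<epsilon>" by blast
  have "?T k N \<omega> < \<epsilon>" if "k \<in> K" for k
    using member_le_sum[of k K "\<lambda>k. ?T k N \<omega>"] that K \<omega> by fastforce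
  with N(2) show ?thesis by blast
qed

text \<open>These differences of circle means are limits of tent integrals of measures and inherit their regularity,
  although \<open>U\<close> may be discontinuous.\<close>
lemma U_tent_lipschitz:
  assumes m: "0 < m" "m \<le> r" "m \<le> r'"
  shows "\<bar>(circle_mean U a (2 * r) - circle_mean U a r) - (circle_mean U a' (2 * r') - circle_mean U a' r')\<bar> \<le> 2 * (cmod (a - a') + \<bar>r - r'\<bar>) / m"
proof (rule field_le_epsilon)
  fix e :: real assume e: "e > 0"
  let ?a = "\<lambda>b. if b then a else a'" and ?r = "\<lambda>b. if b then r else r'"
  have "?r b > 0" for b using m by auto
  from approximating_sample[of "{True, False}" ?r "e / 2" ?a] this e m
  obtain N \<omega> where N: "N > 0" and d: "\<forall>k\<in>{True, False}. \<bar>tent_integral (L N \<omega>) (?r k) (?a k) - (circle_mean U (?a k) (2 * ?r k) - circle_mean U (?a k) (?r k))\<bar> < e / 2"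
    by auto
  have "\<bar>tent_integral (L N \<omega>) r a - (circle_mean U a (2 * r) - circle_mean U a r)\<bar> < e / 2"
    "\<bar>tent_integral (L N \<omega>) r' a' - (circle_mean U a' (2 * r') - circle_mean U a' r')\<bar> < e / 2"
    using bspec[OF d, of True] bspec[OF d, of False] by simp_all
  then show "\<bar>(circle_mean U a (2 * r) - circle_mean U a r) - (circle_mean U a' (2 * r') - circle_mean U a' r')\<bar> \<le> 2 * (cmod (a - a') + \<bar>r - r'\<bar>) / m + e"
    using tent_integral_lipschitz[OF L_prob[OF N] L_sets[OF N] m, of \<omega> a a'] by linarith
qed

text \<open>Choose one realization for each \<open>n\<close>, with tent integrals within \<open>1 / (n + 1)\<close> of the limits for the members
  up to index \<open>n\<close> of a dense family. The first member is the tent at the origin whose limiting integral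
  \<open>ln 2\<close> is maximal: it forces the mass outside the disc of radius \<open>2 R\<close> to vanish, so these
  measures may be truncated to the disc and have a limit point. Its tent integrals are right on the dense family, hence
  everywhere by Lipschitz continuity.\<close>
theorem limit_measure_exists:
  assumes L_pmf: "\<And>N \<omega>. \<exists>p. L N \<omega> = distr (measure_pmf p) borel (\<lambda>z. z)"
    and R: "R > 0" and far: "circle_mean U 0 (2 * R) - circle_mean U 0 R = ln 2"
  shows "\<exists>\<mu>. prob_space \<mu> \<and> sets \<mu> = sets borel \<and> (AE y in \<mu>. cmod y \<le> 4 * R) \<and>
    (\<forall>r>0. \<forall>a. tent_integral \<mu> r a = circle_mean U a (2 * r) - circle_mean U a r)"
proof -
  define V where "V r a = circle_mean U a (2 * r) - circle_mean U a r" for r a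
  obtain D :: "(complex \<times> real) set" where D: "countable D" "\<And>X. open X \<Longrightarrow> X \<noteq> {} \<Longrightarrow> \<exists>d\<in>D. d \<in> X"
    using countable_dense_exists by metis
  have "D \<noteq> {}" using D(2)[of UNIV] by auto
  with D(1) have rng: "range (from_nat_into D) = D" by (rule range_from_nat_into[rotated])
  define p where "p k = (if k = 0 \<or> snd (from_nat_into D (k - 1)) \<le> 0 then (0, R) else from_nat_into D (k - 1))" for k
  have p0: "p 0 = (0, R)" by (simp add: p_def)
  have ppos: "snd (p k) > 0" for k using R by (auto simp: p_def)
  have pD: "\<exists>k. p k = d" if "d \<in> D" "snd d > 0" for d
  proof -
    have "d \<in> range (from_nat_into D)" using that(1) rng by simp
    then obtain k where "from_nat_into D k = d" by blast
    then have "p (Suc k) = d" using that(2) by (simp add: p_def)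
    then show ?thesis ..
  qed
  let ?\<tau> = "\<lambda>n. inverse (real (Suc n))"
  have "\<exists>N \<omega>. N > 0 \<and> (\<forall>k\<in>{..n}. \<bar>tent_integral (L N \<omega>) (snd (p k)) (fst (p k)) - V (snd (p k)) (fst (p k))\<bar> < ?\<tau> n)" for n
    unfolding V_def by (rule approximating_sample) (auto simp: ppos)
  then obtain N \<omega> where N: "\<And>n. N n > (0 :: nat)"
    and close: "\<And>n k. k \<le> n \<Longrightarrow> \<bar>tent_integral (L (N n) (\<omega> n)) (snd (p k)) (fst (p k)) - V (snd (p k)) (fst (p k))\<bar> < ?\<tau> n"
    by (metis atMost_iff)
  define \<rho> where "\<rho> n = L (N n) (\<omega> n)" for n
  have \<rho>: "prob_space (\<rho> n)" "sets (\<rho> n) = sets borel" for n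
    unfolding \<rho>_def by (rule L_prob[OF N] L_sets[OF N])+
  have lim: "(\<lambda>n. tent_integral (\<rho> n) (snd (p k)) (fst (p k))) \<longlonglongrightarrow> V (snd (p k)) (fst (p k))" for k
  proof (rule Lim_transform2[OF tendsto_const], rule tendsto_rabs_zero_cancel, rule tendsto_sandwich[OF _ _ tendsto_const LIMSEQ_inverse_real_of_nat])
    show "\<forall>\<^sub>F n in sequentially. \<bar>V (snd (p k)) (fst (p k)) - tent_integral (\<rho> n) (snd (p k)) (fst (p k))\<bar> \<le> ?\<tau> n"
      using eventually_ge_at_top[of k]
    proof eventually_elim
      case (elim n) then show ?case using close[of k n] by (simp add: \<rho>_def abs_minus_commute less_imp_le)
    qed
  qed simp
  have "\<exists>l. \<forall>n. \<rho> n = distr (measure_pmf (l n)) borel (\<lambda>z. z)"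
    by (rule choice) (simp add: \<rho>_def L_pmf)
  then obtain l where l: "\<And>n. \<rho> n = distr (measure_pmf (l n)) borel (\<lambda>z. z)" by blast
  define \<pi> where "\<pi> z = (if cmod z \<le> 2 * R then z else 0)" for z
  have \<pi>m [measurable]: "\<pi> \<in> borel_measurable borel" unfolding \<pi>_def[abs_def] by measurable
  define q where "q n = map_pmf \<pi> (l n)" for n
  have disc: "set_pmf (q n) \<subseteq> cball 0 (2 * R)" for n using R by (auto simp: q_def \<pi>_def)
  have "2 * R > 0" using R by simp
  from pmf_disc_compactness[where q=q, OF this disc]
  obtain s \<mu> where s: "strict_mono (s :: nat \<Rightarrow> nat)" and \<mu>: "prob_space \<mu>" "sets \<mu> = sets borel" "AE y in \<mu>. cmod y \<le> 2 * (2 * R)"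
    and conv: "\<And>h :: complex \<Rightarrow> real. continuous_on UNIV h \<Longrightarrow> (\<lambda>n. \<integral>y. h y \<partial>measure_pmf (q (s n))) \<longlonglongrightarrow> (\<integral>y. h y \<partial>\<mu>)"
    by blast
  \<comment> \<open>The truncation only moves points outside the support of the first tent.\<close>
  have trunc: "\<bar>(\<integral>y. tent r (y - a) \<partial>measure_pmf (q n)) - tent_integral (\<rho> n) r a\<bar> \<le> ln 2 - tent_integral (\<rho> n) R 0" if r: "r > 0" for r a n
  proof -
    interpret \<rho>: prob_space "\<rho> n" by (rule \<rho>)
    note [measurable_cong] = \<rho>(2)[of n]
    have i: "integrable (\<rho> n) (\<lambda>y. tent r (y - a))" "integrable (\<rho> n) (\<lambda>y. tent R (y - 0))"
      by (rule tent_integral_bounds(1)[OF \<rho> r], rule tent_integral_bounds(1)[OF \<rho> R])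
    have i2: "integrable (\<rho> n) (\<lambda>y. tent r (\<pi> y - a))"
      by (rule \<rho>.integrable_const_bound[where B="ln 2"]) (use tent_bounds(1,2)[OF r] in auto)
    have "(\<integral>y. tent r (y - a) \<partial>measure_pmf (q n)) = (\<integral>y. tent r (\<pi> y - a) \<partial>measure_pmf (l n))"
      by (simp add: q_def)
    also have "\<dots> = (\<integral>y. tent r (\<pi> y - a) \<partial>\<rho> n)" unfolding l by (rule integral_distr[symmetric]) auto
    finally have "\<bar>(\<integral>y. tent r (y - a) \<partial>measure_pmf (q n)) - tent_integral (\<rho> n) r a\<bar> = \<bar>\<integral>y. tent r (\<pi> y - a) - tent r (y - a) \<partial>\<rho> n\<bar>"
      unfolding tent_integral_def using i(1) i2 by simp
    also have "\<dots> \<le> (\<integral>y. \<bar>tent r (\<pi> y - a) - tent r (y - a)\<bar> \<partial>\<rho> n)" by (rule integral_abs_bound)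
    also have "\<dots> \<le> (\<integral>y. ln 2 - tent R (y - 0) \<partial>\<rho> n)"
    proof (rule integral_mono)
      fix y
      show "\<bar>tent r (\<pi> y - a) - tent r (y - a)\<bar> \<le> ln 2 - tent R (y - 0)"
      proof (cases "cmod y \<le> 2 * R")
        case True then show ?thesis using tent_bounds(2)[OF R, of y] by (simp add: \<pi>_def)
      next
        case False
        then have "tent R (y - 0) = 0" using tent_bounds(3)[OF R, of y] by simp
        then show ?thesis using tent_bounds(1,2)[OF r, of "\<pi> y - a"] tent_bounds(1,2)[OF r, of "y - a"] by linarith
      qed
    qed (use i i2 in auto)
    also have "\<dots> = ln 2 - tent_integral (\<rho> n) R 0" unfolding tent_integral_def using i(2) by (simp add: \<rho>.prob_space)
    finally show ?thesis .
  qed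
  have tight: "(\<lambda>n. ln 2 - tent_integral (\<rho> n) R 0) \<longlonglongrightarrow> 0"
  proof -
    have "(\<lambda>n. ln 2 - tent_integral (\<rho> n) R 0) \<longlonglongrightarrow> ln 2 - V R 0"
      using lim[of 0] unfolding p0 by (intro tendsto_intros) simp
    then show ?thesis using far by (simp add: V_def)
  qed
  have dense: "tent_integral \<mu> (snd (p k)) (fst (p k)) = V (snd (p k)) (fst (p k))" for k
  proof -
    have "(\<lambda>n. (\<integral>y. tent (snd (p k)) (y - fst (p k)) \<partial>measure_pmf (q n)) - tent_integral (\<rho> n) (snd (p k)) (fst (p k))) \<longlonglongrightarrow> 0"
      by (rule tendsto_rabs_zero_cancel, rule tendsto_sandwich[OF _ _ tendsto_const tight])
        (use trunc[OF ppos] in auto)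
    from tendsto_add[OF this lim[of k]]
    have "(\<lambda>n. \<integral>y. tent (snd (p k)) (y - fst (p k)) \<partial>measure_pmf (q n)) \<longlonglongrightarrow> V (snd (p k)) (fst (p k))" by simp
    from LIMSEQ_subseq_LIMSEQ[OF this s]
    have "(\<lambda>n. \<integral>y. tent (snd (p k)) (y - fst (p k)) \<partial>measure_pmf (q (s n))) \<longlonglongrightarrow> V (snd (p k)) (fst (p k))" by (simp add: comp_def)
    from LIMSEQ_unique[OF conv[OF continuous_tent[OF ppos]] this] show ?thesis by (simp add: tent_integral_def)
  qed
  have "tent_integral \<mu> r a = V r a" if r: "r > 0" for r a
  proof -
    have "\<bar>tent_integral \<mu> r a - V r a\<bar> \<le> 0 + e" if e: "e > 0" for e
    proof -
      define d where "d = min (r / 2) (e * r / 16)"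
      have d: "d > 0" "d \<le> r / 2" "16 * d \<le> e * r" using r e by (auto simp: d_def)
      have "open (ball a d \<times> ball r d)" "ball a d \<times> ball r d \<noteq> {}" using d by (auto intro: open_Times)
      then obtain x where x: "x \<in> D" "x \<in> ball a d \<times> ball r d" using D(2) by blast
      then have xd: "cmod (a - fst x) < d" "\<bar>r - snd x\<bar> < d" by (auto simp: dist_norm)
      then have xp: "r / 2 \<le> snd x" using d by linarith
      then have "snd x > 0" using r by linarith
      with pD[OF x(1)] obtain k where k: "p k = x" by blast
      have m: "0 < r / 2" "r / 2 \<le> r" using r by auto
      have "\<bar>tent_integral \<mu> r a - tent_integral \<mu> (snd x) (fst x)\<bar> \<le> 2 * (cmod (a - fst x) + \<bar>r - snd x\<bar>) / (r / 2)"
        by (rule tent_integral_lipschitz[OF \<mu>(1,2) m xp])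
      moreover have "\<bar>V r a - V (snd x) (fst x)\<bar> \<le> 2 * (cmod (a - fst x) + \<bar>r - snd x\<bar>) / (r / 2)"
        unfolding V_def by (rule U_tent_lipschitz[OF m xp])
      moreover have "2 * (cmod (a - fst x) + \<bar>r - snd x\<bar>) / (r / 2) \<le> 2 * (2 * d) / (r / 2)"
        using xd m(1) by (intro divide_right_mono) auto
      moreover have "2 * (2 * d) / (r / 2) \<le> e / 2" using d r by (simp add: field_simps)
      ultimately show ?thesis using dense[of k] unfolding k by linarith
    qed
    then have "\<bar>tent_integral \<mu> r a - V r a\<bar> \<le> 0" by (rule field_le_epsilon)
    then show ?thesis by simp
  qed
  then show ?thesis using \<mu> by (intro exI[of _ \<mu>]) (auto simp: V_def)
qed

end

text \<open>The two sides have equal increments along \<open>r, 2 r, 4 r, \<dots>\<close>, and they agree for large radii.\<close>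
lemma integral_log_max_of_tents:
  assumes \<mu>: "prob_space \<mu>" "sets \<mu> = sets borel" and bd: "AE y in \<mu>. cmod y \<le> R"
    and eq: "\<And>r. r > 0 \<Longrightarrow> tent_integral \<mu> r a = circle_mean u a (2 * r) - circle_mean u a r"
    and far: "\<And>s. s \<ge> s0 \<Longrightarrow> circle_mean u a s = ln s" and r: "r > 0"
  shows "(\<integral>y. log_max a r y \<partial>\<mu>) = circle_mean u a r"
proof -
  interpret prob_space \<mu> by fact
  note [measurable_cong] = \<mu>(2)
  note li = integrable_log_max[OF \<mu> integrates_log_of_bounded[OF \<mu> bd]]
  define d where "d r = (\<integral>y. log_max a r y \<partial>\<mu>) - circle_mean u a r" for r
  have step: "d (2 * r) = d r" if "r > 0" for r
  proof -
    have "2 * r > 0" using that by simp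
    then have "tent_integral \<mu> r a = (\<integral>y. log_max a (2 * r) y \<partial>\<mu>) - (\<integral>y. log_max a r y \<partial>\<mu>)"
      unfolding tent_integral_def tent_eq_log_max using li that by simp
    then show ?thesis using eq[OF that] by (simp add: d_def)
  qed
  have iter: "d (2 ^ k * r) = d r" for k
  proof (induction k)
    case (Suc k)
    have "0 < 2 ^ k * r" using r by simp
    from step[OF this] Suc show ?case by (simp add: mult.assoc)
  qed simp
  obtain k where k: "max s0 (R + cmod a) / r < 2 ^ k" using real_arch_pow[of 2 "max s0 (R + cmod a) / r"] by auto
  then have k: "max s0 (R + cmod a) \<le> 2 ^ k * r" using r by (simp add: field_simps)
  have "(\<integral>y. log_max a (2 ^ k * r) y \<partial>\<mu>) = (\<integral>y. ln (2 ^ k * r) \<partial>\<mu>)"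
  proof (rule integral_cong_AE)
    show "AE y in \<mu>. log_max a (2 ^ k * r) y = ln (2 ^ k * r)"
      using bd
    proof eventually_elim
      case (elim y)
      have "cmod (y - a) \<le> cmod y + cmod a" by (rule norm_triangle_ineq4)
      then have "cmod (y - a) \<le> 2 ^ k * r" using elim k by simp
      then show ?case by (simp add: log_max_def max_absorb2)
    qed
  qed measurable
  also have "\<dots> = circle_mean u a (2 ^ k * r)" using far[of "2 ^ k * r"] k by (simp add: prob_space)
  finally have "d (2 ^ k * r) = 0" by (simp add: d_def)
  then show ?thesis using iter[of k] by (simp add: d_def)
qed

section \<open>The clipped potential as a potential\<close>

lemma clipped_potential_le_log_max:
  assumes \<rho>: "prob_space \<rho>" "sets \<rho> = sets borel" "integrates_log_at_infinity \<rho>" and \<tau>: "\<tau> > 0"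
  shows "clipped_potential \<rho> w \<le> max 0 (\<integral>y. log_max w \<tau> y \<partial>\<rho>)"
proof (cases "(AE y in \<rho>. cmod (y - w) \<noteq> 0) \<and> integrable \<rho> (\<lambda>y. ln (cmod (y - w)))")
  case True
  then have ne: "AE y in \<rho>. cmod (y - w) \<noteq> 0" and int: "integrable \<rho> (\<lambda>y. ln (cmod (y - w)))" by auto
  have "(\<integral>y. ln (cmod (y - w)) \<partial>\<rho>) \<le> (\<integral>y. log_max w \<tau> y \<partial>\<rho>)"
  proof (rule integral_mono_AE[OF int integrable_log_max[OF \<rho> \<tau>]])
    show "AE y in \<rho>. ln (cmod (y - w)) \<le> log_max w \<tau> y"
      using ne by eventually_elim (simp add: log_max_def ln_mono)
  qed
  then show ?thesis using True by (simp add: clipped_potential_def max.coboundedI2)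
next
  case False
  have "clipped_potential \<rho> w = 0" unfolding clipped_potential_def by (rule if_not_P[OF False])
  then show ?thesis by simp
qed

lemma clipped_potential_ge:
  assumes "AE y in \<rho>. cmod (y - w) \<noteq> 0" "integrable \<rho> (\<lambda>y. ln (cmod (y - w)))"
  shows "clipped_potential \<rho> w = max 0 (\<integral>y. ln (cmod (y - w)) \<partial>\<rho>)"
  using assms by (simp add: clipped_potential_def)

context
  fixes \<nu> :: "complex measure" and B :: real
  assumes \<nu>: "prob_space \<nu>" "sets \<nu> = sets borel" "AE x in \<nu>. cmod x \<le> B" and B: "B \<ge> 0"
begin

lemma integrates_log_bounded_support: "integrates_log_at_infinity \<nu>"
  by (rule integrates_log_of_bounded[OF \<nu>])

lemma clipped_potential_circ_integrable: "integrable circ (\<lambda>\<theta>. clipped_potential \<nu> (a + of_real r * cis \<theta>))"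
proof -
  interpret circ: prob_space circ by (rule prob_space_circ)
  note [measurable] = clipped_potential_measurable[OF \<nu>(1,2) integrates_log_bounded_support]
  show ?thesis
  proof (rule circ.integrable_const_bound[where B="B + (cmod a + \<bar>r\<bar>)"])
    show "AE \<theta> in circ. norm (clipped_potential \<nu> (a + of_real r * cis \<theta>)) \<le> B + (cmod a + \<bar>r\<bar>)"
    proof (rule AE_I2)
      fix \<theta>
      have "cmod (a + of_real r * cis \<theta>) \<le> cmod a + \<bar>r\<bar>"
        using norm_triangle_ineq[of a "of_real r * cis \<theta>"] by (simp add: norm_mult)
      then show "norm (clipped_potential \<nu> (a + of_real r * cis \<theta>)) \<le> B + (cmod a + \<bar>r\<bar>)"
        using clipped_potential_bounds[OF \<nu> B, of "a + of_real r * cis \<theta>"] unfolding real_norm_def by linarith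
    qed
  qed measurable
qed

text \<open>Subharmonicity: where the potential of \<open>\<nu>\<close> is positive, it is at most its circle mean, and the clipped
  potential lies above the potential almost everywhere on the circle.\<close>
lemma clipped_potential_le_circle_mean:
  assumes r: "r > 0" shows "clipped_potential \<nu> z \<le> circle_mean (clipped_potential \<nu>) z r"
proof -
  interpret circ: prob_space circ by (rule prob_space_circ)
  note li = integrates_log_bounded_support
  have nn: "0 \<le> circle_mean (clipped_potential \<nu>) z r"
    unfolding circle_mean_def by (intro integral_nonneg_AE AE_I2 clipped_potential_bounds[OF \<nu> B])
  note cm = circle_mean_log_potential[OF \<nu>(1,2) li r, of z]
  have "(\<integral>y. log_max z r y \<partial>\<nu>) \<le> circle_mean (clipped_potential \<nu>) z r"
    unfolding circle_mean_def cm(2)[symmetric]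
  proof (rule integral_mono_AE[OF cm(1) clipped_potential_circ_integrable])
    show "AE \<theta> in circ. (\<integral>y. ln (cmod (y - (z + of_real r * cis \<theta>))) \<partial>\<nu>) \<le> clipped_potential \<nu> (z + of_real r * cis \<theta>)"
      using cm(3,4) by eventually_elim (simp add: clipped_potential_ge)
  qed
  with nn clipped_potential_le_log_max[OF \<nu>(1,2) li r, of z] show ?thesis by linarith
qed

lemma circle_mean_clipped_potential_le:
  assumes r: "r > 0" and \<tau>: "\<tau> > 0"
  shows "circle_mean (clipped_potential \<nu>) z r \<le> max 0 (\<integral>y. log_max z \<tau> y \<partial>\<nu>) + r / \<tau>"
proof -
  interpret circ: prob_space circ by (rule prob_space_circ)
  note li = integrates_log_bounded_support
  have "clipped_potential \<nu> (z + of_real r * cis \<theta>) \<le> max 0 (\<integral>y. log_max z \<tau> y \<partial>\<nu>) + r / \<tau>" for \<theta>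
  proof -
    let ?w = "z + of_real r * cis \<theta>"
    have "\<bar>(\<integral>y. log_max ?w \<tau> y \<partial>\<nu>) - (\<integral>y. log_max z \<tau> y \<partial>\<nu>)\<bar> \<le> r / \<tau>"
      using integral_log_max_lipschitz[OF \<nu>(1,2) li \<tau>, of ?w z] r by (simp add: norm_mult)
    moreover have "0 \<le> r / \<tau>" using r \<tau> by simp
    ultimately show ?thesis using clipped_potential_le_log_max[OF \<nu>(1,2) li \<tau>, of ?w] by linarith
  qed
  then have "circle_mean (clipped_potential \<nu>) z r \<le> (\<integral>\<theta>. max 0 (\<integral>y. log_max z \<tau> y \<partial>\<nu>) + r / \<tau> \<partial>circ)"
    unfolding circle_mean_def by (intro integral_mono clipped_potential_circ_integrable) auto
  then show ?thesis by (simp add: circ.prob_space)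
qed

text \<open>The circle means are at least the value at the centre. From above they are compared with the
  truncated potentials at a fixed scale \<open>\<tau>\<close>, which are continuous; then \<open>\<tau>\<close> tends to zero.\<close>
lemma circle_mean_clipped_potential_tendsto:
  "(\<lambda>n. circle_mean (clipped_potential \<nu>) z (inverse (real (Suc n)))) \<longlonglongrightarrow> clipped_potential \<nu> z"
proof (rule order_tendstoI)
  let ?\<tau> = "\<lambda>n. inverse (real (Suc n))"
  have \<tau>: "?\<tau> n > 0" for n by simp
  fix x
  show "\<forall>\<^sub>F n in sequentially. x < circle_mean (clipped_potential \<nu>) z (?\<tau> n)" if "x < clipped_potential \<nu> z"
    using clipped_potential_le_circle_mean[OF \<tau>, of z] that by (intro always_eventually allI) (rule less_le_trans)
  assume x: "clipped_potential \<nu> z < x"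
  note reg = regularized_potential_tendsto[OF \<nu>(1,2) integrates_log_bounded_support, of z]
  obtain m where m: "max 0 (\<integral>y. log_max z (?\<tau> m) y \<partial>\<nu>) < x"
    using eventually_happens'[OF sequentially_bot order_tendstoD(2)[OF reg x]] by blast
  have "(\<lambda>n. max 0 (\<integral>y. log_max z (?\<tau> m) y \<partial>\<nu>) + ?\<tau> n / ?\<tau> m) \<longlonglongrightarrow> max 0 (\<integral>y. log_max z (?\<tau> m) y \<partial>\<nu>) + 0 / ?\<tau> m"
    by (intro tendsto_intros LIMSEQ_inverse_real_of_nat) simp
  then have "\<forall>\<^sub>F n in sequentially. max 0 (\<integral>y. log_max z (?\<tau> m) y \<partial>\<nu>) + ?\<tau> n / ?\<tau> m < x"
    by (rule order_tendstoD(2)) (use m in simp)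
  then show "\<forall>\<^sub>F n in sequentially. circle_mean (clipped_potential \<nu>) z (?\<tau> n) < x"
    by (rule eventually_mono) (rule le_less_trans[OF circle_mean_clipped_potential_le[OF \<tau> \<tau>]])
qed

text \<open>Far out the potential of \<open>\<nu>\<close> is nonnegative, so the clipping is inactive and Jensen's formula applies.\<close>
lemma circle_mean_clipped_potential_far:
  assumes s: "s \<ge> B + 1 + cmod a"
  shows "circle_mean (clipped_potential \<nu>) a s = ln s"
proof -
  interpret \<nu>: prob_space \<nu> by (rule \<nu>)
  note [measurable_cong] = \<nu>(2)
  note li = integrates_log_bounded_support
  have s0: "s > 0" using s B norm_ge_zero[of a] by linarith
  note cm = circle_mean_log_potential[OF \<nu>(1,2) li s0, of a]
  note [measurable] = clipped_potential_measurable[OF \<nu>(1,2) li]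
  have "circle_mean (clipped_potential \<nu>) a s = (\<integral>\<theta>. (\<integral>y. ln (cmod (y - (a + of_real s * cis \<theta>))) \<partial>\<nu>) \<partial>circ)"
    unfolding circle_mean_def
  proof (rule integral_cong_AE)
    show "AE \<theta> in circ. clipped_potential \<nu> (a + of_real s * cis \<theta>) = (\<integral>y. ln (cmod (y - (a + of_real s * cis \<theta>))) \<partial>\<nu>)"
      using cm(3,4)
    proof eventually_elim
      case (elim \<theta>)
      have "0 \<le> (\<integral>y. ln (cmod (y - (a + of_real s * cis \<theta>))) \<partial>\<nu>)"
      proof (rule integral_nonneg_AE)
        show "AE y in \<nu>. 0 \<le> ln (cmod (y - (a + of_real s * cis \<theta>)))"
          using \<nu>(3)
        proof eventually_elim
          case (elim y)
          have "s = cmod ((y - a) - (y - (a + of_real s * cis \<theta>)))" using s0 by (simp add: norm_mult)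
          also have "\<dots> \<le> cmod (y - a) + cmod (y - (a + of_real s * cis \<theta>))" by (rule norm_triangle_ineq4)
          finally have "1 \<le> cmod (y - (a + of_real s * cis \<theta>))"
            using s elim norm_triangle_ineq4[of y a] by linarith
          then show ?case by (rule ln_ge_zero)
        qed
      qed
      then show ?case using clipped_potential_ge[OF elim(2,1)] by simp
    qed
    show "(\<lambda>\<theta>. \<integral>y. ln (cmod (y - (a + of_real s * cis \<theta>))) \<partial>\<nu>) \<in> borel_measurable circ"
      using cm(1) by (rule borel_measurable_integrable)
  qed measurable
  also have "\<dots> = (\<integral>y. log_max a s y \<partial>\<nu>)" by (rule cm(2))
  also have "\<dots> = (\<integral>y. ln s \<partial>\<nu>)"
  proof (rule integral_cong_AE)
    show "AE y in \<nu>. log_max a s y = ln s"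
      using \<nu>(3)
    proof eventually_elim
      case (elim y)
      then have "cmod (y - a) \<le> s" using s norm_triangle_ineq4[of y a] by linarith
      then show ?case by (simp add: log_max_def max_absorb2)
    qed
  qed measurable
  finally show ?thesis by (simp add: \<nu>.prob_space)
qed

lemma has_log_potential_of_circle_means:
  assumes \<mu>: "prob_space \<mu>" "sets \<mu> = sets borel" "integrates_log_at_infinity \<mu>"
    and eq: "\<And>a r. r > 0 \<Longrightarrow> (\<integral>y. log_max a r y \<partial>\<mu>) = circle_mean (clipped_potential \<nu>) a r"
  shows "has_log_potential \<mu> (\<lambda>z. max (log_potential \<nu> z) 0)"
  unfolding has_log_potential_def
proof (intro conjI allI \<mu>)
  fix z
  have "(\<lambda>n. ereal (circle_mean (clipped_potential \<nu>) z (inverse (real (Suc n))))) \<longlonglongrightarrow> log_potential \<mu> z"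
    using log_potential_tendsto[OF \<mu>, of z] by (subst (asm) eq) auto
  moreover have "(\<lambda>n. ereal (circle_mean (clipped_potential \<nu>) z (inverse (real (Suc n))))) \<longlonglongrightarrow> ereal (clipped_potential \<nu> z)"
    unfolding lim_ereal by (rule circle_mean_clipped_potential_tendsto)
  ultimately have "log_potential \<mu> z = ereal (clipped_potential \<nu> z)" by (rule LIMSEQ_unique)
  then show "log_potential \<mu> z = max (log_potential \<nu> z) 0"
    unfolding clipped_potential_eq[OF \<nu>(1,2) integrates_log_bounded_support] .
qed

text \<open>The potential of \<open>\<mu>\<close> is finite everywhere here, so its circle means can be computed from its values.\<close>
lemma circle_means_of_has_log_potential:
  assumes \<mu>: "has_log_potential \<mu> (\<lambda>z. max (log_potential \<nu> z) 0)" and r: "r > 0"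
  shows "integrable \<mu> (log_max a r)" "(\<integral>y. log_max a r y \<partial>\<mu>) = circle_mean (clipped_potential \<nu>) a r"
proof -
  have \<mu>': "prob_space \<mu>" "sets \<mu> = sets borel" "integrates_log_at_infinity \<mu>"
    and pot: "\<And>z. log_potential \<mu> z = ereal (clipped_potential \<nu> z)"
    using \<mu> clipped_potential_eq[OF \<nu>(1,2) integrates_log_bounded_support] unfolding has_log_potential_def by simp_all
  show "integrable \<mu> (log_max a r)" by (rule integrable_log_max[OF \<mu>' r])
  note [measurable] = clipped_potential_measurable[OF \<nu>(1,2) integrates_log_bounded_support]
  note cm = circle_mean_log_potential[OF \<mu>' r, of a]
  show "(\<integral>y. log_max a r y \<partial>\<mu>) = circle_mean (clipped_potential \<nu>) a r"
    unfolding circle_mean_def cm(2)[symmetric]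
  proof (rule integral_cong_AE)
    show "AE \<theta> in circ. (\<integral>y. ln (cmod (y - (a + of_real r * cis \<theta>))) \<partial>\<mu>) = clipped_potential \<nu> (a + of_real r * cis \<theta>)"
      using cm(3,4)
    proof eventually_elim
      case (elim \<theta>)
      from log_potential_eq_integral(1)[OF \<mu>' elim(2,1)] show ?case unfolding pot by simp
    qed
    show "(\<lambda>\<theta>. \<integral>y. ln (cmod (y - (a + of_real r * cis \<theta>))) \<partial>\<mu>) \<in> borel_measurable circ"
      using cm(1) by (rule borel_measurable_integrable)
  qed measurable
qed

lemma has_log_potential_unique:
  assumes \<mu>: "has_log_potential \<mu> (\<lambda>z. max (log_potential \<nu> z) 0)" and \<mu>': "has_log_potential \<mu>' (\<lambda>z. max (log_potential \<nu> z) 0)"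
  shows "\<mu>' = \<mu>"
proof (rule eq_of_tent_integrals)
  show "prob_space \<mu>'" "sets \<mu>' = sets borel" "prob_space \<mu>" "sets \<mu> = sets borel"
    using \<mu> \<mu>' by (auto simp: has_log_potential_def)
  show "tent_integral \<mu>' r a = tent_integral \<mu> r a" if "r > 0" for r a
  proof -
    have r2: "2 * r > 0" using that by simp
    note m = circle_means_of_has_log_potential[OF \<mu> r2, of a] circle_means_of_has_log_potential[OF \<mu> that, of a]
      circle_means_of_has_log_potential[OF \<mu>' r2, of a] circle_means_of_has_log_potential[OF \<mu>' that, of a]
    show ?thesis unfolding tent_integral_def tent_eq_log_max using m by simp
  qed
qed

end

section \<open>The two diagonal models\<close>

lemma (in isotropic_law) random_potentials_noisy_mat:
  fixes P :: "nat \<Rightarrow> 'w measure"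
  assumes P: "\<And>N. prob_space (P N)" and fr: "\<And>N. N > 0 \<Longrightarrow> freezes N (P N) (D N) (G N)"
    and U: "U \<in> borel_measurable borel" "\<And>R. \<exists>B. \<forall>z. cmod z \<le> R \<longrightarrow> \<bar>U z\<bar> \<le> B"
    and int: "\<And>N z. N > 0 \<Longrightarrow> integrable (P N) (\<lambda>\<omega>. normalized_log_det \<gamma> N (\<lambda>i. D N i \<omega>) (\<lambda>e. G N e \<omega>) z)"
    and bdd: "\<And>R. \<exists>B. \<forall>N>0. \<forall>z. cmod z \<le> R \<longrightarrow> (\<integral>\<omega>. \<bar>normalized_log_det \<gamma> N (\<lambda>i. D N i \<omega>) (\<lambda>e. G N e \<omega>) z - U z\<bar> \<partial>P N) \<le> B"
    and lim: "\<And>z. (\<lambda>N. \<integral>\<omega>. \<bar>normalized_log_det \<gamma> N (\<lambda>i. D N i \<omega>) (\<lambda>e. G N e \<omega>) z - U z\<bar> \<partial>P N) \<longlonglongrightarrow> 0"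
  shows "random_potentials P (\<lambda>N \<omega>. empirical_eigenvalue_measure (noisy_mat \<gamma> N (\<lambda>i. D N i \<omega>) (\<lambda>e. G N e \<omega>)))
    (\<lambda>N z \<omega>. normalized_log_det \<gamma> N (\<lambda>i. D N i \<omega>) (\<lambda>e. G N e \<omega>) z) U"
proof (rule random_potentials.intro)
  fix N :: nat assume N: "N > 0"
  have m: "D N i \<in> borel_measurable (P N)" "j < N \<Longrightarrow> G N (i, j) \<in> borel_measurable (P N)" if "i < N" for i j
    using fr[OF N] that by (auto simp: freezes_def)
  have "(\<lambda>p. noisy_det N (\<lambda>i. D N i (snd p) - fst p) (real N powr - \<gamma>) (\<lambda>e. G N e (snd p))) \<in> borel_measurable (borel \<Otimes>\<^sub>M P N)"
  proof (rule measurable_noisy_det[where a="\<lambda>p i. D N i (snd p) - fst p" and g="\<lambda>p e. G N e (snd p)"])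
    show "(\<lambda>p. D N i (snd p) - fst p) \<in> borel_measurable (borel \<Otimes>\<^sub>M P N)" if "i < N" for i
      by (intro borel_measurable_diff measurable_compose[OF measurable_snd m(1)[OF that]] measurable_fst)
    show "(\<lambda>p. G N (i, j) (snd p)) \<in> borel_measurable (borel \<Otimes>\<^sub>M P N)" if "i < N" "j < N" for i j
      by (rule measurable_compose[OF measurable_snd m(2)[OF that]])
  qed
  then show "(\<lambda>p. normalized_log_det \<gamma> N (\<lambda>i. D N i (snd p)) (\<lambda>e. G N e (snd p)) (fst p)) \<in> borel_measurable (borel \<Otimes>\<^sub>M P N)"
    unfolding normalized_log_det_def by measurable
  fix a r \<omega> assume r: "(r :: real) > 0"
  show "integrable circ (\<lambda>\<theta>. normalized_log_det \<gamma> N (\<lambda>i. D N i \<omega>) (\<lambda>e. G N e \<omega>) (a + of_real r * cis \<theta>))"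
    "integrable (empirical_eigenvalue_measure (noisy_mat \<gamma> N (\<lambda>i. D N i \<omega>) (\<lambda>e. G N e \<omega>))) (log_max a r)"
    "(\<integral>y. log_max a r y \<partial>empirical_eigenvalue_measure (noisy_mat \<gamma> N (\<lambda>i. D N i \<omega>) (\<lambda>e. G N e \<omega>)))
      = circle_mean (\<lambda>z. normalized_log_det \<gamma> N (\<lambda>i. D N i \<omega>) (\<lambda>e. G N e \<omega>) z) a r"
    by (rule integral_log_max_empirical[OF N r])+
qed (rule P | rule prob_space_empirical | rule U | rule lim | rule bdd | (rule int, assumption))+

lemma noisy_mat_0: "noisy_mat \<gamma> 0 d g = noisy_mat \<gamma> 0 (\<lambda>_. 0) (\<lambda>_. 0)"
  by (rule eq_matI) (auto simp: noisy_mat_def shift_mat_def)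

lemma (in isotropic_law) iid_diagonal_limit:
  fixes P :: "nat \<Rightarrow> 'w measure"
  assumes \<gamma>: "\<gamma> > 1 / 2" and P: "\<And>N. prob_space (P N)" and G: "\<And>N. iid (P N) ({..<N} \<times> {..<N}) (G N) M"
    and \<nu>: "prob_space \<nu>" "sets \<nu> = sets borel" "AE x in \<nu>. cmod x \<le> B" "B \<ge> 0"
    and d: "\<And>N. iid (P N) {..<N} (d N) \<nu>" and ind: "\<And>N. indep_families (P N) {..<N} (d N) ({..<N} \<times> {..<N}) (G N)"
  shows "\<exists>\<mu>. has_log_potential \<mu> (\<lambda>z. max (log_potential \<nu> z) 0) \<and>
    weakly_converges_in_prob P (\<lambda>N \<omega>. empirical_eigenvalue_measure (noisy_mat \<gamma> N (\<lambda>i. d N i \<omega>) (\<lambda>ij. G N ij \<omega>))) \<mu>"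
proof -
  let ?U = "clipped_potential \<nu>"
  have fr: "freezes N (P N) (d N) (G N)" if N: "N > 0" for N
  proof (rule freezes_independent[OF P G N _ ind])
    show "d N i \<in> borel_measurable (P N)" if "i < N" for i
      using d[of N] that by (auto simp: iid_def prob_space.indep_vars_def2[OF P])
  qed
  interpret random_potentials P "\<lambda>N \<omega>. empirical_eigenvalue_measure (noisy_mat \<gamma> N (\<lambda>i. d N i \<omega>) (\<lambda>ij. G N ij \<omega>))"
    "\<lambda>N z \<omega>. normalized_log_det \<gamma> N (\<lambda>i. d N i \<omega>) (\<lambda>ij. G N ij \<omega>) z" ?U
  proof (rule random_potentials_noisy_mat[OF P fr])
    show "?U \<in> borel_measurable borel"
      by (rule clipped_potential_measurable[OF \<nu>(1,2) integrates_log_of_bounded[OF \<nu>(1-3)]])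
    have "\<bar>?U z\<bar> \<le> B + R" if "cmod z \<le> R" for z R using clipped_potential_bounds[OF \<nu>, of z] that by linarith
    then show "\<exists>B. \<forall>z. cmod z \<le> R \<longrightarrow> \<bar>?U z\<bar> \<le> B" for R by blast
    show "integrable (P N) (\<lambda>\<omega>. normalized_log_det \<gamma> N (\<lambda>i. d N i \<omega>) (\<lambda>e. G N e \<omega>) z)" if "N > 0" for N z
      by (rule iid_log_det_bounded(1)[OF \<gamma> \<nu> fr[OF that] d that order_refl])
    show "\<exists>B. \<forall>N>0. \<forall>z. cmod z \<le> R \<longrightarrow> (\<integral>\<omega>. \<bar>normalized_log_det \<gamma> N (\<lambda>i. d N i \<omega>) (\<lambda>e. G N e \<omega>) z - ?U z\<bar> \<partial>P N) \<le> B" for R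
      by (intro exI allI impI) (rule iid_log_det_bounded(2)[OF \<gamma> \<nu> fr d])
    show "(\<lambda>N. \<integral>\<omega>. \<bar>normalized_log_det \<gamma> N (\<lambda>i. d N i \<omega>) (\<lambda>e. G N e \<omega>) z - ?U z\<bar> \<partial>P N) \<longlonglongrightarrow> 0" for z
      by (rule iid_log_det_tendsto[OF \<gamma> \<nu> fr d])
  qed
  have far: "circle_mean ?U a s = ln s" if "s \<ge> B + 1 + cmod a" for a s
    using circle_mean_clipped_potential_far[OF \<nu> that] .
  have R: "B + 1 > 0" using \<nu>(4) by simp
  have "circle_mean ?U 0 (2 * (B + 1)) - circle_mean ?U 0 (B + 1) = ln 2"
    using far[of 0 "2 * (B + 1)"] far[of 0 "B + 1"] R ln_mult_pos[of 2 "B + 1"] by simp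
  from limit_measure_exists[OF _ R this]
  obtain \<mu> where \<mu>: "prob_space \<mu>" "sets \<mu> = sets borel" "AE y in \<mu>. cmod y \<le> 4 * (B + 1)"
    and tents: "\<And>r a. r > 0 \<Longrightarrow> tent_integral \<mu> r a = circle_mean ?U a (2 * r) - circle_mean ?U a r"
    unfolding empirical_eigenvalue_measure_def by blast
  have "(\<integral>y. log_max a r y \<partial>\<mu>) = circle_mean ?U a r" if "r > 0" for a r
    by (rule integral_log_max_of_tents[OF \<mu> tents far that])
  then have "has_log_potential \<mu> (\<lambda>z. max (log_potential \<nu> z) 0)"
    by (rule has_log_potential_of_circle_means[OF \<nu> \<mu>(1,2) integrates_log_of_bounded[OF \<mu>]])
  moreover have "weakly_converges_in_prob P (\<lambda>N \<omega>. empirical_eigenvalue_measure (noisy_mat \<gamma> N (\<lambda>i. d N i \<omega>) (\<lambda>ij. G N ij \<omega>))) \<mu>"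
    by (rule weak_convergence[OF \<mu>(1,2) tents]) (assumption, subst noisy_mat_0, rule refl)
  ultimately show ?thesis by blast
qed

lemma uniform_unit_interval:
  fixes g :: "real \<Rightarrow> real"
  assumes "continuous_on UNIV g"
  shows "(\<integral>t. g t \<partial>uniform_measure lborel {0..1}) = integral {0..1} g"
proof -
  have [measurable]: "g \<in> borel_measurable borel" using assms by (rule borel_measurable_continuous_onI)
  have si: "set_integrable lborel {0..1} g"
    by (rule borel_integrable_atLeastAtMost') (rule continuous_on_subset[OF assms], simp)
  have "uniform_measure lborel {0..1 :: real} = density lborel (\<lambda>x. ennreal (indicator {0..1} x))"
    unfolding uniform_measure_def by (rule density_cong) (auto simp: ennreal_indicator divide_ennreal_def)
  then have "(\<integral>t. g t \<partial>uniform_measure lborel {0..1}) = (\<integral>t. indicator {0..1} t * g t \<partial>lborel)"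
    by (simp add: integral_density)
  also have "\<dots> = integral {0..1} g"
    using set_borel_integral_eq_integral(2)[OF si] by (simp add: set_lebesgue_integral_def)
  finally show ?thesis .
qed

text \<open>The path is extended constantly to the whole line: continuity on the line gives the measurability that
  \<open>f\<close> may lack outside the interval.\<close>
definition circles_along_path :: "(real \<Rightarrow> complex) \<Rightarrow> complex measure" where
  "circles_along_path f = distr (uniform_measure lborel {0..1} \<Otimes>\<^sub>M circ) borel (\<lambda>(t, \<theta>). f (max 0 (min 1 t)) + cis \<theta>)"

context
  fixes f :: "real \<Rightarrow> complex"
  assumes cont: "continuous_on {0..1} f"
begin

lemma clamped_path_continuous: "continuous_on UNIV (\<lambda>t. f (max 0 (min 1 t)))"
  by (rule continuous_on_compose2[OF cont]) (auto intro!: continuous_intros)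

lemma clamped_path_measurable [measurable]: "(\<lambda>t. f (max 0 (min 1 t))) \<in> borel_measurable borel"
  by (rule borel_measurable_continuous_onI[OF clamped_path_continuous])

lemma circles_along_path_measurable:
  "(\<lambda>(t, \<theta>). f (max 0 (min 1 t)) + cis \<theta>) \<in> borel_measurable (uniform_measure lborel {0..1} \<Otimes>\<^sub>M circ)"
  unfolding split_beta' by measurable

lemma prob_space_uniform_unit: "prob_space (uniform_measure lborel {0..1 :: real})"
  by (rule prob_space_uniform_measure) auto

lemma prob_space_circles_along_path: "prob_space (circles_along_path f)" "sets (circles_along_path f) = sets borel"
proof -
  interpret I: prob_space "uniform_measure lborel {0..1 :: real}" by (rule prob_space_uniform_unit)
  interpret circ: prob_space circ by (rule prob_space_circ)
  interpret pair_prob_space "uniform_measure lborel {0..1 :: real}" circ ..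
  show "prob_space (circles_along_path f)" unfolding circles_along_path_def
    by (rule prob_space_distr[OF circles_along_path_measurable])
qed (simp add: circles_along_path_def)

lemma emeasure_circles_along_path:
  assumes [measurable]: "A \<in> sets borel"
  shows "emeasure (circles_along_path f) A = (\<integral>\<^sup>+ t \<in> {0..1}. emeasure (unif_circle (f t) 1) A \<partial>lborel)"
proof -
  let ?I = "uniform_measure lborel {0..1 :: real}" and ?f = "\<lambda>t. f (max 0 (min 1 t))"
  interpret circ: prob_space circ by (rule prob_space_circ)
  have im: "(\<lambda>(t, \<theta>). indicator A (?f t + cis \<theta>) :: ennreal) \<in> borel_measurable (borel \<Otimes>\<^sub>M circ)"
    unfolding split_beta' by measurable
  have inner: "(\<integral>\<^sup>+\<theta>. indicator A (?f t + cis \<theta>) \<partial>circ) = emeasure (unif_circle (?f t) 1) A" for t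
  proof -
    have "(\<integral>\<^sup>+\<theta>. indicator A (?f t + cis \<theta>) \<partial>circ) = (\<integral>\<^sup>+y. indicator A y \<partial>unif_circle (?f t) 1)"
      unfolding unif_circle_def by (subst nn_integral_distr) auto
    then show ?thesis by (simp add: unif_circle_def)
  qed
  have "emeasure (circles_along_path f) A = (\<integral>\<^sup>+y. indicator A y \<partial>circles_along_path f)"
    by (simp add: circles_along_path_def)
  also have "\<dots> = (\<integral>\<^sup>+p. indicator A (?f (fst p) + cis (snd p)) \<partial>(?I \<Otimes>\<^sub>M circ))"
    unfolding circles_along_path_def by (subst nn_integral_distr[OF circles_along_path_measurable]) (auto simp: split_beta')
  also have "\<dots> = (\<integral>\<^sup>+t. (\<integral>\<^sup>+\<theta>. indicator A (?f t + cis \<theta>) \<partial>circ) \<partial>?I)"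
    by (subst circ.nn_integral_fst[symmetric]) (use im in \<open>auto simp: split_beta'\<close>)
  also have "\<dots> = (\<integral>\<^sup>+t. (\<integral>\<^sup>+\<theta>. indicator A (?f t + cis \<theta>) \<partial>circ) * indicator {0..1} t \<partial>lborel)"
  proof -
    have "(\<lambda>t. \<integral>\<^sup>+\<theta>. indicator A (?f t + cis \<theta>) \<partial>circ) \<in> borel_measurable borel"
      using circ.borel_measurable_nn_integral_fst[OF im] by simp
    then show ?thesis by (subst nn_integral_uniform_measure) (auto simp: divide_ennreal_def)
  qed
  also have "\<dots> = (\<integral>\<^sup>+ t \<in> {0..1}. emeasure (unif_circle (f t) 1) A \<partial>lborel)"
    unfolding inner by (rule nn_integral_cong) (auto simp: indicator_def)
  finally show ?thesis .
qed

lemma path_bounded: "\<exists>B\<ge>0. \<forall>t\<in>{0..1}. cmod (f t) \<le> B"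
proof -
  have "bounded (f ` {0..1})" by (intro compact_imp_bounded compact_continuous_image cont) simp
  then obtain B where "\<forall>x\<in>f ` {0..1}. norm x \<le> B" by (auto simp: bounded_iff)
  then show ?thesis by (intro exI[of _ "max 0 B"]) (auto simp: le_max_iff_disj)
qed

lemma integrates_log_circles_along_path: "integrates_log_at_infinity (circles_along_path f)"
proof -
  obtain B where B: "\<And>t. t \<in> {0..1} \<Longrightarrow> cmod (f t) \<le> B" using path_bounded by blast
  have "cmod (f (max 0 (min 1 t)) + cis \<theta>) \<le> B + 1" for t \<theta>
    using norm_triangle_ineq[of "f (max 0 (min 1 t))" "cis \<theta>"] B[of "max 0 (min 1 t)"] by simp
  then have "AE y in circles_along_path f. cmod y \<le> B + 1"
    unfolding circles_along_path_def by (subst AE_distr_iff[OF circles_along_path_measurable]) auto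
  then show ?thesis by (rule integrates_log_of_bounded[OF prob_space_circles_along_path])
qed

text \<open>By Jensen's formula, the unit circle around \<open>f t\<close> has potential \<open>ln (max 1 \<bar>f t - w\<bar>)\<close> at \<open>w\<close>.\<close>
lemma potential_circles_along_path:
  assumes int: "integrable (circles_along_path f) (\<lambda>y. ln (cmod (y - w)))"
  shows "(\<integral>y. ln (cmod (y - w)) \<partial>circles_along_path f) = path_potential f w"
proof -
  let ?I = "uniform_measure lborel {0..1 :: real}" and ?f = "\<lambda>t. f (max 0 (min 1 t))"
  interpret I: prob_space ?I by (rule prob_space_uniform_unit)
  interpret circ: prob_space circ by (rule prob_space_circ)
  interpret pair_prob_space ?I circ ..
  have m: "(\<lambda>y. ln (cmod (y - w))) \<in> borel_measurable borel" by measurable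
  have int': "integrable (?I \<Otimes>\<^sub>M circ) (\<lambda>(t, \<theta>). ln (cmod (?f t + cis \<theta> - w)))"
    using int unfolding circles_along_path_def
    by (subst (asm) integrable_distr_eq[OF circles_along_path_measurable m]) (simp add: split_beta')
  have "(\<integral>y. ln (cmod (y - w)) \<partial>circles_along_path f) = (\<integral>p. ln (cmod (?f (fst p) + cis (snd p) - w)) \<partial>(?I \<Otimes>\<^sub>M circ))"
    unfolding circles_along_path_def by (subst integral_distr[OF circles_along_path_measurable m]) (simp add: split_beta')
  also have "\<dots> = (\<integral>t. (\<integral>\<theta>. ln (cmod (?f t + cis \<theta> - w)) \<partial>circ) \<partial>?I)"
    using integral_fst[OF int'] by (simp add: split_beta')
  also have "\<dots> = (\<integral>t. ln (max 1 (cmod (?f t - w))) \<partial>?I)"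
    using jensen_circle(2)[of 1] by (simp add: max.commute norm_minus_commute)
  also have "\<dots> = integral {0..1} (\<lambda>t. ln (max 1 (cmod (?f t - w))))"
    by (rule uniform_unit_interval) (intro continuous_intros clamped_path_continuous, auto simp: max_def)
  also have "\<dots> = path_potential f w"
    unfolding path_potential_def by (rule Henstock_Kurzweil_Integration.integral_cong) simp
  finally show ?thesis .
qed

lemma path_potential_measurable: "path_potential f \<in> borel_measurable borel"
proof (rule borel_measurable_continuous_onI)
  have "1-lipschitz_on UNIV (path_potential f)"
  proof (rule lipschitz_onI)
    fix w w'
    have i: "(\<lambda>t. ln (max 1 (cmod (f t - w)))) integrable_on {0..1}" for w
      by (intro integrable_continuous_real continuous_intros cont) (auto simp: max_def)
    have "dist (path_potential f w) (path_potential f w') = norm (integral {0..1} (\<lambda>t. ln (max 1 (cmod (f t - w))) - ln (max 1 (cmod (f t - w')))))"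
      unfolding path_potential_def dist_norm by (subst Henstock_Kurzweil_Integration.integral_diff[OF i i]) simp
    also have "\<dots> \<le> integral {0..1} (\<lambda>t :: real. cmod (w - w'))"
    proof (rule integral_norm_bound_integral)
      show "norm (ln (max 1 (cmod (f t - w))) - ln (max 1 (cmod (f t - w')))) \<le> cmod (w - w')" for t
        using log_max_lipschitz[of 1 1 1 w "f t" w'] by (simp add: log_max_def max.commute)
      show "(\<lambda>t. ln (max 1 (cmod (f t - w))) - ln (max 1 (cmod (f t - w')))) integrable_on {0..1}"
        by (rule integrable_diff[OF i i])
    qed auto
    finally show "dist (path_potential f w) (path_potential f w') \<le> 1 * dist w w'" by (simp add: dist_norm)
  qed simp
  then show "continuous_on UNIV (path_potential f)" by (rule lipschitz_on_continuous_on)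
qed

lemma log_max_circles_along_path:
  assumes r: "r > 0"
  shows "(\<integral>y. log_max a r y \<partial>circles_along_path f) = circle_mean (path_potential f) a r"
proof -
  note cm = circle_mean_log_potential[OF prob_space_circles_along_path integrates_log_circles_along_path r, of a]
  note [measurable] = path_potential_measurable
  show ?thesis unfolding circle_mean_def cm(2)[symmetric]
  proof (rule integral_cong_AE)
    show "AE \<theta> in circ. (\<integral>y. ln (cmod (y - (a + of_real r * cis \<theta>))) \<partial>circles_along_path f) = path_potential f (a + of_real r * cis \<theta>)"
      using cm(3) by eventually_elim (rule potential_circles_along_path)
    show "(\<lambda>\<theta>. \<integral>y. ln (cmod (y - (a + of_real r * cis \<theta>))) \<partial>circles_along_path f) \<in> borel_measurable circ"
      using cm(1) by (rule borel_measurable_integrable)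
  qed measurable
qed

end

lemma (in isotropic_law) path_diagonal_limit:
  fixes P :: "nat \<Rightarrow> 'w measure"
  assumes \<gamma>: "\<gamma> > 1 / 2" and P: "\<And>N. prob_space (P N)" and G: "\<And>N. iid (P N) ({..<N} \<times> {..<N}) (G N) M"
    and cont: "continuous_on {0..1} f"
  shows "weakly_converges_in_prob P (\<lambda>N \<omega>. empirical_eigenvalue_measure
    (noisy_mat \<gamma> N (\<lambda>i. f (real (i + 1) / real N)) (\<lambda>ij. G N ij \<omega>))) (circles_along_path f)"
proof -
  let ?U = "path_potential f" and ?D = "\<lambda>N i (_ :: 'w). f (real (i + 1) / real N)"
  have fr: "freezes N (P N) (?D N) (G N)" if N: "N > 0" for N
    by (rule freezes_deterministic[OF P G N])
  obtain B where B: "\<And>t. t \<in> {0..1} \<Longrightarrow> cmod (f t) \<le> B" using path_bounded[OF cont] by blast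
  interpret random_potentials P "\<lambda>N \<omega>. empirical_eigenvalue_measure (noisy_mat \<gamma> N (\<lambda>i. ?D N i \<omega>) (\<lambda>ij. G N ij \<omega>))"
    "\<lambda>N z \<omega>. normalized_log_det \<gamma> N (\<lambda>i. ?D N i \<omega>) (\<lambda>ij. G N ij \<omega>) z" ?U
  proof (rule random_potentials_noisy_mat[where D="?D", OF P fr])
    show "?U \<in> borel_measurable borel" by (rule path_potential_measurable[OF cont])
    have "\<bar>?U z\<bar> \<le> B + R" if "cmod z \<le> R" for z R using path_potential_bounds[OF cont B, of z] that by linarith
    then show "\<exists>B. \<forall>z. cmod z \<le> R \<longrightarrow> \<bar>?U z\<bar> \<le> B" for R by blast
    show "integrable (P N) (\<lambda>\<omega>. normalized_log_det \<gamma> N (\<lambda>i. ?D N i \<omega>) (\<lambda>e. G N e \<omega>) z)" if "N > 0" for N z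
      by (rule path_log_det_bounded(1)[OF \<gamma> cont B fr[OF that] that order_refl])
    show "\<exists>B. \<forall>N>0. \<forall>z. cmod z \<le> R \<longrightarrow> (\<integral>\<omega>. \<bar>normalized_log_det \<gamma> N (\<lambda>i. ?D N i \<omega>) (\<lambda>e. G N e \<omega>) z - ?U z\<bar> \<partial>P N) \<le> B" for R
      by (intro exI allI impI) (rule path_log_det_bounded(2)[OF \<gamma> cont B fr])
    show "(\<lambda>N. \<integral>\<omega>. \<bar>normalized_log_det \<gamma> N (\<lambda>i. ?D N i \<omega>) (\<lambda>e. G N e \<omega>) z - ?U z\<bar> \<partial>P N) \<longlonglongrightarrow> 0" for z
      by (rule path_log_det_tendsto[OF \<gamma> cont fr])
  qed
  note li = integrable_log_max[OF prob_space_circles_along_path[OF cont] integrates_log_circles_along_path[OF cont]]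
  have tents: "tent_integral (circles_along_path f) r a = circle_mean ?U a (2 * r) - circle_mean ?U a r" if "r > 0" for r a
  proof -
    have r2: "2 * r > 0" using that by simp
    show ?thesis
      unfolding tent_integral_def tent_eq_log_max log_max_circles_along_path[OF cont r2, symmetric] log_max_circles_along_path[OF cont that, symmetric]
      by (rule Bochner_Integration.integral_diff[OF li[OF r2] li[OF that]])
  qed
  show ?thesis
    by (rule weak_convergence[OF prob_space_circles_along_path[OF cont] tents]) (assumption, subst noisy_mat_0, rule refl)
qed

lemma holder_imp_continuous:
  assumes "holder_continuous_on S f" shows "continuous_on S f"
proof -
  obtain C \<alpha> where \<alpha>: "0 < \<alpha>" and h: "\<And>s t. s \<in> S \<Longrightarrow> t \<in> S \<Longrightarrow> cmod (f s - f t) \<le> C * \<bar>s - t\<bar> powr \<alpha>"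
    using assms by (auto simp: holder_continuous_on_def)
  show ?thesis unfolding continuous_on_def
  proof
    fix t assume t: "t \<in> S"
    have "((\<lambda>s. C * \<bar>s - t\<bar> powr \<alpha>) \<longlongrightarrow> C * \<bar>t - t\<bar> powr \<alpha>) (at t within S)"
      by (intro tendsto_intros tendsto_powr') (use \<alpha> in auto)
    then have "((\<lambda>s. C * \<bar>s - t\<bar> powr \<alpha>) \<longlongrightarrow> 0) (at t within S)" by simp
    then have "((\<lambda>s. cmod (f s - f t)) \<longlongrightarrow> 0) (at t within S)"
      by (rule tendsto_sandwich[OF _ _ tendsto_const, rotated 2])
        (use h t in \<open>auto simp: eventually_at_filter intro!: always_eventually\<close>)
    then show "(f \<longlongrightarrow> f t) (at t within S)" by (simp add: tendsto_norm_zero_iff LIM_zero_iff)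
  qed
qed

theorem theorem1p3:
  fixes \<gamma> :: real
    and P :: "nat \<Rightarrow> 'w measure"
    and G :: "nat \<Rightarrow> nat \<times> nat \<Rightarrow> 'w \<Rightarrow> complex"
  assumes "\<gamma> > 1 / 2"
    and "\<And>N. prob_space (P N)"
    and "\<And>N. iid (P N) ({..<N} \<times> {..<N}) (G N) std_complex_gaussian"
  shows "(\<forall>(d :: nat \<Rightarrow> nat \<Rightarrow> 'w \<Rightarrow> complex) (\<nu> :: complex measure) (K :: complex set).
            prob_space \<nu> \<and> sets \<nu> = sets borel \<and>
            compact K \<and> simply_connected K \<and> emeasure lborel K = 0 \<and> (AE x in \<nu>. x \<in> K) \<and>
            (\<forall>N. iid (P N) {..<N} (d N) \<nu>) \<and>
            (\<forall>N. indep_families (P N) {..<N} (d N) ({..<N} \<times> {..<N}) (G N))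
          \<longrightarrow> (\<exists>\<mu>. has_log_potential \<mu> (\<lambda>z. max (log_potential \<nu> z) 0) \<and>
                   (\<forall>\<mu>'. has_log_potential \<mu>' (\<lambda>z. max (log_potential \<nu> z) 0) \<longrightarrow> \<mu>' = \<mu>) \<and>
                   weakly_converges_in_prob P
                     (\<lambda>N \<omega>. empirical_eigenvalue_measure
                        (noisy_mat \<gamma> N (\<lambda>i. d N i \<omega>) (\<lambda>ij. G N ij \<omega>))) \<mu>))
       \<and> (\<forall>f :: real \<Rightarrow> complex. holder_continuous_on {0..1} f
          \<longrightarrow> (\<exists>\<mu>. prob_space \<mu> \<and> sets \<mu> = sets borel \<and>
                   (\<forall>A \<in> sets borel. emeasure \<mu> A =
                      (\<integral>\<^sup>+ t \<in> {0..1}. emeasure (unif_circle (f t) 1) A \<partial>lborel)) \<and>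
                   weakly_converges_in_prob P
                     (\<lambda>N \<omega>. empirical_eigenvalue_measure
                        (noisy_mat \<gamma> N (\<lambda>i. f (real (i + 1) / real N)) (\<lambda>ij. G N ij \<omega>))) \<mu>))"
proof -
  have "prob_space std_complex_gaussian"
  proof -
    interpret prob_space "P 1" by (rule assms(2))
    have "G 1 (0, 0) \<in> borel_measurable (P 1)" "distr (P 1) borel (G 1 (0, 0)) = std_complex_gaussian"
      using assms(3)[of 1] unfolding iid_def indep_vars_def2 by auto
    then show ?thesis using prob_space_distr by metis
  qed
  then obtain c C where "isotropic_law std_complex_gaussian c C" using isotropic_std_complex_gaussian by blast
  then interpret isotropic_law std_complex_gaussian c C .
  show ?thesis
  proof (intro conjI allI impI)
    fix d :: "nat \<Rightarrow> nat \<Rightarrow> 'w \<Rightarrow> complex" and \<nu> :: "complex measure" and K :: "complex set"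
    assume "prob_space \<nu> \<and> sets \<nu> = sets borel \<and>
            compact K \<and> simply_connected K \<and> emeasure lborel K = 0 \<and> (AE x in \<nu>. x \<in> K) \<and>
            (\<forall>N. iid (P N) {..<N} (d N) \<nu>) \<and>
            (\<forall>N. indep_families (P N) {..<N} (d N) ({..<N} \<times> {..<N}) (G N))"
    then have \<nu>: "prob_space \<nu>" "sets \<nu> = sets borel" and K: "compact K" "AE x in \<nu>. x \<in> K"
      and d: "\<And>N. iid (P N) {..<N} (d N) \<nu>" "\<And>N. indep_families (P N) {..<N} (d N) ({..<N} \<times> {..<N}) (G N)"
      by blast+
    obtain B where "\<forall>x\<in>K. norm x \<le> B" using compact_imp_bounded[OF K(1)] by (auto simp: bounded_iff)
    then have B: "AE x in \<nu>. cmod x \<le> max 0 B" using K(2) by (auto elim!: eventually_mono simp: le_max_iff_disj)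
    note \<nu>B = \<nu> B max.cobounded1
    obtain \<mu> where \<mu>: "has_log_potential \<mu> (\<lambda>z. max (log_potential \<nu> z) 0)"
      and conv: "weakly_converges_in_prob P (\<lambda>N \<omega>. empirical_eigenvalue_measure
        (noisy_mat \<gamma> N (\<lambda>i. d N i \<omega>) (\<lambda>ij. G N ij \<omega>))) \<mu>"
      using iid_diagonal_limit[OF assms \<nu>B d] by blast
    have "\<forall>\<mu>'. has_log_potential \<mu>' (\<lambda>z. max (log_potential \<nu> z) 0) \<longrightarrow> \<mu>' = \<mu>"
      using has_log_potential_unique[OF \<nu>B \<mu>] by blast
    with \<mu> conv show "\<exists>\<mu>. has_log_potential \<mu> (\<lambda>z. max (log_potential \<nu> z) 0) \<and>
                   (\<forall>\<mu>'. has_log_potential \<mu>' (\<lambda>z. max (log_potential \<nu> z) 0) \<longrightarrow> \<mu>' = \<mu>) \<and>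
                   weakly_converges_in_prob P
                     (\<lambda>N \<omega>. empirical_eigenvalue_measure
                        (noisy_mat \<gamma> N (\<lambda>i. d N i \<omega>) (\<lambda>ij. G N ij \<omega>))) \<mu>" by blast
  next
    fix f :: "real \<Rightarrow> complex" assume "holder_continuous_on {0..1} f"
    then have cont: "continuous_on {0..1} f" by (rule holder_imp_continuous)
    show "\<exists>\<mu>. prob_space \<mu> \<and> sets \<mu> = sets borel \<and>
                   (\<forall>A \<in> sets borel. emeasure \<mu> A =
                      (\<integral>\<^sup>+ t \<in> {0..1}. emeasure (unif_circle (f t) 1) A \<partial>lborel)) \<and>
                   weakly_converges_in_prob P
                     (\<lambda>N \<omega>. empirical_eigenvalue_measure
                        (noisy_mat \<gamma> N (\<lambda>i. f (real (i + 1) / real N)) (\<lambda>ij. G N ij \<omega>))) \<mu>"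
      using prob_space_circles_along_path[OF cont] emeasure_circles_along_path[OF cont] path_diagonal_limit[OF assms cont] by blast
  qed
qed

end
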